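(* For all $t,v\in [0,1]$ and $j\in\{-1,1\}$, $$\lim_{s\to\infty}\mathbb{P}\left(\sqrt{\frac{\log \cot |\Lambda_s| }{\log s}}\leq t,\ j \Lambda_s \leq 0,\ Y_s\leq v\right) =\begin{cases} t\,(1-(1-v)^2)/2,& \text{if } j=1,\\ t\,v^2/2,& \text{if } j=-1. \end{cases}$$
   Context: Let $\{\Theta_n\}_{n\ge 1}$ be i.i.d. random variables with density $\frac12\cos\theta$ on $(-\pi/2,\pi/2)$ (and $0$ elsewhere), let $X_n=\tan\Theta_n$, $S_0=0$, $S_n=S_{n-1}+X_n$ for $n\ge1$. For $s>0$ let $N_s=\inf\{n>0: S_n>s\}$ (finite almost surely). Consider the semi-infinite strip $D=\{(x,y)\in\mathbb{R}^2: x\le 0,\ 0\le y\le 1\}$. A light ray starts at $(-s,0)$ and follows the consecutive line segments from $\left(-s+S_{n-1},\frac{1-(-1)^{n-1}}{2}\right)$ to $\left(-s+S_{n},\frac{1-(-1)^{n}}{2}\right)$, $n=1,2,\dots,N_s$; the last of these segments (with $n=N_s$) crosses the right edge $\{0\}\times[0,1]$. Let $(0,Y_s)$ be the point where this last segment crosses the right edge, and let $\Lambda_s\in(-\pi/2,\pi/2)$ be the signed angle between this last segment and the normal (horizontal direction) to the right edge, positive if the exiting ray is travelling upward ($N_s$ odd) and negative if it is travelling downward ($N_s$ even); thus $\cot|\Lambda_s|=X_{N_s}$. Convention: if $\log\cot|\Lambda_s|/\log s<0$ (with $s>1$) the square root is read as $0$, so that the event $\{\sqrt{\log\cot|\Lambda_s|/\log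 s}\le t\}$ is $\{\cot|\Lambda_s|\le s^{t^2}\}$. *)

theory Defs
  imports "HOL-Probability.Probability"
begin

definition angle_density :: "real \<Rightarrow> real" where
  "angle_density \<theta> = (if -pi/2 < \<theta> \<and> \<theta> < pi/2 then cos \<theta> / 2 else 0)"

primrec walk :: "(nat \<Rightarrow> 'a \<Rightarrow> real) \<Rightarrow> nat \<Rightarrow> 'a \<Rightarrow> real" where
  "walk \<Theta> 0 \<omega> = 0"
| "walk \<Theta> (Suc n) \<omega> = walk \<Theta> n \<omega> + tan (\<Theta> (Suc n) \<omega>)"

text \<open>The infimum of the empty set of natural numbers is 0, so on the null event where
  the walk never exceeds the level s the passage time below is 0.\<close>

definition passage_time :: "(nat \<Rightarrow> 'a \<Rightarrow> real) \<Rightarrow> real \<Rightarrow> 'a \<Rightarrow> nat" where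
  "passage_time \<Theta> s \<omega> = Inf {n. 0 < n \<and> s < walk \<Theta> n \<omega>}"

definition ray_vertex :: "(nat \<Rightarrow> 'a \<Rightarrow> real) \<Rightarrow> real \<Rightarrow> 'a \<Rightarrow> nat \<Rightarrow> real \<times> real" where
  "ray_vertex \<Theta> s \<omega> n = (- s + walk \<Theta> n \<omega>, (1 - (-1) ^ n) / 2)"

definition exit_height :: "(nat \<Rightarrow> 'a \<Rightarrow> real) \<Rightarrow> real \<Rightarrow> 'a \<Rightarrow> real" where
  "exit_height \<Theta> s \<omega> = (let N = passage_time \<Theta> s \<omega> in
     THE y. (0, y) \<in> closed_segment (ray_vertex \<Theta> s \<omega> (N - 1)) (ray_vertex \<Theta> s \<omega> N)
                     \<inter> {0} \<times> {0..1})"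

text \<open>The signed angle from the outward normal (1,0) of the right edge to the direction of
  travel along the last segment. The horizontal component of that direction is positive, so
  its principal argument lies in (-pi/2, pi/2), and it is positive exactly when the ray
  travels upward.\<close>

definition exit_angle :: "(nat \<Rightarrow> 'a \<Rightarrow> real) \<Rightarrow> real \<Rightarrow> 'a \<Rightarrow> real" where
  "exit_angle \<Theta> s \<omega> = (let N = passage_time \<Theta> s \<omega>;
       d = ray_vertex \<Theta> s \<omega> N - ray_vertex \<Theta> s \<omega> (N - 1)
     in Arg (Complex (fst d) (snd d)))"

text \<open>The truncation by max makes the square root of a negative ratio equal to 0.\<close>

definition exit_log_ratio :: "(nat \<Rightarrow> 'a \<Rightarrow> real) \<Rightarrow> real \<Rightarrow> 'a \<Rightarrow> real" where
  "exit_log_ratio \<Theta> s \<omega> = sqrt (max 0 (ln (cot \<bar>exit_angle \<Theta> s \<omega>\<bar>) / ln s))"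

end

theory Submission
  imports Defs "HOL-Real_Asymp.Real_Asymp"
begin

text \<open>Write \<open>u = s - S\<^sub>n\<close> for the horizontal distance from the edge after \<open>n\<close> crossings, all of them
short of the edge. The next crossing, with displacement \<open>X = tan \<Theta>\<close>, is the last one exactly when
\<open>X > u\<close>. Then \<open>cot \<bar>\<Lambda>\<bar> = X\<close>, the fraction of the last segment covered at the edge is \<open>u / X\<close>, and the
height is \<open>u / X\<close> if the ray travels upward (\<open>n\<close> even) and \<open>1 - u / X\<close> if it travels downward (\<open>n\<close> odd).
So the theorem follows from two facts about the walk:

  \<^item> the probability that the last displacement is at most \<open>s\<^sup>a\<close> while \<open>u \<le> w X\<close> tends to \<open>w\<^sup>2 * sqrt a\<close>
    (\<open>exit_prob_limit\<close>), to be used with \<open>a = t\<^sup>2\<close>;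
  \<^item> the parity of the number of crossings is asymptotically fair and independent of that event
    (\<open>parity_balance\<close>).

The upward case is the first fact with \<open>w = v\<close>, halved. The downward case needs \<open>u \<ge> (1 - v) X\<close>, which is
the difference of the cases \<open>w = 1\<close> and \<open>w = 1 - v\<close>, halved.

The displacement has the symmetric density \<open>f x = 1 / (2 * sqrt (1 + x\<^sup>2) ^ 3)\<close>, which decays like
\<open>1 / (2 x\<^sup>3)\<close>: the variance is infinite, but only logarithmically so. This is where the scale
\<open>log cot \<bar>\<Lambda>\<bar> / log s\<close> comes from.

For the first fact, summing over the number of crossings gives
\<open>exit_prob w T s = \<integral> f x * G s (w x) dx\<close> over \<open>0 < x \<le> T\<close>, where \<open>G s y\<close> is the expected number of visits to the
distances \<open>[0, y]\<close> before the exit (\<open>hit_eq\<close>). Cutting a path at its point closest to the edge expresses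
\<open>G\<close> through the renewal function \<open>U\<close> of the record heights of the walk (\<open>green_ladder\<close>, \<open>occupation_eq\<close>).
Averaged over starting points in \<open>[(1 - \<epsilon>) s, s]\<close> this becomes a product (\<open>window_average\<close>):
with \<open>V\<close> the integral of \<open>U\<close> and \<open>K w T\<close> the integral of \<open>f x * V (w x)\<close> over \<open>[0, T]\<close>,
the averaged probability is about \<open>\<kappa> s * K w T\<close> for a factor \<open>\<kappa> s\<close> that depends on neither \<open>w\<close> nor \<open>T\<close>,
namely the slope of \<open>U\<close> over the window.
The average may be replaced by the value at \<open>s\<close>, because exit probabilities hardly change when the
starting point moves by a small fraction of \<open>s\<close> (\<open>even_sum_smooth\<close>, \<open>hit_smooth\<close>).

The rest is self-consistency. An a priori bound \<open>U x = O(x / sqrt (ln x))\<close> shows that the last displacement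
rarely exceeds \<open>s\<^sup>b\<close> for \<open>b\<close> near 1 (\<open>exit_prob_tail\<close>), so the product formula with \<open>w = 1\<close> forces
\<open>\<kappa> s * K 1 s \<longlonglongrightarrow> 1\<close>. Since \<open>\<kappa>\<close> is the slope of \<open>U\<close>, it follows that \<open>U x\<close> is asymptotic to \<open>x / K 1 x\<close> and
\<open>V x\<close> to \<open>x\<^sup>2 / (2 * K 1 x)\<close>. The derivative of \<open>K 1\<close> is \<open>f * V\<close>, so the derivative of its square is
asymptotic to \<open>1 / (2 x)\<close>, and \<open>K 1 x\<close> to \<open>sqrt (ln x / 2)\<close>. Hence \<open>K w (s\<^sup>a) / K 1 s \<longlonglongrightarrow> w\<^sup>2 * sqrt a\<close>: the square
comes from the quadratic growth of \<open>V\<close>, the square root from that of \<open>K 1\<close>.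

Both the smoothness and the second fact come from a number \<open>n\<close> of steps of order \<open>s\<^sup>2 / ln s\<close>
(\<open>mixing_scale\<close>). It is small enough that the walk from \<open>s\<close> is unlikely to leave within \<open>n\<close> steps
(\<open>free_walk_tail\<close>), and large enough that its position is spread over distances of order \<open>s\<close>
(\<open>concentration_le\<close>), so that two walks with nearby starting points have almost the same law after
\<open>n\<close> steps. The contributions of even and of odd numbers of crossings differ by a single step, and a single
step is invisible at that scale.\<close>

section \<open>The law of a horizontal displacement\<close>

text \<open>The density of \<open>tan \<Theta>\<close> when \<open>\<Theta>\<close> has density \<open>cos \<theta> / 2\<close>.\<close>

definition jump :: "real \<Rightarrow> real" where
  "jump x = 1 / (2 * sqrt (1 + x\<^sup>2) ^ 3)"

lemma one_plus_square_pos [simp]: "0 < 1 + x\<^sup>2" for x :: real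
  by (simp add: add_pos_nonneg)

lemma one_plus_square_neq_0 [simp]: "1 + x\<^sup>2 \<noteq> 0" for x :: real
  using one_plus_square_pos[of x] by linarith

lemma jump_pos [simp]: "0 < jump x"
  by (simp add: jump_def)

lemma jump_nonneg [simp]: "0 \<le> jump x"
  by (rule less_imp_le) simp

lemma jump_minus [simp]: "jump (- x) = jump x"
  by (simp add: jump_def)

lemma jump_commute: "jump (x - y) = jump (y - x)"
  by (simp add: jump_def power2_commute)

lemma jump_mono: "jump y \<le> jump x" if "\<bar>x\<bar> \<le> \<bar>y\<bar>"
proof -
  have "x\<^sup>2 \<le> y\<^sup>2" using that by (simp add: abs_le_square_iff)
  hence "sqrt (1 + x\<^sup>2) ^ 3 \<le> sqrt (1 + y\<^sup>2) ^ 3" by (intro power_mono) auto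
  thus ?thesis unfolding jump_def by (intro divide_left_mono mult_pos_pos zero_less_power) auto
qed

lemma jump_le_half: "jump x \<le> 1 / 2"
  using jump_mono[of 0 x] by (simp add: jump_def)

lemma continuous_jump: "continuous_on A jump"
  unfolding jump_def by (intro continuous_intros) (simp add: add_nonneg_eq_0_iff)

lemma measurable_jump [measurable]: "jump \<in> borel_measurable borel"
  by (intro borel_measurable_continuous_onI continuous_jump)

lemma jump_upper: "jump x \<le> 1 / (2 * x ^ 3)" if "0 < x"
proof -
  have "x ^ 3 \<le> sqrt (1 + x\<^sup>2) ^ 3"
    using that by (intro power_mono real_le_rsqrt) auto
  thus ?thesis unfolding jump_def using that by (intro divide_left_mono mult_pos_pos zero_less_power) auto
qed

lemma jump_lower: "1 / (6 * x ^ 3) \<le> jump x" if "1 \<le> x"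
proof -
  have "sqrt (1 + x\<^sup>2) \<le> sqrt (2 * x\<^sup>2)" using that by (simp add: one_le_power)
  also have "\<dots> = sqrt 2 * x" using that by (simp add: real_sqrt_mult)
  finally have "sqrt (1 + x\<^sup>2) ^ 3 \<le> (sqrt 2 * x) ^ 3" by (intro power_mono) auto
  also have "\<dots> = 2 * sqrt 2 * x ^ 3" by (simp add: power_mult_distrib eval_nat_numeral)
  also have "\<dots> \<le> 3 * x ^ 3"
  proof (intro mult_right_mono)
    have "sqrt 2 \<le> 3 / 2" by (rule real_le_lsqrt) (auto simp: power2_eq_square)
    thus "2 * sqrt 2 \<le> 3" by simp
  qed (use that in simp)
  finally have "2 * sqrt (1 + x\<^sup>2) ^ 3 \<le> 6 * x ^ 3" by simp
  thus ?thesis unfolding jump_def using that by (intro divide_left_mono mult_pos_pos zero_less_power) auto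
qed

lemma jump_asymp: "((\<lambda>x. x ^ 3 * jump x) \<longlongrightarrow> 1 / 2) at_top"
  unfolding jump_def by real_asymp

definition jump_cdf :: "real \<Rightarrow> real" where
  "jump_cdf x = (1 + x / sqrt (1 + x\<^sup>2)) / 2"

lemma DERIV_jump_cdf: "DERIV jump_cdf x :> jump x"
proof -
  define q where "q = sqrt (1 + x\<^sup>2)"
  have q: "q > 0" "q\<^sup>2 = 1 + x\<^sup>2" by (auto simp: q_def)
  have sq: "DERIV (\<lambda>x. sqrt (1 + x\<^sup>2)) x :> inverse q / 2 * (2 * x)"
    unfolding q_def
    by (rule DERIV_chain2[OF DERIV_real_sqrt]) (auto intro!: derivative_eq_intros)
  have "DERIV jump_cdf x :> (0 + (1 * q - x * (inverse q / 2 * (2 * x))) / (q * q)) / 2"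
    unfolding jump_cdf_def[abs_def]
    using DERIV_divide[OF DERIV_ident sq] q
    by (intro DERIV_cdivide DERIV_add DERIV_const) (simp add: q_def)
  also have "(0 + (1 * q - x * (inverse q / 2 * (2 * x))) / (q * q)) / 2 = (q\<^sup>2 - x\<^sup>2) / (2 * q ^ 3)"
    using q(1) by (simp add: field_simps eval_nat_numeral)
  also have "\<dots> = jump x" using q by (simp add: jump_def q_def)
  finally show ?thesis .
qed

lemma nn_integral_jump_Ioi:
  "(\<integral>\<^sup>+y. ennreal (jump y) * indicator {a..} y \<partial>lborel) = ennreal (1 - jump_cdf a)"
  by (rule nn_integral_FTC_atLeast)
    (auto intro: DERIV_jump_cdf, unfold jump_cdf_def, real_asymp)

lemma jump_cdf_minus: "jump_cdf (- x) = 1 - jump_cdf x"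
  by (simp add: jump_cdf_def field_simps)

lemma nn_integral_reflect:
  fixes f :: "real \<Rightarrow> ennreal" assumes [measurable]: "f \<in> borel_measurable borel"
  shows "(\<integral>\<^sup>+x. f (t - x) \<partial>lborel) = (\<integral>\<^sup>+x. f x \<partial>lborel)"
  using nn_integral_real_affine[OF assms, of "-1" t] by simp

lemma nn_integral_shift:
  fixes f :: "real \<Rightarrow> ennreal" assumes [measurable]: "f \<in> borel_measurable borel"
  shows "(\<integral>\<^sup>+x. f (x + t) \<partial>lborel) = (\<integral>\<^sup>+x. f x \<partial>lborel)"
  using nn_integral_real_affine[OF assms, of 1 t] by (simp add: add.commute)

lemma nn_integral_jump_Iic:
  "(\<integral>\<^sup>+y. ennreal (jump y) * indicator {..a} y \<partial>lborel) = ennreal (jump_cdf a)"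
proof -
  have "(\<integral>\<^sup>+y. ennreal (jump y) * indicator {..a} y \<partial>lborel)
     = (\<integral>\<^sup>+y. ennreal (jump (0 - y)) * indicator {..a} (0 - y) \<partial>lborel)"
    by (rule nn_integral_reflect[symmetric]) simp
  also have "\<dots> = (\<integral>\<^sup>+y. ennreal (jump y) * indicator {-a..} y \<partial>lborel)"
    by (intro nn_integral_cong) (auto simp: indicator_def)
  finally show ?thesis by (simp add: nn_integral_jump_Ioi jump_cdf_minus)
qed

lemma nn_integral_jump [simp]: "(\<integral>\<^sup>+y. ennreal (jump y) \<partial>lborel) = 1"
proof -
  have "(\<integral>\<^sup>+y. ennreal (jump y) \<partial>lborel) =
     (\<integral>\<^sup>+y. ennreal (jump y) * indicator {0..} y + ennreal (jump y) * indicator {..0} y \<partial>lborel)"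
    by (rule nn_integral_cong_AE, rule AE_I[of _ _ "{0}"]) (auto simp: indicator_def)
  also have "\<dots> = ennreal (1 / 2) + ennreal (1 / 2)"
    by (subst nn_integral_add)
      (auto simp: nn_integral_jump_Iic nn_integral_jump_Ioi jump_cdf_def)
  also have "\<dots> = 1" by (subst ennreal_plus[symmetric]) auto
  finally show ?thesis .
qed

lemma nn_integral_jump_shift [simp]:
  "(\<integral>\<^sup>+y. ennreal (jump (y - s)) \<partial>lborel) = 1" "(\<integral>\<^sup>+y. ennreal (jump (s - y)) \<partial>lborel) = 1"
  using nn_integral_shift[of "\<lambda>y. ennreal (jump y)" "- s"] nn_integral_reflect[of "\<lambda>y. ennreal (jump y)" s]
  by simp_all

section \<open>The walk stopped at the edge\<close>

text \<open>The variables \<open>s\<close> and \<open>u\<close> are distances from the edge. The index \<open>n\<close> stands for \<open>n + 1\<close> steps, so that there is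
always a density; the \<open>n\<close> intermediate positions are constrained to \<open>A\<close>, but the endpoint \<open>u\<close> is free. With
\<open>A = {0..}\<close> this is the walk before it leaves the strip, with \<open>A = UNIV\<close> the free walk.\<close>

primrec kern :: "real set \<Rightarrow> nat \<Rightarrow> real \<Rightarrow> real \<Rightarrow> ennreal" where
  "kern A 0 s u = ennreal (jump (s - u))"
| "kern A (Suc n) s u = (\<integral>\<^sup>+y. indicator A y * (ennreal (jump (s - y)) * kern A n y u) \<partial>lborel)"

lemma nn_integral_lborel_swap:
  fixes F :: "real \<Rightarrow> real \<Rightarrow> ennreal"
  assumes "(\<lambda>z. F (fst z) (snd z)) \<in> borel_measurable (borel \<Otimes>\<^sub>M borel)"
  shows "(\<integral>\<^sup>+y. \<integral>\<^sup>+x. F x y \<partial>lborel \<partial>lborel) = (\<integral>\<^sup>+x. \<integral>\<^sup>+y. F x y \<partial>lborel \<partial>lborel)"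
  by (rule lborel_pair.Fubini') (use assms in \<open>simp add: split_beta'\<close>)

lemma measurable_kern_pair:
  assumes [measurable]: "A \<in> sets borel"
  shows "(\<lambda>z. kern A n (fst z) (snd z)) \<in> borel_measurable (borel \<Otimes>\<^sub>M borel)"
proof (induction n)
  case (Suc n)
  have [measurable]: "(\<lambda>w. kern A n (snd w) (snd (fst w))) \<in> borel_measurable ((borel \<Otimes>\<^sub>M borel) \<Otimes>\<^sub>M lborel)"
    using measurable_compose[OF _ Suc, of "\<lambda>w. (snd w, snd (fst w))" "(borel \<Otimes>\<^sub>M borel) \<Otimes>\<^sub>M lborel"] by simp
  show ?case
    unfolding kern.simps
    by (rule lborel.borel_measurable_nn_integral) (simp add: split_beta')
qed simp

lemma measurable_kern [measurable (raw)]: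
  assumes "A \<in> sets borel" "f \<in> borel_measurable N" "g \<in> borel_measurable N"
  shows "(\<lambda>x. kern A n (f x) (g x)) \<in> borel_measurable N"
  using measurable_compose[OF measurable_Pair[OF assms(2,3)] measurable_kern_pair[OF assms(1)]] by simp

text \<open>The kernel is defined by splitting off the first step; splitting off the last one instead makes
time reversal available, which gives the symmetry below.\<close>

lemma kern_Suc_right:
  assumes [measurable]: "A \<in> sets borel"
  shows "kern A (Suc n) s u = (\<integral>\<^sup>+y. indicator A y * (kern A n s y * ennreal (jump (y - u))) \<partial>lborel)"
proof (induction n arbitrary: s)
  case (Suc n)
  have "kern A (Suc (Suc n)) s u = (\<integral>\<^sup>+y. indicator A y * (ennreal (jump (s - y)) * kern A (Suc n) y u) \<partial>lborel)"
    by (rule kern.simps)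
  also have "\<dots> = (\<integral>\<^sup>+y. \<integral>\<^sup>+z. indicator A y * ennreal (jump (s - y)) *
                 (indicator A z * (kern A n y z * ennreal (jump (z - u)))) \<partial>lborel \<partial>lborel)"
    unfolding Suc by (subst nn_integral_cmult) (auto simp: mult.assoc)
  also have "\<dots> = (\<integral>\<^sup>+z. \<integral>\<^sup>+y. indicator A y * ennreal (jump (s - y)) *
                 (indicator A z * (kern A n y z * ennreal (jump (z - u)))) \<partial>lborel \<partial>lborel)"
    by (rule nn_integral_lborel_swap) simp
  also have "\<dots> = (\<integral>\<^sup>+z. indicator A z * ennreal (jump (z - u)) *
                 (\<integral>\<^sup>+y. indicator A y * (ennreal (jump (s - y)) * kern A n y z) \<partial>lborel) \<partial>lborel)"
    by (subst nn_integral_cmult[symmetric]) (auto simp: mult_ac)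
  also have "\<dots> = (\<integral>\<^sup>+z. indicator A z * (kern A (Suc n) s z * ennreal (jump (z - u))) \<partial>lborel)"
    by (simp add: mult_ac)
  finally show ?case .
qed simp

lemma kern_commute: "kern A n s u = kern A n u s" if [measurable]: "A \<in> sets borel"
proof (induction n arbitrary: s u)
  case 0
  show ?case by (simp add: jump_commute)
next
  case (Suc n)
  have "kern A (Suc n) s u = (\<integral>\<^sup>+y. indicator A y * (ennreal (jump (s - y)) * kern A n y u) \<partial>lborel)"
    by simp
  also have "\<dots> = (\<integral>\<^sup>+y. indicator A y * (kern A n u y * ennreal (jump (y - s))) \<partial>lborel)"
    by (intro nn_integral_cong) (simp add: Suc[of _ u] jump_commute[of s] mult_ac)
  also have "\<dots> = kern A (Suc n) u s" by (rule kern_Suc_right[symmetric]) simp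
  finally show ?case .
qed

lemma kern_mono: "A \<subseteq> B \<Longrightarrow> kern A n s u \<le> kern B n s u"
  by (induction n arbitrary: s) (auto intro!: nn_integral_mono mult_mono simp: indicator_def)

lemma kern_le_half: "kern A n s u \<le> ennreal (1 / 2)"
proof (induction n arbitrary: s)
  case (Suc n)
  have "kern A (Suc n) s u \<le> (\<integral>\<^sup>+y. ennreal (jump (s - y)) * ennreal (1/2) \<partial>lborel)"
    unfolding kern.simps
    by (intro nn_integral_mono) (auto intro!: mult_left_mono simp: indicator_def Suc simp del: ennreal_half)
  also have "\<dots> = ennreal (1 / 2)" by (subst nn_integral_multc) auto
  finally show ?case .
qed (use ennreal_leI[OF jump_le_half] in simp)

text \<open>One step of the walk that is killed when its distance from the edge becomes negative, acting on functions
of the distance.\<close>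

definition kill_step :: "(real \<Rightarrow> ennreal) \<Rightarrow> real \<Rightarrow> ennreal" where
  "kill_step \<phi> s = (\<integral>\<^sup>+y. indicator {0..} y * (ennreal (jump (s - y)) * \<phi> y) \<partial>lborel)"

lemma measurable_kill_step [measurable (raw)]:
  assumes [measurable]: "\<phi> \<in> borel_measurable borel"
  shows "kill_step \<phi> \<in> borel_measurable borel"
  unfolding kill_step_def[abs_def] by measurable

lemma measurable_kill_step_funpow [measurable (raw)]:
  "\<phi> \<in> borel_measurable borel \<Longrightarrow> (kill_step ^^ n) \<phi> \<in> borel_measurable borel"
  by (induction n) auto

lemma kill_step_kern:
  assumes [measurable]: "\<phi> \<in> borel_measurable borel"
  shows "kill_step (\<lambda>s. \<integral>\<^sup>+u. indicator {0..} u * (kern {0..} n s u * \<phi> u) \<partial>lborel) s =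
    (\<integral>\<^sup>+u. indicator {0..} u * (kern {0..} (Suc n) s u * \<phi> u) \<partial>lborel)"
proof -
  have "kill_step (\<lambda>s. \<integral>\<^sup>+u. indicator {0..} u * (kern {0..} n s u * \<phi> u) \<partial>lborel) s =
    (\<integral>\<^sup>+y. \<integral>\<^sup>+u. indicator {0..} y * (ennreal (jump (s - y)) * (indicator {0..} u * (kern {0..} n y u * \<phi> u))) \<partial>lborel \<partial>lborel)"
    unfolding kill_step_def by (simp add: nn_integral_cmult)
  also have "\<dots> = (\<integral>\<^sup>+u. \<integral>\<^sup>+y. indicator {0..} y * (ennreal (jump (s - y)) * (indicator {0..} u * (kern {0..} n y u * \<phi> u))) \<partial>lborel \<partial>lborel)"
    by (rule nn_integral_lborel_swap) simp
  also have "\<dots> = (\<integral>\<^sup>+u. (indicator {0..} u * \<phi> u) * (\<integral>\<^sup>+y. indicator {0..} y * (ennreal (jump (s - y)) * kern {0..} n y u) \<partial>lborel) \<partial>lborel)"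
    by (subst nn_integral_cmult[symmetric]) (auto simp: mult_ac)
  also have "\<dots> = (\<integral>\<^sup>+u. indicator {0..} u * (kern {0..} (Suc n) s u * \<phi> u) \<partial>lborel)"
    by (simp add: mult_ac)
  finally show ?thesis .
qed

lemma kill_step_funpow_Suc:
  assumes [measurable]: "\<phi> \<in> borel_measurable borel"
  shows "(kill_step ^^ Suc n) \<phi> s = (\<integral>\<^sup>+u. indicator {0..} u * (kern {0..} n s u * \<phi> u) \<partial>lborel)"
proof (induction n arbitrary: s)
  case (Suc n)
  have "(kill_step ^^ Suc (Suc n)) \<phi> s = kill_step ((kill_step ^^ Suc n) \<phi>) s" by simp
  also have "(kill_step ^^ Suc n) \<phi> = (\<lambda>s. \<integral>\<^sup>+u. indicator {0..} u * (kern {0..} n s u * \<phi> u) \<partial>lborel)"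
    using Suc by blast
  finally show ?case by (simp only: kill_step_kern[OF assms])
qed (simp add: kill_step_def)

text \<open>The probabilities that the walk from \<open>s\<close> is still in the strip after step \<open>n + 1\<close>, and that it leaves the
strip with step \<open>n + 1\<close>.\<close>

definition alive :: "nat \<Rightarrow> real \<Rightarrow> ennreal" where
  "alive n s = (\<integral>\<^sup>+y. indicator {0..} y * kern {0..} n s y \<partial>lborel)"

definition exit_mass :: "nat \<Rightarrow> real \<Rightarrow> ennreal" where
  "exit_mass n s = (\<integral>\<^sup>+y. indicator {..<0} y * kern {0..} n s y \<partial>lborel)"

lemma alive_0_add: "alive 0 s + exit_mass 0 s = 1"
  unfolding alive_def exit_mass_def
  by (subst nn_integral_add[symmetric])
    (auto simp: indicator_def intro!: trans[OF nn_integral_cong nn_integral_jump_shift(2)[of s]])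

lemma kern_total:
  assumes [measurable]: "A \<in> sets borel"
  shows "(\<integral>\<^sup>+y. kern A (Suc n) s y \<partial>lborel) = (\<integral>\<^sup>+y. indicator A y * kern A n s y \<partial>lborel)"
proof -
  have "(\<integral>\<^sup>+y. kern A (Suc n) s y \<partial>lborel) =
     (\<integral>\<^sup>+y. \<integral>\<^sup>+z. indicator A z * (kern A n s z * ennreal (jump (z - y))) \<partial>lborel \<partial>lborel)"
    by (simp only: kern_Suc_right[OF assms])
  also have "\<dots> = (\<integral>\<^sup>+z. \<integral>\<^sup>+y. indicator A z * (kern A n s z * ennreal (jump (z - y))) \<partial>lborel \<partial>lborel)"
    by (rule nn_integral_lborel_swap) simp
  also have "\<dots> = (\<integral>\<^sup>+z. indicator A z * kern A n s z \<partial>lborel)"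
    by (subst mult.assoc[symmetric], subst nn_integral_cmult) auto
  finally show ?thesis .
qed

lemma kern_UNIV_total [simp]: "(\<integral>\<^sup>+y. kern UNIV n s y \<partial>lborel) = 1"
  by (induction n) (auto simp: kern_total simp del: kern.simps(2))

lemma alive_Suc_add: "alive (Suc n) s + exit_mass (Suc n) s = alive n s"
proof -
  have "alive (Suc n) s + exit_mass (Suc n) s = (\<integral>\<^sup>+y. kern {0..} (Suc n) s y \<partial>lborel)"
    unfolding alive_def exit_mass_def
    by (subst nn_integral_add[symmetric]) (auto simp: indicator_def intro!: nn_integral_cong)
  thus ?thesis by (simp add: kern_total alive_def del: kern.simps)
qed

lemma sum_exit_mass: "(\<Sum>i<Suc n. exit_mass i s) + alive n s = 1"
proof (induction n)
  case 0 show ?case using alive_0_add by (simp add: add.commute)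
next
  case (Suc n)
  have "(\<Sum>i<Suc (Suc n). exit_mass i s) + alive (Suc n) s
      = (\<Sum>i<Suc n. exit_mass i s) + (alive (Suc n) s + exit_mass (Suc n) s)"
    by (simp add: add_ac)
  with Suc show ?case by (simp only: alive_Suc_add)
qed

lemma alive_le_1: "alive n s \<le> 1"
  using sum_exit_mass[of s n] by (metis add.commute le_iff_add)

lemma measurable_alive [measurable]: "alive n \<in> borel_measurable borel"
  unfolding alive_def[abs_def] by measurable

lemma alive_Suc: "alive (Suc n) s = kill_step (alive n) s"
  using kill_step_kern[of "\<lambda>_. 1" n s] by (simp add: alive_def[abs_def])

text \<open>The free walk does not see the edge.\<close>

lemma kern_UNIV_shift: "kern UNIV n (s + t) (u + t) = kern UNIV n s u"
proof (induction n arbitrary: s)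
  case (Suc n)
  have "kern UNIV (Suc n) (s + t) (u + t) =
     (\<integral>\<^sup>+y. ennreal (jump (s + t - (y + t))) * kern UNIV n (y + t) (u + t) \<partial>lborel)"
    using nn_integral_shift[of "\<lambda>y. ennreal (jump (s + t - y)) * kern UNIV n y (u + t)" t] by simp
  thus ?case by (simp add: Suc)
qed simp

lemma kern_UNIV_minus: "kern UNIV n (- s) (- u) = kern UNIV n s u"
  using kern_UNIV_shift[of n "- s" "s + u" "- u"] by (simp add: kern_commute)

text \<open>Tonelli in the shape in which it is used throughout: an inner integral against a kernel is moved from one
weight to the other.\<close>

lemma nn_integral_mult_swap:
  fixes F :: "real \<Rightarrow> real \<Rightarrow> ennreal" and \<phi> \<psi> :: "real \<Rightarrow> ennreal"
  assumes [measurable]: "(\<lambda>z. F (fst z) (snd z)) \<in> borel_measurable (borel \<Otimes>\<^sub>M borel)"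
    "\<phi> \<in> borel_measurable borel" "\<psi> \<in> borel_measurable borel"
  shows "(\<integral>\<^sup>+y. \<phi> y * (\<integral>\<^sup>+z. F y z * \<psi> z \<partial>lborel) \<partial>lborel) = (\<integral>\<^sup>+z. \<psi> z * (\<integral>\<^sup>+y. \<phi> y * F y z \<partial>lborel) \<partial>lborel)"
proof -
  have [measurable]: "(\<lambda>z. F (snd z) (fst z)) \<in> borel_measurable (borel \<Otimes>\<^sub>M borel)"
    using measurable_compose[OF _ assms(1), of "\<lambda>z. (snd z, fst z)" "borel \<Otimes>\<^sub>M borel"] by simp
  have [measurable]: "F y \<in> borel_measurable borel" for y
    using measurable_compose[OF measurable_Pair1' assms(1), of y] by simp
  have [measurable]: "(\<lambda>y. F y z) \<in> borel_measurable borel" for z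
    using measurable_compose[OF measurable_Pair2' assms(1), of z] by simp
  have "(\<integral>\<^sup>+y. \<phi> y * (\<integral>\<^sup>+z. F y z * \<psi> z \<partial>lborel) \<partial>lborel) = (\<integral>\<^sup>+y. \<integral>\<^sup>+z. \<phi> y * (F y z * \<psi> z) \<partial>lborel \<partial>lborel)"
    by (subst nn_integral_cmult) auto
  also have "\<dots> = (\<integral>\<^sup>+z. \<integral>\<^sup>+y. \<phi> y * (F y z * \<psi> z) \<partial>lborel \<partial>lborel)"
    by (rule nn_integral_lborel_swap) simp
  also have "\<dots> = (\<integral>\<^sup>+z. \<psi> z * (\<integral>\<^sup>+y. \<phi> y * F y z \<partial>lborel) \<partial>lborel)"
    by (subst nn_integral_cmult[symmetric]) (auto simp: mult_ac)
  finally show ?thesis .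
qed

text \<open>The reflection principle: a path that has crossed the edge is, by symmetry, beyond it at time \<open>n + 1\<close> with
conditional probability at least one half, so leaving within \<open>n + 1\<close> steps costs at most twice the probability that the
free walk ends beyond the edge. Stating it for all \<open>s\<close>, with the indicator, makes the induction on the first step work.\<close>

lemma alive_reflection_bound:
  "1 \<le> indicator {0..} s * alive n s + 2 * (\<integral>\<^sup>+y. indicator {..<0} y * kern UNIV n s y \<partial>lborel)"
    (is "_ \<le> _ + 2 * ?F n s")
proof (induction n arbitrary: s)
  \<comment> \<open>A start beyond the edge: reflecting at the start maps the strip into the region beyond the edge.\<close>
  have neg: "1 \<le> 2 * ?F n s" if "s < 0" for n s
  proof -
    have "?F n s + (\<integral>\<^sup>+y. indicator {0..} y * kern UNIV n s y \<partial>lborel) = (\<integral>\<^sup>+y. kern UNIV n s y \<partial>lborel)"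
      by (subst nn_integral_add[symmetric])
        (auto simp: indicator_def simp del: kern_UNIV_total intro!: nn_integral_cong)
    moreover have "(\<integral>\<^sup>+y. indicator {0..} y * kern UNIV n s y \<partial>lborel) =
       (\<integral>\<^sup>+y. indicator {0..} (2 * s - y) * kern UNIV n s (2 * s - y) \<partial>lborel)"
      by (rule nn_integral_reflect[symmetric]) simp
    moreover have "\<dots> \<le> ?F n s"
    proof (intro nn_integral_mono)
      fix y
      have "kern UNIV n s (2 * s - y) = kern UNIV n s y"
        using kern_UNIV_shift[of n "- s" "2 * s" "- y"] by (simp add: kern_UNIV_minus)
      thus "indicator {0..} (2 * s - y) * kern UNIV n s (2 * s - y) \<le> indicator {..<0} y * kern UNIV n s y"
        using that by (auto simp: indicator_def)
    qed
    ultimately have "1 \<le> ?F n s + ?F n s" by (metis add_left_mono kern_UNIV_total)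
    thus ?thesis by (simp add: mult_2)
  qed
  { case 0
    have "1 = alive 0 s + ?F 0 s" using alive_0_add[of s] by (simp add: exit_mass_def)
    also have "\<dots> \<le> alive 0 s + 2 * ?F 0 s" by (simp add: mult_2)
    finally show ?case using neg[of s 0] by (cases "s < 0") auto }
  { case (Suc n)
    have "1 = (\<integral>\<^sup>+y. ennreal (jump (s - y)) * 1 \<partial>lborel)" by simp
    also have "\<dots> \<le> (\<integral>\<^sup>+y. ennreal (jump (s - y)) * (indicator {0..} y * alive n y + 2 * ?F n y) \<partial>lborel)"
      by (intro nn_integral_mono mult_left_mono Suc) auto
    also have "\<dots> = (\<integral>\<^sup>+y. indicator {0..} y * (ennreal (jump (s - y)) * alive n y) \<partial>lborel) +
                  2 * (\<integral>\<^sup>+y. ennreal (jump (s - y)) * ?F n y \<partial>lborel)"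
      by (subst nn_integral_cmult[symmetric], simp, subst nn_integral_add[symmetric])
        (auto simp: distrib_left mult_ac)
    also have "(\<integral>\<^sup>+y. indicator {0..} y * (ennreal (jump (s - y)) * alive n y) \<partial>lborel) = alive (Suc n) s"
      by (simp add: alive_Suc kill_step_def)
    also have "(\<integral>\<^sup>+y. ennreal (jump (s - y)) * ?F n y \<partial>lborel) = ?F (Suc n) s"
      using nn_integral_mult_swap[of "kern UNIV n" "\<lambda>y. ennreal (jump (s - y))" "indicator {..<0}"]
      by (simp add: mult_ac)
    finally show ?case using neg[of s "Suc n"] by (cases "s < 0") auto }
qed

section \<open>Ladder decomposition of the Green function\<close>

text \<open>The Cauchy product with the index shift that occurs when a path of \<open>n + 1\<close> steps is cut into two paths with
at least one step each.\<close>

lemma ennreal_Cauchy_suminf: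
  fixes a b :: "nat \<Rightarrow> ennreal"
  shows "(\<Sum>n. \<Sum>i<n. a i * b (n - Suc i)) = (\<Sum>i. a i) * (\<Sum>j. b j)"
proof -
  have shift: "(\<Sum>n. if i < n then b (n - Suc i) else 0) = (\<Sum>j. b j)" for i
  proof (induction i)
    case 0
    have "(\<lambda>n. if 0 < n then b (n - Suc 0) else 0) sums ((\<Sum>j. b j) + 0)"
      using sums_Suc[of "\<lambda>n. if 0 < n then b (n - Suc 0) else 0" "\<Sum>j. b j"] by (simp add: summable_sums)
    thus ?case by (simp add: sums_iff)
  next
    case (Suc i)
    have "(\<lambda>n. if i < n then b (n - Suc i) else 0) sums (\<Sum>j. b j)"
      using Suc by (simp add: sums_iff)
    hence "(\<lambda>n. if Suc i < n then b (n - Suc (Suc i)) else 0) sums ((\<Sum>j. b j) + 0)"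
      using sums_Suc[of "\<lambda>n. if Suc i < n then b (n - Suc (Suc i)) else 0" "\<Sum>j. b j"]
      by (simp only: diff_Suc_Suc Suc_less_eq not_less0 if_False)
    from sums_unique[OF this] show ?case by (simp only: add_0_right)
  qed
  have "(\<Sum>n. \<Sum>i<n. a i * b (n - Suc i)) = (\<Sum>n. \<Sum>i. if i < n then a i * b (n - Suc i) else 0)"
  proof (rule suminf_cong)
    fix n
    have "(\<Sum>i. if i < n then a i * b (n - Suc i) else 0) = (\<Sum>i<n. if i < n then a i * b (n - Suc i) else 0)"
      by (rule suminf_finite) auto
    thus "(\<Sum>i<n. a i * b (n - Suc i)) = (\<Sum>i. if i < n then a i * b (n - Suc i) else 0)" by simp
  qed
  also have "\<dots> = (\<Sum>i. \<Sum>n. if i < n then a i * b (n - Suc i) else 0)"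
    using nn_integral_suminf[of "\<lambda>i n. if i < n then a i * b (n - Suc i) else 0" "count_space UNIV"]
    by (simp add: nn_integral_count_space_nat)
  also have "\<dots> = (\<Sum>i. a i * (\<Sum>n. if i < n then b (n - Suc i) else 0))"
    by (rule suminf_cong, rule trans[OF suminf_cong ennreal_suminf_cmult]) auto
  finally show ?thesis by (simp add: shift)
qed

abbreviation hkern :: "nat \<Rightarrow> real \<Rightarrow> real \<Rightarrow> ennreal" where
  "hkern \<equiv> kern {0..}"

text \<open>The decomposition proved next assumes \<open>u \<le> s\<close>, but after a first step to \<open>y\<close> the order of \<open>y\<close> and \<open>u\<close> is
arbitrary. Symmetry of the kernel supplies the other order; the indicators combine both into one formula.\<close>

lemma hkern_ladder_sym:
  assumes "0 \<le> u" "0 \<le> y"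
    and "\<And>s u. 0 \<le> u \<Longrightarrow> u \<le> s \<Longrightarrow> hkern n s u = hkern n (s - u) 0 +
      (\<Sum>i<n. \<integral>\<^sup>+z. indicator {0..u} z * (hkern i (s - z) 0 * hkern (n - Suc i) (u - z) 0) \<partial>lborel)"
  shows "hkern n y u = indicator {u..} y * hkern n (y - u) 0 + indicator {..<u} y * hkern n (u - y) 0 +
      (\<Sum>i<n. \<integral>\<^sup>+z. indicator {0..u} z * (indicator {0..} (y - z) * hkern i (y - z) 0 * hkern (n - Suc i) (u - z) 0) \<partial>lborel)"
proof (cases "u \<le> y")
  case True
  have "indicator {0..u} z * (hkern i (y - z) 0 * hkern (n - Suc i) (u - z) 0) =
     indicator {0..u} z * (indicator {0..} (y - z) * hkern i (y - z) 0 * hkern (n - Suc i) (u - z) 0)" for i z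
    using True by (auto simp: indicator_def)
  thus ?thesis using True assms(1) by (subst assms(3)) simp_all
next
  case False
  have "hkern n y u = hkern n u y" by (rule kern_commute) simp
  also have "\<dots> = hkern n (u - y) 0 + (\<Sum>i<n. \<integral>\<^sup>+z. indicator {0..y} z *
       (hkern i (u - z) 0 * hkern (n - Suc i) (y - z) 0) \<partial>lborel)"
    using False assms(2) by (intro assms(3)) simp_all
  also have "(\<Sum>i<n. \<integral>\<^sup>+z. indicator {0..y} z * (hkern i (u - z) 0 * hkern (n - Suc i) (y - z) 0) \<partial>lborel)
    = (\<Sum>i<n. \<integral>\<^sup>+z. indicator {0..y} z * (hkern (n - Suc i) (u - z) 0 * hkern i (y - z) 0) \<partial>lborel)"
    by (subst sum.nat_diff_reindex[symmetric]) (simp add: Suc_diff_Suc)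
  also have "\<dots> = (\<Sum>i<n. \<integral>\<^sup>+z. indicator {0..u} z * (indicator {0..} (y - z) * hkern i (y - z) 0 * hkern (n - Suc i) (u - z) 0) \<partial>lborel)"
    using False by (intro sum.cong nn_integral_cong) (auto simp: indicator_def mult_ac)
  finally show ?thesis using False by simp
qed

text \<open>A path from \<open>s\<close> to \<open>u \<le> s\<close> that stays in the half-line is cut at its lowest point \<open>z\<close>: before and after it
the path stays above \<open>z\<close>, so both pieces are, up to translation, paths in the half-line ending or starting at \<open>0\<close>.
The first summand is the case in which the lowest point is the endpoint \<open>u\<close>. Formally this is an
induction on the first step.\<close>

lemma hkern_ladder:
  assumes "0 \<le> u" "u \<le> s"
  shows "hkern n s u = hkern n (s - u) 0 +
    (\<Sum>i<n. \<integral>\<^sup>+z. indicator {0..u} z * (hkern i (s - z) 0 * hkern (n - Suc i) (u - z) 0) \<partial>lborel)"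
  using assms
proof (induction n arbitrary: s u)
  case (Suc n)
  let ?T = "\<lambda>i y. \<integral>\<^sup>+z. indicator {0..u} z * (indicator {0..} (y - z) * hkern i (y - z) 0 * hkern (n - Suc i) (u - z) 0) \<partial>lborel"
  \<comment> \<open>Prepending a step to the first piece of the decomposition lengthens it by one.\<close>
  have T: "(\<integral>\<^sup>+y. indicator {0..} y * ennreal (jump (s - y)) * ?T i y \<partial>lborel) =
      (\<integral>\<^sup>+z. indicator {0..u} z * (hkern (Suc i) (s - z) 0 * hkern (Suc n - Suc (Suc i)) (u - z) 0) \<partial>lborel)" for i
  proof -
    have "(\<integral>\<^sup>+y. indicator {0..} y * ennreal (jump (s - y)) * ?T i y \<partial>lborel) =
       (\<integral>\<^sup>+y. indicator {0..} y * ennreal (jump (s - y)) *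
         (\<integral>\<^sup>+z. indicator {0..} (y - z) * hkern i (y - z) 0 * (indicator {0..u} z * hkern (n - Suc i) (u - z) 0) \<partial>lborel) \<partial>lborel)"
      by (simp add: mult_ac)
    also have "\<dots> = (\<integral>\<^sup>+z. indicator {0..u} z * hkern (n - Suc i) (u - z) 0 *
         (\<integral>\<^sup>+y. indicator {0..} y * ennreal (jump (s - y)) * (indicator {0..} (y - z) * hkern i (y - z) 0) \<partial>lborel) \<partial>lborel)"
      by (rule nn_integral_mult_swap) (simp_all add: indicator_def)
    also have "\<dots> = (\<integral>\<^sup>+z. indicator {0..u} z * (hkern (Suc i) (s - z) 0 * hkern (Suc n - Suc (Suc i)) (u - z) 0) \<partial>lborel)"
    proof (intro nn_integral_cong)
      fix z
      have "(\<integral>\<^sup>+y. indicator {0..} y * ennreal (jump (s - y)) * (indicator {0..} (y - z) * hkern i (y - z) 0) \<partial>lborel) =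
         hkern (Suc i) (s - z) 0" if "0 \<le> z"
        using that nn_integral_shift[of "\<lambda>y. indicator {0..} y * ennreal (jump (s - y)) * (indicator {0..} (y - z) * hkern i (y - z) 0)" z, symmetric]
        by (auto simp: indicator_def algebra_simps intro!: nn_integral_cong)
      thus "indicator {0..u} z * hkern (n - Suc i) (u - z) 0 *
         (\<integral>\<^sup>+y. indicator {0..} y * ennreal (jump (s - y)) * (indicator {0..} (y - z) * hkern i (y - z) 0) \<partial>lborel) =
         indicator {0..u} z * (hkern (Suc i) (s - z) 0 * hkern (Suc n - Suc (Suc i)) (u - z) 0)"
        by (simp add: indicator_def mult_ac)
    qed
    finally show ?thesis .
  qed
  \<comment> \<open>After the first step to \<open>y\<close>: for \<open>y \<ge> u\<close> the lowest point may be \<open>u\<close>; for \<open>y < u\<close> it may be \<open>y\<close> itself, the term \<open>i = 0\<close> of the new sum; otherwise it lies strictly inside.\<close>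
  have alg: "J * (i * A + k * B + S) = i * (J * A) + (k * (J * B) + J * S)" for J i A k B S :: ennreal
    by (simp add: distrib_left mult_ac add_ac)
  have "hkern (Suc n) s u = (\<integral>\<^sup>+y. indicator {0..} y * (ennreal (jump (s - y)) * hkern n y u) \<partial>lborel)"
    by simp
  also have "\<dots> = (\<integral>\<^sup>+y. indicator {u..} y * (ennreal (jump (s - y)) * hkern n (y - u) 0) +
      (indicator {0..<u} y * (ennreal (jump (s - y)) * hkern n (u - y) 0) +
      (\<Sum>i<n. indicator {0..} y * ennreal (jump (s - y)) * ?T i y)) \<partial>lborel)"
  proof (intro nn_integral_cong)
    fix y
    show "indicator {0..} y * (ennreal (jump (s - y)) * hkern n y u) =
      indicator {u..} y * (ennreal (jump (s - y)) * hkern n (y - u) 0) +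
      (indicator {0..<u} y * (ennreal (jump (s - y)) * hkern n (u - y) 0) +
      (\<Sum>i<n. indicator {0..} y * ennreal (jump (s - y)) * ?T i y))"
    proof (cases "0 \<le> y")
      case True
      have "hkern n y u = indicator {u..} y * hkern n (y - u) 0 + indicator {..<u} y * hkern n (u - y) 0 + (\<Sum>i<n. ?T i y)"
        by (rule hkern_ladder_sym[OF Suc.prems(1) True Suc.IH])
      hence "indicator {0..} y * (ennreal (jump (s - y)) * hkern n y u) = ennreal (jump (s - y)) *
        (indicator {u..} y * hkern n (y - u) 0 + indicator {..<u} y * hkern n (u - y) 0 + (\<Sum>i<n. ?T i y))"
        using True by simp
      moreover have "(\<Sum>i<n. indicator {0..} y * ennreal (jump (s - y)) * ?T i y) = ennreal (jump (s - y)) * (\<Sum>i<n. ?T i y)"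
        using True by (simp add: sum_distrib_left)
      moreover have "indicator {0..<u} y = (indicator {..<u} y :: ennreal)" using True by (simp add: indicator_def)
      ultimately show ?thesis by (simp only: alg)
    qed (use Suc.prems in \<open>auto simp: indicator_def\<close>)
  qed
  also have "\<dots> = (\<integral>\<^sup>+y. indicator {u..} y * (ennreal (jump (s - y)) * hkern n (y - u) 0) \<partial>lborel) +
      ((\<integral>\<^sup>+y. indicator {0..<u} y * (ennreal (jump (s - y)) * hkern n (u - y) 0) \<partial>lborel) +
      (\<Sum>i<n. \<integral>\<^sup>+y. indicator {0..} y * ennreal (jump (s - y)) * ?T i y \<partial>lborel))"
    by (subst nn_integral_add, measurable, subst nn_integral_add, measurable, subst nn_integral_sum) auto
  also have "(\<integral>\<^sup>+y. indicator {u..} y * (ennreal (jump (s - y)) * hkern n (y - u) 0) \<partial>lborel) = hkern (Suc n) (s - u) 0"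
    using nn_integral_shift[of "\<lambda>y. indicator {u..} y * (ennreal (jump (s - y)) * hkern n (y - u) 0)" u, symmetric]
    by (simp add: indicator_def algebra_simps)
  also have "(\<integral>\<^sup>+y. indicator {0..<u} y * (ennreal (jump (s - y)) * hkern n (u - y) 0) \<partial>lborel) =
      (\<integral>\<^sup>+z. indicator {0..u} z * (hkern 0 (s - z) 0 * hkern (Suc n - Suc 0) (u - z) 0) \<partial>lborel)"
    by (rule nn_integral_cong_AE, rule AE_I[of _ _ "{u}"]) (auto simp: indicator_def)
  finally show ?case by (simp only: T sum.lessThan_Suc_shift)
qed simp

text \<open>A path from \<open>a + y\<close> down to \<open>0\<close> is cut at the first time at which it drops below the level \<open>y\<close>, by an amount \<open>z\<close>.\<close>

lemma hkern_first_passage: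
  assumes "0 \<le> y"
  shows "hkern n (a + y) 0 = hkern n a (- y) +
    (\<Sum>i<n. \<integral>\<^sup>+z. indicator {0..y} z * (hkern i a (- z) * hkern (n - Suc i) (y - z) 0) \<partial>lborel)"
proof (induction n arbitrary: a)
  case (Suc n)
  let ?T = "\<lambda>i b. \<integral>\<^sup>+z. indicator {0..y} z * (hkern i b (- z) * hkern (n - Suc i) (y - z) 0) \<partial>lborel"
  \<comment> \<open>A first step to \<open>b \<ge> 0\<close> stays above the level; one to \<open>b < 0\<close> is itself the passage and yields the term \<open>i = 0\<close>.\<close>
  have T: "(\<integral>\<^sup>+b. indicator {0..} b * ennreal (jump (a - b)) * ?T i b \<partial>lborel) =
      (\<integral>\<^sup>+z. indicator {0..y} z * (hkern (Suc i) a (- z) * hkern (Suc n - Suc (Suc i)) (y - z) 0) \<partial>lborel)" for i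
  proof -
    have "(\<integral>\<^sup>+b. indicator {0..} b * ennreal (jump (a - b)) * ?T i b \<partial>lborel) =
       (\<integral>\<^sup>+b. indicator {0..} b * ennreal (jump (a - b)) *
         (\<integral>\<^sup>+z. hkern i b (- z) * (indicator {0..y} z * hkern (n - Suc i) (y - z) 0) \<partial>lborel) \<partial>lborel)"
      by (simp add: mult_ac)
    also have "\<dots> = (\<integral>\<^sup>+z. indicator {0..y} z * hkern (n - Suc i) (y - z) 0 *
         (\<integral>\<^sup>+b. indicator {0..} b * ennreal (jump (a - b)) * hkern i b (- z) \<partial>lborel) \<partial>lborel)"
      by (rule nn_integral_mult_swap) simp_all
    finally show ?thesis by (simp add: mult_ac)
  qed
  have "hkern (Suc n) (a + y) 0 = (\<integral>\<^sup>+b. indicator {-y..} b * (ennreal (jump (a - b)) * hkern n (b + y) 0) \<partial>lborel)"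
    using nn_integral_shift[of "\<lambda>b. indicator {0..} b * (ennreal (jump (a + y - b)) * hkern n b 0)" y, symmetric]
    by (auto simp: indicator_def algebra_simps intro!: nn_integral_cong)
  also have "\<dots> = (\<integral>\<^sup>+b. indicator {0..} b * (ennreal (jump (a - b)) * hkern n b (- y)) +
      ((indicator {-y..<0} b * (ennreal (jump (a - b)) * hkern n (b + y) 0)) +
      (\<Sum>i<n. indicator {0..} b * ennreal (jump (a - b)) * ?T i b)) \<partial>lborel)"
    unfolding Suc using assms
    by (intro nn_integral_cong) (auto simp: indicator_def distrib_left sum_distrib_left mult_ac Suc)
  also have "\<dots> = (\<integral>\<^sup>+b. indicator {0..} b * (ennreal (jump (a - b)) * hkern n b (- y)) \<partial>lborel) +
      ((\<integral>\<^sup>+b. indicator {-y..<0} b * (ennreal (jump (a - b)) * hkern n (b + y) 0) \<partial>lborel) +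
      (\<Sum>i<n. \<integral>\<^sup>+b. indicator {0..} b * ennreal (jump (a - b)) * ?T i b \<partial>lborel))"
    by (subst nn_integral_add, measurable, subst nn_integral_add, measurable, subst nn_integral_sum) auto
  also have "(\<integral>\<^sup>+b. indicator {0..} b * (ennreal (jump (a - b)) * hkern n b (- y)) \<partial>lborel) = hkern (Suc n) a (- y)"
    by simp
  also have "(\<integral>\<^sup>+b. indicator {-y..<0} b * (ennreal (jump (a - b)) * hkern n (b + y) 0) \<partial>lborel) =
     (\<integral>\<^sup>+z. indicator {-y..<0} (0 - z) * (ennreal (jump (a - (0 - z))) * hkern n ((0 - z) + y) 0) \<partial>lborel)"
    by (rule nn_integral_reflect[symmetric]) simp
  also have "\<dots> = (\<integral>\<^sup>+z. indicator {0..y} z * (hkern 0 a (- z) * hkern (Suc n - Suc 0) (y - z) 0) \<partial>lborel)"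
    by (rule nn_integral_cong_AE, rule AE_I[of _ _ "{0}"]) (auto simp: indicator_def)
  finally show ?case by (simp only: T sum.lessThan_Suc_shift)
qed simp

definition green :: "real \<Rightarrow> real \<Rightarrow> ennreal" where
  "green s u = (\<Sum>n. hkern n s u)"

lemma measurable_green [measurable (raw)]:
  assumes [measurable]: "f \<in> borel_measurable N" "g \<in> borel_measurable N"
  shows "(\<lambda>x. green (f x) (g x)) \<in> borel_measurable N"
  unfolding green_def by measurable

text \<open>Read backwards, a path from \<open>x\<close> to \<open>0\<close> in the half-line is a path from \<open>0\<close> to \<open>x\<close> that stays below \<open>x\<close>
until its end. So this is the density of the expected number of record heights at \<open>x\<close>.\<close>

definition renewal_density :: "real \<Rightarrow> ennreal" where
  "renewal_density x = green x 0"

lemma measurable_renewal_density [measurable]: "renewal_density \<in> borel_measurable borel"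
  unfolding renewal_density_def[abs_def] by measurable

lemma suminf_convolution:
  fixes a b :: "nat \<Rightarrow> real \<Rightarrow> ennreal"
  assumes [measurable]: "\<And>i. a i \<in> borel_measurable borel" "\<And>i. b i \<in> borel_measurable borel" "A \<in> sets borel"
  shows "(\<Sum>n. \<Sum>i<n. \<integral>\<^sup>+z. indicator A z * (a i z * b (n - Suc i) z) \<partial>lborel) =
    (\<integral>\<^sup>+z. indicator A z * ((\<Sum>i. a i z) * (\<Sum>i. b i z)) \<partial>lborel)"
proof -
  have "(\<Sum>n. \<Sum>i<n. \<integral>\<^sup>+z. indicator A z * (a i z * b (n - Suc i) z) \<partial>lborel) =
    (\<Sum>n. \<integral>\<^sup>+z. indicator A z * (\<Sum>i<n. a i z * b (n - Suc i) z) \<partial>lborel)"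
    by (subst nn_integral_sum[symmetric]) (auto simp: sum_distrib_left)
  also have "\<dots> = (\<integral>\<^sup>+z. (\<Sum>n. indicator A z * (\<Sum>i<n. a i z * b (n - Suc i) z)) \<partial>lborel)"
    by (rule nn_integral_suminf[symmetric]) measurable
  finally show ?thesis by (simp add: ennreal_Cauchy_suminf[of "\<lambda>i. a i z" "\<lambda>i. b i z" for z])
qed

lemma green_ladder:
  assumes "0 \<le> u" "u \<le> s"
  shows "green s u = renewal_density (s - u) +
    (\<integral>\<^sup>+z. indicator {0..u} z * (renewal_density (s - z) * renewal_density (u - z)) \<partial>lborel)"
proof -
  have "green s u = (\<Sum>n. hkern n (s - u) 0) +
    (\<Sum>n. \<Sum>i<n. \<integral>\<^sup>+z. indicator {0..u} z * (hkern i (s - z) 0 * hkern (n - Suc i) (u - z) 0) \<partial>lborel)"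
    unfolding green_def hkern_ladder[OF assms] by (rule suminf_add[symmetric]) auto
  thus ?thesis by (subst (asm) suminf_convolution) (auto simp: renewal_density_def green_def)
qed

lemma renewal_first_passage:
  assumes "0 \<le> y"
  shows "renewal_density (a + y) = green a (- y) +
    (\<integral>\<^sup>+z. indicator {0..y} z * (green a (- z) * renewal_density (y - z)) \<partial>lborel)"
proof -
  have "renewal_density (a + y) = (\<Sum>n. hkern n a (- y)) +
    (\<Sum>n. \<Sum>i<n. \<integral>\<^sup>+z. indicator {0..y} z * (hkern i a (- z) * hkern (n - Suc i) (y - z) 0) \<partial>lborel)"
    unfolding green_def renewal_density_def hkern_first_passage[OF assms] by (rule suminf_add[symmetric]) auto
  thus ?thesis by (subst (asm) suminf_convolution) (auto simp: renewal_density_def green_def)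
qed

lemma green_commute: "green s u = green u s"
  unfolding green_def by (intro suminf_cong kern_commute) simp

text \<open>The integrand is the density of the overshoot at the exit from the strip.\<close>

lemma overshoot_mass_le_1: "(\<integral>\<^sup>+z. indicator {0..} z * green a (- z) \<partial>lborel) \<le> 1"
proof -
  have E: "(\<integral>\<^sup>+z. indicator {0..} z * hkern n a (- z) \<partial>lborel) = exit_mass n a" for n
  proof -
    have "exit_mass n a = (\<integral>\<^sup>+z. indicator {..<0} (0 - z) * hkern n a (0 - z) \<partial>lborel)"
      unfolding exit_mass_def by (rule nn_integral_reflect[symmetric]) simp
    also have "\<dots> = (\<integral>\<^sup>+z. indicator {0..} z * hkern n a (- z) \<partial>lborel)"
      by (rule nn_integral_cong_AE, rule AE_I[of _ _ "{0}"]) (auto simp: indicator_def)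
    finally show ?thesis by simp
  qed
  have "(\<integral>\<^sup>+z. indicator {0..} z * green a (- z) \<partial>lborel) = (\<integral>\<^sup>+z. (\<Sum>n. indicator {0..} z * hkern n a (- z)) \<partial>lborel)"
    by (simp add: green_def)
  also have "\<dots> = (\<Sum>n. exit_mass n a)"
    by (subst nn_integral_suminf) (auto simp: E)
  also have "(\<Sum>n. exit_mass n a) \<le> 1"
  proof (rule suminf_le_const)
    fix n
    have "sum (\<lambda>n. exit_mass n a) {..<n} \<le> sum (\<lambda>n. exit_mass n a) {..<Suc n}" by simp
    also have "\<dots> \<le> 1" using sum_exit_mass[of a n] by (metis le_iff_add)
    finally show "sum (\<lambda>n. exit_mass n a) {..<n} \<le> 1" .
  qed simp
  finally show ?thesis .
qed

section \<open>The renewal function and the occupation of a neighbourhood of the edge\<close>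

text \<open>The renewal function of the record heights; the summand 1 counts the starting point.\<close>

definition renewal_mass :: "real \<Rightarrow> ennreal" where
  "renewal_mass x = 1 + (\<integral>\<^sup>+y. indicator {0..x} y * renewal_density y \<partial>lborel)"

lemma measurable_indicator_Icc [measurable (raw)]:
  fixes f g h :: "'a \<Rightarrow> real"
  assumes [measurable]: "f \<in> borel_measurable N" "g \<in> borel_measurable N" "h \<in> borel_measurable N"
  shows "(\<lambda>x. indicator {f x..g x} (h x) :: ennreal) \<in> borel_measurable N"
proof -
  have "(\<lambda>x. indicator {f x..g x} (h x) :: ennreal) = (\<lambda>x. if f x \<le> h x \<and> h x \<le> g x then 1 else 0)"
    by (auto simp: indicator_def)
  thus ?thesis by simp
qed

lemma renewal_mass_mono: "x \<le> y \<Longrightarrow> renewal_mass x \<le> renewal_mass y"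
  unfolding renewal_mass_def by (intro add_left_mono nn_integral_mono mult_right_mono) (auto simp: indicator_def)

lemma renewal_mass_ge_1: "1 \<le> renewal_mass x"
  unfolding renewal_mass_def by simp

lemma measurable_renewal_mass [measurable]: "renewal_mass \<in> borel_measurable borel"
  unfolding renewal_mass_def[abs_def] by measurable

lemma renewal_window:
  "(\<integral>\<^sup>+u. indicator {z + a..z + b} u * renewal_density (u - z) \<partial>lborel) = (\<integral>\<^sup>+y. indicator {a..b} y * renewal_density y \<partial>lborel)"
  using nn_integral_shift[of "\<lambda>u. indicator {z + a..z + b} u * renewal_density (u - z)" z]
  by (simp add: indicator_def algebra_simps)

lemma renewal_window_reflect:
  "(\<integral>\<^sup>+u. indicator {s - b..s - a} u * renewal_density (s - u) \<partial>lborel) = (\<integral>\<^sup>+y. indicator {a..b} y * renewal_density y \<partial>lborel)"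
  using nn_integral_reflect[of "\<lambda>u. indicator {s - b..s - a} u * renewal_density (s - u)" s]
  by (simp add: indicator_def algebra_simps conj_commute)

lemma renewal_mass_add:
  assumes "0 \<le> c" "c \<le> d"
  shows "renewal_mass d = renewal_mass c + (\<integral>\<^sup>+y. indicator {c..d} y * renewal_density y \<partial>lborel)"
proof -
  have "(\<integral>\<^sup>+y. indicator {0..d} y * renewal_density y \<partial>lborel) =
     (\<integral>\<^sup>+y. indicator {0..c} y * renewal_density y + indicator {c..d} y * renewal_density y \<partial>lborel)"
    by (rule nn_integral_cong_AE, rule AE_I[of _ _ "{c}"]) (use assms in \<open>auto simp: indicator_def\<close>)
  thus ?thesis unfolding renewal_mass_def by (subst (asm) nn_integral_add) (auto simp: add_ac)
qed

text \<open>Before a window of length \<open>x\<close> can contain a record, the records have to enter it, and from the first record in it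
they start afresh; that such an entry has total mass at most 1 is \<open>overshoot_mass_le_1\<close>.\<close>

lemma renewal_window_le:
  assumes "0 \<le> x"
  shows "(\<integral>\<^sup>+y. indicator {a..a+x} y * renewal_density y \<partial>lborel) \<le> renewal_mass x"
proof -
  have "(\<integral>\<^sup>+y. indicator {a..a+x} y * renewal_density y \<partial>lborel) = (\<integral>\<^sup>+y. indicator {0..x} y * renewal_density (a + y) \<partial>lborel)"
    using nn_integral_shift[of "\<lambda>y. indicator {a..a+x} y * renewal_density y" a]
    by (simp add: indicator_def add.commute)
  also have "\<dots> = (\<integral>\<^sup>+y. indicator {0..x} y * green a (- y) +
      indicator {0..x} y * (\<integral>\<^sup>+z. indicator {0..y} z * (green a (- z) * renewal_density (y - z)) \<partial>lborel) \<partial>lborel)"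
    by (intro nn_integral_cong) (auto simp: indicator_def renewal_first_passage distrib_left)
  also have "\<dots> = (\<integral>\<^sup>+y. indicator {0..x} y * green a (- y) \<partial>lborel) +
      (\<integral>\<^sup>+y. indicator {0..x} y * (\<integral>\<^sup>+z. (indicator {0..} (y - z) * renewal_density (y - z)) * (indicator {0..} z * green a (- z)) \<partial>lborel) \<partial>lborel)"
    by (subst nn_integral_add) (auto simp: indicator_def mult_ac intro!: nn_integral_cong arg_cong2[where f = "(+)"])
  also have "(\<integral>\<^sup>+y. indicator {0..x} y * (\<integral>\<^sup>+z. (indicator {0..} (y - z) * renewal_density (y - z)) * (indicator {0..} z * green a (- z)) \<partial>lborel) \<partial>lborel)
     = (\<integral>\<^sup>+z. (indicator {0..} z * green a (- z)) * (\<integral>\<^sup>+y. indicator {0..x} y * (indicator {0..} (y - z) * renewal_density (y - z)) \<partial>lborel) \<partial>lborel)"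
    by (rule nn_integral_mult_swap) simp_all
  also have "(\<integral>\<^sup>+y. indicator {0..x} y * green a (- y) \<partial>lborel) + \<dots> =
     (\<integral>\<^sup>+z. indicator {0..x} z * green a (- z) + (indicator {0..} z * green a (- z)) *
        (\<integral>\<^sup>+y. indicator {0..x} y * (indicator {0..} (y - z) * renewal_density (y - z)) \<partial>lborel) \<partial>lborel)"
    by (rule nn_integral_add[symmetric]) simp_all
  also have "\<dots> \<le> (\<integral>\<^sup>+z. indicator {0..} z * green a (- z) * renewal_mass x \<partial>lborel)"
  proof (intro nn_integral_mono)
    fix z
    have "(\<integral>\<^sup>+y. indicator {0..x} y * (indicator {0..} (y - z) * renewal_density (y - z)) \<partial>lborel)
      \<le> (\<integral>\<^sup>+y. indicator {z + 0..z + x} y * renewal_density (y - z) \<partial>lborel)" if "0 \<le> z"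
      using that by (intro nn_integral_mono) (auto simp: indicator_def)
    hence "(\<integral>\<^sup>+y. indicator {0..x} y * (indicator {0..} (y - z) * renewal_density (y - z)) \<partial>lborel) + 1 \<le> renewal_mass x" if "0 \<le> z"
      using that unfolding renewal_window by (simp add: renewal_mass_def add.commute)
    hence "indicator {0..} z * green a (- z) * ((\<integral>\<^sup>+y. indicator {0..x} y * (indicator {0..} (y - z) * renewal_density (y - z)) \<partial>lborel) + 1)
      \<le> indicator {0..} z * green a (- z) * renewal_mass x"
      by (cases "0 \<le> z") (auto intro!: mult_left_mono)
    moreover have "indicator {0..x} z * green a (- z) \<le> indicator {0..} z * green a (- z)"
      by (auto simp: indicator_def)
    ultimately show "indicator {0..x} z * green a (- z) + (indicator {0..} z * green a (- z)) *
        (\<integral>\<^sup>+y. indicator {0..x} y * (indicator {0..} (y - z) * renewal_density (y - z)) \<partial>lborel)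
        \<le> indicator {0..} z * green a (- z) * renewal_mass x"
      by (auto simp: distrib_left add.commute intro: order_trans add_right_mono)
  qed
  also have "\<dots> = (\<integral>\<^sup>+z. indicator {0..} z * green a (- z) \<partial>lborel) * renewal_mass x"
    by (rule nn_integral_multc) simp
  also have "\<dots> \<le> 1 * renewal_mass x" by (intro mult_right_mono overshoot_mass_le_1) simp
  finally show ?thesis by simp
qed

lemma renewal_mass_subadditive:
  assumes "0 \<le> c" "0 \<le> x" shows "renewal_mass (c + x) \<le> renewal_mass c + renewal_mass x"
  using renewal_mass_add[of c "c + x"] renewal_window_le[of x c] assms by (simp add: add_left_mono)

text \<open>The expected number of visits to distances in \<open>[0, x]\<close> before the exit from the strip, the start
\<open>s\<close> included.\<close>

definition occupation :: "real \<Rightarrow> real \<Rightarrow> ennreal" where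
  "occupation s x = indicator {0..x} s + (\<integral>\<^sup>+u. indicator {0..x} u * green s u \<partial>lborel)"

lemma measurable_occupation [measurable (raw)]:
  assumes [measurable]: "f \<in> borel_measurable N" "g \<in> borel_measurable N"
  shows "(\<lambda>x. occupation (f x) (g x)) \<in> borel_measurable N"
  unfolding occupation_def by measurable

text \<open>The ladder decomposition without the assumption on the order of \<open>s\<close> and \<open>u\<close>.\<close>

lemma green_ladder_sym:
  assumes "0 \<le> s" "0 \<le> u"
  shows "green s u = indicator {0..} (s - u) * renewal_density (s - u) + indicator {0<..} (u - s) * renewal_density (u - s) +
    (\<integral>\<^sup>+z. indicator {0..} (u - z) * renewal_density (u - z) * (indicator {0..s} z * renewal_density (s - z)) \<partial>lborel)"
proof (cases "u \<le> s")
  case True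
  have "(\<integral>\<^sup>+z. indicator {0..u} z * (renewal_density (s - z) * renewal_density (u - z)) \<partial>lborel) =
    (\<integral>\<^sup>+z. indicator {0..} (u - z) * renewal_density (u - z) * (indicator {0..s} z * renewal_density (s - z)) \<partial>lborel)"
    using True by (intro nn_integral_cong) (auto simp: indicator_def mult_ac)
  thus ?thesis using True assms green_ladder[of u s] by simp
next
  case False
  have "(\<integral>\<^sup>+z. indicator {0..s} z * (renewal_density (u - z) * renewal_density (s - z)) \<partial>lborel) =
    (\<integral>\<^sup>+z. indicator {0..} (u - z) * renewal_density (u - z) * (indicator {0..s} z * renewal_density (s - z)) \<partial>lborel)"
    using False by (intro nn_integral_cong) (auto simp: indicator_def mult_ac)
  thus ?thesis using False assms green_ladder[of s u] green_commute[of s u] by simp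
qed

text \<open>Here \<open>z\<close> is the lowest point of the path up to its visit; afterwards the visits are counted by
the renewal function of the remaining interval.\<close>

lemma occupation_eq:
  assumes "0 \<le> s" "0 \<le> x"
  shows "occupation s x = indicator {0..} (x - s) * renewal_mass (x - s) +
    (\<integral>\<^sup>+z. indicator {0..x} z * (indicator {0..} (s - z) * renewal_density (s - z) * renewal_mass (x - z)) \<partial>lborel)"
proof -
  have "(\<integral>\<^sup>+u. indicator {0..x} u * green s u \<partial>lborel) =
    (\<integral>\<^sup>+u. indicator {0..x} u * (indicator {0..} (s - u) * renewal_density (s - u)) +
      (indicator {0..x} u * (indicator {0<..} (u - s) * renewal_density (u - s)) +
       indicator {0..x} u * (\<integral>\<^sup>+z. indicator {0..} (u - z) * renewal_density (u - z) * (indicator {0..s} z * renewal_density (s - z)) \<partial>lborel)) \<partial>lborel)"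
    using assms by (intro nn_integral_cong) (auto simp: indicator_def green_ladder_sym add_ac)
  also have "\<dots> = (\<integral>\<^sup>+u. indicator {0..x} u * (indicator {0..} (s - u) * renewal_density (s - u)) \<partial>lborel) +
      ((\<integral>\<^sup>+u. indicator {0..x} u * (indicator {0<..} (u - s) * renewal_density (u - s)) \<partial>lborel) +
      (\<integral>\<^sup>+u. indicator {0..x} u * (\<integral>\<^sup>+z. indicator {0..} (u - z) * renewal_density (u - z) * (indicator {0..s} z * renewal_density (s - z)) \<partial>lborel) \<partial>lborel))"
    by (subst nn_integral_add, measurable, subst nn_integral_add) auto
  also have "(\<integral>\<^sup>+u. indicator {0..x} u * (\<integral>\<^sup>+z. indicator {0..} (u - z) * renewal_density (u - z) * (indicator {0..s} z * renewal_density (s - z)) \<partial>lborel) \<partial>lborel)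
     = (\<integral>\<^sup>+z. (indicator {0..s} z * renewal_density (s - z)) * (\<integral>\<^sup>+u. indicator {0..x} u * (indicator {0..} (u - z) * renewal_density (u - z)) \<partial>lborel) \<partial>lborel)"
    by (rule nn_integral_mult_swap) simp_all
  also have "\<dots> = (\<integral>\<^sup>+z. indicator {0..x} z * (indicator {0..} (s - z) * renewal_density (s - z)) * (\<integral>\<^sup>+y. indicator {0..x - z} y * renewal_density y \<partial>lborel) \<partial>lborel)"
  proof (intro nn_integral_cong)
    fix z
    have "(\<integral>\<^sup>+u. indicator {0..x} u * (indicator {0..} (u - z) * renewal_density (u - z)) \<partial>lborel) =
      (\<integral>\<^sup>+u. indicator {z + 0..z + (x - z)} u * renewal_density (u - z) \<partial>lborel)" if "0 \<le> z"
      using that by (intro nn_integral_cong) (auto simp: indicator_def)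
    thus "(indicator {0..s} z * renewal_density (s - z)) * (\<integral>\<^sup>+u. indicator {0..x} u * (indicator {0..} (u - z) * renewal_density (u - z)) \<partial>lborel) =
      indicator {0..x} z * (indicator {0..} (s - z) * renewal_density (s - z)) * (\<integral>\<^sup>+y. indicator {0..x - z} y * renewal_density y \<partial>lborel)"
      unfolding renewal_window
      by (cases "0 \<le> z"; cases "z \<le> x") (simp_all add: indicator_def atLeastatMost_empty)
  qed
  also have "(\<integral>\<^sup>+u. indicator {0..x} u * (indicator {0<..} (u - s) * renewal_density (u - s)) \<partial>lborel) =
     (\<integral>\<^sup>+u. indicator {s + 0..s + (x - s)} u * renewal_density (u - s) \<partial>lborel)"
    by (rule nn_integral_cong_AE, rule AE_I[of _ _ "{s}"]) (use assms in \<open>auto simp: indicator_def\<close>)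
  also note renewal_window
  finally have "occupation s x = (indicator {0..x} s + (\<integral>\<^sup>+y. indicator {0..x - s} y * renewal_density y \<partial>lborel)) +
      ((\<integral>\<^sup>+u. indicator {0..x} u * (indicator {0..} (s - u) * renewal_density (s - u)) \<partial>lborel) +
      (\<integral>\<^sup>+z. indicator {0..x} z * (indicator {0..} (s - z) * renewal_density (s - z)) * (\<integral>\<^sup>+y. indicator {0..x - z} y * renewal_density y \<partial>lborel) \<partial>lborel))"
    by (simp add: occupation_def add_ac)
  also have "(indicator {0..x} s + (\<integral>\<^sup>+y. indicator {0..x - s} y * renewal_density y \<partial>lborel)) = indicator {0..} (x - s) * renewal_mass (x - s)"
    using assms by (cases "s \<le> x") (simp_all add: indicator_def renewal_mass_def atLeastatMost_empty)
  also have "((\<integral>\<^sup>+u. indicator {0..x} u * (indicator {0..} (s - u) * renewal_density (s - u)) \<partial>lborel) +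
      (\<integral>\<^sup>+z. indicator {0..x} z * (indicator {0..} (s - z) * renewal_density (s - z)) * (\<integral>\<^sup>+y. indicator {0..x - z} y * renewal_density y \<partial>lborel) \<partial>lborel)) =
      (\<integral>\<^sup>+z. indicator {0..x} z * (indicator {0..} (s - z) * renewal_density (s - z) * renewal_mass (x - z)) \<partial>lborel)"
    by (subst nn_integral_add[symmetric]) (auto simp: renewal_mass_def distrib_left mult_ac)
  finally show ?thesis .
qed

lemma occupation_le_mult:
  assumes "0 \<le> s" "0 \<le> x" shows "occupation s x \<le> renewal_mass x * renewal_mass s"
proof -
  have "(\<integral>\<^sup>+z. indicator {0..x} z * (indicator {0..} (s - z) * renewal_density (s - z) * renewal_mass (x - z)) \<partial>lborel)
    \<le> (\<integral>\<^sup>+z. renewal_mass x * (indicator {s - s..s - 0} z * renewal_density (s - z)) \<partial>lborel)"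
    by (intro nn_integral_mono) (auto simp: indicator_def mult.commute[of "renewal_mass x"] intro!: mult_left_mono renewal_mass_mono)
  also have "\<dots> = renewal_mass x * (\<integral>\<^sup>+y. indicator {0..s} y * renewal_density y \<partial>lborel)"
    using renewal_window_reflect[of s s 0] by (subst nn_integral_cmult) simp_all
  finally have "occupation s x \<le> renewal_mass x + renewal_mass x * (\<integral>\<^sup>+y. indicator {0..s} y * renewal_density y \<partial>lborel)"
    unfolding occupation_eq[OF assms] using assms
    by (intro add_mono) (auto simp: indicator_def intro: renewal_mass_mono)
  thus ?thesis by (simp add: renewal_mass_def[of s] distrib_left)
qed

lemma occupation_le_square:
  assumes "0 \<le> x" "x < s" shows "occupation s x \<le> renewal_mass x * renewal_mass x"
proof -
  have "occupation s x = (\<integral>\<^sup>+z. indicator {0..x} z * (indicator {0..} (s - z) * renewal_density (s - z) * renewal_mass (x - z)) \<partial>lborel)"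
    using assms by (subst occupation_eq) auto
  also have "\<dots> \<le> (\<integral>\<^sup>+z. renewal_mass x * (indicator {s - s..s - (s - x)} z * renewal_density (s - z)) \<partial>lborel)"
    using assms by (intro nn_integral_mono) (auto simp: indicator_def mult.commute[of "renewal_mass x"] intro!: mult_left_mono renewal_mass_mono)
  also have "\<dots> = renewal_mass x * (\<integral>\<^sup>+y. indicator {(s-x)..(s-x)+x} y * renewal_density y \<partial>lborel)"
    by (subst nn_integral_cmult, simp, subst renewal_window_reflect) simp
  also have "\<dots> \<le> renewal_mass x * renewal_mass x"
    using assms by (intro mult_left_mono renewal_window_le) auto
  finally show ?thesis .
qed

text \<open>For \<open>x < c\<close> every start in the window lies above the target interval, so \<open>s - z\<close> is never negative and the
integration over \<open>s\<close> only sees an increment of the renewal function.\<close>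

lemma occupation_window:
  assumes "0 \<le> x" "x < c"
  shows "(\<integral>\<^sup>+s. indicator {c..d} s * occupation s x \<partial>lborel) =
    (\<integral>\<^sup>+z. indicator {0..x} z * renewal_mass (x - z) * (\<integral>\<^sup>+y. indicator {c - z..d - z} y * renewal_density y \<partial>lborel) \<partial>lborel)"
proof -
  have "(\<integral>\<^sup>+s. indicator {c..d} s * occupation s x \<partial>lborel) = (\<integral>\<^sup>+s. indicator {c..d} s *
     (\<integral>\<^sup>+z. indicator {0..} (s - z) * renewal_density (s - z) * (indicator {0..x} z * renewal_mass (x - z)) \<partial>lborel) \<partial>lborel)"
    using assms by (intro nn_integral_cong) (auto simp: indicator_def occupation_eq mult_ac)
  also have "\<dots> = (\<integral>\<^sup>+z. (indicator {0..x} z * renewal_mass (x - z)) *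
     (\<integral>\<^sup>+s. indicator {c..d} s * (indicator {0..} (s - z) * renewal_density (s - z)) \<partial>lborel) \<partial>lborel)"
    by (rule nn_integral_mult_swap) simp_all
  also have "\<dots> = (\<integral>\<^sup>+z. (indicator {0..x} z * renewal_mass (x - z)) *
     (\<integral>\<^sup>+s. indicator {z + (c - z)..z + (d - z)} s * renewal_density (s - z) \<partial>lborel) \<partial>lborel)"
  proof (intro nn_integral_cong)
    fix z
    have "(\<integral>\<^sup>+s. indicator {c..d} s * (indicator {0..} (s - z) * renewal_density (s - z)) \<partial>lborel) =
        (\<integral>\<^sup>+s. indicator {z + (c - z)..z + (d - z)} s * renewal_density (s - z) \<partial>lborel)" if "z \<le> x"
      using that assms by (intro nn_integral_cong) (auto simp: indicator_def)
    thus "(indicator {0..x} z * renewal_mass (x - z)) *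
      (\<integral>\<^sup>+s. indicator {c..d} s * (indicator {0..} (s - z) * renewal_density (s - z)) \<partial>lborel) =
      (indicator {0..x} z * renewal_mass (x - z)) *
      (\<integral>\<^sup>+s. indicator {z + (c - z)..z + (d - z)} s * renewal_density (s - z) \<partial>lborel)"
      by (cases "z \<le> x") auto
  qed
  finally show ?thesis unfolding renewal_window .
qed

definition renewal_mass_integral :: "real \<Rightarrow> ennreal" where
  "renewal_mass_integral x = (\<integral>\<^sup>+y. indicator {0..x} y * renewal_mass y \<partial>lborel)"

lemma renewal_mass_integral_reflect:
  "(\<integral>\<^sup>+z. indicator {0..x} z * renewal_mass (x - z) \<partial>lborel) = renewal_mass_integral x"
  using nn_integral_reflect[of "\<lambda>z. indicator {0..x} z * renewal_mass z" x]
  by (simp add: renewal_mass_integral_def indicator_def conj_commute)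

text \<open>Starting points in \<open>[0, 2 b]\<close> suffice because \<open>z \<le> x \<le> b\<close> and only records of height at most \<open>b\<close> are kept.
Together with the fact that exit probabilities are at most 1, this bounds the renewal function from above.\<close>

lemma occupation_integral_lower:
  assumes "0 \<le> x" "x \<le> b"
  shows "renewal_mass_integral x * renewal_mass b \<le> (\<integral>\<^sup>+s. indicator {0..2*b} s * occupation s x \<partial>lborel)"
proof -
  have "renewal_mass_integral x * renewal_mass b =
     (\<integral>\<^sup>+z. indicator {0..x} z * renewal_mass (x - z) \<partial>lborel) +
     (\<integral>\<^sup>+z. indicator {0..x} z * renewal_mass (x - z) * (\<integral>\<^sup>+y. indicator {0..b} y * renewal_density y \<partial>lborel) \<partial>lborel)"
    by (subst nn_integral_multc) (auto simp: renewal_mass_integral_reflect renewal_mass_def[of b] distrib_left)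
  also have "\<dots> \<le> (\<integral>\<^sup>+z. indicator {0..2*b} z * (indicator {0..} (x - z) * renewal_mass (x - z)) \<partial>lborel) +
     (\<integral>\<^sup>+z. (indicator {0..x} z * renewal_mass (x - z)) *
         (\<integral>\<^sup>+s. indicator {0..2*b} s * (indicator {0..} (s - z) * renewal_density (s - z)) \<partial>lborel) \<partial>lborel)"
  proof (intro add_mono nn_integral_mono)
    fix z
    have "(\<integral>\<^sup>+y. indicator {0..b} y * renewal_density y \<partial>lborel) = (\<integral>\<^sup>+s. indicator {z + 0..z + b} s * renewal_density (s - z) \<partial>lborel)"
      unfolding renewal_window ..
    also have "\<dots> \<le> (\<integral>\<^sup>+s. indicator {0..2*b} s * (indicator {0..} (s - z) * renewal_density (s - z)) \<partial>lborel)"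
      if "0 \<le> z" "z \<le> x"
      using that assms by (intro nn_integral_mono) (auto simp: indicator_def)
    finally show "indicator {0..x} z * renewal_mass (x - z) * (\<integral>\<^sup>+y. indicator {0..b} y * renewal_density y \<partial>lborel) \<le>
       (indicator {0..x} z * renewal_mass (x - z)) *
         (\<integral>\<^sup>+s. indicator {0..2*b} s * (indicator {0..} (s - z) * renewal_density (s - z)) \<partial>lborel)"
      by (cases "z \<in> {0..x}") (auto intro: mult_left_mono)
  qed (use assms in \<open>auto simp: indicator_def\<close>)
  also have "(\<integral>\<^sup>+z. (indicator {0..x} z * renewal_mass (x - z)) *
         (\<integral>\<^sup>+s. indicator {0..2*b} s * (indicator {0..} (s - z) * renewal_density (s - z)) \<partial>lborel) \<partial>lborel) =
     (\<integral>\<^sup>+s. indicator {0..2*b} s * (\<integral>\<^sup>+z. indicator {0..} (s - z) * renewal_density (s - z) * (indicator {0..x} z * renewal_mass (x - z)) \<partial>lborel) \<partial>lborel)"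
    by (rule nn_integral_mult_swap[symmetric]) simp_all
  also have "(\<integral>\<^sup>+z. indicator {0..2*b} z * (indicator {0..} (x - z) * renewal_mass (x - z)) \<partial>lborel) + \<dots> =
     (\<integral>\<^sup>+s. indicator {0..2*b} s * (indicator {0..} (x - s) * renewal_mass (x - s)) +
       indicator {0..2*b} s * (\<integral>\<^sup>+z. indicator {0..} (s - z) * renewal_density (s - z) * (indicator {0..x} z * renewal_mass (x - z)) \<partial>lborel) \<partial>lborel)"
    by (rule nn_integral_add[symmetric]) simp_all
  also have "\<dots> = (\<integral>\<^sup>+s. indicator {0..2*b} s * occupation s x \<partial>lborel)"
    using assms by (intro nn_integral_cong) (auto simp: indicator_def occupation_eq mult_ac)
  finally show ?thesis .
qed

section \<open>The free walk: unimodality and Fourier transform\<close>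

lemma ennreal_rearrange:
  fixes a b c d :: ennreal
  assumes "b \<le> a" "d \<le> c" shows "b * c + a * d \<le> a * c + b * d"
proof -
  obtain e where a: "a = b + e" using assms(1) le_iff_add by blast
  have "e * d \<le> e * c" using assms(2) by (rule mult_left_mono) simp
  thus ?thesis by (simp add: a distrib_right add_ac add_left_mono)
qed

lemma nn_integral_fold:
  fixes F :: "real \<Rightarrow> ennreal" assumes [measurable]: "F \<in> borel_measurable borel"
  shows "(\<integral>\<^sup>+y. F y \<partial>lborel) = (\<integral>\<^sup>+y. indicator {..<m} y * (F y + F (2 * m - y)) \<partial>lborel)"
proof -
  have "(\<integral>\<^sup>+y. F y \<partial>lborel) = (\<integral>\<^sup>+y. indicator {..<m} y * F y + indicator {m<..} y * F y \<partial>lborel)"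
    by (rule nn_integral_cong_AE, rule AE_I[of _ _ "{m}"]) (auto simp: indicator_def)
  also have "\<dots> = (\<integral>\<^sup>+y. indicator {..<m} y * F y \<partial>lborel) + (\<integral>\<^sup>+y. indicator {m<..} y * F y \<partial>lborel)"
    by (rule nn_integral_add) auto
  also have "(\<integral>\<^sup>+y. indicator {m<..} y * F y \<partial>lborel) = (\<integral>\<^sup>+y. indicator {m<..} (2 * m - y) * F (2 * m - y) \<partial>lborel)"
    by (rule nn_integral_reflect[symmetric]) auto
  also have "(\<integral>\<^sup>+y. indicator {..<m} y * F y \<partial>lborel) + \<dots> =
      (\<integral>\<^sup>+y. indicator {..<m} y * F y + indicator {m<..} (2 * m - y) * F (2 * m - y) \<partial>lborel)"
    by (rule nn_integral_add[symmetric]) auto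
  also have "\<dots> = (\<integral>\<^sup>+y. indicator {..<m} y * (F y + F (2 * m - y)) \<partial>lborel)"
    by (intro nn_integral_cong) (auto simp: indicator_def)
  finally show ?thesis .
qed

lemma kern_UNIV_even: "kern UNIV n (- x) 0 = kern UNIV n x 0"
  using kern_UNIV_minus[of n x 0] by simp

text \<open>Convolving two symmetric unimodal densities gives a symmetric unimodal density. The two values are compared by
folding the convolution integral at the midpoint \<open>m\<close> of \<open>x\<close> and \<open>x'\<close>, which turns the
claim into the rearrangement inequality at every pair of mirror points.\<close>

lemma kern_UNIV_unimodal:
  "\<bar>x\<bar> \<le> \<bar>x'\<bar> \<Longrightarrow> kern UNIV n x' 0 \<le> kern UNIV n x 0"
proof (induction n arbitrary: x x')
  case 0
  thus ?case by (simp add: jump_mono ennreal_leI)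
next
  case (Suc n)
  have main: "kern UNIV (Suc n) x' 0 \<le> kern UNIV (Suc n) x 0" if "0 \<le> x" "x \<le> x'" for x x' :: real
  proof -
    define m where "m = (x + x') / 2"
    let ?p = "\<lambda>y. kern UNIV n y 0"
    have fold: "kern UNIV (Suc n) z 0 = (\<integral>\<^sup>+y. indicator {..<m} y *
        (ennreal (jump (z - y)) * ?p y + ennreal (jump (x + x' - z - y)) * ?p (2 * m - y)) \<partial>lborel)" for z
    proof -
      have J: "jump (z - (2 * m - y)) = jump (x + x' - z - y)" for y
      proof -
        have "2 * m = x + x'" by (simp add: m_def)
        hence "z - (2 * m - y) = - (x + x' - z - y)" by simp
        thus ?thesis by (simp only: jump_minus)
      qed
      have "kern UNIV (Suc n) z 0 = (\<integral>\<^sup>+y. ennreal (jump (z - y)) * ?p y \<partial>lborel)" by simp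
      also have "\<dots> = (\<integral>\<^sup>+y. indicator {..<m} y *
        (ennreal (jump (z - y)) * ?p y + ennreal (jump (z - (2 * m - y))) * ?p (2 * m - y)) \<partial>lborel)"
        by (rule nn_integral_fold) simp
      also have "\<dots> = (\<integral>\<^sup>+y. indicator {..<m} y *
        (ennreal (jump (z - y)) * ?p y + ennreal (jump (x + x' - z - y)) * ?p (2 * m - y)) \<partial>lborel)"
        by (simp only: J)
      finally show ?thesis .
    qed
    show ?thesis unfolding fold
    proof (intro nn_integral_mono)
      fix y
      have "ennreal (jump (x' - y)) * ?p y + ennreal (jump (x + x' - x' - y)) * ?p (2 * m - y)
         \<le> ennreal (jump (x - y)) * ?p y + ennreal (jump (x + x' - x - y)) * ?p (2 * m - y)" if "y < m"
      proof -
        have "jump (x' - y) \<le> jump (x - y)"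
          using that \<open>x \<le> x'\<close> by (intro jump_mono) (auto simp: m_def)
        moreover have "0 \<le> m" using \<open>x \<le> x'\<close> \<open>0 \<le> x\<close> by (simp add: m_def)
        hence "?p (2 * m - y) \<le> ?p y"
          using that by (intro Suc.IH) (simp add: abs_if)
        ultimately show ?thesis
          using ennreal_rearrange[of "ennreal (jump (x' - y))" "ennreal (jump (x - y))" "?p (2 * m - y)" "?p y"]
          by (simp add: ennreal_leI)
      qed
      thus "indicator {..<m} y * (ennreal (jump (x' - y)) * ?p y + ennreal (jump (x + x' - x' - y)) * ?p (2 * m - y))
        \<le> indicator {..<m} y * (ennreal (jump (x - y)) * ?p y + ennreal (jump (x + x' - x - y)) * ?p (2 * m - y))"
        by (cases "y < m") auto
    qed
  qed
  have "kern UNIV (Suc n) \<bar>z\<bar> 0 = kern UNIV (Suc n) z 0" for z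
    using kern_UNIV_even[of "Suc n" z] by (cases "z \<ge> 0") (simp_all del: kern.simps)
  with main[of "\<bar>x\<bar>" "\<bar>x'\<bar>"] Suc.prems show ?case by (simp del: kern.simps)
qed

lemma kern_UNIV_diff: "kern UNIV n s y = kern UNIV n (s - y) 0"
  using kern_UNIV_shift[of n "s - y" y 0] by simp

text \<open>The probability that the free walk is within \<open>r\<close> of its start after \<open>n + 1\<close> steps.\<close>

definition concentration :: "nat \<Rightarrow> real \<Rightarrow> ennreal" where
  "concentration n r = (\<integral>\<^sup>+x. indicator {-r..r} x * kern UNIV n x 0 \<partial>lborel)"

lemma concentration_mono: "r \<le> r' \<Longrightarrow> concentration n r \<le> concentration n r'"
  unfolding concentration_def by (intro nn_integral_mono) (auto simp: indicator_def)

lemma kern_UNIV_total_left [simp]: "(\<integral>\<^sup>+x. kern UNIV n x 0 \<partial>lborel) = 1"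
  using kern_UNIV_total[of n 0] by (simp add: kern_commute[of UNIV n 0])

text \<open>The total variation distance of two translates of a symmetric unimodal density: the two densities cross at the
midpoint of the starting points, and the mass by which they differ is that of an interval of length \<open>\<bar>s - s'\<bar>\<close> around the centre.\<close>

lemma kern_UNIV_shift_bound:
  fixes D :: "real \<Rightarrow> ennreal"
  assumes [measurable]: "D \<in> borel_measurable borel" and D: "\<And>y. D y \<le> 1"
  shows "(\<integral>\<^sup>+y. kern UNIV n s y * D y \<partial>lborel) \<le>
    (\<integral>\<^sup>+y. kern UNIV n s' y * D y \<partial>lborel) + concentration n (\<bar>s - s'\<bar> / 2)"
proof -
  have main: "(\<integral>\<^sup>+y. kern UNIV n s y * D y \<partial>lborel) \<le>
      (\<integral>\<^sup>+y. kern UNIV n s' y * D y \<partial>lborel) + concentration n ((s - s') / 2)"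
    if "s' \<le> s" and [measurable]: "D \<in> borel_measurable borel" and D: "\<And>y. D y \<le> 1"
    for s s' and D :: "real \<Rightarrow> ennreal"
  proof -
    define m r where "m = (s + s') / 2" and "r = (s - s') / 2"
    have sm: "s = m + r" "s' = m - r" and "0 \<le> r" using that(1) by (auto simp: m_def r_def field_simps)
    let ?p = "\<lambda>y. kern UNIV n s y" and ?q = "\<lambda>y. kern UNIV n s' y"
    let ?B = "\<integral>\<^sup>+y. indicator {m..} y * ?q y \<partial>lborel"
    have "?B \<le> (\<integral>\<^sup>+y. ?q y \<partial>lborel)" by (intro nn_integral_mono) (auto simp: indicator_def)
    hence fin: "?B \<noteq> \<infinity>" by (auto simp: top_unique)
    have "(\<integral>\<^sup>+y. ?p y * D y \<partial>lborel) + ?B = (\<integral>\<^sup>+y. ?p y * D y + indicator {m..} y * ?q y \<partial>lborel)"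
      by (rule nn_integral_add[symmetric]) auto
    also have "\<dots> \<le> (\<integral>\<^sup>+y. ?q y * D y + indicator {m..} y * ?p y \<partial>lborel)"
    proof (intro nn_integral_mono)
      fix y
      show "?p y * D y + indicator {m..} y * ?q y \<le> ?q y * D y + indicator {m..} y * ?p y"
      proof (cases "m \<le> y")
        case True
        have "?q y \<le> ?p y"
          using True that(1) unfolding kern_UNIV_diff[of n s y] kern_UNIV_diff[of n s' y]
          by (intro kern_UNIV_unimodal) (auto simp: m_def)
        with ennreal_rearrange[of "?q y" "?p y" "D y" 1] D True show ?thesis
          by (simp add: add.commute)
      next
        case False
        have "?p y \<le> ?q y"
          using False that(1) unfolding kern_UNIV_diff[of n s y] kern_UNIV_diff[of n s' y]
          by (intro kern_UNIV_unimodal) (auto simp: m_def)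
        thus ?thesis using False by (simp add: mult_right_mono)
      qed
    qed
    also have "\<dots> = (\<integral>\<^sup>+y. ?q y * D y \<partial>lborel) + (\<integral>\<^sup>+y. indicator {m..} y * ?p y \<partial>lborel)"
      by (rule nn_integral_add) auto
    also have "(\<integral>\<^sup>+y. indicator {m..} y * ?p y \<partial>lborel) = (\<integral>\<^sup>+x. indicator {..r} x * kern UNIV n x 0 \<partial>lborel)"
      using nn_integral_reflect[of "\<lambda>y. indicator {m..} y * ?p y" s]
      by (simp add: kern_UNIV_diff[of n s "s - _"] indicator_def) (simp add: sm)
    also have "\<dots> = (\<integral>\<^sup>+x. indicator {-r..r} x * kern UNIV n x 0 + indicator {..-r} x * kern UNIV n x 0 \<partial>lborel)"
      by (rule nn_integral_cong_AE, rule AE_I[of _ _ "{-r}"])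
        (use \<open>0 \<le> r\<close> in \<open>auto simp: indicator_def\<close>)
    also have "\<dots> = concentration n r + (\<integral>\<^sup>+x. indicator {..-r} x * kern UNIV n x 0 \<partial>lborel)"
      unfolding concentration_def by (rule nn_integral_add) auto
    also have "(\<integral>\<^sup>+x. indicator {..-r} x * kern UNIV n x 0 \<partial>lborel) = ?B"
      using nn_integral_reflect[of "\<lambda>y. indicator {m..} y * ?q y" s']
      by (simp add: kern_UNIV_diff[of n s' "s' - _"] indicator_def) (simp add: sm)
    finally have "?B + (\<integral>\<^sup>+y. ?p y * D y \<partial>lborel) \<le> ?B + ((\<integral>\<^sup>+y. ?q y * D y \<partial>lborel) + concentration n r)"
      by (simp only: add_ac)
    thus ?thesis using fin ennreal_add_left_cancel_le by (auto simp: r_def)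
  qed
  show ?thesis
  proof (cases "s' \<le> s")
    case True
    thus ?thesis using main[OF True assms] by simp
  next
    case False
    have flip: "(\<integral>\<^sup>+y. kern UNIV n (- t) y * D (- y) \<partial>lborel) = (\<integral>\<^sup>+y. kern UNIV n t y * D y \<partial>lborel)" for t
      using nn_integral_reflect[of "\<lambda>y. kern UNIV n (- t) y * D (- y)" 0] by (simp add: kern_UNIV_minus)
    from False have "- s' \<le> - s" by simp
    from main[OF this, of "\<lambda>y. D (- y)"] show ?thesis using False D by (simp add: flip)
  qed
qed

text \<open>Finiteness of the kernel allows a real-valued density, as the cosine transform needs signs.\<close>

definition walk_density :: "nat \<Rightarrow> real \<Rightarrow> real" where
  "walk_density n x = enn2real (kern UNIV n x 0)"

lemma kern_eq_walk_density: "kern UNIV n x 0 = ennreal (walk_density n x)"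
  unfolding walk_density_def using kern_le_half[of UNIV n x 0]
  by (subst ennreal_enn2real) (auto simp: less_top[symmetric] top_unique)

lemma walk_density_nonneg [simp]: "0 \<le> walk_density n x"
  by (simp add: walk_density_def)

lemma measurable_walk_density [measurable]: "walk_density n \<in> borel_measurable borel"
  unfolding walk_density_def[abs_def] by measurable

lemma integrable_walk_density: "integrable lborel (walk_density n)"
  using kern_UNIV_total_left[of n] unfolding kern_eq_walk_density
  by (intro integrableI_nonneg) auto

lemma integral_walk_density: "(\<integral>x. walk_density n x \<partial>lborel) = 1"
  using kern_UNIV_total_left[of n] unfolding kern_eq_walk_density
  by (subst (asm) nn_integral_eq_integral[OF integrable_walk_density]) auto

lemma integrable_walk_density_mult:
  assumes [measurable]: "c \<in> borel_measurable borel" and "\<And>x. \<bar>c x\<bar> \<le> 1"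
  shows "integrable lborel (\<lambda>x. walk_density n x * c x)"
  by (rule Bochner_Integration.integrable_bound[OF integrable_walk_density[of n]])
    (use assms(2) in \<open>auto simp: abs_mult mult_left_le\<close>)

lemma walk_density_0: "walk_density 0 x = jump x"
  by (simp add: walk_density_def)

lemma walk_density_Suc: "ennreal (walk_density (Suc n) x) = (\<integral>\<^sup>+y. ennreal (jump (x - y) * walk_density n y) \<partial>lborel)"
  by (simp add: kern_eq_walk_density[symmetric] ennreal_mult')

text \<open>The characteristic function of a displacement, real because the law is symmetric.\<close>

definition jump_cos :: "real \<Rightarrow> real" where
  "jump_cos \<theta> = (\<integral>x. jump x * cos (\<theta> * x) \<partial>lborel)"

lemma integral_odd_zero:
  fixes g :: "real \<Rightarrow> real" assumes "\<And>x. g (- x) = - g x"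
  shows "(\<integral>x. g x \<partial>lborel) = 0"
proof -
  have "(\<integral>x. g x \<partial>lborel) = (\<integral>x. g (- x) \<partial>lborel)"
    using lborel_integral_real_affine[of "-1" g 0] by simp
  thus ?thesis by (simp add: assms)
qed

lemma walk_density_cos: "(\<integral>x. walk_density n x * cos (\<theta> * x) \<partial>lborel) = jump_cos \<theta> ^ Suc n"
proof (induction n)
  case 0
  show ?case by (simp add: jump_cos_def walk_density_0)
next
  case (Suc n)
  let ?F = "\<lambda>x y. jump (x - y) * walk_density n y * cos (\<theta> * x)"
  have bound: "(\<integral>\<^sup>+z. ennreal (norm (case_prod ?F z)) \<partial>(lborel \<Otimes>\<^sub>M lborel)) < \<infinity>"
  proof -
    have "(\<integral>\<^sup>+z. ennreal (norm (case_prod ?F z)) \<partial>(lborel \<Otimes>\<^sub>M lborel)) \<le>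
       (\<integral>\<^sup>+z. ennreal (jump (fst z - snd z) * walk_density n (snd z)) \<partial>(lborel \<Otimes>\<^sub>M lborel))"
      by (intro nn_integral_mono ennreal_leI) (auto simp: abs_mult mult_left_le)
    also have "\<dots> = (\<integral>\<^sup>+x. \<integral>\<^sup>+y. ennreal (jump (x - y) * walk_density n y) \<partial>lborel \<partial>lborel)"
      by (subst lborel.nn_integral_fst[symmetric]) auto
    also have "\<dots> = (\<integral>\<^sup>+x. kern UNIV (Suc n) x 0 \<partial>lborel)"
      by (intro nn_integral_cong) (simp add: walk_density_Suc[symmetric] kern_eq_walk_density del: kern.simps)
    also have "\<dots> = 1" by (rule kern_UNIV_total_left)
    finally show ?thesis by (rule order_le_less_trans) simp
  qed
  have int: "integrable (lborel \<Otimes>\<^sub>M lborel) (case_prod ?F)"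
    by (rule integrableI_bounded) (use bound in auto)
  have wd: "walk_density (Suc n) x * cos (\<theta> * x) = (\<integral>y. ?F x y \<partial>lborel)" for x
  proof -
    have "walk_density (Suc n) x = (\<integral>y. jump (x - y) * walk_density n y \<partial>lborel)"
      by (subst integral_eq_nn_integral) (auto simp: walk_density_Suc[symmetric])
    thus ?thesis by simp
  qed
  have inner: "(\<integral>x. ?F x y \<partial>lborel) = jump_cos \<theta> * (walk_density n y * cos (\<theta> * y))" for y
  proof -
    have int1: "integrable lborel (\<lambda>z. jump z * cos (\<theta> * z))" "integrable lborel (\<lambda>z. jump z * sin (\<theta> * z))"
      using integrable_walk_density_mult[of "\<lambda>z. cos (\<theta> * z)" 0] integrable_walk_density_mult[of "\<lambda>z. sin (\<theta> * z)" 0]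
      by (auto simp: walk_density_0)
    have "(\<integral>x. ?F x y \<partial>lborel) = (\<integral>z. jump z * walk_density n y * cos (\<theta> * (y + z)) \<partial>lborel)"
      using lborel_integral_real_affine[of 1 "\<lambda>x. ?F x y" y] by simp
    also have "\<dots> = (\<integral>z. walk_density n y * (cos (\<theta> * y) * (jump z * cos (\<theta> * z)) - sin (\<theta> * y) * (jump z * sin (\<theta> * z))) \<partial>lborel)"
      by (intro Bochner_Integration.integral_cong) (auto simp: distrib_left cos_add algebra_simps)
    also have "\<dots> = walk_density n y * (cos (\<theta> * y) * jump_cos \<theta> - sin (\<theta> * y) * (\<integral>z. jump z * sin (\<theta> * z) \<partial>lborel))"
      using int1 by (simp add: jump_cos_def)
    also have "(\<integral>z. jump z * sin (\<theta> * z) \<partial>lborel) = 0" by (rule integral_odd_zero) simp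
    finally show ?thesis by simp
  qed
  have "(\<integral>x. walk_density (Suc n) x * cos (\<theta> * x) \<partial>lborel) = (\<integral>x. \<integral>y. ?F x y \<partial>lborel \<partial>lborel)"
    by (simp add: wd)
  also have "\<dots> = (\<integral>y. \<integral>x. ?F x y \<partial>lborel \<partial>lborel)"
    by (rule lborel_pair.Fubini_integral[symmetric, OF int])
  also have "\<dots> = jump_cos \<theta> ^ Suc (Suc n)"
    by (simp add: inner Suc)
  finally show ?case .
qed

section \<open>Tail and concentration of the free walk\<close>

lemma one_minus_cos_le: "1 - cos z \<le> z\<^sup>2 / 2" for z :: real
proof -
  have "1 - cos z = 2 * (sin (z / 2))\<^sup>2" using cos_double_sin[of "z / 2"] by simp
  also have "(sin (z / 2))\<^sup>2 \<le> (z / 2)\<^sup>2"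
    using abs_sin_x_le_abs_x[of "z / 2"] by (simp only: abs_le_square_iff)
  finally show ?thesis by (simp add: power_divide)
qed

lemma one_minus_cos_ge:
  fixes z :: real assumes "\<bar>z\<bar> \<le> 1" shows "z\<^sup>2 / 4 \<le> 1 - cos z"
proof -
  have s: "z / 2 \<le> sin z" if "0 \<le> z" "z \<le> 1" for z :: real
  proof -
    have "sin 0 - 0 / 2 \<le> sin z - z / 2"
    proof (rule DERIV_nonneg_imp_nondecreasing[of 0 z "\<lambda>x. sin x - x / 2"])
      fix x :: real assume x: "0 \<le> x" "x \<le> z"
      have "cos (pi / 3) \<le> cos x" using x that pi_gt3 by (intro cos_monotone_0_pi_le) auto
      hence "0 \<le> cos x - 1 / 2" by (simp add: cos_60)
      moreover have "DERIV (\<lambda>x. sin x - x / 2) x :> cos x - 1 / 2" by (auto intro!: derivative_eq_intros)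
      ultimately show "\<exists>y. DERIV (\<lambda>x. sin x - x / 2) x :> y \<and> 0 \<le> y" by blast
    qed (use that in auto)
    thus ?thesis by simp
  qed
  have "1 - cos 0 - 0\<^sup>2 / 4 \<le> 1 - cos \<bar>z\<bar> - \<bar>z\<bar>\<^sup>2 / 4"
  proof (rule DERIV_nonneg_imp_nondecreasing[of 0 "\<bar>z\<bar>" "\<lambda>x. 1 - cos x - x\<^sup>2 / 4"])
    fix x :: real assume x: "0 \<le> x" "x \<le> \<bar>z\<bar>"
    have "DERIV (\<lambda>x. 1 - cos x - x\<^sup>2 / 4) x :> sin x - x / 2" by (auto intro!: derivative_eq_intros)
    moreover have "0 \<le> sin x - x / 2" using s[of x] x assms by auto
    ultimately show "\<exists>y. DERIV (\<lambda>x. 1 - cos x - x\<^sup>2 / 4) x :> y \<and> 0 \<le> y" by blast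
  qed auto
  thus ?thesis by simp
qed

lemma abs_jump_cos_le_1: "\<bar>jump_cos \<theta>\<bar> \<le> 1"
proof -
  have "\<bar>\<integral>x. walk_density 0 x * cos (\<theta> * x) \<partial>lborel\<bar> \<le> (\<integral>x. \<bar>walk_density 0 x * cos (\<theta> * x)\<bar> \<partial>lborel)"
    by (rule integral_abs_bound)
  also have "\<dots> \<le> (\<integral>x. walk_density 0 x \<partial>lborel)"
    by (intro integral_mono integrable_walk_density integrable_abs integrable_walk_density_mult)
      (auto simp: abs_mult mult_left_le)
  finally show ?thesis by (simp add: integral_walk_density walk_density_cos)
qed

lemma walk_density_one_minus_cos:
  "(\<integral>\<^sup>+x. ennreal (walk_density n x * (1 - cos (\<theta> * x))) \<partial>lborel) = ennreal (1 - jump_cos \<theta> ^ Suc n)"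
proof -
  have i: "integrable lborel (\<lambda>x. walk_density n x * cos (\<theta> * x))"
    by (rule integrable_walk_density_mult) auto
  have "(\<integral>\<^sup>+x. ennreal (walk_density n x * (1 - cos (\<theta> * x))) \<partial>lborel) =
     ennreal (\<integral>x. walk_density n x - walk_density n x * cos (\<theta> * x) \<partial>lborel)"
    by (subst nn_integral_eq_integral[symmetric])
      (auto intro!: Bochner_Integration.integrable_diff integrable_walk_density i AE_I2 simp: right_diff_distrib mult_left_le)
  thus ?thesis
    by (simp add: Bochner_Integration.integral_diff[OF integrable_walk_density i] integral_walk_density
        walk_density_cos del: power_Suc)
qed

lemma walk_density_one_plus_cos:
  "(\<integral>\<^sup>+x. ennreal (walk_density n x * (1 + cos (\<theta> * x))) \<partial>lborel) = ennreal (1 + jump_cos \<theta> ^ Suc n)"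
proof -
  have i: "integrable lborel (\<lambda>x. walk_density n x * cos (\<theta> * x))"
    by (rule integrable_walk_density_mult) auto
  have nn: "0 \<le> walk_density n x * (1 + cos (\<theta> * x))" for x
    using cos_ge_minus_one[of "\<theta> * x"] by (intro mult_nonneg_nonneg) (auto simp del: cos_ge_minus_one)
  have "(\<integral>\<^sup>+x. ennreal (walk_density n x * (1 + cos (\<theta> * x))) \<partial>lborel) =
     ennreal (\<integral>x. walk_density n x + walk_density n x * cos (\<theta> * x) \<partial>lborel)"
    using nn by (subst nn_integral_eq_integral[symmetric])
      (auto intro!: Bochner_Integration.integrable_add integrable_walk_density i AE_I2 simp: distrib_left)
  thus ?thesis
    by (simp add: Bochner_Integration.integral_add[OF integrable_walk_density i] integral_walk_density
        walk_density_cos del: power_Suc)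
qed

lemma nn_integral_even:
  fixes F :: "real \<Rightarrow> ennreal" assumes [measurable]: "F \<in> borel_measurable borel" and "\<And>x. F (- x) = F x"
  shows "(\<integral>\<^sup>+x. F x \<partial>lborel) = 2 * (\<integral>\<^sup>+x. indicator {0..} x * F x \<partial>lborel)"
proof -
  have "(\<integral>\<^sup>+x. F x \<partial>lborel) = (\<integral>\<^sup>+y. indicator {..<0} y * (F y + F (2 * 0 - y)) \<partial>lborel)"
    by (rule nn_integral_fold) simp
  also have "\<dots> = (\<integral>\<^sup>+y. 2 * (indicator {..<0} y * F y) \<partial>lborel)"
    by (intro nn_integral_cong) (simp add: assms(2) mult_2 indicator_def)
  also have "\<dots> = 2 * (\<integral>\<^sup>+y. indicator {..<0} y * F y \<partial>lborel)"
    by (rule nn_integral_cmult) simp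
  also have "(\<integral>\<^sup>+y. indicator {..<0} y * F y \<partial>lborel) = (\<integral>\<^sup>+y. indicator {..<0} (0 - y) * F (0 - y) \<partial>lborel)"
    by (rule nn_integral_reflect[symmetric]) simp
  also have "\<dots> = (\<integral>\<^sup>+x. indicator {0..} x * F x \<partial>lborel)"
    by (rule nn_integral_cong_AE, rule AE_I[of _ _ "{0}"]) (auto simp: indicator_def assms(2))
  finally show ?thesis .
qed

lemma nn_integral_inverse_Icc:
  assumes "0 < a" "a \<le> b"
  shows "(\<integral>\<^sup>+x. ennreal (1 / x) * indicator {a..b} x \<partial>lborel) = ennreal (ln (b / a))"
proof -
  have "(\<integral>\<^sup>+x. ennreal (1 / x) * indicator {a..b} x \<partial>lborel) = ennreal (ln b - ln a)"
  proof (rule nn_integral_FTC_Icc[where F = ln])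
    fix x assume x: "x \<in> {a..b}"
    with assms show "DERIV ln x :> 1 / x" by (intro DERIV_ln_divide) auto
    show "0 \<le> 1 / x" using x assms by simp
  qed (use assms in simp_all)
  thus ?thesis using assms by (simp add: ln_div)
qed

lemma nn_integral_cmult_inverse_Icc:
  assumes "1 \<le> b"
  shows "(\<integral>\<^sup>+x. c * (ennreal (1 / x) * indicator {1..b} x) \<partial>lborel) = c * ennreal (ln b)"
proof -
  have "(\<integral>\<^sup>+x. c * (ennreal (1 / x) * indicator {1..b} x) \<partial>lborel) = c * (\<integral>\<^sup>+x. ennreal (1 / x) * indicator {1..b} x \<partial>lborel)"
    by (rule nn_integral_cmult) simp
  also have "\<dots> = c * ennreal (ln b)"
    using assms by (subst nn_integral_inverse_Icc) auto
  finally show ?thesis .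
qed

lemma jump_tail_le:
  assumes "0 < a" shows "1 - jump_cdf a \<le> 1 / (4 * a\<^sup>2)"
proof -
  have "sqrt (1 + a\<^sup>2) \<le> a + 1 / (2 * a)"
    using assms by (intro real_le_lsqrt) (auto simp: power2_eq_square field_simps)
  hence "a / (a + 1 / (2 * a)) \<le> a / sqrt (1 + a\<^sup>2)"
    using assms by (intro divide_left_mono) (auto intro!: mult_pos_pos add_pos_pos)
  moreover have "a / (a + 1 / (2 * a)) = 1 - 1 / (2 * a\<^sup>2 + 1)"
  proof -
    have "a + 1 / (2 * a) = (2 * a\<^sup>2 + 1) / (2 * a)" using assms by (simp add: field_simps power2_eq_square)
    moreover have "2 * a\<^sup>2 + 1 \<noteq> 0" using zero_le_power2[of a] by linarith
    ultimately show ?thesis using assms by (simp add: field_simps power2_eq_square)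
  qed
  moreover have "1 / (2 * a\<^sup>2 + 1) \<le> 1 / (2 * a\<^sup>2)"
    using assms by (intro divide_left_mono) (auto intro!: mult_pos_pos add_pos_pos)
  ultimately have "1 - 1 / (2 * a\<^sup>2) \<le> a / sqrt (1 + a\<^sup>2)" by linarith
  moreover have "1 - (1 + q) / 2 \<le> 1 / (4 * a\<^sup>2)" if "1 - 1 / (2 * a\<^sup>2) \<le> q" for q
    using that by (simp add: field_simps)
  ultimately show ?thesis unfolding jump_cdf_def by blast
qed

lemma ln_inverse_ge_1: "1 \<le> ln (1 / \<delta>)" if "0 < \<delta>" "\<delta> \<le> 1 / 3" for \<delta> :: real
proof -
  have "exp 1 \<le> (3 :: real)" by (rule exp_le)
  also have "3 \<le> 1 / \<delta>" using that by (simp add: field_simps)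
  finally show ?thesis using that by (simp add: ln_ge_iff)
qed

text \<open>Near 0 the characteristic function is \<open>1 - \<theta>\<^sup>2 ln (1 / \<bar>\<theta>\<bar>) / 2\<close> to leading order; the logarithm reflects
the infinite variance. The bound is uniform over \<open>\<bar>\<theta>\<bar> \<le> \<delta>\<close> because it is integrated over \<open>\<theta>\<close> below. The integral over \<open>x\<close> is split
at 1, where the bound \<open>1 / 2\<close> of the density gives way to \<open>1 / (2 x\<^sup>3)\<close>, and at \<open>1 / \<delta>\<close>, beyond which one minus the cosine is only
known to be at most 2.\<close>

lemma jump_cos_upper:
  assumes "0 < \<delta>" "\<delta> \<le> 1 / 3" "\<bar>\<theta>\<bar> \<le> \<delta>"
  shows "1 - jump_cos \<theta> \<le> 3 * \<delta>\<^sup>2 * ln (1 / \<delta>)"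
proof -
  let ?L = "ln (1 / \<delta>)"
  have L: "1 \<le> ?L" using assms by (intro ln_inverse_ge_1)
  have "ennreal (1 - jump_cos \<theta>) = (\<integral>\<^sup>+x. ennreal (jump x * (1 - cos (\<theta> * x))) \<partial>lborel)"
    using walk_density_one_minus_cos[of 0 \<theta>] by (simp add: walk_density_0)
  also have "\<dots> = 2 * (\<integral>\<^sup>+x. indicator {0..} x * ennreal (jump x * (1 - cos (\<theta> * x))) \<partial>lborel)"
    by (rule nn_integral_even) auto
  finally have E: "ennreal (1 - jump_cos \<theta>) = 2 * (\<integral>\<^sup>+x. indicator {0..} x * ennreal (jump x * (1 - cos (\<theta> * x))) \<partial>lborel)" .
  have "(\<integral>\<^sup>+x. indicator {0..} x * ennreal (jump x * (1 - cos (\<theta> * x))) \<partial>lborel) \<le>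
     (\<integral>\<^sup>+x. ennreal (\<delta>\<^sup>2 / 4) * indicator {0..1} x +
        (ennreal (\<delta>\<^sup>2 / 4) * (ennreal (1 / x) * indicator {1..1/\<delta>} x) + 2 * (ennreal (jump x) * indicator {1/\<delta>..} x)) \<partial>lborel)"
  proof (intro nn_integral_mono)
    fix x :: real
    have sq: "1 - cos (\<theta> * x) \<le> \<delta>\<^sup>2 * x\<^sup>2 / 2"
    proof -
      have "(\<theta> * x)\<^sup>2 \<le> \<delta>\<^sup>2 * x\<^sup>2"
        using assms(1,3) by (auto simp: power_mult_distrib intro!: mult_right_mono simp flip: abs_le_square_iff)
      thus ?thesis using one_minus_cos_le[of "\<theta> * x"] by simp
    qed
    have t: "a \<le> a + (b + c)" "b \<le> a + (b + c)" "c \<le> a + (b + c)" for a b c :: ennreal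
      by (auto simp: add_increasing add_increasing2)
    show "indicator {0..} x * ennreal (jump x * (1 - cos (\<theta> * x))) \<le> ennreal (\<delta>\<^sup>2 / 4) * indicator {0..1} x +
        (ennreal (\<delta>\<^sup>2 / 4) * (ennreal (1 / x) * indicator {1..1/\<delta>} x) + 2 * (ennreal (jump x) * indicator {1/\<delta>..} x))"
    proof (cases "x < 0 \<or> 1 / \<delta> \<le> x")
      case True
      have "jump x * (1 - cos (\<theta> * x)) \<le> 2 * jump x"
        using cos_ge_minus_one[of "\<theta> * x"] by (simp add: mult.commute mult_left_mono del: cos_ge_minus_one)
      hence "ennreal (jump x * (1 - cos (\<theta> * x))) \<le> 2 * ennreal (jump x)"
        using ennreal_leI[of "jump x * (1 - cos (\<theta> * x))" "2 * jump x"] by (simp add: ennreal_mult')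
      hence "indicator {0..} x * ennreal (jump x * (1 - cos (\<theta> * x))) \<le> 2 * (ennreal (jump x) * indicator {1/\<delta>..} x)"
        using True by (cases "x < 0") (simp_all add: indicator_def)
      thus ?thesis by (rule order_trans[OF _ t(3)])
    next
      case F: False
      show ?thesis
      proof (cases "x \<le> 1")
        case True
        have "jump x * (1 - cos (\<theta> * x)) \<le> (1 / 2) * (\<delta>\<^sup>2 * x\<^sup>2 / 2)"
          using sq by (intro mult_mono jump_le_half) auto
        also have "\<dots> \<le> \<delta>\<^sup>2 / 4" using True F by (simp add: mult_left_le power_le_one)
        finally have "indicator {0..} x * ennreal (jump x * (1 - cos (\<theta> * x))) \<le> ennreal (\<delta>\<^sup>2 / 4) * indicator {0..1} x"
          using F True by (simp add: indicator_def ennreal_leI)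
        thus ?thesis by (rule order_trans[OF _ t(1)])
      next
        case False
        have "jump x * (1 - cos (\<theta> * x)) \<le> (1 / (2 * x ^ 3)) * (\<delta>\<^sup>2 * x\<^sup>2 / 2)"
          using sq False by (intro mult_mono jump_upper) auto
        also have "\<dots> = \<delta>\<^sup>2 / 4 * (1 / x)" using False by (simp add: power2_eq_square power3_eq_cube)
        finally have "ennreal (jump x * (1 - cos (\<theta> * x))) \<le> ennreal (\<delta>\<^sup>2 / 4) * ennreal (1 / x)"
          by (subst ennreal_mult'[symmetric]) (auto intro: ennreal_leI)
        hence "indicator {0..} x * ennreal (jump x * (1 - cos (\<theta> * x))) \<le>
           ennreal (\<delta>\<^sup>2 / 4) * (ennreal (1 / x) * indicator {1..1/\<delta>} x)"
          using F False by (simp add: indicator_def)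
        thus ?thesis by (rule order_trans[OF _ t(2)])
      qed
    qed
  qed
  also have "\<dots> = ennreal (\<delta>\<^sup>2 / 4) + (ennreal (\<delta>\<^sup>2 / 4) * ennreal ?L + 2 * ennreal (1 - jump_cdf (1 / \<delta>)))"
  proof -
    have "(\<integral>\<^sup>+x. c * indicator {0..1::real} x \<partial>lborel) = c" for c
      by (subst nn_integral_cmult_indicator) auto
    moreover have "(\<integral>\<^sup>+x. c * (ennreal (1 / x) * indicator {1..1/\<delta>} x) \<partial>lborel) = c * ennreal ?L" for c
      using assms by (intro nn_integral_cmult_inverse_Icc) auto
    moreover have "(\<integral>\<^sup>+x. 2 * (ennreal (jump x) * indicator {1/\<delta>..} x) \<partial>lborel) = 2 * ennreal (1 - jump_cdf (1 / \<delta>))"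
      by (subst nn_integral_cmult) (simp_all add: nn_integral_jump_Ioi)
    moreover have "(\<integral>\<^sup>+x. F x + (G x + H x) \<partial>lborel) = (\<integral>\<^sup>+x. F x \<partial>lborel) + ((\<integral>\<^sup>+x. G x \<partial>lborel) + (\<integral>\<^sup>+x. H x \<partial>lborel))"
      if "F \<in> borel_measurable lborel" "G \<in> borel_measurable lborel" "H \<in> borel_measurable lborel"
      for F G H :: "real \<Rightarrow> ennreal"
      using that by (simp add: nn_integral_add)
    ultimately show ?thesis by simp
  qed
  also have "\<dots> \<le> ennreal (\<delta>\<^sup>2 / 4) + (ennreal (\<delta>\<^sup>2 / 4) * ennreal ?L + 2 * ennreal (\<delta>\<^sup>2 / 4))"
    using jump_tail_le[of "1 / \<delta>"] assms(1)
    by (intro add_left_mono mult_left_mono ennreal_leI) (auto simp: power_divide)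
  also have "\<dots> = ennreal (3 * \<delta>\<^sup>2 / 4 + \<delta>\<^sup>2 / 4 * ?L)"
    using L by (simp add: mult_2 ennreal_mult'[symmetric] ennreal_plus[symmetric] del: ennreal_plus)
  finally have "ennreal (1 - jump_cos \<theta>) \<le> 2 * ennreal (3 * \<delta>\<^sup>2 / 4 + \<delta>\<^sup>2 / 4 * ?L)"
    unfolding E by (rule mult_left_mono) simp
  also have "\<dots> = ennreal (2 * (3 * \<delta>\<^sup>2 / 4 + \<delta>\<^sup>2 / 4 * ?L))"
    using L by (subst ennreal_mult') auto
  finally have "1 - jump_cos \<theta> \<le> 2 * (3 * \<delta>\<^sup>2 / 4 + \<delta>\<^sup>2 / 4 * ?L)"
    using L by (subst (asm) ennreal_le_iff) auto
  also have "\<dots> = \<delta>\<^sup>2 * (3 / 2 + ?L / 2)" by (simp add: algebra_simps)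
  also have "\<dots> \<le> \<delta>\<^sup>2 * (3 * ?L)" using L by (intro mult_left_mono) auto
  finally show ?thesis by simp
qed

text \<open>Only \<open>1 \<le> x \<le> 1 / \<theta>\<close> is kept, the range that produces the logarithm.\<close>

lemma jump_cos_lower:
  assumes "0 < \<theta>" "\<theta> \<le> 1"
  shows "\<theta>\<^sup>2 * ln (1 / \<theta>) / 12 \<le> 1 - jump_cos \<theta>"
proof -
  have "ennreal (2 * (\<theta>\<^sup>2 / 24 * ln (1 / \<theta>))) = 2 * (ennreal (\<theta>\<^sup>2 / 24) * ennreal (ln (1 / \<theta>)))"
    using assms by (subst ennreal_mult', simp, subst ennreal_mult') auto
  also have "\<dots> =
      2 * (\<integral>\<^sup>+x. ennreal (\<theta>\<^sup>2 / 24) * (ennreal (1 / x) * indicator {1..1/\<theta>} x) \<partial>lborel)"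
    using assms by (subst nn_integral_cmult_inverse_Icc) auto
  also have "\<dots> \<le> 2 * (\<integral>\<^sup>+x. indicator {0..} x * ennreal (jump x * (1 - cos (\<theta> * x))) \<partial>lborel)"
  proof (intro mult_left_mono nn_integral_mono)
    fix x :: real
    have "\<theta>\<^sup>2 / 24 * (1 / x) \<le> jump x * (1 - cos (\<theta> * x))" if "1 \<le> x" "x \<le> 1 / \<theta>"
    proof -
      have "\<theta>\<^sup>2 / 24 * (1 / x) = 1 / (6 * x ^ 3) * ((\<theta> * x)\<^sup>2 / 4)"
        using that by (simp add: power2_eq_square power3_eq_cube)
      also have "\<dots> \<le> jump x * (1 - cos (\<theta> * x))"
        using that assms by (intro mult_mono jump_lower one_minus_cos_ge) (auto simp: field_simps)
      finally show ?thesis .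
    qed
    thus "ennreal (\<theta>\<^sup>2 / 24) * (ennreal (1 / x) * indicator {1..1/\<theta>} x)
      \<le> indicator {0..} x * ennreal (jump x * (1 - cos (\<theta> * x)))"
      by (auto simp: indicator_def ennreal_mult'[symmetric] intro!: ennreal_leI)
  qed auto
  also have "\<dots> = (\<integral>\<^sup>+x. ennreal (jump x * (1 - cos (\<theta> * x))) \<partial>lborel)"
    by (rule nn_integral_even[symmetric]) auto
  also have "\<dots> = ennreal (1 - jump_cos \<theta>)"
    using walk_density_one_minus_cos[of 0 \<theta>] by (simp add: walk_density_0)
  finally show ?thesis using abs_jump_cos_le_1[of \<theta>] by (subst (asm) ennreal_le_iff) (auto simp: mult.commute)
qed

lemma jump_cos_nonneg:
  assumes "\<bar>\<theta>\<bar> \<le> 1 / 3" shows "0 \<le> jump_cos \<theta>"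
proof -
  have "ln 3 \<le> (2 :: real)" using ln_add_one_self_le_self[of 2] by simp
  moreover have "1 - jump_cos \<theta> \<le> 3 * (1 / 3)\<^sup>2 * ln (1 / (1 / 3))"
    using assms by (intro jump_cos_upper) auto
  ultimately show ?thesis by (simp add: power2_eq_square)
qed

lemma nn_integral_one_minus_cos:
  assumes "0 < \<delta>" "x \<noteq> 0"
  shows "(\<integral>\<^sup>+\<theta>. ennreal (1 - cos (\<theta> * x)) * indicator {0..\<delta>} \<theta> \<partial>lborel) = ennreal (\<delta> - sin (\<delta> * x) / x)"
proof -
  have "(\<integral>\<^sup>+\<theta>. ennreal (1 - cos (\<theta> * x)) * indicator {0..\<delta>} \<theta> \<partial>lborel) =
      ennreal ((\<delta> - sin (\<delta> * x) / x) - (0 - sin (0 * x) / x))"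
  proof (rule nn_integral_FTC_Icc[where F = "\<lambda>\<theta>. \<theta> - sin (\<theta> * x) / x"])
    fix \<theta> show "DERIV (\<lambda>\<theta>. \<theta> - sin (\<theta> * x) / x) \<theta> :> 1 - cos (\<theta> * x)"
      using assms by (auto intro!: derivative_eq_intros)
  qed (use assms in auto)
  thus ?thesis by simp
qed

text \<open>Averaging \<open>1 - cos (\<theta> x)\<close> over \<open>\<theta> \<in> [0, \<delta>]\<close> gives at least \<open>1 / 2\<close> as soon as \<open>\<bar>x\<bar> \<ge> 2 / \<delta>\<close>, so the tail is at
most twice the average of one minus the characteristic function.\<close>

lemma free_walk_tail:
  assumes "0 < \<delta>" "\<delta> \<le> 1 / 3" "2 / \<delta> \<le> s"
  shows "(\<integral>\<^sup>+y. indicator {..<0} y * kern UNIV n s y \<partial>lborel) \<le> ennreal (6 * real (Suc n) * \<delta>\<^sup>2 * ln (1 / \<delta>))"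
proof -
  let ?w = "\<lambda>x. ennreal (walk_density n x)"
  let ?L = "ln (1 / \<delta>)"
  have L: "1 \<le> ?L" using assms by (intro ln_inverse_ge_1)
  have tail: "(\<integral>\<^sup>+y. indicator {..<0} y * kern UNIV n s y \<partial>lborel) = (\<integral>\<^sup>+x. indicator {s<..} x * ?w x \<partial>lborel)"
    using nn_integral_reflect[of "\<lambda>y. indicator {..<0} y * kern UNIV n s y" s]
    by (simp add: kern_UNIV_diff[of n s "s - _"] indicator_def kern_eq_walk_density)
  have "ennreal (\<delta> / 2) * (\<integral>\<^sup>+x. indicator {s<..} x * ?w x \<partial>lborel) = (\<integral>\<^sup>+x. ennreal (\<delta> / 2) * (indicator {s<..} x * ?w x) \<partial>lborel)"
    by (rule nn_integral_cmult[symmetric]) simp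
  also have "\<dots> \<le> (\<integral>\<^sup>+x. ?w x * (\<integral>\<^sup>+\<theta>. ennreal (1 - cos (\<theta> * x)) * indicator {0..\<delta>} \<theta> \<partial>lborel) \<partial>lborel)"
  proof (intro nn_integral_mono)
    fix x
    have "ennreal (\<delta> / 2) \<le> (\<integral>\<^sup>+\<theta>. ennreal (1 - cos (\<theta> * x)) * indicator {0..\<delta>} \<theta> \<partial>lborel)" if "s < x"
    proof -
      have x: "2 / \<delta> < x" using that assms(3) by simp
      moreover have "0 < 2 / \<delta>" using assms by simp
      ultimately have x0: "0 < x" by linarith
      have "sin (\<delta> * x) / x \<le> 1 / x" using x0 by (intro divide_right_mono) auto
      also have "\<dots> \<le> \<delta> / 2" using x x0 assms by (simp add: field_simps)
      finally show ?thesis using x0 assms by (subst nn_integral_one_minus_cos) (auto intro!: ennreal_leI)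
    qed
    thus "ennreal (\<delta> / 2) * (indicator {s<..} x * ?w x) \<le> ?w x * (\<integral>\<^sup>+\<theta>. ennreal (1 - cos (\<theta> * x)) * indicator {0..\<delta>} \<theta> \<partial>lborel)"
      by (cases "s < x") (auto simp: mult.commute[of "?w x"] intro!: mult_right_mono)
  qed
  also have "\<dots> = (\<integral>\<^sup>+\<theta>. indicator {0..\<delta>} \<theta> * (\<integral>\<^sup>+x. ?w x * ennreal (1 - cos (\<theta> * x)) \<partial>lborel) \<partial>lborel)"
    by (rule nn_integral_mult_swap) simp_all
  also have "\<dots> \<le> (\<integral>\<^sup>+\<theta>. ennreal (real (Suc n) * (3 * \<delta>\<^sup>2 * ?L)) * indicator {0..\<delta>} \<theta> \<partial>lborel)"
  proof (intro nn_integral_mono)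
    fix \<theta>
    have "(\<integral>\<^sup>+x. ?w x * ennreal (1 - cos (\<theta> * x)) \<partial>lborel) = ennreal (1 - jump_cos \<theta> ^ Suc n)"
      by (simp only: walk_density_one_minus_cos[symmetric] ennreal_mult' walk_density_nonneg)
    also have "\<dots> \<le> ennreal (real (Suc n) * (3 * \<delta>\<^sup>2 * ?L))" if "0 \<le> \<theta>" "\<theta> \<le> \<delta>"
    proof (rule ennreal_leI)
      have "0 \<le> jump_cos \<theta>" using that assms by (intro jump_cos_nonneg) auto
      hence "1 + real (Suc n) * (jump_cos \<theta> - 1) \<le> (1 + (jump_cos \<theta> - 1)) ^ Suc n"
        by (intro Bernoulli_inequality) auto
      hence "1 - jump_cos \<theta> ^ Suc n \<le> real (Suc n) * (1 - jump_cos \<theta>)" by (simp add: algebra_simps)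
      also have "\<dots> \<le> real (Suc n) * (3 * \<delta>\<^sup>2 * ?L)"
        using that assms by (intro mult_left_mono jump_cos_upper) auto
      finally show "1 - jump_cos \<theta> ^ Suc n \<le> real (Suc n) * (3 * \<delta>\<^sup>2 * ?L)" .
    qed
    finally show "indicator {0..\<delta>} \<theta> * (\<integral>\<^sup>+x. ?w x * ennreal (1 - cos (\<theta> * x)) \<partial>lborel)
      \<le> ennreal (real (Suc n) * (3 * \<delta>\<^sup>2 * ?L)) * indicator {0..\<delta>} \<theta>"
      by (cases "\<theta> \<in> {0..\<delta>}") auto
  qed
  also have "\<dots> = ennreal (real (Suc n) * (3 * \<delta>\<^sup>2 * ?L)) * ennreal \<delta>"
    using assms by (subst nn_integral_cmult_indicator) auto
  finally have "ennreal (2 / \<delta>) * (ennreal (\<delta> / 2) * (\<integral>\<^sup>+x. indicator {s<..} x * ?w x \<partial>lborel)) \<le>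
     ennreal (2 / \<delta>) * (ennreal (real (Suc n) * (3 * \<delta>\<^sup>2 * ?L)) * ennreal \<delta>)"
    by (rule mult_left_mono) simp
  also have "ennreal (2 / \<delta>) * (ennreal (\<delta> / 2) * (\<integral>\<^sup>+x. indicator {s<..} x * ?w x \<partial>lborel)) =
      (\<integral>\<^sup>+x. indicator {s<..} x * ?w x \<partial>lborel)"
    using assms by (subst mult.assoc[symmetric], subst ennreal_mult'[symmetric]) auto
  also have "ennreal (2 / \<delta>) * (ennreal (real (Suc n) * (3 * \<delta>\<^sup>2 * ?L)) * ennreal \<delta>) =
     ennreal (2 / \<delta> * (real (Suc n) * (3 * \<delta>\<^sup>2 * ?L) * \<delta>))"
    using assms L by (subst ennreal_mult', simp, subst ennreal_mult') auto
  also have "2 / \<delta> * (real (Suc n) * (3 * \<delta>\<^sup>2 * ?L) * \<delta>) = 6 * real (Suc n) * \<delta>\<^sup>2 * ?L"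
    using assms by (simp add: field_simps)
  finally show ?thesis by (simp only: tail)
qed

text \<open>Apart from the constant \<open>1 / 2\<close>, this is the cosine transform of the triangular weight \<open>1 - u\<close>: a nonnegative
function of \<open>z\<close> that is bounded away from 0 for \<open>\<bar>z\<bar> \<le> 1\<close>.\<close>

lemma nn_integral_triangle_cos:
  assumes "z \<noteq> 0"
  shows "(\<integral>\<^sup>+u. ennreal ((1 - u) * (1 + cos (u * z))) * indicator {0..1} u \<partial>lborel) = ennreal (1 / 2 + (1 - cos z) / z\<^sup>2)"
proof -
  define F where "F u = u - u\<^sup>2 / 2 + (1 - u) * (sin (u * z) / z) - cos (u * z) / z\<^sup>2" for u
  have "(\<integral>\<^sup>+u. ennreal ((1 - u) * (1 + cos (u * z))) * indicator {0..1} u \<partial>lborel) = ennreal (F 1 - F 0)"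
  proof (rule nn_integral_FTC_Icc[where F = F])
    fix u :: real assume u: "u \<in> {0..1}"
    show "DERIV F u :> (1 - u) * (1 + cos (u * z))"
    proof -
      have "DERIV (\<lambda>u. sin (u * z)) u :> cos (u * z) * z" "DERIV (\<lambda>u. cos (u * z)) u :> - sin (u * z) * z"
        by (auto intro!: derivative_eq_intros)
      from DERIV_cdivide[OF this(1), of z] DERIV_cdivide[OF this(2), of "z\<^sup>2"]
      have "DERIV F u :> 1 - 2 * u / 2 + ((0 - 1) * (sin (u * z) / z) + cos (u * z) * z / z * (1 - u)) - - sin (u * z) * z / z\<^sup>2"
        unfolding F_def
        by (intro DERIV_diff DERIV_add DERIV_mult DERIV_ident DERIV_const DERIV_cdivide)
          (auto intro!: derivative_eq_intros)
      also have "1 - 2 * u / 2 + ((0 - 1) * (sin (u * z) / z) + cos (u * z) * z / z * (1 - u)) - - sin (u * z) * z / z\<^sup>2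
         = (1 - u) * (1 + cos (u * z))"
        using assms by (simp add: power2_eq_square) (simp add: algebra_simps)
      finally show ?thesis .
    qed
    show "0 \<le> (1 - u) * (1 + cos (u * z))"
      using u cos_ge_minus_one[of "u * z"] by (intro mult_nonneg_nonneg) (auto simp del: cos_ge_minus_one)
  qed auto
  moreover have "F 1 - F 0 = 1 / 2 + (1 - cos z) / z\<^sup>2" by (simp add: F_def diff_divide_distrib)
  ultimately show ?thesis by (simp only:)
qed

lemma nn_integral_lorentzian:
  assumes "0 < B"
  shows "(\<integral>\<^sup>+u. ennreal ((1 - u) + 1 / (1 + B * u\<^sup>2)) * indicator {0..1} u \<partial>lborel) = ennreal (1 / 2 + arctan (sqrt B) / sqrt B)"
proof -
  define F where "F u = u - u\<^sup>2 / 2 + arctan (sqrt B * u) / sqrt B" for u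
  have "(\<integral>\<^sup>+u. ennreal ((1 - u) + 1 / (1 + B * u\<^sup>2)) * indicator {0..1} u \<partial>lborel) = ennreal (F 1 - F 0)"
  proof (rule nn_integral_FTC_Icc[where F = F])
    fix u :: real assume u: "u \<in> {0..1}"
    have "1 + (sqrt B * u)\<^sup>2 = 1 + B * u\<^sup>2" using assms by (simp add: power_mult_distrib)
    moreover have "DERIV F u :> 1 - u + inverse (1 + (sqrt B * u)\<^sup>2) * sqrt B / sqrt B"
    proof -
      have "DERIV (\<lambda>u. arctan (sqrt B * u)) u :> inverse (1 + (sqrt B * u)\<^sup>2) * sqrt B"
        by (auto intro!: derivative_eq_intros)
      from DERIV_cdivide[OF this, of "sqrt B"]
      have "DERIV F u :> 1 - 2 * u / 2 + inverse (1 + (sqrt B * u)\<^sup>2) * sqrt B / sqrt B"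
        unfolding F_def
        by (intro DERIV_diff DERIV_add DERIV_ident DERIV_cdivide) (auto intro!: derivative_eq_intros)
      thus ?thesis by simp
    qed
    ultimately show "DERIV F u :> (1 - u) + 1 / (1 + B * u\<^sup>2)"
      using assms by (simp add: divide_inverse mult.assoc)
    show "0 \<le> (1 - u) + 1 / (1 + B * u\<^sup>2)" using u assms by simp
  qed auto
  thus ?thesis by (simp add: F_def)
qed

text \<open>Esseen's concentration inequality with the triangular weight. Using \<open>1 + cos\<close> rather than \<open>cos\<close> keeps
all integrands nonnegative; the constant contributions \<open>1 / 2\<close> cancel at the end. The remaining integral of the
\<open>n + 1\<close>-st power of the characteristic function over \<open>\<bar>\<theta>\<bar> \<le> 1 / r\<close> is bounded by a Lorentzian, because
\<open>\<phi> \<le> exp (\<phi> - 1)\<close> and \<open>exp y \<ge> 1 + y\<close>.\<close>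

lemma concentration_le:
  assumes "3 \<le> r"
  shows "concentration n r \<le> ennreal (28 * r / sqrt (real (Suc n) * ln r))"
proof -
  let ?w = "\<lambda>x. ennreal (walk_density n x)"
  \<comment> \<open>The exponent in the Gaussian bound for the power of the characteristic function at \<open>u / r\<close>.\<close>
  define B where "B = real (Suc n) * ln r / (12 * r\<^sup>2)"
  have "0 < ln r" using assms by simp
  hence B: "0 < B" using assms by (simp add: B_def)
  have "ennreal (1 / 2) + ennreal (1 / 4) * concentration n r =
      (\<integral>\<^sup>+x. ennreal (1 / 2) * ?w x + ennreal (1 / 4) * (indicator {-r..r} x * ?w x) \<partial>lborel)"
  proof (subst nn_integral_add)
    have "(\<integral>\<^sup>+x. ennreal (1 / 2) * ?w x \<partial>lborel) = ennreal (1 / 2) * (\<integral>\<^sup>+x. ?w x \<partial>lborel)"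
      by (rule nn_integral_cmult) simp
    also have "(\<integral>\<^sup>+x. ?w x \<partial>lborel) = 1" using kern_UNIV_total_left[of n] by (simp add: kern_eq_walk_density)
    finally have 1: "(\<integral>\<^sup>+x. ennreal (1 / 2) * ?w x \<partial>lborel) = ennreal (1 / 2)" by simp
    have 2: "(\<integral>\<^sup>+x. ennreal (1 / 4) * (indicator {-r..r} x * ?w x) \<partial>lborel) = ennreal (1 / 4) * concentration n r"
      unfolding concentration_def kern_eq_walk_density by (rule nn_integral_cmult) simp
    show "ennreal (1 / 2) + ennreal (1 / 4) * concentration n r =
      (\<integral>\<^sup>+x. ennreal (1 / 2) * ?w x \<partial>lborel) + (\<integral>\<^sup>+x. ennreal (1 / 4) * (indicator {-r..r} x * ?w x) \<partial>lborel)"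
      unfolding 1 2 ..
  qed simp_all
  also have "\<dots> \<le> (\<integral>\<^sup>+x. ?w x * (\<integral>\<^sup>+u. ennreal ((1 - u) * (1 + cos (u * (x / r)))) * indicator {0..1} u \<partial>lborel) \<partial>lborel)"
  proof (rule nn_integral_mono_AE, rule AE_I[of _ _ "{0}"])
    have "ennreal (1 / 2) * ?w x + ennreal (1 / 4) * (indicator {-r..r} x * ?w x) \<le>
       ?w x * (\<integral>\<^sup>+u. ennreal ((1 - u) * (1 + cos (u * (x / r)))) * indicator {0..1} u \<partial>lborel)" if "x \<noteq> 0" for x
    proof -
      have x: "x / r \<noteq> 0" using that assms by auto
      have "ennreal (1 / 2) + ennreal (1 / 4) * indicator {-r..r} x \<le> ennreal (1 / 2 + (1 - cos (x / r)) / (x / r)\<^sup>2)"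
      proof (cases "x \<in> {-r..r}")
        case True
        hence "\<bar>x / r\<bar> \<le> 1" using assms by (auto simp: field_simps abs_le_iff)
        from one_minus_cos_ge[OF this] have "1 / 4 \<le> (1 - cos (x / r)) / (x / r)\<^sup>2"
          using x by (subst pos_le_divide_eq) auto
        hence "ennreal (1 / 2 + 1 / 4) \<le> ennreal (1 / 2 + (1 - cos (x / r)) / (x / r)\<^sup>2)"
          by (intro ennreal_leI) simp
        moreover have "ennreal (1 / 2 + 1 / 4) = ennreal (1 / 2) + ennreal (1 / 4)" by (rule ennreal_plus) auto
        ultimately show ?thesis using True by simp
      next
        case False
        thus ?thesis by (auto intro!: ennreal_leI)
      qed
      hence "(ennreal (1 / 2) + ennreal (1 / 4) * indicator {-r..r} x) * ?w x \<le> ennreal (1 / 2 + (1 - cos (x / r)) / (x / r)\<^sup>2) * ?w x"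
        by (rule mult_right_mono) simp
      moreover have "p * w + q * (i * w) \<le> w * v" if "(p + q * i) * w \<le> v * w" for p q i v w :: ennreal
        using that by (simp add: distrib_left distrib_right mult_ac)
      ultimately have "ennreal (1 / 2) * ?w x + ennreal (1 / 4) * (indicator {-r..r} x * ?w x) \<le>
         ?w x * ennreal (1 / 2 + (1 - cos (x / r)) / (x / r)\<^sup>2)"
        by blast
      thus ?thesis unfolding nn_integral_triangle_cos[OF x] .
    qed
    thus "{x \<in> space lborel. \<not> ennreal (1 / 2) * ?w x + ennreal (1 / 4) * (indicator {-r..r} x * ?w x) \<le>
       ?w x * (\<integral>\<^sup>+u. ennreal ((1 - u) * (1 + cos (u * (x / r)))) * indicator {0..1} u \<partial>lborel)} \<subseteq> {0}"
      by blast
  qed simp_all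
  also have "\<dots> = (\<integral>\<^sup>+u. indicator {0..1} u * (\<integral>\<^sup>+x. ?w x * ennreal ((1 - u) * (1 + cos (u * (x / r)))) \<partial>lborel) \<partial>lborel)"
    by (rule nn_integral_mult_swap) simp_all
  also have "\<dots> \<le> (\<integral>\<^sup>+u. ennreal ((1 - u) + 1 / (1 + B * u\<^sup>2)) * indicator {0..1} u \<partial>lborel)"
  proof (rule nn_integral_mono_AE, rule AE_I[of _ _ "{0}"])
    have "indicator {0..1} u * (\<integral>\<^sup>+x. ?w x * ennreal ((1 - u) * (1 + cos (u * (x / r)))) \<partial>lborel) \<le>
        ennreal ((1 - u) + 1 / (1 + B * u\<^sup>2)) * indicator {0..1} u" if "u \<noteq> 0" for u
    proof (cases "u \<in> {0..1}")
      case True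
      with that have u: "0 < u" "u \<le> 1" by auto
      let ?\<theta> = "u / r"
      have \<theta>: "0 < ?\<theta>" "?\<theta> \<le> 1 / 3" using u assms by (auto simp: field_simps)
      have "(\<integral>\<^sup>+x. ?w x * ennreal ((1 - u) * (1 + cos (u * (x / r)))) \<partial>lborel) =
         (\<integral>\<^sup>+x. ennreal (1 - u) * ennreal (walk_density n x * (1 + cos (?\<theta> * x))) \<partial>lborel)"
        using u by (intro nn_integral_cong) (auto simp: ennreal_mult' mult_ac)
      also have "\<dots> = ennreal (1 - u) * ennreal (1 + jump_cos ?\<theta> ^ Suc n)"
        by (subst nn_integral_cmult, simp, simp only: walk_density_one_plus_cos)
      also have "\<dots> = ennreal ((1 - u) * (1 + jump_cos ?\<theta> ^ Suc n))"
        by (rule ennreal_mult'[symmetric]) (use u in simp)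
      also have "\<dots> \<le> ennreal ((1 - u) + 1 / (1 + B * u\<^sup>2))"
      proof (rule ennreal_leI)
        have pos: "0 \<le> jump_cos ?\<theta>" using \<theta> by (intro jump_cos_nonneg) auto
        have "ln r \<le> ln (1 / ?\<theta>)" using u assms by (subst ln_le_cancel_iff) (auto simp: field_simps)
        hence "?\<theta>\<^sup>2 * ln r / 12 \<le> ?\<theta>\<^sup>2 * ln (1 / ?\<theta>) / 12" by (intro divide_right_mono mult_left_mono) auto
        also have "\<dots> \<le> 1 - jump_cos ?\<theta>" using \<theta> by (intro jump_cos_lower) linarith+
        finally have "jump_cos ?\<theta> \<le> 1 + (- (?\<theta>\<^sup>2 * ln r / 12))" by simp
        also have "\<dots> \<le> exp (- (?\<theta>\<^sup>2 * ln r / 12))" by (rule exp_ge_add_one_self)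
        finally have "jump_cos ?\<theta> ^ Suc n \<le> exp (- (?\<theta>\<^sup>2 * ln r / 12)) ^ Suc n"
          using pos by (intro power_mono)
        also have "\<dots> = exp (- (B * u\<^sup>2))"
        proof -
          have "real (Suc n) * (- (?\<theta>\<^sup>2 * ln r / 12)) = - (B * u\<^sup>2)"
            unfolding B_def power_divide by (simp only: times_divide_eq_left times_divide_eq_right
                divide_divide_eq_left minus_divide_left mult_minus_right mult_minus_left mult_ac)
          thus ?thesis by (simp only: exp_of_nat_mult[symmetric])
        qed
        also have "\<dots> = 1 / exp (B * u\<^sup>2)" by (simp only: exp_minus inverse_eq_divide)
        also have "\<dots> \<le> 1 / (1 + B * u\<^sup>2)"
          using B by (intro divide_left_mono mult_pos_pos exp_ge_add_one_self exp_gt_zero add_pos_nonneg) auto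
        finally have *: "jump_cos ?\<theta> ^ Suc n \<le> 1 / (1 + B * u\<^sup>2)" .
        have "(1 - u) * (1 + jump_cos ?\<theta> ^ Suc n) = (1 - u) + (1 - u) * jump_cos ?\<theta> ^ Suc n" by (simp add: algebra_simps)
        also have "(1 - u) * jump_cos ?\<theta> ^ Suc n \<le> 1 * jump_cos ?\<theta> ^ Suc n"
          using u pos by (intro mult_right_mono zero_le_power) auto
        finally show "(1 - u) * (1 + jump_cos ?\<theta> ^ Suc n) \<le> (1 - u) + 1 / (1 + B * u\<^sup>2)" using * by simp
      qed
      finally show ?thesis using True by simp
    qed simp
    thus "{u \<in> space lborel. \<not> indicator {0..1} u * (\<integral>\<^sup>+x. ?w x * ennreal ((1 - u) * (1 + cos (u * (x / r)))) \<partial>lborel) \<le>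
        ennreal ((1 - u) + 1 / (1 + B * u\<^sup>2)) * indicator {0..1} u} \<subseteq> {0}" by blast
  qed simp_all
  also have "\<dots> = ennreal (1 / 2 + arctan (sqrt B) / sqrt B)" by (rule nn_integral_lorentzian[OF B])
  also have "\<dots> = ennreal (1 / 2) + ennreal (arctan (sqrt B) / sqrt B)" using B by (intro ennreal_plus) auto
  finally have "ennreal (1 / 4) * concentration n r \<le> ennreal (arctan (sqrt B) / sqrt B)"
    by (subst (asm) ennreal_add_left_cancel_le) auto
  also have "\<dots> \<le> ennreal (2 / sqrt B)"
    using B arctan_ubound[of "sqrt B"] pi_less_4 by (intro ennreal_leI divide_right_mono) auto
  finally have "ennreal 4 * (ennreal (1 / 4) * concentration n r) \<le> ennreal 4 * ennreal (2 / sqrt B)"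
    by (rule mult_left_mono) simp
  moreover have "ennreal 4 * (ennreal (1 / 4) * concentration n r) = concentration n r"
    by (subst mult.assoc[symmetric], subst ennreal_mult'[symmetric]) auto
  moreover have "ennreal 4 * ennreal (2 / sqrt B) = ennreal (4 * (2 / sqrt B))"
    by (rule ennreal_mult'[symmetric]) simp
  moreover have "4 * (2 / sqrt B) \<le> 28 * r / sqrt (real (Suc n) * ln r)"
  proof -
    have "sqrt B = sqrt (real (Suc n) * ln r) / (sqrt 12 * r)"
      using assms by (simp add: B_def real_sqrt_divide real_sqrt_mult)
    hence "4 * (2 / sqrt B) = 8 * sqrt 12 * r / sqrt (real (Suc n) * ln r)" by simp
    also have "sqrt 12 \<le> (3.5 :: real)" by (rule real_le_lsqrt) (auto simp: power2_eq_square)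
    hence "8 * sqrt 12 * r / sqrt (real (Suc n) * ln r) \<le> 28 * r / sqrt (real (Suc n) * ln r)"
      using assms \<open>0 < ln r\<close> by (intro divide_right_mono mult_right_mono) auto
    finally show ?thesis .
  qed
  ultimately show ?thesis by (metis ennreal_leI order_trans)
qed

section \<open>Exit probabilities vary slowly with the starting point\<close>

lemma alive_ge:
  assumes "0 < \<delta>" "\<delta> \<le> 1 / 3" "2 / \<delta> \<le> s"
  shows "1 \<le> alive n s + ennreal (12 * real (Suc n) * \<delta>\<^sup>2 * ln (1 / \<delta>))"
proof -
  have "0 \<le> s" using assms(1,3) by (meson divide_nonneg_pos order_trans zero_le_numeral)
  hence "1 \<le> alive n s + 2 * (\<integral>\<^sup>+y. indicator {..<0} y * kern UNIV n s y \<partial>lborel)"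
    using alive_reflection_bound[of s n] by simp
  also have "\<dots> \<le> alive n s + 2 * ennreal (6 * real (Suc n) * \<delta>\<^sup>2 * ln (1 / \<delta>))"
    by (intro add_left_mono mult_left_mono free_walk_tail assms) auto
  also have "2 * ennreal (6 * real (Suc n) * \<delta>\<^sup>2 * ln (1 / \<delta>)) = ennreal (2 * (6 * real (Suc n) * \<delta>\<^sup>2 * ln (1 / \<delta>)))"
    using ennreal_mult'[of 2 "6 * real (Suc n) * \<delta>\<^sup>2 * ln (1 / \<delta>)"] by simp
  also have "2 * (6 * real (Suc n) * \<delta>\<^sup>2 * ln (1 / \<delta>)) = 12 * real (Suc n) * \<delta>\<^sup>2 * ln (1 / \<delta>)" by simp
  finally show ?thesis .
qed

text \<open>With \<open>n\<close> about \<open>2 A s\<^sup>2 / ln s\<close> the exit probability is of order \<open>A\<close> and the concentration on scale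
\<open>\<epsilon> s\<close> of order \<open>\<epsilon> / sqrt A\<close>, so first \<open>A\<close> and then \<open>\<epsilon>\<close> is chosen small. The index \<open>n\<close> is odd because it stands for \<open>n + 1\<close>
steps, and an even number of steps preserves the parity classes.\<close>

lemma mixing_scale:
  fixes \<eta> :: real assumes "0 < \<eta>"
  obtains \<epsilon> s0 where "0 < \<epsilon>" "\<epsilon> \<le> 1 / 2" "1 \<le> s0"
    "\<And>s. s0 \<le> s \<Longrightarrow> \<exists>n. odd n \<and> (\<forall>s'\<ge>s/2. 1 \<le> alive n s' + ennreal \<eta>) \<and> concentration n (\<epsilon> * s) \<le> ennreal \<eta>"
proof -
  \<comment> \<open>Below, the exit probability is at most \<open>384 * A\<close> plus a null sequence, and \<open>384 / 800 < 1 / 2\<close>.\<close>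
  define A where "A = \<eta> / 800"
  define \<epsilon> where "\<epsilon> = min (1 / 2) (\<eta> * sqrt A / 28)"
  have A: "0 < A" using assms by (simp add: A_def)
  have \<epsilon>: "0 < \<epsilon>" "\<epsilon> \<le> 1 / 2" "28 * \<epsilon> \<le> \<eta> * sqrt A" using assms A by (auto simp: \<epsilon>_def)
  have "((\<lambda>s::real. 384 * ln s / s\<^sup>2) \<longlongrightarrow> 0) at_top" by real_asymp
  hence "eventually (\<lambda>s. 384 * ln s / s\<^sup>2 < \<eta> / 2) at_top" by (rule order_tendstoD(2)) (use assms in simp)
  then obtain s1 where s1: "\<And>s. s1 \<le> s \<Longrightarrow> 384 * ln s / s\<^sup>2 < \<eta> / 2" by (auto simp: eventually_at_top_linorder)
  define s0 where "s0 = max (max s1 12) (max (3 / \<epsilon>) (1 / \<epsilon>\<^sup>2))"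
  have "\<exists>n. odd n \<and> (\<forall>s'\<ge>s/2. 1 \<le> alive n s' + ennreal \<eta>) \<and> concentration n (\<epsilon> * s) \<le> ennreal \<eta>" if "s0 \<le> s" for s
  proof -
    have s: "s1 \<le> s" "12 \<le> s" "3 / \<epsilon> \<le> s" "1 / \<epsilon>\<^sup>2 \<le> s" using that by (auto simp: s0_def)
    have ln: "0 < ln s" using s by simp
    define X where "X = A * s\<^sup>2 / ln s"
    have X: "0 < X" using A ln s by (simp add: X_def)
    define m where "m = nat \<lceil>X\<rceil>"
    have m: "X \<le> real m" "real m \<le> X + 1" "0 < m" using X by (auto simp: m_def)
    define n where "n = 2 * m - 1"
    have n: "odd n" "real (Suc n) = 2 * real m" using m(3) by (cases m; simp add: n_def)+
    have "1 \<le> alive n s' + ennreal \<eta>" if "s / 2 \<le> s'" for s'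
    proof -
      \<comment> \<open>The frequency cutoff \<open>4 / s\<close> is the smallest admissible one for the starts \<open>s' \<ge> s / 2\<close>.\<close>
      have "1 \<le> alive n s' + ennreal (12 * real (Suc n) * (4 / s)\<^sup>2 * ln (1 / (4 / s)))"
        using s that by (intro alive_ge) (auto simp: field_simps)
      also have "12 * real (Suc n) * (4 / s)\<^sup>2 * ln (1 / (4 / s)) \<le> \<eta>"
      proof -
        have "12 * real (Suc n) * (4 / s)\<^sup>2 * ln (1 / (4 / s)) = 384 * real m / s\<^sup>2 * ln (s / 4)"
          unfolding n by (simp add: power_divide)
        also have "\<dots> \<le> 384 * (X + 1) / s\<^sup>2 * ln s"
          using s m by (intro mult_mono divide_right_mono) auto
        also have "\<dots> = 384 * A + 384 * ln s / s\<^sup>2"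
          using ln s by (simp add: X_def field_simps)
        also have "\<dots> \<le> 384 * A + \<eta> / 2" using s1[OF s(1)] by simp
        also have "\<dots> \<le> \<eta>" using assms by (simp add: A_def)
        finally show ?thesis .
      qed
      finally show ?thesis by (simp add: ennreal_leI add_left_mono)
    qed
    moreover have "concentration n (\<epsilon> * s) \<le> ennreal \<eta>"
    proof -
      have r: "3 \<le> \<epsilon> * s" using s \<epsilon> by (simp add: field_simps)
      have "1 \<le> \<epsilon>\<^sup>2 * s" using s \<epsilon> by (simp add: field_simps)
      hence "s \<le> (\<epsilon> * s)\<^sup>2" using s by (simp add: power2_eq_square mult_ac)
      hence "ln s \<le> ln ((\<epsilon> * s)\<^sup>2)" using s \<epsilon> by (subst ln_le_cancel_iff) auto
      hence lnr: "ln s \<le> 2 * ln (\<epsilon> * s)" using r by (simp add: ln_realpow)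
      have "A * s\<^sup>2 = X * ln s" using ln by (simp add: X_def)
      also have "\<dots> \<le> real m * (2 * ln (\<epsilon> * s))" using lnr m ln by (intro mult_mono) auto
      also have "\<dots> = real (Suc n) * ln (\<epsilon> * s)" unfolding n by simp
      finally have "sqrt (A * s\<^sup>2) \<le> sqrt (real (Suc n) * ln (\<epsilon> * s))" by simp
      hence sq: "sqrt A * s \<le> sqrt (real (Suc n) * ln (\<epsilon> * s))" using s by (simp add: real_sqrt_mult)
      have "28 * (\<epsilon> * s) / sqrt (real (Suc n) * ln (\<epsilon> * s)) \<le> 28 * (\<epsilon> * s) / (sqrt A * s)"
      proof (intro divide_left_mono sq)
        have "0 < sqrt A * s" using A s by simp
        with sq show "0 < sqrt (real (Suc n) * ln (\<epsilon> * s)) * (sqrt A * s)"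
          by (intro mult_pos_pos[of "sqrt (real (Suc n) * ln (\<epsilon> * s))" "sqrt A * s"]) linarith+
      qed (use s \<epsilon> in auto)
      also have "\<dots> = 28 * \<epsilon> / sqrt A" using s by simp
      also have "\<dots> \<le> \<eta>" using \<epsilon> A by (subst pos_divide_le_eq) auto
      finally have "ennreal (28 * (\<epsilon> * s) / sqrt (real (Suc n) * ln (\<epsilon> * s))) \<le> ennreal \<eta>" by (rule ennreal_leI)
      thus ?thesis using concentration_le[OF r, of n] by (rule order_trans[rotated])
    qed
    ultimately show ?thesis using n(1) by blast
  qed
  moreover have "1 \<le> s0" by (simp add: s0_def)
  ultimately show thesis using that \<epsilon> by blast
qed

lemma ennreal_add_cancel_finite:
  fixes a b c :: ennreal assumes "a + c \<le> b + c" "c \<le> 1" shows "a \<le> b"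
  using assms by (metis ennreal_add_left_cancel_le add.commute infinity_ennreal_def neq_top_trans ennreal_one_neq_top)

text \<open>If \<open>h\<close> is almost invariant under \<open>n + 1\<close> steps of the killed walk and this walk is unlikely to be killed in the
meantime (probability at most \<open>E\<close>), then the killed walk may be replaced by the free one, whose laws from \<open>s\<close> and \<open>s'\<close> are
compared by \<open>kern_UNIV_shift_bound\<close>.\<close>

lemma half_line_shift_bound:
  fixes h :: "real \<Rightarrow> ennreal"
  defines "Q \<equiv> \<lambda>n s. \<integral>\<^sup>+y. indicator {0..} y * (hkern n s y * h y) \<partial>lborel"
  assumes [measurable]: "h \<in> borel_measurable borel" and h1: "\<And>y. h y \<le> 1"
    and up: "h s + alive n s \<le> Q n s + 1" and lo: "Q n s' \<le> h s'"
    and E: "1 \<le> alive n s + E" "1 \<le> alive n s' + E"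
  shows "h s \<le> h s' + (2 * E + concentration n (\<bar>s - s'\<bar> / 2))"
proof -
  let ?g = "\<lambda>y. indicator {0..} y * h y"
  have "h s + alive n s \<le> (Q n s + E) + alive n s"
    using order_trans[OF up add_left_mono[OF E(1), of "Q n s"]] by (simp only: add_ac)
  hence 1: "h s \<le> Q n s + E" using alive_le_1 by (rule ennreal_add_cancel_finite)
  have 2: "Q n s \<le> (\<integral>\<^sup>+y. kern UNIV n s y * ?g y \<partial>lborel)"
    unfolding Q_def by (intro nn_integral_mono) (auto simp: indicator_def intro!: mult_right_mono kern_mono)
  have 3: "(\<integral>\<^sup>+y. kern UNIV n s y * ?g y \<partial>lborel) \<le> (\<integral>\<^sup>+y. kern UNIV n s' y * ?g y \<partial>lborel) + concentration n (\<bar>s - s'\<bar> / 2)"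
    by (rule kern_UNIV_shift_bound) (auto simp: indicator_def h1)
  have "(\<integral>\<^sup>+y. kern UNIV n s' y * ?g y \<partial>lborel) + alive n s' =
     (\<integral>\<^sup>+y. kern UNIV n s' y * ?g y + indicator {0..} y * hkern n s' y \<partial>lborel)"
    unfolding alive_def by (rule nn_integral_add[symmetric]) auto
  also have "\<dots> \<le> (\<integral>\<^sup>+y. indicator {0..} y * (hkern n s' y * h y) + kern UNIV n s' y \<partial>lborel)"
  proof (intro nn_integral_mono)
    fix y
    show "kern UNIV n s' y * ?g y + indicator {0..} y * hkern n s' y \<le> indicator {0..} y * (hkern n s' y * h y) + kern UNIV n s' y"
      using ennreal_rearrange[of "hkern n s' y" "kern UNIV n s' y" "h y" 1] kern_mono[of "{0..}" UNIV n s' y] h1[of y]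
      by (auto simp: indicator_def add_ac)
  qed
  also have "\<dots> = Q n s' + 1"
    unfolding Q_def by (subst nn_integral_add) auto
  also have "\<dots> \<le> Q n s' + (alive n s' + E)" by (intro add_left_mono E)
  finally have "(\<integral>\<^sup>+y. kern UNIV n s' y * ?g y \<partial>lborel) + alive n s' \<le> (Q n s' + E) + alive n s'"
    by (simp add: add_ac)
  hence "(\<integral>\<^sup>+y. kern UNIV n s' y * ?g y \<partial>lborel) \<le> Q n s' + E"
    using alive_le_1 by (rule ennreal_add_cancel_finite)
  also have "\<dots> \<le> h s' + E" using lo by (rule add_right_mono)
  finally have 4: "(\<integral>\<^sup>+y. kern UNIV n s' y * ?g y \<partial>lborel) \<le> h s' + E" .
  have "h s \<le> Q n s + E" by (rule 1)
  also have "\<dots> \<le> (\<integral>\<^sup>+y. kern UNIV n s y * ?g y \<partial>lborel) + E" using 2 by (rule add_right_mono)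
  also have "\<dots> \<le> (\<integral>\<^sup>+y. kern UNIV n s' y * ?g y \<partial>lborel) + concentration n (\<bar>s - s'\<bar> / 2) + E" using 3 by (rule add_right_mono)
  also have "\<dots> \<le> h s' + E + concentration n (\<bar>s - s'\<bar> / 2) + E" using 4 by (intro add_right_mono)
  also have "\<dots> = h s' + (2 * E + concentration n (\<bar>s - s'\<bar> / 2))" by (simp add: mult_2 add_ac)
  finally show ?thesis .
qed

lemma exit_mass_Suc: "exit_mass (Suc n) s = kill_step (exit_mass n) s"
proof -
  have "exit_mass (Suc n) s = (\<integral>\<^sup>+u. indicator {..<0} u * (\<integral>\<^sup>+y. (indicator {0..} y * ennreal (jump (s - y))) * hkern n y u \<partial>lborel) \<partial>lborel)"
    by (simp add: exit_mass_def mult.assoc)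
  also have "\<dots> = (\<integral>\<^sup>+y. (indicator {0..} y * ennreal (jump (s - y))) * (\<integral>\<^sup>+u. hkern n y u * indicator {..<0} u \<partial>lborel) \<partial>lborel)"
    by (rule nn_integral_mult_swap[symmetric]) simp_all
  finally show ?thesis by (simp add: kill_step_def exit_mass_def mult_ac)
qed

lemma measurable_exit_mass [measurable]: "exit_mass n \<in> borel_measurable borel"
  unfolding exit_mass_def[abs_def] by measurable

lemma kill_step_mono:
  "(\<And>y. 0 \<le> y \<Longrightarrow> \<phi> y \<le> \<psi> y) \<Longrightarrow> kill_step \<phi> s \<le> kill_step \<psi> s"
  unfolding kill_step_def by (intro nn_integral_mono) (auto simp: indicator_def intro!: mult_left_mono)

lemma kill_step_funpow_le_exit_mass:
  assumes "\<And>y. 0 \<le> y \<Longrightarrow> \<psi> y \<le> exit_mass i y" "0 \<le> s"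
  shows "(kill_step ^^ n) \<psi> s \<le> exit_mass (n + i) s"
  using assms(2)
proof (induction n arbitrary: s)
  case (Suc n)
  show ?case by (simp add: exit_mass_Suc) (intro kill_step_mono Suc.IH)
qed (use assms(1) in simp)

lemma kill_step_suminf:
  assumes [measurable]: "\<And>k. F k \<in> borel_measurable borel"
  shows "kill_step (\<lambda>s. \<Sum>k. F k s) s = (\<Sum>k. kill_step (F k) s)"
  unfolding kill_step_def by (subst nn_integral_suminf[symmetric]) auto

lemma kill_step_funpow_suminf:
  assumes [measurable]: "\<And>k. F k \<in> borel_measurable borel"
  shows "(kill_step ^^ n) (\<lambda>s. \<Sum>k. F k s) = (\<lambda>s. \<Sum>k. (kill_step ^^ n) (F k) s)"
proof (induction n)
  case (Suc n)
  show ?case by (rule ext) (simp add: Suc kill_step_suminf)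
qed simp

text \<open>If \<open>\<psi> u\<close> is the probability that the next step from \<open>u\<close> is a last step of some prescribed kind, this
is the probability of a last step of this kind after an even number of earlier steps.\<close>

definition even_sum :: "(real \<Rightarrow> ennreal) \<Rightarrow> real \<Rightarrow> ennreal" where
  "even_sum \<psi> s = (\<Sum>k. (kill_step ^^ (2 * k)) \<psi> s)"

lemma measurable_even_sum [measurable (raw)]:
  assumes [measurable]: "\<psi> \<in> borel_measurable borel"
  shows "even_sum \<psi> \<in> borel_measurable borel"
  unfolding even_sum_def[abs_def] by measurable

lemma sum_exit_mass_le_1: "sum (\<lambda>i. exit_mass i s) {..<n} \<le> 1"
proof -
  have "sum (\<lambda>i. exit_mass i s) {..<n} \<le> sum (\<lambda>i. exit_mass i s) {..<Suc n}" by simp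
  also have "\<dots> \<le> 1" using sum_exit_mass[of s n] by (metis le_iff_add)
  finally show ?thesis .
qed

lemma sum_even_le:
  fixes f :: "nat \<Rightarrow> ennreal"
  shows "(\<Sum>k<m. f (2 * k)) \<le> (\<Sum>i<2 * m. f i)"
proof (induction m)
  case (Suc m)
  have "(\<Sum>k<Suc m. f (2 * k)) = (\<Sum>k<m. f (2 * k)) + f (2 * m)" by simp
  also have "\<dots> \<le> (\<Sum>i<2 * m. f i) + (f (2 * m) + f (Suc (2 * m)))"
    using Suc by (intro add_mono) auto
  finally show ?case by (simp add: add.assoc)
qed simp

lemma ennreal_suminf_split:
  fixes f :: "nat \<Rightarrow> ennreal"
  shows "(\<Sum>k. f k) = (\<Sum>k<m. f k) + (\<Sum>k. f (k + m))"
proof (induction m)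
  case (Suc m)
  have "(\<lambda>k. f (Suc k + m)) sums (\<Sum>k. f (Suc k + m))" by (simp add: summable_sums)
  hence "(\<lambda>k. f (k + m)) sums ((\<Sum>k. f (Suc k + m)) + f (0 + m))" by (rule sums_Suc)
  hence "(\<Sum>k. f (k + m)) = (\<Sum>k. f (Suc k + m)) + f (0 + m)" by (rule sums_unique[symmetric])
  with Suc show ?case by (simp add: add_ac)
qed simp

lemma even_sum_split:
  assumes [measurable]: "\<psi> \<in> borel_measurable borel"
  shows "even_sum \<psi> s = (\<Sum>k<m. (kill_step ^^ (2 * k)) \<psi> s) + (kill_step ^^ (2 * m)) (even_sum \<psi>) s"
proof -
  have "(kill_step ^^ (2 * m)) (even_sum \<psi>) s = (\<Sum>k. (kill_step ^^ (2 * m)) ((kill_step ^^ (2 * k)) \<psi>) s)"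
    unfolding even_sum_def[abs_def] by (subst kill_step_funpow_suminf) auto
  also have "\<dots> = (\<Sum>k. (kill_step ^^ (2 * (k + m))) \<psi> s)"
    by (simp add: funpow_add[THEN fun_cong, unfolded o_def, symmetric] algebra_simps)
  finally have "(kill_step ^^ (2 * m)) (even_sum \<psi>) s = (\<Sum>k. (kill_step ^^ (2 * (k + m))) \<psi> s)" .
  thus ?thesis
    unfolding even_sum_def using ennreal_suminf_split[of "\<lambda>k. (kill_step ^^ (2 * k)) \<psi> s" m] by (simp only:)
qed

lemma even_sum_le_1:
  assumes "\<And>y. 0 \<le> y \<Longrightarrow> \<psi> y \<le> exit_mass 0 y" "0 \<le> s"
  shows "even_sum \<psi> s \<le> 1"
  unfolding even_sum_def
proof (rule suminf_le_const)
  fix m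
  have "(\<Sum>k<m. (kill_step ^^ (2 * k)) \<psi> s) \<le> (\<Sum>k<m. exit_mass (2 * k) s)"
    using kill_step_funpow_le_exit_mass[OF assms] by (intro sum_mono) auto
  also have "\<dots> \<le> (\<Sum>i<2 * m. exit_mass i s)" by (rule sum_even_le)
  also have "\<dots> \<le> 1" by (rule sum_exit_mass_le_1)
  finally show "(\<Sum>k<m. (kill_step ^^ (2 * k)) \<psi> s) \<le> 1" .
qed simp

text \<open>After an even number of steps the function reproduces itself, up to the terms for an exit before that time; these
are small by \<open>mixing_scale\<close>. The bound is uniform over all kinds of last steps \<open>\<psi>\<close>.\<close>

lemma even_sum_smooth:
  fixes \<eta> :: real assumes "0 < \<eta>"
  obtains \<epsilon> s0 where "0 < \<epsilon>" "\<epsilon> \<le> 1 / 2" "1 \<le> s0"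
    "\<And>s s' \<psi>. s0 \<le> s \<Longrightarrow> \<bar>s - s'\<bar> \<le> \<epsilon> * s \<Longrightarrow> \<psi> \<in> borel_measurable borel \<Longrightarrow>
       (\<And>y. 0 \<le> y \<Longrightarrow> \<psi> y \<le> exit_mass 0 y) \<Longrightarrow>
       even_sum \<psi> s \<le> even_sum \<psi> s' + ennreal \<eta> \<and> even_sum \<psi> s' \<le> even_sum \<psi> s + ennreal \<eta>"
proof -
  have "0 < \<eta> / 3" using assms by simp
  then obtain \<epsilon> s0 where \<epsilon>: "0 < \<epsilon>" "\<epsilon> \<le> 1 / 2" "1 \<le> s0" and
    M: "\<And>s. s0 \<le> s \<Longrightarrow> \<exists>n. odd n \<and> (\<forall>s'\<ge>s/2. 1 \<le> alive n s' + ennreal (\<eta>/3)) \<and> concentration n (\<epsilon> * s) \<le> ennreal (\<eta>/3)"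
    by (rule mixing_scale) blast
  have "even_sum \<psi> s \<le> even_sum \<psi> s' + ennreal \<eta> \<and> even_sum \<psi> s' \<le> even_sum \<psi> s + ennreal \<eta>"
    if s: "s0 \<le> s" "\<bar>s - s'\<bar> \<le> \<epsilon> * s" and [measurable]: "\<psi> \<in> borel_measurable borel"
      and \<psi>: "\<And>y. 0 \<le> y \<Longrightarrow> \<psi> y \<le> exit_mass 0 y" for s s' \<psi>
  proof -
    from M[OF s(1)] obtain n where n: "odd n" "\<And>s'. s / 2 \<le> s' \<Longrightarrow> 1 \<le> alive n s' + ennreal (\<eta>/3)"
      "concentration n (\<epsilon> * s) \<le> ennreal (\<eta>/3)" by blast
    have "1 \<le> s" using s \<epsilon> by linarith
    have "\<epsilon> * s \<le> 1 / 2 * s" using \<epsilon> \<open>1 \<le> s\<close> by (intro mult_right_mono) auto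
    hence s': "s / 2 \<le> s'" using s(2) by linarith
    obtain m where m: "n = 2 * m + 1" using n(1) by (rule oddE)
    hence Sn: "2 * Suc m = Suc n" by simp
    \<comment> \<open>The bound by 1 holds for nonnegative distances only, so the function is cut off at the edge.\<close>
    define h where "h y = (if 0 \<le> y then even_sum \<psi> y else 0)" for y
    have [measurable]: "h \<in> borel_measurable borel" unfolding h_def[abs_def] by measurable
    have h1: "h y \<le> 1" for y using even_sum_le_1[OF \<psi>] by (simp add: h_def)
    define Q where "Q t = (\<integral>\<^sup>+y. indicator {0..} y * (hkern n t y * h y) \<partial>lborel)" for t
    have Q: "even_sum \<psi> t = (\<Sum>k<Suc m. (kill_step ^^ (2 * k)) \<psi> t) + Q t" for t
    proof -
      have "even_sum \<psi> t = (\<Sum>k<Suc m. (kill_step ^^ (2 * k)) \<psi> t) + (kill_step ^^ Suc n) (even_sum \<psi>) t"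
        using even_sum_split[of \<psi> t "Suc m"] by (simp only: Sn) simp
      also have "(kill_step ^^ Suc n) (even_sum \<psi>) t = Q t"
        unfolding Q_def by (subst kill_step_funpow_Suc) (auto simp: h_def indicator_def intro!: nn_integral_cong)
      finally show ?thesis .
    qed
    have up: "h t + alive n t \<le> Q t + 1" if "0 \<le> t" for t
    proof -
      have "(\<Sum>k<Suc m. (kill_step ^^ (2 * k)) \<psi> t) \<le> (\<Sum>k<Suc m. exit_mass (2 * k) t)"
        using kill_step_funpow_le_exit_mass[OF \<psi> that] by (intro sum_mono) auto
      also have "\<dots> \<le> (\<Sum>i<Suc n. exit_mass i t)" using sum_even_le[of "\<lambda>i. exit_mass i t" "Suc m"] by (simp only: Sn)
      finally have "h t + alive n t \<le> Q t + ((\<Sum>i<Suc n. exit_mass i t) + alive n t)"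
        using that Q[of t] by (simp add: h_def add_mono add_ac del: sum.lessThan_Suc)
      thus ?thesis by (simp only: sum_exit_mass)
    qed
    have lo: "Q t \<le> h t" if "0 \<le> t" for t using that Q[of t] by (simp add: h_def)
    have t: "0 \<le> s" "0 \<le> s'" "s / 2 \<le> s" using \<open>1 \<le> s\<close> s' by auto
    have C: "concentration n (\<bar>s - s'\<bar> / 2) \<le> ennreal (\<eta>/3)"
      using s(2) by (intro order_trans[OF concentration_mono n(3)]) auto
    have "2 * ennreal (\<eta>/3) + concentration n (\<bar>s - s'\<bar> / 2) \<le> 2 * ennreal (\<eta>/3) + ennreal (\<eta>/3)"
      using C by (rule add_left_mono)
    also have "\<dots> = ennreal (\<eta>/3 + \<eta>/3 + \<eta>/3)"
      using assms by (subst ennreal_plus, simp, simp, subst ennreal_plus) (simp_all add: mult_2)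
    also have "\<dots> = ennreal \<eta>" by simp
    finally have tot: "2 * ennreal (\<eta>/3) + concentration n (\<bar>s - s'\<bar> / 2) \<le> ennreal \<eta>" .
    have "h s \<le> h s' + (2 * ennreal (\<eta>/3) + concentration n (\<bar>s - s'\<bar> / 2))"
      using up[OF t(1)] lo[OF t(2)] n(2)[OF t(3)] n(2)[OF s'] h1 unfolding Q_def
      by (intro half_line_shift_bound) auto
    moreover have "h s' \<le> h s + (2 * ennreal (\<eta>/3) + concentration n (\<bar>s' - s\<bar> / 2))"
      using up[OF t(2)] lo[OF t(1)] n(2)[OF t(3)] n(2)[OF s'] h1 unfolding Q_def
      by (intro half_line_shift_bound) auto
    ultimately show ?thesis
      using order_trans[OF _ add_left_mono[OF tot, of "h s'"], of "h s"]
        order_trans[OF _ add_left_mono[OF tot, of "h s"], of "h s'"] t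
      unfolding abs_minus_commute[of s' s] by (simp add: h_def del: ennreal_add_left_cancel_le)
  qed
  thus thesis using that[OF \<epsilon>] by blast
qed

section \<open>The ray leaves the strip\<close>

text \<open>If the ray stayed in the strip with positive probability from \<open>s\<close>, then by a zero-one argument there would be
starts \<open>t\<close> from which it leaves with probability below \<open>1 / 4\<close>. From such a \<open>t\<close>, the free walk would be within \<open>t\<close> of its start with
probability at least \<open>1 / 2\<close> at every time, against the spreading of the walk.\<close>

lemma passage_certain:
  assumes "0 \<le> s"
  shows "(\<Sum>i. exit_mass i s) = 1"
proof -
  define x where "x t = (\<Sum>i. exit_mass i t)" for t
  have x1: "x t \<le> 1" for t
    unfolding x_def by (rule suminf_le_const) (auto intro: sum_exit_mass_le_1)
  have [measurable]: "x \<in> borel_measurable borel" unfolding x_def[abs_def] by measurable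
  have tail: "x t = (\<Sum>i<Suc n. exit_mass i t) + (\<integral>\<^sup>+u. indicator {0..} u * (hkern n t u * x u) \<partial>lborel)" for t n
  proof -
    have "exit_mass (i + Suc n) t = (kill_step ^^ Suc n) (exit_mass i) t" for i
    proof (induction n arbitrary: t)
      case (Suc n)
      have "exit_mass (i + Suc (Suc n)) t = kill_step (exit_mass (i + Suc n)) t" by (simp add: exit_mass_Suc)
      also have "exit_mass (i + Suc n) = (kill_step ^^ Suc n) (exit_mass i)" using Suc by blast
      finally show ?case by simp
    qed (simp add: exit_mass_Suc)
    hence "(\<Sum>i. exit_mass (i + Suc n) t) = (kill_step ^^ Suc n) x t"
      unfolding x_def[abs_def] by (subst kill_step_funpow_suminf) (simp_all del: funpow.simps)
    also have "\<dots> = (\<integral>\<^sup>+u. indicator {0..} u * (hkern n t u * x u) \<partial>lborel)"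
      by (rule kill_step_funpow_Suc) simp
    finally show ?thesis
      unfolding x_def by (subst ennreal_suminf_split[of _ "Suc n"]) simp
  qed
  \<comment> \<open>If \<open>x\<close> were at least \<open>1 / 4\<close> everywhere, a walk still alive at any time would leave later with probability at least \<open>1 / 4\<close>. Letting the time tend to infinity gives \<open>4 * x s \<ge> 3 * x s + 1\<close>.\<close>
  have "\<exists>t\<ge>0. x t < ennreal (1 / 4)" if "x s < 1"
  proof (rule ccontr)
    assume "\<not> ?thesis"
    hence c: "\<And>u. 0 \<le> u \<Longrightarrow> ennreal (1 / 4) \<le> x u" by (meson not_le)
    let ?r = "\<lambda>n. \<Sum>i<Suc n. exit_mass i s"
    have "3 * ?r n + 1 \<le> 4 * x s" for n
    proof -
      have "(\<integral>\<^sup>+u. indicator {0..} u * (hkern n s u * ennreal (1 / 4)) \<partial>lborel) \<le>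
          (\<integral>\<^sup>+u. indicator {0..} u * (hkern n s u * x u) \<partial>lborel)"
        by (intro nn_integral_mono) (use c in \<open>auto simp: indicator_def intro!: mult_left_mono\<close>)
      also have "(\<integral>\<^sup>+u. indicator {0..} u * (hkern n s u * ennreal (1 / 4)) \<partial>lborel) = alive n s * ennreal (1 / 4)"
        unfolding alive_def by (subst nn_integral_multc[symmetric]) (simp_all add: mult.assoc)
      finally have "?r n + alive n s * ennreal (1 / 4) \<le> x s"
        unfolding tail[of s n] by (rule add_left_mono)
      hence "4 * (?r n + alive n s * ennreal (1 / 4)) \<le> 4 * x s"
        by (rule mult_left_mono) simp
      moreover have "4 * (alive n s * ennreal (1 / 4)) = alive n s"
      proof -
        have "4 * ennreal (1 / 4) = 1" using ennreal_mult'[of 4 "1 / 4"] by simp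
        thus ?thesis by (simp only: mult.left_commute[of 4] mult_1_right)
      qed
      moreover have "4 * ?r n = 3 * ?r n + ?r n"
      proof -
        have "(4 :: ennreal) = 3 + 1" by simp
        thus ?thesis by (simp only: distrib_right mult_1_left)
      qed
      ultimately show ?thesis using sum_exit_mass[of s n] by (simp only: distrib_left add.assoc)
    qed
    moreover have "?r \<longlonglongrightarrow> x s"
      unfolding x_def by (rule LIMSEQ_Suc, rule summable_LIMSEQ) simp
    hence "(\<lambda>n. 3 * ?r n + 1) \<longlonglongrightarrow> 3 * x s + 1"
      by (intro tendsto_add tendsto_const ennreal_tendsto_cmult) auto
    ultimately have "3 * x s + 1 \<le> 4 * x s"
      by (intro LIMSEQ_le_const2) auto
    also have "(4 :: ennreal) = 3 + 1" by simp
    finally have "1 + 3 * x s \<le> x s + 3 * x s" by (simp only: distrib_right mult_1_left add.commute)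
    moreover have "3 * x s \<noteq> \<top>" using x1[of s] by (auto simp: ennreal_mult_eq_top_iff top_unique)
    ultimately have "1 \<le> x s" by (simp only: add.commute[of _ "3 * x s"]) (simp add: ennreal_add_left_cancel_le)
    thus False using that by simp
  qed
  moreover have False if t: "0 \<le> t" "x t < ennreal (1 / 4)" for t
  proof -
    \<comment> \<open>The walk from \<open>t\<close> ends beyond the edge with probability at most \<open>1 / 4\<close>, and by symmetry it equally rarely moves farther than \<open>t\<close> in the other direction.\<close>
    have big: "ennreal (1 / 2) \<le> concentration n t" for n
    proof -
      let ?T = "\<integral>\<^sup>+z. indicator {t<..} z * kern UNIV n z 0 \<partial>lborel"
      let ?T' = "\<integral>\<^sup>+z. indicator {..t} z * kern UNIV n z 0 \<partial>lborel"
      have T: "?T' + ?T = 1"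
        by (subst nn_integral_add[symmetric])
          (auto simp: indicator_def intro!: trans[OF nn_integral_cong kern_UNIV_total_left[of n]])
      have "alive n t \<le> (\<integral>\<^sup>+y. indicator {0..} y * kern UNIV n t y \<partial>lborel)"
        unfolding alive_def by (intro nn_integral_mono mult_left_mono kern_mono) auto
      also have "(\<integral>\<^sup>+y. indicator {0..} y * kern UNIV n t y \<partial>lborel) = ?T'"
        using nn_integral_reflect[of "\<lambda>y. indicator {0..} y * kern UNIV n t y" t]
        by (simp add: kern_UNIV_diff[of n t "t - _"] indicator_def)
      finally have al: "alive n t \<le> ?T'" .
      have "1 = (\<Sum>i<Suc n. exit_mass i t) + alive n t" by (rule sum_exit_mass[symmetric])
      also have "\<dots> \<le> x t + alive n t"
        unfolding tail[of t n] by (intro add_right_mono) simp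
      also have "\<dots> \<le> ennreal (1 / 4) + alive n t" using t(2) by (intro add_right_mono) simp
      also have "\<dots> \<le> ennreal (1 / 4) + ?T'" using al by (rule add_left_mono)
      finally have "?T' + ?T \<le> ?T' + ennreal (1 / 4)" unfolding T by (simp only: add.commute)
      moreover have "?T' \<noteq> \<top>"
      proof
        assume "?T' = \<top>"
        with T show False by simp
      qed
      ultimately have T4: "?T \<le> ennreal (1 / 4)" by (simp add: ennreal_add_left_cancel_le)
      have "?T' \<le> concentration n t + (\<integral>\<^sup>+z. indicator {..<-t} z * kern UNIV n z 0 \<partial>lborel)"
        unfolding concentration_def
        by (subst nn_integral_add[symmetric]) (auto simp: indicator_def intro!: nn_integral_mono)
      also have "(\<integral>\<^sup>+z. indicator {..<-t} z * kern UNIV n z 0 \<partial>lborel) = ?T"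
        using nn_integral_reflect[of "\<lambda>z. indicator {..<-t} z * kern UNIV n z 0" 0]
        by (simp add: kern_UNIV_even indicator_def)
      finally have "1 \<le> concentration n t + ?T + ?T" using T by (metis add_right_mono)
      also have "\<dots> \<le> concentration n t + ennreal (1 / 4) + ennreal (1 / 4)" by (intro add_mono T4 order_refl)
      also have "\<dots> = concentration n t + ennreal (1 / 2)"
        by (simp only: add.assoc, subst ennreal_plus[symmetric]) auto
      finally have "ennreal (1 / 2) + ennreal (1 / 2) \<le> concentration n t + ennreal (1 / 2)"
        by (subst ennreal_plus[symmetric]) auto
      moreover have "ennreal (1 / 2) \<le> ennreal 1" by (rule ennreal_leI) simp
      hence "ennreal (1 / 2) \<le> 1" unfolding ennreal_1 .
      ultimately show ?thesis by (rule ennreal_add_cancel_finite)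
    qed
    define r where "r = max t 3"
    have "((\<lambda>n. 28 * r / sqrt (real (Suc n) * ln r)) \<longlongrightarrow> 0) sequentially"
    proof -
      have "0 < ln r" "0 < r" by (auto simp: r_def)
      thus ?thesis by real_asymp
    qed
    hence "eventually (\<lambda>n. 28 * r / sqrt (real (Suc n) * ln r) < 1 / 2) sequentially"
      by (rule order_tendstoD(2)) simp
    then obtain n where n: "28 * r / sqrt (real (Suc n) * ln r) < 1 / 2" by (meson eventually_happens' sequentially_bot)
    have "ennreal (1 / 2) \<le> concentration n r" using big[of n] concentration_mono[of t r n] by (simp add: r_def)
    also have "\<dots> \<le> ennreal (28 * r / sqrt (real (Suc n) * ln r))" by (rule concentration_le) (simp add: r_def)
    also have "\<dots> < ennreal (1 / 2)" using n by (intro ennreal_lessI) auto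
    finally show False by simp
  qed
  ultimately have "\<not> x s < 1" by blast
  with x1[of s] show ?thesis by (simp add: x_def)
qed

section \<open>The last displacement\<close>

text \<open>The probability that the next displacement \<open>x\<close> from distance \<open>u\<close> lies in \<open>W\<close> and satisfies \<open>u \<le> w x\<close>. For
\<open>w \<le> 1\<close> and \<open>W\<close> positive such a displacement almost surely leaves the strip.\<close>

definition exit_profile :: "real set \<Rightarrow> real \<Rightarrow> real \<Rightarrow> ennreal" where
  "exit_profile W w u = (\<integral>\<^sup>+x. (indicator W x * ennreal (jump x)) * indicator {0..} (w * x - u) \<partial>lborel)"

lemma measurable_exit_profile [measurable (raw)]:
  assumes [measurable]: "W \<in> sets borel" "f \<in> borel_measurable N"
  shows "(\<lambda>x. exit_profile W w (f x)) \<in> borel_measurable N"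
  unfolding exit_profile_def by measurable

text \<open>The probability, from \<open>s\<close>, that the last displacement \<open>x\<close> lies in \<open>W\<close> and that the distance \<open>u\<close> before it
satisfies \<open>u \<le> w x\<close>.\<close>

definition hit :: "real set \<Rightarrow> real \<Rightarrow> real \<Rightarrow> ennreal" where
  "hit W w s = (\<Sum>n. (kill_step ^^ n) (exit_profile W w) s)"

lemma measurable_hit [measurable (raw)]:
  assumes [measurable]: "W \<in> sets borel"
  shows "hit W w \<in> borel_measurable borel"
  unfolding hit_def[abs_def] by measurable

text \<open>For a fixed last displacement \<open>x\<close>, the sum over all times counts the visits to distances
at most \<open>w x\<close>.\<close>

lemma hit_eq:
  assumes [measurable]: "W \<in> sets borel" and "0 \<le> s"
  shows "hit W w s = (\<integral>\<^sup>+x. (indicator W x * ennreal (jump x)) * occupation s (w * x) \<partial>lborel)"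
proof -
  let ?p = "exit_profile W w"
  have "hit W w s = (\<Sum>n<Suc 0. (kill_step ^^ n) ?p s) + (\<Sum>n. (kill_step ^^ (n + Suc 0)) ?p s)"
    unfolding hit_def by (rule ennreal_suminf_split)
  also have "\<dots> = ?p s + (\<Sum>n. \<integral>\<^sup>+u. indicator {0..} u * (hkern n s u * ?p u) \<partial>lborel)"
    using kill_step_funpow_Suc[of ?p] by simp
  also have "(\<Sum>n. \<integral>\<^sup>+u. indicator {0..} u * (hkern n s u * ?p u) \<partial>lborel) =
      (\<integral>\<^sup>+u. (\<Sum>n. indicator {0..} u * (hkern n s u * ?p u)) \<partial>lborel)"
    by (rule nn_integral_suminf[symmetric]) measurable
  also have "\<dots> = (\<integral>\<^sup>+u. (indicator {0..} u * green s u) *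
      (\<integral>\<^sup>+x. indicator {0..} (w * x - u) * (indicator W x * ennreal (jump x)) \<partial>lborel) \<partial>lborel)"
    by (simp add: green_def exit_profile_def mult_ac)
  also have "\<dots> = (\<integral>\<^sup>+x. (indicator W x * ennreal (jump x)) *
      (\<integral>\<^sup>+u. (indicator {0..} u * green s u) * indicator {0..} (w * x - u) \<partial>lborel) \<partial>lborel)"
    by (rule nn_integral_mult_swap) simp_all
  also have "?p s + \<dots> = (\<integral>\<^sup>+x. (indicator W x * ennreal (jump x)) * indicator {0..} (w * x - s) +
      (indicator W x * ennreal (jump x)) * (\<integral>\<^sup>+u. (indicator {0..} u * green s u) * indicator {0..} (w * x - u) \<partial>lborel) \<partial>lborel)"
    unfolding exit_profile_def by (rule nn_integral_add[symmetric]) simp_all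
  also have "\<dots> = (\<integral>\<^sup>+x. (indicator W x * ennreal (jump x)) * occupation s (w * x) \<partial>lborel)"
  proof (intro nn_integral_cong)
    fix x
    have 1: "(indicator {0..} (w * x - s) :: ennreal) = indicator {0..w * x} s"
      using \<open>0 \<le> s\<close> by (simp add: indicator_def)
    have 2: "(\<integral>\<^sup>+u. (indicator {0..} u * green s u) * indicator {0..} (w * x - u) \<partial>lborel) =
       (\<integral>\<^sup>+u. indicator {0..w * x} u * green s u \<partial>lborel)"
      by (intro nn_integral_cong) (simp add: indicator_def)
    show "(indicator W x * ennreal (jump x)) * indicator {0..} (w * x - s) +
      (indicator W x * ennreal (jump x)) * (\<integral>\<^sup>+u. (indicator {0..} u * green s u) * indicator {0..} (w * x - u) \<partial>lborel)
      = (indicator W x * ennreal (jump x)) * occupation s (w * x)"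
      unfolding 1 2 occupation_def by (simp only: distrib_left)
  qed
  finally show ?thesis .
qed

lemma exit_profile_le:
  assumes [measurable]: "W \<in> sets borel" and "W \<subseteq> {0<..}" "w \<le> 1"
  shows "exit_profile W w u \<le> exit_mass 0 u"
proof -
  have "exit_mass 0 u = (\<integral>\<^sup>+x. indicator {..<0} (u - x) * ennreal (jump (u - (u - x))) \<partial>lborel)"
    unfolding exit_mass_def kern.simps by (rule nn_integral_reflect[symmetric]) simp
  moreover have "exit_profile W w u \<le> (\<integral>\<^sup>+x. indicator {..<0} (u - x) * ennreal (jump (u - (u - x))) \<partial>lborel)"
    unfolding exit_profile_def
  proof (rule nn_integral_mono_AE, rule AE_I[of _ _ "{u}"])
    have "indicator W x * ennreal (jump x) * indicator {0..} (w * x - u) \<le> indicator {..<0} (u - x) * ennreal (jump (u - (u - x)))"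
      if "x \<noteq> u" for x
    proof (cases "x \<in> W \<and> u \<le> w * x")
      case True
      with assms have "0 < x" by auto
      with assms have "w * x \<le> x" by simp
      with True that have "u < x" by linarith
      thus ?thesis using True by (simp add: indicator_def)
    qed (auto simp: indicator_def)
    thus "{x \<in> space lborel. \<not> indicator W x * ennreal (jump x) * indicator {0..} (w * x - u) \<le>
      indicator {..<0} (u - x) * ennreal (jump (u - (u - x)))} \<subseteq> {u}" by blast
  qed auto
  ultimately show ?thesis by simp
qed

lemma exit_profile_all:
  assumes "0 \<le> u" shows "exit_profile {0<..} 1 u = exit_mass 0 u"
proof (rule antisym)
  show "exit_profile {0<..} 1 u \<le> exit_mass 0 u" by (rule exit_profile_le) auto
  have "exit_mass 0 u = (\<integral>\<^sup>+x. indicator {..<0} (u - x) * ennreal (jump (u - (u - x))) \<partial>lborel)"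
    unfolding exit_mass_def kern.simps by (rule nn_integral_reflect[symmetric]) simp
  also have "\<dots> \<le> exit_profile {0<..} 1 u"
    unfolding exit_profile_def using assms by (intro nn_integral_mono) (auto simp: indicator_def)
  finally show "exit_mass 0 u \<le> exit_profile {0<..} 1 u" .
qed

lemma kill_step_funpow_cong:
  assumes "\<And>y. 0 \<le> y \<Longrightarrow> \<phi> y = \<psi> y" "0 \<le> s"
  shows "(kill_step ^^ n) \<phi> s = (kill_step ^^ n) \<psi> s"
  using assms(2)
proof (induction n arbitrary: s)
  case (Suc n)
  show ?case
    by (simp, rule antisym; rule kill_step_mono) (simp_all add: Suc.IH)
qed (use assms(1) in simp)

lemma exit_mass_funpow: "exit_mass n = (kill_step ^^ n) (exit_mass 0)"
proof (induction n)
  case (Suc n)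
  have "exit_mass (Suc n) = kill_step (exit_mass n)" by (rule ext) (rule exit_mass_Suc)
  also have "\<dots> = (kill_step ^^ Suc n) (exit_mass 0)" by (simp only: Suc funpow.simps o_apply)
  finally show ?case .
qed simp

lemma hit_total:
  assumes "0 \<le> s" shows "hit {0<..} 1 s = 1"
proof -
  have "(kill_step ^^ n) (exit_profile {0<..} 1) s = exit_mass n s" for n
    by (subst exit_mass_funpow, rule kill_step_funpow_cong) (auto simp: exit_profile_all assms)
  thus ?thesis by (simp add: hit_def passage_certain assms)
qed

lemma hit_Un:
  assumes [measurable]: "W \<in> sets borel" "W' \<in> sets borel" and "W \<inter> W' = {}" "0 \<le> s"
  shows "hit (W \<union> W') w s = hit W w s + hit W' w s"
proof -
  have "hit (W \<union> W') w s = (\<integral>\<^sup>+x. (indicator W x * ennreal (jump x)) * occupation s (w * x) +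
      (indicator W' x * ennreal (jump x)) * occupation s (w * x) \<partial>lborel)"
  proof -
    have "W \<union> W' \<in> sets borel" by simp
    from hit_eq[OF this assms(4), of w] have "hit (W \<union> W') w s =
      (\<integral>\<^sup>+x. (indicator (W \<union> W') x * ennreal (jump x)) * occupation s (w * x) \<partial>lborel)" .
    also have "\<dots> = (\<integral>\<^sup>+x. (indicator W x * ennreal (jump x)) * occupation s (w * x) +
      (indicator W' x * ennreal (jump x)) * occupation s (w * x) \<partial>lborel)"
      using assms(3) by (intro nn_integral_cong) (auto simp: indicator_def)
    finally show ?thesis .
  qed
  also have "\<dots> = hit W w s + hit W' w s"
    unfolding hit_eq[OF assms(1,4)] hit_eq[OF assms(2,4)] by (rule nn_integral_add) measurable
  finally show ?thesis .
qed

lemma hit_even_odd: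
  assumes [measurable]: "W \<in> sets borel"
  shows "hit W w s = even_sum (exit_profile W w) s + even_sum (kill_step (exit_profile W w)) s"
proof -
  let ?f = "\<lambda>n. (kill_step ^^ n) (exit_profile W w) s"
  have pair: "(\<Sum>n<2 * m. ?f n) = (\<Sum>k<m. ?f (2 * k)) + (\<Sum>k<m. ?f (2 * k + 1))" for m
    by (induction m) (auto simp: add_ac)
  have odd: "even_sum (kill_step (exit_profile W w)) s = (\<Sum>k. ?f (2 * k + 1))"
    unfolding even_sum_def by (simp add: funpow_swap1)
  have "(\<lambda>m. \<Sum>n<2 * m. ?f n) \<longlonglongrightarrow> hit W w s"
    unfolding hit_def
    by (rule filterlim_compose[OF summable_LIMSEQ])
      (auto intro: mult_nat_left_at_top)
  moreover have "(\<lambda>m. (\<Sum>k<m. ?f (2 * k)) + (\<Sum>k<m. ?f (2 * k + 1))) \<longlonglongrightarrow>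
     even_sum (exit_profile W w) s + even_sum (kill_step (exit_profile W w)) s"
  proof (rule tendsto_add)
    show "(\<lambda>m. \<Sum>k<m. ?f (2 * k)) \<longlonglongrightarrow> even_sum (exit_profile W w) s"
      unfolding even_sum_def by (rule summable_LIMSEQ) simp
    show "(\<lambda>m. \<Sum>k<m. ?f (2 * k + 1)) \<longlonglongrightarrow> even_sum (kill_step (exit_profile W w)) s"
      unfolding odd by (rule summable_LIMSEQ) simp
  qed
  ultimately show ?thesis unfolding pair by (rule LIMSEQ_unique)
qed

lemma even_sum_kill_step:
  assumes [measurable]: "\<psi> \<in> borel_measurable borel"
  shows "even_sum (kill_step \<psi>) s = kill_step (even_sum \<psi>) s"
proof -
  have "kill_step (even_sum \<psi>) s = (\<Sum>k. kill_step ((kill_step ^^ (2 * k)) \<psi>) s)"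
    unfolding even_sum_def[abs_def] by (rule kill_step_suminf) simp
  also have "\<dots> = even_sum (kill_step \<psi>) s"
    unfolding even_sum_def by (rule suminf_cong) (simp only: funpow_swap1)
  finally show ?thesis by simp
qed

lemma jump_two_sided_tail:
  assumes "0 < a"
  shows "(\<integral>\<^sup>+y. ennreal (jump (s - y)) * indicator {y. a < \<bar>s - y\<bar>} y \<partial>lborel) \<le> ennreal (1 / (2 * a\<^sup>2))"
proof -
  have "(\<integral>\<^sup>+y. ennreal (jump (s - y)) * indicator {y. a < \<bar>s - y\<bar>} y \<partial>lborel) =
      (\<integral>\<^sup>+x. ennreal (jump x) * indicator {x. a < \<bar>x\<bar>} x \<partial>lborel)"
    using nn_integral_reflect[of "\<lambda>x. ennreal (jump x) * indicator {x. a < \<bar>x\<bar>} x" s] by (simp add: indicator_def)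
  also have "\<dots> = 2 * (\<integral>\<^sup>+x. indicator {0..} x * (ennreal (jump x) * indicator {x. a < \<bar>x\<bar>} x) \<partial>lborel)"
    by (rule nn_integral_even) (auto simp: indicator_def)
  also have "\<dots> \<le> 2 * (\<integral>\<^sup>+x. ennreal (jump x) * indicator {a..} x \<partial>lborel)"
    by (intro mult_left_mono nn_integral_mono) (auto simp: indicator_def)
  also have "\<dots> = 2 * ennreal (1 - jump_cdf a)" by (simp add: nn_integral_jump_Ioi)
  also have "\<dots> \<le> 2 * ennreal (1 / (4 * a\<^sup>2))"
    by (intro mult_left_mono ennreal_leI jump_tail_le assms) auto
  also have "\<dots> = ennreal (2 * (1 / (4 * a\<^sup>2)))" using ennreal_mult'[of 2 "1 / (4 * a\<^sup>2)"] by simp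
  finally show ?thesis by simp
qed

text \<open>The odd sum is one step applied to the even sum, and a step moves the walk from \<open>s\<close> by more than \<open>\<epsilon> s\<close> only with
probability of order \<open>1 / (\<epsilon> s)\<^sup>2\<close>, while smaller moves hardly change the even sum.\<close>

lemma parity_balance:
  fixes \<eta> :: real assumes "0 < \<eta>"
  obtains s0 where "0 \<le> s0"
    "\<And>s \<psi>. s0 \<le> s \<Longrightarrow> \<psi> \<in> borel_measurable borel \<Longrightarrow> (\<And>y. 0 \<le> y \<Longrightarrow> \<psi> y \<le> exit_mass 0 y) \<Longrightarrow>
       even_sum (kill_step \<psi>) s \<le> even_sum \<psi> s + ennreal \<eta> \<and> even_sum \<psi> s \<le> even_sum (kill_step \<psi>) s + ennreal \<eta>"
proof -
  have "0 < \<eta> / 2" using assms by simp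
  then obtain \<epsilon> s1 where \<epsilon>: "0 < \<epsilon>" "\<epsilon> \<le> 1 / 2" "1 \<le> s1" and sm:
    "\<And>s s' \<psi>. s1 \<le> s \<Longrightarrow> \<bar>s - s'\<bar> \<le> \<epsilon> * s \<Longrightarrow> \<psi> \<in> borel_measurable borel \<Longrightarrow>
       (\<And>y. 0 \<le> y \<Longrightarrow> \<psi> y \<le> exit_mass 0 y) \<Longrightarrow>
       even_sum \<psi> s \<le> even_sum \<psi> s' + ennreal (\<eta>/2) \<and> even_sum \<psi> s' \<le> even_sum \<psi> s + ennreal (\<eta>/2)"
    by (rule even_sum_smooth) blast
  define s0 where "s0 = max s1 (max 1 (1 / (\<epsilon>\<^sup>2 * \<eta>)))"
  have "even_sum (kill_step \<psi>) s \<le> even_sum \<psi> s + ennreal \<eta> \<and> even_sum \<psi> s \<le> even_sum (kill_step \<psi>) s + ennreal \<eta>"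
    if "s0 \<le> s" and [measurable]: "\<psi> \<in> borel_measurable borel" and \<psi>: "\<And>y. 0 \<le> y \<Longrightarrow> \<psi> y \<le> exit_mass 0 y" for s \<psi>
  proof -
    have s: "s1 \<le> s" "1 \<le> s" "1 / (\<epsilon>\<^sup>2 * \<eta>) \<le> s" using that(1) by (auto simp: s0_def)
    let ?h = "even_sum \<psi>" and ?J = "\<lambda>y. ennreal (jump (s - y))"
    let ?I = "\<lambda>y. indicator {y. \<epsilon> * s < \<bar>s - y\<bar>} y :: ennreal"
    have small: "(\<integral>\<^sup>+y. ?J y * ?I y \<partial>lborel) \<le> ennreal (\<eta> / 2)"
    proof -
      have "1 \<le> \<epsilon>\<^sup>2 * \<eta> * s" using s(3) \<epsilon> assms by (simp add: field_simps)
      also have "\<dots> \<le> \<epsilon>\<^sup>2 * \<eta> * s\<^sup>2" using s(2) \<epsilon> assms by (intro mult_left_mono) (auto simp: power2_eq_square)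
      finally have "1 / (2 * (\<epsilon> * s)\<^sup>2) \<le> \<eta> / 2" using s \<epsilon> by (simp add: field_simps power_mult_distrib)
      thus ?thesis using s \<epsilon> by (intro order_trans[OF jump_two_sided_tail] ennreal_leI) auto
    qed
    have sum2: "ennreal (\<eta> / 2) + ennreal (\<eta> / 2) = ennreal \<eta>"
      using assms by (subst ennreal_plus[symmetric]) auto
    have near: "0 \<le> y \<and> ?h s \<le> ?h y + ennreal (\<eta>/2) \<and> ?h y \<le> ?h s + ennreal (\<eta>/2)" if "\<bar>s - y\<bar> \<le> \<epsilon> * s" for y
    proof -
      have "\<epsilon> * s \<le> 1 / 2 * s" using \<epsilon> s by (intro mult_right_mono) auto
      hence "0 \<le> y" using that s(2) by linarith
      thus ?thesis using sm[OF s(1) that, of \<psi>] \<psi> by auto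
    qed
    have "kill_step ?h s \<le> (\<integral>\<^sup>+y. ?J y * (?h s + ennreal (\<eta>/2)) + ?J y * ?I y \<partial>lborel)"
      unfolding kill_step_def
    proof (intro nn_integral_mono)
      fix y
      show "indicator {0..} y * (?J y * ?h y) \<le> ?J y * (?h s + ennreal (\<eta>/2)) + ?J y * ?I y"
      proof (cases "\<bar>s - y\<bar> \<le> \<epsilon> * s")
        case True
        hence "?J y * ?h y \<le> ?J y * (?h s + ennreal (\<eta>/2))" using near by (intro mult_left_mono) auto
        thus ?thesis using True near[OF True] by (simp add: indicator_def)
      next
        case False
        have "indicator {0..} y * (?J y * ?h y) \<le> ?J y * 1"
          using even_sum_le_1[OF \<psi>, of y] by (cases "0 \<le> y") (auto intro!: mult_left_mono simp: mult_left_le)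
        also have "\<dots> \<le> ?J y * (?h s + ennreal (\<eta>/2)) + ?J y * ?I y" using False by (simp add: indicator_def)
        finally show ?thesis .
      qed
    qed
    also have "\<dots> = (?h s + ennreal (\<eta>/2)) + (\<integral>\<^sup>+y. ?J y * ?I y \<partial>lborel)"
      by (subst nn_integral_add) (simp_all add: nn_integral_multc)
    also have "\<dots> \<le> (?h s + ennreal (\<eta>/2)) + ennreal (\<eta>/2)" using small by (rule add_left_mono)
    finally have A: "kill_step ?h s \<le> ?h s + ennreal \<eta>" by (simp only: add.assoc sum2)
    have "?h s = (\<integral>\<^sup>+y. ?J y * ?h s \<partial>lborel)" by (subst nn_integral_multc) simp_all
    also have "\<dots> \<le> (\<integral>\<^sup>+y. indicator {0..} y * (?J y * ?h y) + (?J y * ennreal (\<eta>/2) + ?J y * ?I y) \<partial>lborel)"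
    proof (intro nn_integral_mono)
      fix y
      show "?J y * ?h s \<le> indicator {0..} y * (?J y * ?h y) + (?J y * ennreal (\<eta>/2) + ?J y * ?I y)"
      proof (cases "\<bar>s - y\<bar> \<le> \<epsilon> * s")
        case True
        hence "?J y * ?h s \<le> ?J y * (?h y + ennreal (\<eta>/2))" using near by (intro mult_left_mono) auto
        thus ?thesis using True near[OF True] by (simp add: indicator_def distrib_left)
      next
        case False
        have "?J y * ?h s \<le> ?J y * 1" using even_sum_le_1[OF \<psi>, of s] s by (intro mult_left_mono) auto
        also have "\<dots> \<le> indicator {0..} y * (?J y * ?h y) + (?J y * ennreal (\<eta>/2) + ?J y * ?I y)"
          using False by (simp add: indicator_def add_increasing)
        finally show ?thesis .
      qed
    qed
    also have "\<dots> = kill_step ?h s + (ennreal (\<eta>/2) + (\<integral>\<^sup>+y. ?J y * ?I y \<partial>lborel))"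
      unfolding kill_step_def
      by (subst nn_integral_add, simp, simp, subst nn_integral_add) (simp_all add: nn_integral_multc)
    also have "\<dots> \<le> kill_step ?h s + (ennreal (\<eta>/2) + ennreal (\<eta>/2))" using small by (intro add_left_mono)
    finally have "?h s \<le> kill_step ?h s + ennreal \<eta>" by (simp only: sum2)
    with A show ?thesis by (simp add: even_sum_kill_step)
  qed
  moreover have "0 \<le> s0" by (simp add: s0_def)
  ultimately show thesis using that by blast
qed

section \<open>The renewal function as a real function\<close>

text \<open>For a fixed last displacement, only the occupation depends on the starting point.\<close>

lemma occupation_hit_swap:
  assumes [measurable]: "W \<in> sets borel"
  shows "0 \<le> c \<Longrightarrow> (\<integral>\<^sup>+s. indicator {c..d} s * hit W w s \<partial>lborel) =
    (\<integral>\<^sup>+x. (indicator W x * ennreal (jump x)) * (\<integral>\<^sup>+s. indicator {c..d} s * occupation s (w * x) \<partial>lborel) \<partial>lborel)"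
proof -
  assume "0 \<le> c"
  hence "(\<integral>\<^sup>+s. indicator {c..d} s * hit W w s \<partial>lborel) = (\<integral>\<^sup>+s. indicator {c..d} s *
      (\<integral>\<^sup>+x. occupation s (w * x) * (indicator W x * ennreal (jump x)) \<partial>lborel) \<partial>lborel)"
    using hit_eq[OF assms] by (intro nn_integral_cong) (auto simp: indicator_def mult_ac)
  also have "\<dots> = (\<integral>\<^sup>+x. (indicator W x * ennreal (jump x)) * (\<integral>\<^sup>+s. indicator {c..d} s * occupation s (w * x) \<partial>lborel) \<partial>lborel)"
    by (rule nn_integral_mult_swap) simp_all
  finally show ?thesis .
qed

lemma hit_le_1:
  assumes [measurable]: "W \<in> sets borel" and "W \<subseteq> {0<..}" "0 \<le> s" "w \<le> 1"
  shows "hit W w s \<le> 1"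
proof -
  have "hit W w s \<le> (\<Sum>n. exit_mass n s)"
    unfolding hit_def
  proof (rule suminf_le)
    fix n show "(kill_step ^^ n) (exit_profile W w) s \<le> exit_mass n s"
      using kill_step_funpow_le_exit_mass[of "exit_profile W w" 0 s n] exit_profile_le[OF assms(1,2,4)] assms(3) by simp
  qed auto
  thus ?thesis by (simp add: passage_certain assms)
qed

lemma greaterThanAtMost_subset_greaterThan: "{a<..b} \<subseteq> {a<..}" for a :: real
  by auto

text \<open>The integral over starting points in \<open>[0, 2 b]\<close> of a probability is at most \<open>2 b\<close>.\<close>

lemma ladder_product_bound:
  assumes "0 < b"
  shows "(\<integral>\<^sup>+x. (indicator {0<..b} x * ennreal (jump x)) * renewal_mass_integral x \<partial>lborel) * renewal_mass b \<le> ennreal (2 * b)"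
proof -
  have [measurable]: "renewal_mass_integral \<in> borel_measurable borel"
    unfolding renewal_mass_integral_def[abs_def] by measurable
  have "(\<integral>\<^sup>+x. (indicator {0<..b} x * ennreal (jump x)) * renewal_mass_integral x \<partial>lborel) * renewal_mass b =
     (\<integral>\<^sup>+x. (indicator {0<..b} x * ennreal (jump x)) * renewal_mass_integral x * renewal_mass b \<partial>lborel)"
    by (rule nn_integral_multc[symmetric]) simp
  also have "\<dots> \<le> (\<integral>\<^sup>+x. (indicator {0<..b} x * ennreal (jump x)) *
      (\<integral>\<^sup>+s. indicator {0..2*b} s * occupation s (1 * x) \<partial>lborel) \<partial>lborel)"
  proof (intro nn_integral_mono)
    fix x
    have "renewal_mass_integral x * renewal_mass b \<le> (\<integral>\<^sup>+s. indicator {0..2*b} s * occupation s (1 * x) \<partial>lborel)" if "0 < x" "x \<le> b"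
      using occupation_integral_lower[of x b] that by simp
    thus "(indicator {0<..b} x * ennreal (jump x)) * renewal_mass_integral x * renewal_mass b \<le> (indicator {0<..b} x * ennreal (jump x)) *
      (\<integral>\<^sup>+s. indicator {0..2*b} s * occupation s (1 * x) \<partial>lborel)"
      by (cases "x \<in> {0<..b}") (auto simp: mult.assoc intro!: mult_left_mono)
  qed
  also have "\<dots> = (\<integral>\<^sup>+s. indicator {0..2*b} s * hit {0<..b} 1 s \<partial>lborel)"
    by (rule occupation_hit_swap[symmetric]) auto
  also have "\<dots> \<le> (\<integral>\<^sup>+s. indicator {0..2*b} s \<partial>lborel)"
  proof (intro nn_integral_mono)
    fix s show "indicator {0..2*b} s * hit {0<..b} 1 s \<le> indicator {0..2*b} s"
      using hit_le_1[of "{0<..b}" s 1, OF _ greaterThanAtMost_subset_greaterThan] by (cases "s \<in> {0..2*b}") auto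
  qed
  also have "\<dots> = ennreal (2 * b)" using assms by simp
  finally show ?thesis .
qed

lemma renewal_mass_integral_ge: "0 \<le> x \<Longrightarrow> ennreal x \<le> renewal_mass_integral x"
proof -
  assume "0 \<le> x"
  hence "ennreal x = (\<integral>\<^sup>+y. indicator {0..x} y * 1 \<partial>lborel)" by simp
  also have "\<dots> \<le> renewal_mass_integral x"
    unfolding renewal_mass_integral_def by (intro nn_integral_mono mult_left_mono renewal_mass_ge_1) auto
  finally show ?thesis .
qed

text \<open>Nothing so far excludes an infinite renewal function; the product bound does, because its other factor is
positive.\<close>

lemma renewal_mass_finite: "renewal_mass x < \<top>"
proof -
  define b where "b = max x 2"
  have "ennreal (jump 2) \<le> (\<integral>\<^sup>+x. ennreal (jump 2) * indicator {1..2 :: real} x \<partial>lborel)"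
    by (subst nn_integral_cmult_indicator) auto
  also have "\<dots> \<le> (\<integral>\<^sup>+x. (indicator {0<..b} x * ennreal (jump x)) * renewal_mass_integral x \<partial>lborel)"
  proof (intro nn_integral_mono)
    fix y :: real
    have "ennreal (jump 2) * 1 \<le> ennreal (jump y) * renewal_mass_integral y" if "1 \<le> y" "y \<le> 2"
    proof (intro mult_mono ennreal_leI jump_mono)
      have "1 = ennreal 1" by simp
      also have "\<dots> \<le> ennreal y" using that by (intro ennreal_leI)
      also have "\<dots> \<le> renewal_mass_integral y" using that by (intro renewal_mass_integral_ge) auto
      finally show "1 \<le> renewal_mass_integral y" .
    qed (use that in auto)
    thus "ennreal (jump 2) * indicator {1..2} y \<le> (indicator {0<..b} y * ennreal (jump y)) * renewal_mass_integral y"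
      by (auto simp: indicator_def b_def)
  qed
  finally have "ennreal (jump 2) * renewal_mass b \<le>
    (\<integral>\<^sup>+x. (indicator {0<..b} x * ennreal (jump x)) * renewal_mass_integral x \<partial>lborel) * renewal_mass b"
    by (rule mult_right_mono) simp
  also have "\<dots> \<le> ennreal (2 * b)" by (rule ladder_product_bound) (simp add: b_def)
  finally have "ennreal (jump 2) * renewal_mass b < \<top>" by (rule order_le_less_trans) simp
  hence "renewal_mass b < \<top>" using jump_pos[of 2] by (auto simp: ennreal_mult_less_top ennreal_eq_0_iff simp del: jump_pos)
  moreover have "renewal_mass x \<le> renewal_mass b" by (rule renewal_mass_mono) (simp add: b_def)
  ultimately show ?thesis by (rule order_le_less_trans[rotated])
qed

definition ladder_U :: "real \<Rightarrow> real" where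
  "ladder_U x = enn2real (renewal_mass x)"

lemma renewal_mass_eq: "renewal_mass x = ennreal (ladder_U x)"
  using renewal_mass_finite[of x] by (simp add: ladder_U_def)

lemma ladder_U_ge_1: "1 \<le> ladder_U x"
  using renewal_mass_ge_1[of x] by (simp add: renewal_mass_eq ennreal_ge_1)

lemma ladder_U_nonneg [simp]: "0 \<le> ladder_U x"
  using ladder_U_ge_1[of x] by linarith

lemma ladder_U_mono: "x \<le> y \<Longrightarrow> ladder_U x \<le> ladder_U y"
  using renewal_mass_mono[of x y] by (simp add: renewal_mass_eq)

lemma ladder_U_subadditive: "0 \<le> x \<Longrightarrow> 0 \<le> y \<Longrightarrow> ladder_U (x + y) \<le> ladder_U x + ladder_U y"
  using renewal_mass_subadditive[of x y] by (simp add: renewal_mass_eq ennreal_plus[symmetric] del: ennreal_plus)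

lemma continuous_ladder_U: "continuous_on {0..b} ladder_U"
proof (cases "0 \<le> b")
  case True
  define v where "v y = enn2real (renewal_density y)" for y
  have [measurable]: "v \<in> borel_measurable borel" unfolding v_def[abs_def] by measurable
  have "(\<integral>\<^sup>+y. indicator {0..b} y * renewal_density y \<partial>lborel) \<le> renewal_mass b" by (simp add: renewal_mass_def)
  also have "\<dots> < \<top>" by (rule renewal_mass_finite)
  finally have "AE y in lborel. indicator {0..b} y * renewal_density y \<noteq> \<infinity>"
    by (intro nn_integral_PInf_AE) auto
  hence fin: "AE y in lborel. y \<in> {0..b} \<longrightarrow> renewal_density y = ennreal (v y)"
    by eventually_elim (auto simp: v_def indicator_def less_top)
  have eq: "(\<integral>\<^sup>+y. ennreal (indicator {0..x} y * v y) \<partial>lborel) = (\<integral>\<^sup>+y. indicator {0..x} y * renewal_density y \<partial>lborel)" if "x \<le> b" for x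
    using fin by (intro nn_integral_cong_AE, eventually_elim) (use that in \<open>auto simp: indicator_def\<close>)
  have hi: "((\<lambda>y. indicator {0..x} y * v y) has_integral (ladder_U x - 1)) UNIV" if "x \<le> b" for x
  proof (rule nn_integral_has_integral)
    have "renewal_mass x = 1 + (\<integral>\<^sup>+y. indicator {0..x} y * renewal_density y \<partial>lborel)" by (rule renewal_mass_def)
    moreover have "renewal_mass x = 1 + ennreal (ladder_U x - 1)"
      using ladder_U_ge_1[of x] ennreal_plus[of 1 "ladder_U x - 1"] by (simp add: renewal_mass_eq del: ennreal_plus)
    ultimately show "(\<integral>\<^sup>+y. ennreal (indicator {0..x} y * v y) \<partial>lborel) = ennreal (ladder_U x - 1)"
      by (simp add: eq that ennreal_add_left_cancel)
  qed (use ladder_U_ge_1[of x] in \<open>auto simp: v_def\<close>)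
  have hi': "(v has_integral (ladder_U x - 1)) {0..x}" if "x \<le> b" for x
  proof -
    have "(\<lambda>y. indicator {0..x} y * v y) = (\<lambda>y. if y \<in> {0..x} then v y else 0)"
      by (auto simp: indicator_def)
    with hi[OF that] show ?thesis by (simp only: has_integral_restrict_UNIV)
  qed
  have "continuous_on {0..b} (\<lambda>x. integral {0..x} v)"
    using hi'[of b] by (intro indefinite_integral_continuous_1) auto
  hence "continuous_on {0..b} (\<lambda>x. 1 + integral {0..x} v)" by (intro continuous_intros)
  thus ?thesis
    by (rule continuous_on_eq) (simp add: integral_unique[OF hi'])
qed simp

definition ladder_V :: "real \<Rightarrow> real" where
  "ladder_V x = integral {0..x} ladder_U"

lemma ladder_U_integrable: "ladder_U integrable_on {a..b}" if "0 \<le> a"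
  using that by (intro integrable_subinterval_real[OF integrable_continuous_real[OF continuous_ladder_U[of b]]]) auto

lemma renewal_mass_integral_eq: "renewal_mass_integral x = ennreal (ladder_V x)"
proof -
  have "(ladder_U has_integral ladder_V x) {0..x}"
    unfolding ladder_V_def by (intro integrable_integral ladder_U_integrable) simp
  from nn_integral_has_integral_lebesgue'[OF _ this]
  show ?thesis by (simp add: renewal_mass_integral_def renewal_mass_eq mult.commute)
qed

lemma DERIV_ladder_V: "0 < x \<Longrightarrow> DERIV ladder_V x :> ladder_U x"
proof -
  assume x: "0 < x"
  have "(ladder_V has_real_derivative ladder_U x) (at x within {0..x + 1})"
    unfolding ladder_V_def[abs_def]
    using x by (intro integral_has_real_derivative continuous_ladder_U) auto
  moreover have "at x within {0..x + 1} = at x" using x by (intro at_within_interior) auto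
  ultimately show ?thesis by simp
qed

lemma continuous_ladder_V: "continuous_on {0..b} ladder_V"
  unfolding ladder_V_def[abs_def] by (intro indefinite_integral_continuous_1 ladder_U_integrable) simp

lemma ladder_V_nonneg [simp]: "0 \<le> ladder_V x"
  unfolding ladder_V_def by (intro integral_nonneg ladder_U_integrable) auto

lemma ladder_V_mono: "x \<le> y \<Longrightarrow> ladder_V x \<le> ladder_V y"
  unfolding ladder_V_def by (intro integral_subset_le ladder_U_integrable) auto

lemma ladder_V_le: "0 \<le> x \<Longrightarrow> ladder_V x \<le> x * ladder_U x"
proof -
  assume "0 \<le> x"
  have "ladder_V x \<le> integral {0..x} (\<lambda>_. ladder_U x)"
    unfolding ladder_V_def by (intro integral_le ladder_U_integrable) (auto intro: ladder_U_mono)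
  thus ?thesis using \<open>0 \<le> x\<close> by (simp add: mult.commute)
qed

lemma ladder_V_0 [simp]: "ladder_V 0 = 0"
  by (simp add: ladder_V_def)

text \<open>The weight with which last displacements up to \<open>T\<close> enter the product formula for exit probabilities.\<close>

definition ladder_K :: "real \<Rightarrow> real \<Rightarrow> real" where
  "ladder_K w T = integral {0..T} (\<lambda>x. jump x * ladder_V (w * x))"

lemma continuous_ladder_K_integrand:
  assumes "0 \<le> w" shows "continuous_on {0..b} (\<lambda>x. jump x * ladder_V (w * x))"
proof (intro continuous_intros continuous_jump)
  show "continuous_on {0..b} (\<lambda>x. ladder_V (w * x))"
    by (rule continuous_on_compose2[OF continuous_ladder_V[of "w * b"]])
      (use assms in \<open>auto intro!: continuous_intros mult_left_mono\<close>)
qed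

lemma ladder_K_integrable: "0 \<le> w \<Longrightarrow> 0 \<le> a \<Longrightarrow> (\<lambda>x. jump x * ladder_V (w * x)) integrable_on {a..b}"
  by (rule integrable_subinterval_real[OF integrable_continuous_real[OF continuous_ladder_K_integrand[of w b]]]) auto

lemma DERIV_ladder_K: "0 \<le> w \<Longrightarrow> 0 < x \<Longrightarrow> DERIV (ladder_K w) x :> jump x * ladder_V (w * x)"
proof -
  assume x: "0 \<le> w" "0 < x"
  have "(ladder_K w has_real_derivative jump x * ladder_V (w * x)) (at x within {0..x + 1})"
    unfolding ladder_K_def[abs_def]
    using x by (intro integral_has_real_derivative continuous_ladder_K_integrand) auto
  moreover have "at x within {0..x + 1} = at x" using x by (intro at_within_interior) auto
  ultimately show ?thesis by simp
qed

lemma ladder_K_nonneg [simp]: "0 \<le> w \<Longrightarrow> 0 \<le> ladder_K w T"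
  unfolding ladder_K_def by (intro integral_nonneg ladder_K_integrable) auto

lemma ladder_K_mono: "0 \<le> w \<Longrightarrow> S \<le> T \<Longrightarrow> ladder_K w S \<le> ladder_K w T"
  unfolding ladder_K_def by (intro integral_subset_le ladder_K_integrable) auto

lemma measurable_ladder_V [measurable]: "ladder_V \<in> borel_measurable borel"
  by (rule borel_measurable_mono) (auto simp: mono_def intro: ladder_V_mono)

lemma measurable_ladder_U [measurable]: "ladder_U \<in> borel_measurable borel"
  by (rule borel_measurable_mono) (auto simp: mono_def intro: ladder_U_mono)

lemma nn_integral_ladder_K:
  assumes "0 \<le> w"
  shows "(\<integral>\<^sup>+x. (indicator {0<..T} x * ennreal (jump x)) * renewal_mass_integral (w * x) \<partial>lborel) = ennreal (ladder_K w T)"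
proof -
  have "((\<lambda>x. jump x * ladder_V (w * x)) has_integral ladder_K w T) {0..T}"
    unfolding ladder_K_def using assms by (intro integrable_integral ladder_K_integrable) auto
  from nn_integral_has_integral_lebesgue'[OF _ this]
  have "(\<integral>\<^sup>+x. ennreal (jump x * ladder_V (w * x)) * indicator {0..T} x \<partial>lborel) = ennreal (ladder_K w T)" by simp
  moreover have "(\<integral>\<^sup>+x. (indicator {0<..T} x * ennreal (jump x)) * renewal_mass_integral (w * x) \<partial>lborel) =
     (\<integral>\<^sup>+x. ennreal (jump x * ladder_V (w * x)) * indicator {0..T} x \<partial>lborel)"
    by (rule nn_integral_cong_AE, rule AE_I[of _ _ "{0}"])
      (auto simp: indicator_def renewal_mass_integral_eq ennreal_mult')
  ultimately show ?thesis by simp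
qed

lemma ladder_UK_le: "0 < b \<Longrightarrow> ladder_U b * ladder_K 1 b \<le> 2 * b"
  using ladder_product_bound[of b] nn_integral_ladder_K[of 1 b]
  by (simp add: renewal_mass_eq ennreal_mult'[symmetric] mult.commute)

lemma ladder_U_mult: "0 \<le> z \<Longrightarrow> ladder_U (real (Suc n) * z) \<le> real (Suc n) * ladder_U z"
proof (induction n)
  case (Suc n)
  have "ladder_U (real (Suc (Suc n)) * z) = ladder_U (real (Suc n) * z + z)" by (simp add: algebra_simps)
  also have "\<dots> \<le> ladder_U (real (Suc n) * z) + ladder_U z" using Suc by (intro ladder_U_subadditive) auto
  also have "\<dots> \<le> real (Suc n) * ladder_U z + ladder_U z" using Suc by simp
  finally show ?case by (simp add: algebra_simps)
qed simp

text \<open>Subadditivity makes \<open>U\<close> grow at most linearly from any scale to a larger one.\<close>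

lemma ladder_U_quotient:
  assumes "0 < z" "z \<le> x" shows "z * ladder_U x \<le> 2 * x * ladder_U z"
proof -
  define n where "n = nat \<lfloor>x / z\<rfloor>"
  have "1 \<le> x / z" using assms by simp
  hence n: "real n \<le> x / z" "x / z \<le> real (Suc n)" unfolding n_def by linarith+
  have "x \<le> real (Suc n) * z" using n(2) assms by (simp add: field_simps)
  hence "ladder_U x \<le> ladder_U (real (Suc n) * z)" by (rule ladder_U_mono)
  also have "\<dots> \<le> real (Suc n) * ladder_U z" using assms by (intro ladder_U_mult) auto
  also have "\<dots> \<le> (2 * (x / z)) * ladder_U z"
    using n(1) \<open>1 \<le> x / z\<close> by (intro mult_right_mono) auto
  finally show ?thesis using assms by (simp add: field_simps)
qed

text \<open>A large value \<open>U x\<close> forces \<open>U z \<ge> c z\<close> for \<open>z \<le> x\<close> by \<open>ladder_U_quotient\<close>, hence \<open>V\<close> is at least quadratic and \<open>K\<close> at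
least logarithmic on \<open>[1, x]\<close>; then the product bound limits \<open>U x\<close>. The constant is \<open>sqrt 48\<close>, rounded up.\<close>

lemma ladder_U_upper:
  assumes "1 < x" shows "ladder_U x \<le> 7 * x / sqrt (ln x)"
proof -
  have ln: "0 < ln x" using assms by simp
  define c where "c = ladder_U x / (2 * x)"
  have c: "0 \<le> c" using assms by (simp add: c_def)
  have V: "c / 2 * y\<^sup>2 \<le> ladder_V y" if "0 \<le> y" "y \<le> x" for y
  proof -
    have "((\<lambda>z. c * z) has_integral (c / 2 * y\<^sup>2 - c / 2 * 0\<^sup>2)) {0..y}"
      using that(1) by (intro fundamental_theorem_of_calculus)
        (auto intro!: derivative_eq_intros simp: has_real_derivative_iff_has_vector_derivative[symmetric])
    hence "((\<lambda>z. c * z) has_integral (c / 2 * y\<^sup>2)) {0..y}" by simp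
    moreover have "(ladder_U has_integral ladder_V y) {0..y}"
      unfolding ladder_V_def by (intro integrable_integral ladder_U_integrable) simp
    moreover have "c * z \<le> ladder_U z" if "z \<in> {0..y}" for z
    proof (cases "z = 0")
      case False
      thus ?thesis using ladder_U_quotient[of z x] that \<open>y \<le> x\<close> assms by (auto simp: c_def field_simps)
    qed simp
    ultimately show ?thesis by (rule has_integral_le)
  qed
  have "((\<lambda>y. c / 12 * (1 / y)) has_integral (c / 12 * ln x - c / 12 * ln 1)) {1..x}"
    using assms by (intro fundamental_theorem_of_calculus)
      (auto intro!: derivative_eq_intros simp: has_real_derivative_iff_has_vector_derivative[symmetric])
  hence "((\<lambda>y. c / 12 * (1 / y)) has_integral (c / 12 * ln x)) {1..x}" by simp
  moreover have "((\<lambda>y. jump y * ladder_V (1 * y)) has_integral integral {1..x} (\<lambda>y. jump y * ladder_V (1 * y))) {1..x}"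
    by (intro integrable_integral ladder_K_integrable) auto
  moreover have "c / 12 * (1 / y) \<le> jump y * ladder_V (1 * y)" if "y \<in> {1..x}" for y
  proof -
    have "c / 12 * (1 / y) = 1 / (6 * y ^ 3) * (c / 2 * y\<^sup>2)" using that by (simp add: power2_eq_square power3_eq_cube)
    also have "\<dots> \<le> jump y * ladder_V y" using that c by (intro mult_mono jump_lower V) auto
    finally show ?thesis by simp
  qed
  ultimately have "c / 12 * ln x \<le> integral {1..x} (\<lambda>y. jump y * ladder_V (1 * y))" by (rule has_integral_le)
  also have "\<dots> \<le> ladder_K 1 x"
    unfolding ladder_K_def by (intro integral_subset_le ladder_K_integrable) auto
  finally have "ladder_U x * (c / 12 * ln x) \<le> ladder_U x * ladder_K 1 x" by (intro mult_left_mono) auto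
  also have "\<dots> \<le> 2 * x" using assms by (intro ladder_UK_le) auto
  finally have "(ladder_U x)\<^sup>2 * ln x \<le> 48 * x\<^sup>2" using assms by (simp add: c_def field_simps power2_eq_square)
  moreover have "48 * x\<^sup>2 \<le> 49 * x\<^sup>2" by simp
  ultimately have "(ladder_U x)\<^sup>2 * ln x \<le> 49 * x\<^sup>2" by (rule order_trans)
  hence "(ladder_U x)\<^sup>2 \<le> 49 * x\<^sup>2 / ln x" unfolding pos_le_divide_eq[OF ln] .
  also have "\<dots> = (7 * x / sqrt (ln x))\<^sup>2" using ln by (simp add: power_divide power_mult_distrib)
  finally have "(ladder_U x)\<^sup>2 \<le> (7 * x / sqrt (ln x))\<^sup>2" .
  thus ?thesis by (rule power2_le_imp_le) (use assms ln in simp)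
qed

section \<open>Averaging over the starting point\<close>

text \<open>Even and odd contributions are each close at \<open>s\<close> and \<open>s'\<close>; the odd one is compared through the even one, which is
why the error is split into four parts.\<close>

lemma hit_smooth:
  fixes \<eta> :: real assumes "0 < \<eta>"
  obtains \<epsilon> s0 where "0 < \<epsilon>" "\<epsilon> \<le> 1 / 2" "1 \<le> s0"
    "\<And>s s' W w. s0 \<le> s \<Longrightarrow> \<bar>s - s'\<bar> \<le> \<epsilon> * s \<Longrightarrow> W \<in> sets borel \<Longrightarrow> W \<subseteq> {0<..} \<Longrightarrow> w \<le> 1 \<Longrightarrow>
       hit W w s \<le> hit W w s' + ennreal \<eta> \<and> hit W w s' \<le> hit W w s + ennreal \<eta>"
proof -
  have e: "0 < \<eta> / 4" using assms by simp
  obtain \<epsilon> s1 where \<epsilon>: "0 < \<epsilon>" "\<epsilon> \<le> 1 / 2" "1 \<le> s1" and sm: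
    "\<And>s s' \<psi>. s1 \<le> s \<Longrightarrow> \<bar>s - s'\<bar> \<le> \<epsilon> * s \<Longrightarrow> \<psi> \<in> borel_measurable borel \<Longrightarrow>
       (\<And>y. 0 \<le> y \<Longrightarrow> \<psi> y \<le> exit_mass 0 y) \<Longrightarrow>
       even_sum \<psi> s \<le> even_sum \<psi> s' + ennreal (\<eta>/4) \<and> even_sum \<psi> s' \<le> even_sum \<psi> s + ennreal (\<eta>/4)"
    using even_sum_smooth[OF e] by blast
  obtain s2 where s2: "0 \<le> s2" and par:
    "\<And>s \<psi>. s2 \<le> s \<Longrightarrow> \<psi> \<in> borel_measurable borel \<Longrightarrow> (\<And>y. 0 \<le> y \<Longrightarrow> \<psi> y \<le> exit_mass 0 y) \<Longrightarrow>
       even_sum (kill_step \<psi>) s \<le> even_sum \<psi> s + ennreal (\<eta>/4) \<and> even_sum \<psi> s \<le> even_sum (kill_step \<psi>) s + ennreal (\<eta>/4)"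
    using parity_balance[OF e] by blast
  define s0 where "s0 = max s1 (2 * s2)"
  have "hit W w s \<le> hit W w s' + ennreal \<eta> \<and> hit W w s' \<le> hit W w s + ennreal \<eta>"
    if s: "s0 \<le> s" "\<bar>s - s'\<bar> \<le> \<epsilon> * s" and [measurable]: "W \<in> sets borel" and W: "W \<subseteq> {0<..}" "w \<le> 1" for s s' W w
  proof -
    define \<psi> where "\<psi> = exit_profile W w"
    have [measurable]: "\<psi> \<in> borel_measurable borel" unfolding \<psi>_def by measurable
    have \<psi>: "\<psi> y \<le> exit_mass 0 y" for y unfolding \<psi>_def by (rule exit_profile_le) (use W in auto)
    have ss: "s1 \<le> s" "2 * s2 \<le> s" using s by (auto simp: s0_def)
    have "0 \<le> s" using ss s2 by linarith
    hence "\<epsilon> * s \<le> 1 / 2 * s" using \<epsilon> by (intro mult_right_mono) auto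
    hence s': "s2 \<le> s'" "s2 \<le> s" using ss s(2) s2 by linarith+
    let ?q = "ennreal (\<eta>/4)"
    have q4: "?q + ?q + ?q + ?q = ennreal \<eta>"
    proof -
      have "ennreal \<eta> = ennreal (\<eta>/4 + \<eta>/4 + \<eta>/4 + \<eta>/4)" by simp
      also have "\<dots> = ?q + ?q + ?q + ?q" using e by (simp only: ennreal_plus add_nonneg_nonneg less_imp_le)
      finally show ?thesis by simp
    qed
    have "even_sum \<psi> s \<le> even_sum \<psi> s' + ?q" "even_sum \<psi> s' \<le> even_sum \<psi> s + ?q"
      using sm[OF ss(1) s(2), of \<psi>] \<psi> by auto
    moreover have "even_sum (kill_step \<psi>) t \<le> even_sum \<psi> t + ?q" "even_sum \<psi> t \<le> even_sum (kill_step \<psi>) t + ?q"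
      if "t = s \<or> t = s'" for t
      using par[of t \<psi>] \<psi> s' that by auto
    note p = this[of s] this[of s']
    have chain: "A + B \<le> A' + B' + ennreal \<eta>"
      if "A \<le> A' + ?q" "B \<le> A + ?q" "A' \<le> B' + ?q" for A B A' B' :: ennreal
    proof -
      have "B \<le> A + ?q" by fact
      also have "\<dots> \<le> A' + ?q + ?q" using that(1) by (rule add_right_mono)
      also have "\<dots> \<le> B' + ?q + ?q + ?q" using that(3) by (intro add_right_mono)
      finally have "A + B \<le> (A' + ?q) + (B' + ?q + ?q + ?q)" using that(1) by (rule add_mono[rotated])
      also have "\<dots> = A' + B' + (?q + ?q + ?q + ?q)" by (simp add: add_ac)
      finally show ?thesis by (simp only: q4)
    qed
    have "hit W w t = even_sum \<psi> t + even_sum (kill_step \<psi>) t" for t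
      unfolding \<psi>_def by (rule hit_even_odd) simp
    thus ?thesis using chain calculation p by (simp only: simp_thms)
  qed
  moreover have "1 \<le> s0" using \<epsilon>(3) by (simp add: s0_def)
  ultimately show thesis using that \<epsilon> by blast
qed

lemma renewal_increment:
  assumes "0 \<le> c" "c \<le> d"
  shows "(\<integral>\<^sup>+y. indicator {c..d} y * renewal_density y \<partial>lborel) = ennreal (ladder_U d - ladder_U c)"
proof -
  have "ennreal (ladder_U c) + (\<integral>\<^sup>+y. indicator {c..d} y * renewal_density y \<partial>lborel) = ennreal (ladder_U c + (ladder_U d - ladder_U c))"
    using renewal_mass_add[OF assms] by (simp add: renewal_mass_eq)
  also have "\<dots> = ennreal (ladder_U c) + ennreal (ladder_U d - ladder_U c)"
    using ladder_U_mono[OF assms(2)] by (intro ennreal_plus) auto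
  finally show ?thesis by (simp add: ennreal_add_left_cancel)
qed

text \<open>A bound for \<open>f * V * U\<close>, the density of the error in the window average.\<close>

definition window_const :: real where "window_const = 2 * (ladder_U 1)\<^sup>2"

text \<open>The density decays like the inverse cube, \<open>V\<close> grows at most quadratically and \<open>U\<close> at most linearly.\<close>

lemma window_const_bound:
  assumes "0 < x" shows "jump x * (ladder_V x * ladder_U x) \<le> window_const"
proof (cases "x \<le> 1")
  case True
  have "jump x * (ladder_V x * ladder_U x) \<le> 1 / 2 * ((1 * ladder_U 1) * ladder_U 1)"
  proof (intro mult_mono jump_le_half)
    have "ladder_V x \<le> x * ladder_U x" using assms by (intro ladder_V_le) simp
    also have "\<dots> \<le> 1 * ladder_U 1" using True assms by (intro mult_mono ladder_U_mono) auto
    finally show "ladder_V x \<le> 1 * ladder_U 1" .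
  qed (use True in \<open>auto intro: ladder_U_mono\<close>)
  also have "\<dots> \<le> window_const" using ladder_U_nonneg[of 1] by (simp add: window_const_def power2_eq_square)
  finally show ?thesis .
next
  case False
  have U: "ladder_U x \<le> 2 * x * ladder_U 1" using ladder_U_quotient[of 1 x] False by simp
  have "jump x * (ladder_V x * ladder_U x) \<le> 1 / (2 * x ^ 3) * ((x * (2 * x * ladder_U 1)) * (2 * x * ladder_U 1))"
  proof (intro mult_mono jump_upper U)
    have "ladder_V x \<le> x * ladder_U x" using assms by (intro ladder_V_le) simp
    also have "\<dots> \<le> x * (2 * x * ladder_U 1)" using U assms by (intro mult_left_mono) auto
    finally show "ladder_V x \<le> x * (2 * x * ladder_U 1)" .
  qed (use assms in auto)
  also have "\<dots> = window_const" using assms by (simp add: window_const_def power2_eq_square power3_eq_cube)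
  finally show ?thesis .
qed

text \<open>In \<open>occupation_window\<close> the increment of \<open>U\<close> is taken over the window shifted by \<open>z \<le> y\<close>. By subadditivity and monotonicity, the
shift changes it by at most \<open>U y\<close>.\<close>

lemma occupation_window_bounds:
  assumes "0 \<le> y" "y < c" "c \<le> d"
  defines "D \<equiv> ladder_U d - ladder_U c"
  shows "(\<integral>\<^sup>+s. indicator {c..d} s * occupation s y \<partial>lborel) \<le> ennreal (ladder_V y * (D + ladder_U y))"
    and "ennreal (ladder_V y * D) \<le> (\<integral>\<^sup>+s. indicator {c..d} s * occupation s y \<partial>lborel) + ennreal (ladder_V y * ladder_U y)"
proof -
  let ?O = "\<integral>\<^sup>+s. indicator {c..d} s * occupation s y \<partial>lborel"
  define I where "I z = ladder_U (d - z) - ladder_U (c - z)" for z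
  have D0: "0 \<le> D" using assms ladder_U_mono[of c d] by simp
  have I: "0 \<le> I z" "I z \<le> D + ladder_U y" "D \<le> I z + ladder_U y" if "0 \<le> z" "z \<le> y" for z
  proof -
    have "ladder_U c \<le> ladder_U (c - z) + ladder_U z" "ladder_U d \<le> ladder_U (d - z) + ladder_U z"
      using ladder_U_subadditive[of "c - z" z] ladder_U_subadditive[of "d - z" z] that assms by auto
    moreover have "ladder_U z \<le> ladder_U y" "ladder_U (d - z) \<le> ladder_U d" "ladder_U (c - z) \<le> ladder_U c"
      "ladder_U (c - z) \<le> ladder_U (d - z)"
      using that assms by (auto intro: ladder_U_mono)
    ultimately show "0 \<le> I z" "I z \<le> D + ladder_U y" "D \<le> I z + ladder_U y" by (auto simp: I_def D_def)
  qed
  have O: "?O = (\<integral>\<^sup>+z. indicator {0..y} z * renewal_mass (y - z) * ennreal (I z) \<partial>lborel)"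
    unfolding occupation_window[OF assms(1,2)]
  proof (intro nn_integral_cong)
    fix z
    show "indicator {0..y} z * renewal_mass (y - z) * (\<integral>\<^sup>+y. indicator {c - z..d - z} y * renewal_density y \<partial>lborel) =
      indicator {0..y} z * renewal_mass (y - z) * ennreal (I z)"
      using assms by (cases "z \<in> {0..y}") (auto simp: renewal_increment I_def)
  qed
  have [measurable]: "I \<in> borel_measurable borel" unfolding I_def[abs_def] by measurable
  have V: "(\<integral>\<^sup>+z. indicator {0..y} z * renewal_mass (y - z) * ennreal q \<partial>lborel) = ennreal (ladder_V y * q)" for q
    by (subst nn_integral_multc) (auto simp: renewal_mass_integral_reflect renewal_mass_integral_eq ennreal_mult')
  have "?O \<le> (\<integral>\<^sup>+z. indicator {0..y} z * renewal_mass (y - z) * ennreal (D + ladder_U y) \<partial>lborel)"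
    unfolding O
  proof (intro nn_integral_mono)
    fix z
    show "indicator {0..y} z * renewal_mass (y - z) * ennreal (I z) \<le> indicator {0..y} z * renewal_mass (y - z) * ennreal (D + ladder_U y)"
      using I[of z] by (cases "z \<in> {0..y}") (auto intro!: mult_left_mono ennreal_leI)
  qed
  thus "?O \<le> ennreal (ladder_V y * (D + ladder_U y))" unfolding V .
  have "ennreal (ladder_V y * D) = (\<integral>\<^sup>+z. indicator {0..y} z * renewal_mass (y - z) * ennreal D \<partial>lborel)" unfolding V ..
  also have "\<dots> \<le> (\<integral>\<^sup>+z. indicator {0..y} z * renewal_mass (y - z) * ennreal (I z) +
      indicator {0..y} z * renewal_mass (y - z) * ennreal (ladder_U y) \<partial>lborel)"
  proof (intro nn_integral_mono)
    fix z
    have "ennreal D \<le> ennreal (I z) + ennreal (ladder_U y)" if "0 \<le> z" "z \<le> y"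
      using ennreal_leI[OF I(3)[OF that]] ennreal_plus[OF I(1)[OF that] ladder_U_nonneg[of y]] by simp
    hence "renewal_mass (y - z) * ennreal D \<le> renewal_mass (y - z) * (ennreal (I z) + ennreal (ladder_U y))" if "0 \<le> z" "z \<le> y"
      using that by (intro mult_left_mono) auto
    thus "indicator {0..y} z * renewal_mass (y - z) * ennreal D \<le> indicator {0..y} z * renewal_mass (y - z) * ennreal (I z) +
      indicator {0..y} z * renewal_mass (y - z) * ennreal (ladder_U y)"
      by (cases "z \<in> {0..y}") (auto simp: distrib_left)
  qed
  also have "\<dots> = ?O + ennreal (ladder_V y * ladder_U y)"
    unfolding O V[symmetric] by (rule nn_integral_add) simp_all
  finally show "ennreal (ladder_V y * D) \<le> ?O + ennreal (ladder_V y * ladder_U y)" .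
qed

text \<open>The probability that the last displacement is at most \<open>T\<close> and that the distance before it is at most \<open>w\<close> times
this displacement.\<close>

definition exit_prob :: "real \<Rightarrow> real \<Rightarrow> real \<Rightarrow> real" where
  "exit_prob w T s = enn2real (hit {0<..T} w s)"

lemma hit_eq_exit_prob:
  assumes "0 \<le> s" "w \<le> 1" shows "hit {0<..T} w s = ennreal (exit_prob w T s)"
  using hit_le_1[of "{0<..T}" s w, OF _ greaterThanAtMost_subset_greaterThan] assms
  unfolding exit_prob_def by (subst ennreal_enn2real) (auto simp: less_top[symmetric] top_unique)

lemma exit_prob_nonneg [simp]: "0 \<le> exit_prob w T s"
  by (simp add: exit_prob_def)

text \<open>The product formula. The hypothesis \<open>sm\<close> says that the probability is almost constant on the window, so it
agrees with its average there, which \<open>occupation_window_bounds\<close> evaluates.\<close>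

lemma window_average:
  assumes w: "0 \<le> w" "w \<le> 1" and T: "0 \<le> T" "T < c" and cd: "c < d" and "0 \<le> \<eta>" "0 \<le> s"
    and sm: "\<And>s'. c \<le> s' \<Longrightarrow> s' \<le> d \<Longrightarrow> hit {0<..T} w s \<le> hit {0<..T} w s' + ennreal \<eta> \<and> hit {0<..T} w s' \<le> hit {0<..T} w s + ennreal \<eta>"
  shows "\<bar>exit_prob w T s - (ladder_U d - ladder_U c) / (d - c) * ladder_K w T\<bar> \<le> \<eta> + window_const * T / (d - c)"
proof -
  define D where "D = ladder_U d - ladder_U c"
  have D0: "0 \<le> D" using cd ladder_U_mono[of c d] by (simp add: D_def)
  let ?r = "exit_prob w T s"
  let ?W = "\<integral>\<^sup>+s. indicator {c..d} s * hit {0<..T} w s \<partial>lborel"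
  let ?m = "\<lambda>x. indicator {0<..T} x * ennreal (jump x)"
  let ?O = "\<lambda>x. \<integral>\<^sup>+s. indicator {c..d} s * occupation s (w * x) \<partial>lborel"
  have c0: "0 \<le> c" using T by linarith
  have [measurable]: "renewal_mass_integral \<in> borel_measurable borel"
    unfolding renewal_mass_integral_def[abs_def] by measurable
  have W: "?W = (\<integral>\<^sup>+x. ?m x * ?O x \<partial>lborel)" by (rule occupation_hit_swap) (use c0 in auto)
  have wx: "0 \<le> w * x" "w * x \<le> x" "w * x < c" if "0 < x" "x \<le> T" for x
  proof -
    show "w * x \<le> x" using w that by (simp add: mult_left_le_one_le)
    thus "w * x < c" using that T by linarith
  qed (use w that in auto)
  have err: "(\<integral>\<^sup>+x. ?m x * ennreal (ladder_V (w * x) * ladder_U (w * x)) \<partial>lborel) \<le> ennreal (window_const * T)"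
  proof -
    have "(\<integral>\<^sup>+x. ?m x * ennreal (ladder_V (w * x) * ladder_U (w * x)) \<partial>lborel) \<le> (\<integral>\<^sup>+x. ennreal window_const * indicator {0<..T} x \<partial>lborel)"
    proof (intro nn_integral_mono)
      fix x
      have "jump x * (ladder_V (w * x) * ladder_U (w * x)) \<le> window_const" if "0 < x" "x \<le> T"
      proof -
        have "jump x * (ladder_V (w * x) * ladder_U (w * x)) \<le> jump x * (ladder_V x * ladder_U x)"
          using wx[OF that] by (intro mult_left_mono mult_mono ladder_V_mono ladder_U_mono) auto
        thus ?thesis using window_const_bound[OF that(1)] by linarith
      qed
      thus "?m x * ennreal (ladder_V (w * x) * ladder_U (w * x)) \<le> ennreal window_const * indicator {0<..T} x"
        by (cases "x \<in> {0<..T}") (auto simp: ennreal_mult'[symmetric] intro!: ennreal_leI)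
    qed
    also have "\<dots> = ennreal window_const * ennreal T" using T by (subst nn_integral_cmult_indicator) auto
    also have "\<dots> = ennreal (window_const * T)" using T by (intro ennreal_mult'[symmetric]) (simp add: window_const_def)
    finally show ?thesis .
  qed
  have KD: "(\<integral>\<^sup>+x. ?m x * ennreal (ladder_V (w * x) * D) \<partial>lborel) = ennreal (D * ladder_K w T)"
  proof -
    have "(\<integral>\<^sup>+x. ?m x * ennreal (ladder_V (w * x) * D) \<partial>lborel) = (\<integral>\<^sup>+x. ?m x * renewal_mass_integral (w * x) * ennreal D \<partial>lborel)"
      using D0 by (intro nn_integral_cong) (simp add: renewal_mass_integral_eq ennreal_mult' mult.assoc)
    also have "\<dots> = (\<integral>\<^sup>+x. ?m x * renewal_mass_integral (w * x) \<partial>lborel) * ennreal D"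
      by (rule nn_integral_multc) simp
    also have "\<dots> = ennreal (ladder_K w T) * ennreal D" by (simp only: nn_integral_ladder_K[OF w(1)])
    also have "\<dots> = ennreal (D * ladder_K w T)" using D0 by (simp add: ennreal_mult' mult.commute)
    finally show ?thesis .
  qed
  have wc: "0 \<le> window_const * T" using T by (simp add: window_const_def)
  have "?W \<le> (\<integral>\<^sup>+x. ?m x * ennreal (ladder_V (w * x) * D) + ?m x * ennreal (ladder_V (w * x) * ladder_U (w * x)) \<partial>lborel)"
    unfolding W
  proof (intro nn_integral_mono)
    fix x
    have "?O x \<le> ennreal (ladder_V (w * x) * D) + ennreal (ladder_V (w * x) * ladder_U (w * x))" if "0 < x" "x \<le> T"
      using occupation_window_bounds(1)[OF wx(1,3)[OF that], of d] cd D0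
      by (subst ennreal_plus[symmetric]) (auto simp: D_def[symmetric] distrib_left)
    thus "?m x * ?O x \<le> ?m x * ennreal (ladder_V (w * x) * D) + ?m x * ennreal (ladder_V (w * x) * ladder_U (w * x))"
      by (cases "x \<in> {0<..T}") (auto simp: distrib_left[symmetric] intro!: mult_left_mono)
  qed
  also have "\<dots> = ennreal (D * ladder_K w T) + (\<integral>\<^sup>+x. ?m x * ennreal (ladder_V (w * x) * ladder_U (w * x)) \<partial>lborel)"
    unfolding KD[symmetric] by (rule nn_integral_add) simp_all
  also have "\<dots> \<le> ennreal (D * ladder_K w T) + ennreal (window_const * T)" using err by (rule add_left_mono)
  finally have up: "?W \<le> ennreal (D * ladder_K w T + window_const * T)"
    using w D0 wc by (subst ennreal_plus) auto
  have "ennreal (D * ladder_K w T) \<le> (\<integral>\<^sup>+x. ?m x * ?O x + ?m x * ennreal (ladder_V (w * x) * ladder_U (w * x)) \<partial>lborel)"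
    unfolding KD[symmetric]
  proof (intro nn_integral_mono)
    fix x
    have "ennreal (ladder_V (w * x) * D) \<le> ?O x + ennreal (ladder_V (w * x) * ladder_U (w * x))" if "0 < x" "x \<le> T"
      using occupation_window_bounds(2)[OF wx(1,3)[OF that], of d] cd by (simp add: D_def)
    thus "?m x * ennreal (ladder_V (w * x) * D) \<le> ?m x * ?O x + ?m x * ennreal (ladder_V (w * x) * ladder_U (w * x))"
      by (cases "x \<in> {0<..T}") (auto simp: distrib_left[symmetric] intro!: mult_left_mono)
  qed
  also have "\<dots> = ?W + (\<integral>\<^sup>+x. ?m x * ennreal (ladder_V (w * x) * ladder_U (w * x)) \<partial>lborel)"
    unfolding W by (rule nn_integral_add) simp_all
  also have "\<dots> \<le> ?W + ennreal (window_const * T)" using err by (rule add_left_mono)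
  finally have lo: "ennreal (D * ladder_K w T) \<le> ?W + ennreal (window_const * T)" .
  have const: "(\<integral>\<^sup>+s. indicator {c..d} s * ennreal q \<partial>lborel) = ennreal ((d - c) * q)" for q
    using cd by (subst nn_integral_multc) (auto simp: ennreal_mult')
  have rs: "hit {0<..T} w s = ennreal ?r" using assms by (intro hit_eq_exit_prob)
  have "ennreal ((d - c) * ?r) \<le> (\<integral>\<^sup>+s. indicator {c..d} s * hit {0<..T} w s + indicator {c..d} s * ennreal \<eta> \<partial>lborel)"
    unfolding const[symmetric]
  proof (intro nn_integral_mono)
    fix s' show "indicator {c..d} s' * ennreal ?r \<le> indicator {c..d} s' * hit {0<..T} w s' + indicator {c..d} s' * ennreal \<eta>"
      using sm[of s'] unfolding rs by (cases "s' \<in> {c..d}") auto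
  qed
  also have "\<dots> = ?W + ennreal ((d - c) * \<eta>)" unfolding const[symmetric] by (rule nn_integral_add) simp_all
  also have "\<dots> \<le> ennreal (D * ladder_K w T + window_const * T) + ennreal ((d - c) * \<eta>)" using up by (rule add_right_mono)
  also have "\<dots> = ennreal (D * ladder_K w T + window_const * T + (d - c) * \<eta>)"
    using w D0 wc cd \<open>0 \<le> \<eta>\<close> by (intro ennreal_plus[symmetric]) auto
  finally have "(d - c) * ?r \<le> D * ladder_K w T + window_const * T + (d - c) * \<eta>"
    using w D0 wc cd \<open>0 \<le> \<eta>\<close> by (subst (asm) ennreal_le_iff) auto
  moreover have "r \<le> D / q * K + (\<eta> + X / q)" if "q * r \<le> D * K + X + q * \<eta>" "0 < q" for q r K X
    using that by (simp add: field_simps)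
  ultimately have A: "?r \<le> D / (d - c) * ladder_K w T + (\<eta> + window_const * T / (d - c))"
    using cd by simp
  have "?W \<le> (\<integral>\<^sup>+s'. indicator {c..d} s' * ennreal (?r + \<eta>) \<partial>lborel)"
  proof (intro nn_integral_mono)
    fix s' show "indicator {c..d} s' * hit {0<..T} w s' \<le> indicator {c..d} s' * ennreal (?r + \<eta>)"
      using sm[of s'] \<open>0 \<le> \<eta>\<close> unfolding rs by (cases "s' \<in> {c..d}") auto
  qed
  hence "ennreal (D * ladder_K w T) \<le> ennreal ((d - c) * (?r + \<eta>)) + ennreal (window_const * T)"
    unfolding const using lo by (meson add_right_mono order_trans)
  also have "\<dots> = ennreal ((d - c) * (?r + \<eta>) + window_const * T)"
    using wc cd \<open>0 \<le> \<eta>\<close> by (intro ennreal_plus[symmetric]) auto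
  finally have "D * ladder_K w T \<le> (d - c) * (?r + \<eta>) + window_const * T"
    using wc cd \<open>0 \<le> \<eta>\<close> by (subst (asm) ennreal_le_iff) auto
  moreover have "D / q * K \<le> r + (\<eta> + X / q)" if "D * K \<le> q * (r + \<eta>) + X" "0 < q" for q r K X
    using that by (simp add: field_simps)
  ultimately have B: "D / (d - c) * ladder_K w T \<le> ?r + (\<eta> + window_const * T / (d - c))"
    using cd by simp
  show ?thesis using A B unfolding D_def[symmetric] by (simp add: abs_le_iff)
qed

text \<open>Displacements between \<open>T\<close> and \<open>s\<close> contribute at most \<open>f x * (U x)\<^sup>2\<close>, of order \<open>1 / (x ln T)\<close>. Longer ones contribute
at most \<open>f x * U x * U s\<close>, of order \<open>s / (x\<^sup>2 ln s)\<close>, with total mass of order \<open>1 / ln s\<close>. The constant \<open>25\<close> is \<open>49 / 2\<close>, rounded up.\<close>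

lemma exit_prob_tail:
  assumes "2 \<le> T" "T \<le> s"
  shows "1 - exit_prob 1 T s \<le> 25 * ln (s / T) / ln T + 25 / ln s"
proof -
  let ?m = "\<lambda>x. indicator {T<..} x * ennreal (jump x)"
  have lnT: "0 < ln T" "ln T \<le> ln s" "0 < ln s" using assms by auto
  have s0: "0 \<le> s" "0 < s" using assms by auto
  have "hit {T<..} 1 s = (\<integral>\<^sup>+x. ?m x * occupation s (1 * x) \<partial>lborel)" by (rule hit_eq) (use s0 in auto)
  also have "\<dots> \<le> (\<integral>\<^sup>+x. ennreal (25 / ln T) * (ennreal (1 / x) * indicator {T..s} x) +
       ennreal (25 * s / ln s) * (ennreal (1 / x\<^sup>2) * indicator {s..} x) \<partial>lborel)"
  proof (intro nn_integral_mono)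
    fix x
    show "?m x * occupation s (1 * x) \<le> ennreal (25 / ln T) * (ennreal (1 / x) * indicator {T..s} x) +
       ennreal (25 * s / ln s) * (ennreal (1 / x\<^sup>2) * indicator {s..} x)"
    proof (cases "T < x")
      case T: True
      hence x: "1 < x" "0 < x" using assms by auto
      have U: "ladder_U y \<le> 7 * y / sqrt (ln z)" if "1 < z" "z \<le> y" for y z
      proof -
        have "ladder_U y \<le> 7 * y / sqrt (ln y)" using that by (intro ladder_U_upper) auto
        also have "\<dots> \<le> 7 * y / sqrt (ln z)" using that by (intro divide_left_mono) auto
        finally show ?thesis .
      qed
      show ?thesis
      proof (cases "x < s")
        case True
        have "jump x * (ladder_U x * ladder_U x) \<le> 1 / (2 * x ^ 3) * ((7 * x / sqrt (ln T)) * (7 * x / sqrt (ln T)))"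
          using U[of T x] T assms x lnT by (intro mult_mono jump_upper) auto
        also have "\<dots> = 49 / (2 * ln T) * (1 / x)" using x lnT by (simp add: power3_eq_cube)
        also have "\<dots> \<le> 25 / ln T * (1 / x)" using x lnT by (intro mult_right_mono) (auto simp: field_simps)
        finally have "ennreal (jump x * (ladder_U x * ladder_U x)) \<le> ennreal (25 / ln T) * ennreal (1 / x)"
          using x lnT by (subst ennreal_mult'[symmetric]) (auto intro!: ennreal_leI)
        moreover have "occupation s x \<le> ennreal (ladder_U x * ladder_U x)"
          using occupation_le_square[of x s] True x by (simp add: renewal_mass_eq ennreal_mult')
        hence "ennreal (jump x) * occupation s x \<le> ennreal (jump x * (ladder_U x * ladder_U x))"
          by (simp add: ennreal_mult' mult_left_mono)
        ultimately have "ennreal (jump x) * occupation s x \<le> ennreal (25 / ln T) * ennreal (1 / x)" by (rule order_trans[rotated])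
        thus ?thesis using True T by (simp add: indicator_def)
      next
        case False
        have "jump x * (ladder_U x * ladder_U s) \<le> 1 / (2 * x ^ 3) * ((7 * x / sqrt (ln s)) * (7 * s / sqrt (ln s)))"
          using U[of s x] U[of s s] False assms x lnT by (intro mult_mono jump_upper) auto
        also have "\<dots> = 49 * s / (2 * ln s) * (1 / x\<^sup>2)" using x lnT s0 by (simp add: power3_eq_cube power2_eq_square)
        also have "49 * s / (2 * ln s) = (49 / 2 * s) / ln s" by simp
        also have "(49 / 2 * s) / ln s * (1 / x\<^sup>2) \<le> 25 * s / ln s * (1 / x\<^sup>2)"
          using x lnT s0 by (intro mult_right_mono divide_right_mono) auto
        finally have "ennreal (jump x * (ladder_U x * ladder_U s)) \<le> ennreal (25 * s / ln s) * ennreal (1 / x\<^sup>2)"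
          using x lnT s0 by (subst ennreal_mult'[symmetric]) (auto intro!: ennreal_leI)
        moreover have "occupation s x \<le> ennreal (ladder_U x * ladder_U s)"
          using occupation_le_mult[of s x] s0 x by (simp add: renewal_mass_eq ennreal_mult')
        hence "ennreal (jump x) * occupation s x \<le> ennreal (jump x * (ladder_U x * ladder_U s))"
          by (simp add: ennreal_mult' mult_left_mono)
        ultimately have *: "ennreal (jump x) * occupation s x \<le> ennreal (25 * s / ln s) * ennreal (1 / x\<^sup>2)" by (rule order_trans[rotated])
        have "?m x * occupation s (1 * x) \<le> ennreal (25 * s / ln s) * (ennreal (1 / x\<^sup>2) * indicator {s..} x)"
          using False T * by (simp add: indicator_def)
        thus ?thesis by (rule order_trans) simp
      qed
    qed simp
  qed
  also have "\<dots> = ennreal (25 / ln T) * ennreal (ln (s / T)) + ennreal (25 * s / ln s) * ennreal (1 / s)"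
  proof -
    have "(\<integral>\<^sup>+x. ennreal (1 / x\<^sup>2) * indicator {s..} x \<partial>lborel) = ennreal (0 - (- (1 / s)))"
    proof (rule nn_integral_FTC_atLeast)
      fix x assume "s \<le> x"
      hence "0 < x" using s0 by linarith
      thus "DERIV (\<lambda>x. - (1 / x)) x :> 1 / x\<^sup>2" by (auto intro!: derivative_eq_intros simp: power2_eq_square)
    next
      show "((\<lambda>x::real. - (1 / x)) \<longlongrightarrow> 0) at_top" by real_asymp
    qed auto
    moreover have "(\<integral>\<^sup>+x. ennreal (1 / x) * indicator {T..s} x \<partial>lborel) = ennreal (ln (s / T))"
      using assms by (intro nn_integral_inverse_Icc) auto
    ultimately show ?thesis
      by (subst nn_integral_add, simp, simp, subst (1 2) nn_integral_cmult) simp_all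
  qed
  also have "\<dots> = ennreal (25 / ln T * ln (s / T) + 25 / ln s)"
  proof -
    have "ennreal (25 / ln T) * ennreal (ln (s / T)) = ennreal (25 / ln T * ln (s / T))"
      by (rule ennreal_mult'[symmetric]) (use lnT in simp)
    moreover have "ennreal (25 * s / ln s) * ennreal (1 / s) = ennreal (25 * s / ln s * (1 / s))"
      by (rule ennreal_mult'[symmetric]) (use lnT s0 in simp)
    moreover have "25 * s / ln s * (1 / s) = 25 / ln s" using s0 by simp
    moreover have "ennreal (25 / ln T * ln (s / T) + 25 / ln s) = ennreal (25 / ln T * ln (s / T)) + ennreal (25 / ln s)"
      using lnT assms by (intro ennreal_plus mult_nonneg_nonneg) auto
    ultimately show ?thesis by (simp only:)
  qed
  finally have tail: "hit {T<..} 1 s \<le> ennreal (25 / ln T * ln (s / T) + 25 / ln s)" .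
  have split: "{0<..} = {0<..T} \<union> {T<..}" using assms by auto
  have "hit ({0<..T} \<union> {T<..}) 1 s = hit {0<..T} 1 s + hit {T<..} 1 s"
    by (rule hit_Un) (use s0 in auto)
  hence "1 = hit {0<..T} 1 s + hit {T<..} 1 s"
    unfolding split[symmetric] hit_total[OF s0(1)] .
  also have "\<dots> \<le> ennreal (exit_prob 1 T s) + ennreal (25 / ln T * ln (s / T) + 25 / ln s)"
    unfolding hit_eq_exit_prob[OF s0(1) order_refl] using tail by (rule add_left_mono)
  also have "\<dots> = ennreal (exit_prob 1 T s + (25 / ln T * ln (s / T) + 25 / ln s))"
    using lnT assms by (intro ennreal_plus[symmetric]) auto
  finally have "1 \<le> exit_prob 1 T s + (25 / ln T * ln (s / T) + 25 / ln s)"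
    by (simp add: ennreal_ge_1)
  thus ?thesis by simp
qed

section \<open>Asymptotics of the renewal function\<close>

abbreviation "ladder_k \<equiv> ladder_K 1"

text \<open>The average slope of \<open>U\<close> over the window \<open>[(1 - \<epsilon>) s, s]\<close>, the factor called \<open>\<kappa>\<close> in the introduction.\<close>

definition renewal_rate :: "real \<Rightarrow> real \<Rightarrow> real" where
  "renewal_rate \<epsilon> s = (ladder_U s - ladder_U ((1 - \<epsilon>) * s)) / (\<epsilon> * s)"

lemma jump_ladder_V_le:
  assumes "1 < x" shows "jump x * ladder_V x \<le> 7 / (2 * x * sqrt (ln x))"
proof -
  have "jump x * ladder_V x \<le> 1 / (2 * x ^ 3) * (x * (7 * x / sqrt (ln x)))"
  proof (intro mult_mono jump_upper)
    have "ladder_V x \<le> x * ladder_U x" using assms by (intro ladder_V_le) simp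
    also have "\<dots> \<le> x * (7 * x / sqrt (ln x))" using assms by (intro mult_left_mono ladder_U_upper) auto
    finally show "ladder_V x \<le> x * (7 * x / sqrt (ln x))" .
  qed (use assms in auto)
  also have "\<dots> = 7 / (2 * x * sqrt (ln x))" using assms by (simp add: power3_eq_cube)
  finally show ?thesis .
qed

text \<open>The derivative of \<open>K\<close> is \<open>f * V\<close>, at most \<open>7 / (2 x sqrt (ln x))\<close> by the a priori bound. This makes \<open>K\<close>
slowly varying.\<close>

lemma ladder_k_increment:
  assumes "1 < t" "t \<le> s" shows "ladder_k s - ladder_k t \<le> 7 * (sqrt (ln s) - sqrt (ln t))"
proof -
  have "7 * sqrt (ln t) - ladder_k t \<le> 7 * sqrt (ln s) - ladder_k s"
  proof (rule DERIV_nonneg_imp_nondecreasing[of t s "\<lambda>x. 7 * sqrt (ln x) - ladder_k x"])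
    fix x assume x: "t \<le> x" "x \<le> s"
    hence x1: "1 < x" using assms by simp
    have "DERIV (\<lambda>x. sqrt (ln x)) x :> inverse (sqrt (ln x)) / 2 * (1 / x)"
      using x1 by (intro DERIV_chain2[OF DERIV_real_sqrt] DERIV_ln_divide) auto
    hence "DERIV (\<lambda>x. 7 * sqrt (ln x) - ladder_k x) x :> 7 * (inverse (sqrt (ln x)) / 2 * (1 / x)) - jump x * ladder_V (1 * x)"
      using x1 by (intro DERIV_diff DERIV_cmult DERIV_ladder_K) auto
    moreover have "7 * (inverse (sqrt (ln x)) / 2 * (1 / x)) = 7 / (2 * x * sqrt (ln x))"
      by (simp only: inverse_eq_divide times_divide_times_eq times_divide_eq_right divide_divide_eq_left mult_1 mult_1_right mult_ac)
    hence "0 \<le> 7 * (inverse (sqrt (ln x)) / 2 * (1 / x)) - jump x * ladder_V (1 * x)"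
      using jump_ladder_V_le[OF x1] by (simp only: mult_1 diff_ge_0_iff_ge)
    ultimately show "\<exists>y. DERIV (\<lambda>x. 7 * sqrt (ln x) - ladder_k x) x :> y \<and> 0 \<le> y"
      by blast
  qed (use assms in auto)
  thus ?thesis by simp
qed

text \<open>For \<open>T = s\<^sup>b\<close> with \<open>b < 1\<close> the error term \<open>window_const * T / (\<epsilon> s)\<close> of \<open>window_average\<close> vanishes in the limit.\<close>

lemma exit_prob_approximation:
  fixes \<eta> :: real assumes "0 < \<eta>"
  obtains \<epsilon> where "0 < \<epsilon>" "\<epsilon> \<le> 1 / 2"
    "\<And>w b. 0 \<le> w \<Longrightarrow> w \<le> 1 \<Longrightarrow> 0 < b \<Longrightarrow> b < 1 \<Longrightarrow>
      eventually (\<lambda>s. \<bar>exit_prob w (s powr b) s - renewal_rate \<epsilon> s * ladder_K w (s powr b)\<bar> \<le> \<eta>) at_top"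
proof -
  have "0 < \<eta> / 2" using assms by simp
  then obtain \<epsilon> s0 where \<epsilon>: "0 < \<epsilon>" "\<epsilon> \<le> 1 / 2" "1 \<le> s0" and sm:
    "\<And>s s' W w. s0 \<le> s \<Longrightarrow> \<bar>s - s'\<bar> \<le> \<epsilon> * s \<Longrightarrow> W \<in> sets borel \<Longrightarrow> W \<subseteq> {0<..} \<Longrightarrow> w \<le> 1 \<Longrightarrow>
       hit W w s \<le> hit W w s' + ennreal (\<eta>/2) \<and> hit W w s' \<le> hit W w s + ennreal (\<eta>/2)"
    using hit_smooth by blast
  have "eventually (\<lambda>s. \<bar>exit_prob w (s powr b) s - renewal_rate \<epsilon> s * ladder_K w (s powr b)\<bar> \<le> \<eta>) at_top"
    if w: "0 \<le> w" "w \<le> 1" and b: "0 < b" "b < 1" for w b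
  proof -
    have lim: "((\<lambda>s. s powr (b - 1)) \<longlongrightarrow> 0) at_top"
      using b by (intro tendsto_neg_powr filterlim_ident) auto
    have "eventually (\<lambda>s. s powr (b - 1) < 1 / 2) at_top" by (rule order_tendstoD(2)[OF lim]) simp
    moreover have "((\<lambda>s. window_const / \<epsilon> * s powr (b - 1)) \<longlongrightarrow> 0) at_top"
      using tendsto_mult_left[OF lim, of "window_const / \<epsilon>"] by simp
    hence "eventually (\<lambda>s. window_const / \<epsilon> * s powr (b - 1) < \<eta> / 2) at_top"
      by (rule order_tendstoD(2)) (use assms in simp)
    moreover have "eventually (\<lambda>s. s0 \<le> s) at_top" by (rule eventually_ge_at_top)
    ultimately show ?thesis
    proof eventually_elim
      case (elim s)
      have s: "1 \<le> s" using elim \<epsilon> by linarith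
      have p: "s powr b = s powr (b - 1) * s" using s by (simp add: powr_diff)
      have "s powr b < 1 / 2 * s" unfolding p using elim s by (intro mult_strict_right_mono) auto
      also have "\<dots> \<le> (1 - \<epsilon>) * s" using \<epsilon> s by (intro mult_right_mono) auto
      finally have T: "s powr b < (1 - \<epsilon>) * s" .
      have ds: "s - (1 - \<epsilon>) * s = \<epsilon> * s" by (simp add: algebra_simps)
      have "\<bar>exit_prob w (s powr b) s - (ladder_U s - ladder_U ((1 - \<epsilon>) * s)) / (s - (1 - \<epsilon>) * s) * ladder_K w (s powr b)\<bar>
         \<le> \<eta> / 2 + window_const * (s powr b) / (s - (1 - \<epsilon>) * s)"
      proof (rule window_average)
        fix s' assume s': "(1 - \<epsilon>) * s \<le> s'" "s' \<le> s"
        hence "\<bar>s - s'\<bar> \<le> \<epsilon> * s" by (simp add: algebra_simps)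
        thus "hit {0<..s powr b} w s \<le> hit {0<..s powr b} w s' + ennreal (\<eta> / 2) \<and>
          hit {0<..s powr b} w s' \<le> hit {0<..s powr b} w s + ennreal (\<eta> / 2)"
          using elim w by (intro sm) auto
      qed (use w T s \<epsilon> assms in auto)
      also have "window_const * (s powr b) / (s - (1 - \<epsilon>) * s) = window_const / \<epsilon> * s powr (b - 1)"
        unfolding ds p using s by simp
      finally have "\<bar>exit_prob w (s powr b) s - (ladder_U s - ladder_U ((1 - \<epsilon>) * s)) / (s - (1 - \<epsilon>) * s) * ladder_K w (s powr b)\<bar> \<le> \<eta>"
        using elim(2) by linarith
      thus ?case by (simp only: renewal_rate_def ds)
    qed
  qed
  thus thesis using that \<epsilon> by blast
qed

lemma exit_prob_le_1: "0 \<le> s \<Longrightarrow> w \<le> 1 \<Longrightarrow> exit_prob w T s \<le> 1"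
  using hit_le_1[of "{0<..T}" s w, OF _ greaterThanAtMost_subset_greaterThan] hit_eq_exit_prob[of s w T]
  by (simp add: ennreal_le_1)

lemma exit_prob_tail_powr:
  assumes b: "0 < b" "b < 1"
  shows "eventually (\<lambda>s. 1 - exit_prob 1 (s powr b) s \<le> 25 * (1 - b) / b + 25 / ln s) at_top"
proof -
  have "filterlim (\<lambda>s. s powr b) at_top at_top" using b by real_asymp
  hence "eventually (\<lambda>s. 2 \<le> s powr b) at_top" by (auto simp: filterlim_at_top)
  moreover have "eventually (\<lambda>s. 1 < s) (at_top :: real filter)" by (rule eventually_gt_at_top)
  ultimately show ?thesis
  proof eventually_elim
    case (elim s)
    have "s powr b \<le> s powr 1" using elim b by (intro powr_mono) auto
    hence "1 - exit_prob 1 (s powr b) s \<le> 25 * ln (s / s powr b) / ln (s powr b) + 25 / ln s"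
      using elim by (intro exit_prob_tail) auto
    also have "ln (s / s powr b) = (1 - b) * ln s" using elim by (simp add: ln_div ln_powr algebra_simps)
    also have "25 * ((1 - b) * ln s) / ln (s powr b) = 25 * (1 - b) / b" using elim b by (simp add: ln_powr)
    finally show ?case .
  qed
qed

lemma inverse_ln_small: "0 < \<eta> \<Longrightarrow> eventually (\<lambda>s. c / ln s \<le> \<eta>) (at_top :: real filter)"
proof -
  assume "0 < \<eta>"
  have "((\<lambda>s::real. c / ln s) \<longlongrightarrow> 0) at_top" by real_asymp
  from order_tendstoD(2)[OF this \<open>0 < \<eta>\<close>] show ?thesis by eventually_elim simp
qed

lemma renewal_rate_nonneg: "0 < \<epsilon> \<Longrightarrow> \<epsilon> \<le> 1 \<Longrightarrow> 0 < s \<Longrightarrow> 0 \<le> renewal_rate \<epsilon> s"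
proof -
  assume a: "0 < \<epsilon>" "\<epsilon> \<le> 1" "0 < s"
  hence "(1 - \<epsilon>) * s \<le> s" by (simp add: algebra_simps)
  from ladder_U_mono[OF this] show ?thesis using a unfolding renewal_rate_def by (intro divide_nonneg_pos) auto
qed

text \<open>The matching lower bound: for \<open>b\<close> near 1 the exit probability at \<open>s\<^sup>b\<close> is bounded below, hence so is \<open>\<kappa> * K\<close>, while \<open>\<kappa>\<close> is
at most of order \<open>1 / sqrt (ln s)\<close>.\<close>

lemma ladder_k_lower:
  obtains c where "0 < c" "eventually (\<lambda>s. c * sqrt (ln s) \<le> ladder_k s) at_top"
proof -
  obtain \<epsilon> where \<epsilon>: "0 < \<epsilon>" "\<epsilon> \<le> 1 / 2" and ap:
    "\<And>w b. 0 \<le> w \<Longrightarrow> w \<le> 1 \<Longrightarrow> 0 < b \<Longrightarrow> b < 1 \<Longrightarrow>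
      eventually (\<lambda>s. \<bar>exit_prob w (s powr b) s - renewal_rate \<epsilon> s * ladder_K w (s powr b)\<bar> \<le> 1 / 4) at_top"
    using exit_prob_approximation[of "1/4"] by auto
  \<comment> \<open>Chosen so that the first error term of the tail bound is exactly \<open>1 / 4\<close>.\<close>
  define b :: real where "b = 100 / 101"
  have b: "0 < b" "b < 1" "25 * (1 - b) / b = 1 / 4" by (auto simp: b_def)
  have "eventually (\<lambda>s::real. 25 / ln s \<le> 1 / 4) at_top" by (rule inverse_ln_small) simp
  moreover have "eventually (\<lambda>s. 1 < s) (at_top :: real filter)" by (rule eventually_gt_at_top)
  moreover note exit_prob_tail_powr[OF b(1,2)] ap[of 1 b, OF zero_le_one order_refl b(1,2)]
  ultimately have "eventually (\<lambda>s. \<epsilon> / 28 * sqrt (ln s) \<le> ladder_k s) at_top"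
  proof eventually_elim
    case (elim s)
    let ?r = "renewal_rate \<epsilon> s"
    have ln: "0 < ln s" using elim by simp
    have "1 / 4 \<le> ?r * ladder_k (s powr b)"
      using elim(1,3) abs_le_D1[OF elim(4)] unfolding b(3) by linarith
    also have "\<dots> \<le> ?r * ladder_k s"
      using elim b \<epsilon> powr_mono[of b 1 s] by (intro mult_left_mono ladder_K_mono renewal_rate_nonneg) auto
    also have "\<dots> \<le> 7 / (\<epsilon> * sqrt (ln s)) * ladder_k s"
    proof (intro mult_right_mono)
      have "?r \<le> ladder_U s / (\<epsilon> * s)" unfolding renewal_rate_def using \<epsilon> elim by (intro divide_right_mono) auto
      also have "\<dots> \<le> (7 * s / sqrt (ln s)) / (\<epsilon> * s)" using \<epsilon> elim by (intro divide_right_mono ladder_U_upper) auto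
      also have "\<dots> = 7 / (\<epsilon> * sqrt (ln s))" using elim \<epsilon> by simp
      finally show "?r \<le> 7 / (\<epsilon> * sqrt (ln s))" .
    qed simp
    finally show ?case using ln \<epsilon> by (simp add: field_simps)
  qed
  thus thesis using that[of "\<epsilon> / 28"] \<epsilon> by auto
qed

lemma ladder_k_at_top: "filterlim ladder_k at_top at_top"
proof -
  obtain c where c: "0 < c" "eventually (\<lambda>s. c * sqrt (ln s) \<le> ladder_k s) at_top" by (rule ladder_k_lower)
  have "filterlim (\<lambda>s::real. c * sqrt (ln s)) at_top at_top" using c(1) by real_asymp
  thus ?thesis using c(2) by (rule filterlim_at_top_mono)
qed

text \<open>The product formula with \<open>w = 1\<close> and \<open>T = s\<^sup>b\<close>, \<open>b\<close> near 1: the probability is almost 1 by the tail bound, and \<open>K\<close> hardly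
changes between \<open>s\<^sup>b\<close> and \<open>s\<close>. The approximation for general \<open>w\<close> is repeated in the conclusion because both statements have to hold for the same
\<open>\<epsilon>\<close>.\<close>

lemma renewal_rate_asymp:
  fixes \<eta> :: real assumes "0 < \<eta>" "\<eta> \<le> 1 / 4"
  obtains \<epsilon> where "0 < \<epsilon>" "\<epsilon> \<le> 1 / 2"
    "\<And>w b. 0 \<le> w \<Longrightarrow> w \<le> 1 \<Longrightarrow> 0 < b \<Longrightarrow> b < 1 \<Longrightarrow>
      eventually (\<lambda>s. \<bar>exit_prob w (s powr b) s - renewal_rate \<epsilon> s * ladder_K w (s powr b)\<bar> \<le> \<eta>) at_top"
    "eventually (\<lambda>s. \<bar>renewal_rate \<epsilon> s * ladder_k s - 1\<bar> \<le> 6 * \<eta>) at_top"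
proof -
  obtain \<epsilon> where \<epsilon>: "0 < \<epsilon>" "\<epsilon> \<le> 1 / 2" and ap:
    "\<And>w b. 0 \<le> w \<Longrightarrow> w \<le> 1 \<Longrightarrow> 0 < b \<Longrightarrow> b < 1 \<Longrightarrow>
      eventually (\<lambda>s. \<bar>exit_prob w (s powr b) s - renewal_rate \<epsilon> s * ladder_K w (s powr b)\<bar> \<le> \<eta>) at_top"
    using exit_prob_approximation[OF assms(1)] by blast
  obtain c where c: "0 < c" "eventually (\<lambda>s. c * sqrt (ln s) \<le> ladder_k s) at_top" by (rule ladder_k_lower)
  \<comment> \<open>The bound \<open>\<eta> / 50\<close> makes the tail small; \<open>c * \<eta> / 7\<close> makes the relative increment of \<open>K\<close> between \<open>s\<^sup>b\<close> and \<open>s\<close> small.\<close>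
  define \<beta> where "\<beta> = min (1 / 2) (min (\<eta> / 50) (c * \<eta> / 7))"
  have \<beta>: "0 < \<beta>" "\<beta> \<le> 1 / 2" "50 * \<beta> \<le> \<eta>" "\<beta> \<le> c * \<eta> / 7"
    using assms c by (auto simp: \<beta>_def)
  define b where "b = 1 - \<beta>"
  have b: "0 < b" "b < 1" using \<beta> by (auto simp: b_def)
  have b25: "25 * (1 - b) / b \<le> \<eta>"
  proof -
    have "25 * (1 - b) \<le> \<eta> * (1 / 2)" using \<beta> by (simp add: b_def)
    also have "\<dots> \<le> \<eta> * b" using \<beta> assms by (intro mult_left_mono) (auto simp: b_def)
    finally show ?thesis using b by (subst pos_divide_le_eq) auto
  qed
  have "filterlim (\<lambda>s. s powr b) at_top at_top" using b by real_asymp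
  hence "eventually (\<lambda>s. 2 \<le> s powr b) at_top" by (auto simp: filterlim_at_top)
  moreover have "eventually (\<lambda>s::real. 25 / ln s \<le> \<eta>) at_top" by (rule inverse_ln_small) fact
  moreover have "eventually (\<lambda>s. 1 < s) (at_top :: real filter)" by (rule eventually_gt_at_top)
  moreover note exit_prob_tail_powr[OF b(1,2)] ap[of 1 b, OF zero_le_one order_refl b(1,2)] c(2)
  ultimately have "eventually (\<lambda>s. \<bar>renewal_rate \<epsilon> s * ladder_k s - 1\<bar> \<le> 6 * \<eta>) at_top"
  proof eventually_elim
    case (elim s)
    let ?r = "renewal_rate \<epsilon> s" and ?T = "s powr b"
    have r: "0 \<le> ?r" using \<epsilon> elim by (intro renewal_rate_nonneg) auto
    have ln: "0 < ln s" using elim by simp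
    have Ts: "?T \<le> s" using powr_mono[of b 1 s] elim b by simp
    have e1: "exit_prob 1 ?T s \<le> 1" using elim by (intro exit_prob_le_1) auto
    have near: "1 - 3 * \<eta> \<le> ?r * ladder_k ?T" "?r * ladder_k ?T \<le> 1 + \<eta>"
      using elim b25 e1 by (auto simp: abs_le_iff)
    have kT: "ladder_k ?T \<le> ladder_k s" using Ts by (intro ladder_K_mono) auto
    have "ladder_k s - ladder_k ?T \<le> \<eta> * ladder_k s"
    proof -
      have "ladder_k s - ladder_k ?T \<le> 7 * (sqrt (ln s) - sqrt (ln ?T))"
        using elim Ts by (intro ladder_k_increment) auto
      also have "sqrt (ln ?T) = sqrt b * sqrt (ln s)" using elim by (simp add: ln_powr real_sqrt_mult)
      also have "7 * (sqrt (ln s) - sqrt b * sqrt (ln s)) = 7 * (1 - sqrt b) * sqrt (ln s)" by (simp add: algebra_simps)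
      also have "\<dots> \<le> 7 * \<beta> * sqrt (ln s)"
      proof -
        have "b \<le> sqrt b" using b real_sqrt_le_mono[of "b * b" b] by (simp add: real_sqrt_mult)
        thus ?thesis using ln by (intro mult_right_mono) (auto simp: b_def)
      qed
      also have "\<dots> \<le> \<eta> * c * sqrt (ln s)" using \<beta>(4) ln by (intro mult_right_mono) (auto simp: mult.commute)
      also have "\<dots> = \<eta> * (c * sqrt (ln s))" by simp
      also have "\<dots> \<le> \<eta> * ladder_k s" using elim assms by (intro mult_left_mono) auto
      finally show ?thesis .
    qed
    hence "?r * ((1 - \<eta>) * ladder_k s) \<le> ?r * ladder_k ?T" using r by (intro mult_left_mono) (simp_all add: algebra_simps)
    hence "(1 - \<eta>) * (?r * ladder_k s) \<le> 1 + \<eta>" using near by (simp add: mult_ac)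
    also have "\<dots> \<le> (1 - \<eta>) * (1 + 6 * \<eta>)"
    proof -
      have "\<eta> * \<eta> \<le> \<eta> * (1 / 4)" using assms by (intro mult_left_mono) auto
      thus ?thesis using assms by (simp add: algebra_simps)
    qed
    finally have up: "?r * ladder_k s \<le> 1 + 6 * \<eta>" using assms by (subst (asm) mult_le_cancel_left_pos) auto
    have "?r * ladder_k ?T \<le> ?r * ladder_k s" using r kT by (intro mult_left_mono)
    with near(1) have "1 - 3 * \<eta> \<le> ?r * ladder_k s" by linarith
    with up assms show ?case by (simp add: abs_le_iff)
  qed
  thus thesis using that \<epsilon> ap by blast
qed

text \<open>Iterating the recursion multiplies the bounded initial error by \<open>q\<close> each time.\<close>

lemma contraction_eventually:
  fixes E :: "real \<Rightarrow> real"
  assumes q: "0 < q" "q < 1" and s0: "0 < s0" and h: "0 \<le> h" "0 < \<delta>"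
    and step: "\<And>s. s0 \<le> s \<Longrightarrow> \<bar>E s\<bar> \<le> (1 - q) * h + q * \<bar>E (q * s)\<bar>"
    and bound: "\<And>s. q * s0 \<le> s \<Longrightarrow> \<bar>E s\<bar> \<le> B"
  shows "eventually (\<lambda>s. \<bar>E s\<bar> \<le> h + \<delta>) at_top"
proof -
  have B: "0 \<le> B" using bound[of "q * s0"] by simp
  have iter: "\<bar>E s\<bar> \<le> h + q ^ n * B" if "q * s0 \<le> q ^ n * s" for n s
    using that
  proof (induction n arbitrary: s)
    case 0
    thus ?case using bound[of s] h by simp
  next
    case (Suc n)
    have "q ^ Suc n * s \<le> q * s" if "0 \<le> s" using q that by (simp add: power_le_one mult_left_le_one_le mult_right_mono)
    moreover have "0 \<le> s"
    proof (rule ccontr)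
      assume "\<not> 0 \<le> s"
      hence "q ^ Suc n * s < 0" using q by (intro mult_pos_neg) auto
      thus False using Suc.prems mult_pos_pos[OF q(1) s0] by linarith
    qed
    ultimately have "q * s0 \<le> q * s" using Suc.prems by linarith
    hence "s0 \<le> s" using q by simp
    hence "\<bar>E s\<bar> \<le> (1 - q) * h + q * \<bar>E (q * s)\<bar>" by (rule step)
    also have "\<bar>E (q * s)\<bar> \<le> h + q ^ n * B" using Suc.prems by (intro Suc.IH) (simp add: mult_ac)
    hence "(1 - q) * h + q * \<bar>E (q * s)\<bar> \<le> (1 - q) * h + q * (h + q ^ n * B)" using q by (intro add_left_mono mult_left_mono) auto
    also have "\<dots> = h + q ^ Suc n * B" by (simp add: algebra_simps)
    finally show ?case .
  qed
  have "(\<lambda>n. q ^ n * B) \<longlonglongrightarrow> 0 * B" using q by (intro tendsto_mult tendsto_const LIMSEQ_power_zero) auto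
  hence "eventually (\<lambda>n. q ^ n * B < \<delta>) sequentially" using h by (intro order_tendstoD(2)[of _ "0 * B"]) auto
  then obtain n where n: "q ^ n * B < \<delta>" by (auto simp: eventually_sequentially)
  have "eventually (\<lambda>s. q * s0 / q ^ n \<le> s) at_top" by (rule eventually_ge_at_top)
  thus ?thesis
  proof eventually_elim
    case (elim s)
    have "q * s0 \<le> q ^ n * s" using elim q by (simp add: field_simps)
    from iter[OF this] n show ?case by linarith
  qed
qed

text \<open>The product \<open>\<Phi> s = U s * K s / s\<close> satisfies \<open>\<Phi> s = \<epsilon> * (\<kappa> s * K s) + q * \<Phi> (q s) * \<beta>\<close> with \<open>q = 1 - \<epsilon>\<close> and
\<open>\<beta> = K s / K (q s)\<close> near 1. As \<open>\<kappa> s * K s\<close> is almost 1, the distance of \<open>\<Phi>\<close> from 1 contracts.\<close>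

lemma ladder_U_asymp: "((\<lambda>s. ladder_U s * ladder_k s / s) \<longlongrightarrow> 1) at_top"
proof (rule tendstoI)
  fix e :: real assume "0 < e"
  define \<eta> where "\<eta> = min (1 / 4) (e / 16)"
  have \<eta>: "0 < \<eta>" "\<eta> \<le> 1 / 4" "16 * \<eta> \<le> e" using \<open>0 < e\<close> by (auto simp: \<eta>_def)
  obtain \<epsilon> where \<epsilon>: "0 < \<epsilon>" "\<epsilon> \<le> 1 / 2" and
    rate: "eventually (\<lambda>s. \<bar>renewal_rate \<epsilon> s * ladder_k s - 1\<bar> \<le> 6 * \<eta>) at_top"
    by (rule renewal_rate_asymp[OF \<eta>(1,2)]) (rule that; assumption)
  define q where "q = 1 - \<epsilon>"
  have q: "0 < q" "q < 1" "1 - q = \<epsilon>" using \<epsilon> by (auto simp: q_def)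
  let ?\<Phi> = "\<lambda>s. ladder_U s * ladder_k s / s"
  have \<Phi>: "0 \<le> ?\<Phi> s" "?\<Phi> s \<le> 2" if "0 < s" for s
    using that ladder_UK_le[OF that] by (auto simp: field_simps)
  have "eventually (\<lambda>s. 2 * (ladder_k s - ladder_k (q * s)) \<le> \<epsilon> * \<eta> * ladder_k (q * s)) at_top"
  proof -
    have gen: "2 * a \<le> e" if "a \<le> 7 * d" "14 * d < e" for a d e :: real using that by linarith
    have lim: "((\<lambda>s. 14 * (sqrt (ln s) - sqrt (ln (q * s)))) \<longlongrightarrow> 0) at_top" using q by real_asymp
    have "eventually (\<lambda>s. 14 * (sqrt (ln s) - sqrt (ln (q * s))) < \<epsilon> * \<eta>) at_top"
      by (rule order_tendstoD(2)[OF lim]) (use \<epsilon> \<eta> in simp)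
    moreover have "filterlim (\<lambda>s. ladder_k (q * s)) at_top at_top"
      by (rule filterlim_compose[OF ladder_k_at_top]) (use q in real_asymp)
    hence "eventually (\<lambda>s. 1 \<le> ladder_k (q * s)) at_top" by (auto simp: filterlim_at_top)
    moreover have "eventually (\<lambda>s. 1 / q < s) at_top" by (rule eventually_gt_at_top)
    ultimately show ?thesis
    proof eventually_elim
      case (elim s)
      have qs: "1 < q * s" using elim q by (simp add: field_simps)
      hence "0 < q * s" by linarith
      hence "0 < s" using q(1) by (simp add: zero_less_mult_iff)
      hence "q * s \<le> s" using q by simp
      from ladder_k_increment[OF qs this] have "2 * (ladder_k s - ladder_k (q * s)) \<le> \<epsilon> * \<eta>"
        using gen[OF _ elim(1)] by blast
      also have "\<dots> \<le> \<epsilon> * \<eta> * ladder_k (q * s)" using mult_left_mono[of 1 "ladder_k (q * s)" "\<epsilon> * \<eta>"] elim(2) \<epsilon> \<eta> by simp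
      finally show ?case .
    qed
  qed
  moreover have "filterlim (\<lambda>s. ladder_k (q * s)) at_top at_top"
    by (rule filterlim_compose[OF ladder_k_at_top]) (use q in real_asymp)
  hence "eventually (\<lambda>s. 0 < ladder_k (q * s)) at_top" by (auto simp: filterlim_at_top_dense)
  moreover have "eventually (\<lambda>s. 0 < s) (at_top :: real filter)" by (rule eventually_gt_at_top)
  moreover note rate
  ultimately have "eventually (\<lambda>s. 0 < s \<and> \<bar>?\<Phi> s - 1\<bar> \<le> (1 - q) * (7 * \<eta>) + q * \<bar>?\<Phi> (q * s) - 1\<bar>) at_top"
  proof eventually_elim
    case (elim s)
    have qs: "0 < q * s" using q elim by simp
    \<comment> \<open>Here \<open>P\<close>, \<open>Q\<close>, \<open>R\<close> stand for \<open>\<Phi> s\<close>, \<open>\<Phi> (q s)\<close> and \<open>\<kappa> s * K s\<close>.\<close>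
    have alg: "P - 1 = \<epsilon> * (R - 1) + q * (Q - 1) + q * Q * (\<beta> - 1)" if "P = \<epsilon> * R + q * (Q * \<beta>)" for P Q R \<beta>
      using that by (simp add: q_def algebra_simps)
    have tri: "\<bar>x\<bar> \<le> \<bar>a\<bar> + \<bar>b\<bar> + \<bar>c\<bar>" if "x = a + b + c" for x a b c :: real
      using that by linarith
    let ?\<beta> = "ladder_k s / ladder_k (q * s)"
    have "ladder_k (q * s) \<le> ladder_k s" using q elim by (intro ladder_K_mono) auto
    hence \<beta>: "1 \<le> ?\<beta>" using elim by simp
    have \<beta>2: "2 * (?\<beta> - 1) \<le> \<epsilon> * \<eta>" using elim by (simp add: field_simps)
    have "ladder_U s = renewal_rate \<epsilon> s * (\<epsilon> * s) + ladder_U (q * s)"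
      using \<epsilon> elim by (simp add: renewal_rate_def q_def)
    hence "?\<Phi> s = \<epsilon> * (renewal_rate \<epsilon> s * ladder_k s) + ladder_U (q * s) * ladder_k s / s"
      using elim by (simp add: field_simps)
    also have "ladder_U (q * s) * ladder_k s / s = q * (?\<Phi> (q * s) * ?\<beta>)"
      using elim q by (simp add: field_simps)
    finally have "?\<Phi> s - 1 = \<epsilon> * (renewal_rate \<epsilon> s * ladder_k s - 1) + q * (?\<Phi> (q * s) - 1) + q * ?\<Phi> (q * s) * (?\<beta> - 1)"
      by (rule alg)
    hence t0: "\<bar>?\<Phi> s - 1\<bar> \<le> \<bar>\<epsilon> * (renewal_rate \<epsilon> s * ladder_k s - 1)\<bar> + \<bar>q * (?\<Phi> (q * s) - 1)\<bar> + \<bar>q * ?\<Phi> (q * s) * (?\<beta> - 1)\<bar>"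
      by (rule tri)
    have t1: "\<bar>\<epsilon> * (renewal_rate \<epsilon> s * ladder_k s - 1)\<bar> \<le> \<epsilon> * (6 * \<eta>)"
      unfolding abs_mult using elim \<epsilon> by (intro mult_mono) auto
    have t2: "\<bar>q * (?\<Phi> (q * s) - 1)\<bar> = q * \<bar>?\<Phi> (q * s) - 1\<bar>" using q by (simp add: abs_mult)
    have t3: "\<bar>q * ?\<Phi> (q * s) * (?\<beta> - 1)\<bar> \<le> \<epsilon> * \<eta>"
    proof -
      have "\<bar>q * ?\<Phi> (q * s) * (?\<beta> - 1)\<bar> = q * ?\<Phi> (q * s) * (?\<beta> - 1)"
        using q \<Phi>(1)[OF qs] \<beta> by (intro abs_of_nonneg mult_nonneg_nonneg) auto
      also have "\<dots> \<le> 1 * 2 * (?\<beta> - 1)" using q \<Phi>[OF qs] \<beta> by (intro mult_mono) auto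
      finally show ?thesis using \<beta>2 by simp
    qed
    have "\<bar>?\<Phi> s - 1\<bar> \<le> \<epsilon> * (6 * \<eta>) + q * \<bar>?\<Phi> (q * s) - 1\<bar> + \<epsilon> * \<eta>"
      using t0 t1 t3 unfolding t2 by (meson add_mono order_refl order_trans)
    also have "\<epsilon> * (6 * \<eta>) + q * \<bar>?\<Phi> (q * s) - 1\<bar> + \<epsilon> * \<eta> = (1 - q) * (7 * \<eta>) + q * \<bar>?\<Phi> (q * s) - 1\<bar>"
      unfolding q(3) by (simp only: add.commute add.left_commute)
    finally show ?case using elim by blast
  qed
  then obtain s0 where s0: "\<And>s. s0 \<le> s \<Longrightarrow> 0 < s \<and> \<bar>?\<Phi> s - 1\<bar> \<le> (1 - q) * (7 * \<eta>) + q * \<bar>?\<Phi> (q * s) - 1\<bar>"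
    by (auto simp: eventually_at_top_linorder)
  have "0 < s0" using s0[of s0] by simp
  have "eventually (\<lambda>s. \<bar>?\<Phi> s - 1\<bar> \<le> 7 * \<eta> + \<eta>) at_top"
  proof (rule contraction_eventually[where E = "\<lambda>s. ?\<Phi> s - 1" and B = 1 and ?s0.0 = s0])
    fix s assume "s0 \<le> s" thus "\<bar>?\<Phi> s - 1\<bar> \<le> (1 - q) * (7 * \<eta>) + q * \<bar>?\<Phi> (q * s) - 1\<bar>" using s0 by blast
  next
    fix s assume "q * s0 \<le> s"
    hence "0 < s" using mult_pos_pos[OF q(1) \<open>0 < s0\<close>] by linarith
    from \<Phi>[OF this] show "\<bar>?\<Phi> s - 1\<bar> \<le> 1" by (simp add: abs_le_iff)
  qed (use q \<open>0 < s0\<close> \<eta> in auto)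
  thus "eventually (\<lambda>s. dist (?\<Phi> s) 1 < e) at_top"
    by eventually_elim (use \<eta> in \<open>auto simp: dist_real_def\<close>)
qed

section \<open>The limit law of the last displacement\<close>

lemma ladder_k_pos: "eventually (\<lambda>x. 0 < ladder_k x) at_top"
  using ladder_k_at_top by (auto simp: filterlim_at_top_dense)

text \<open>By l'Hospital's rule, comparing with \<open>x\<^sup>2 / (2 * K x)\<close>; the derivative of \<open>1 / K\<close> is negligible because \<open>K\<close> varies slowly.\<close>

lemma ladder_V_asymp: "((\<lambda>x. ladder_V x * ladder_k x / x\<^sup>2) \<longlongrightarrow> 1 / 2) at_top"
proof -
  let ?g = "\<lambda>x. x\<^sup>2 / (2 * ladder_k x)"
  let ?e = "\<lambda>x. x * (jump x * ladder_V x) / (2 * ladder_k x)"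
  let ?g' = "\<lambda>x. x / ladder_k x * (1 - ?e x)"
  have small: "(?e \<longlongrightarrow> 0) at_top"
  proof (rule Lim_null_comparison)
    show "eventually (\<lambda>x. norm (?e x) \<le> 7 / (2 * sqrt (ln x))) at_top"
      using eventually_gt_at_top[of "1::real"] ladder_k_at_top[unfolded filterlim_at_top, rule_format, of 1]
    proof eventually_elim
      case (elim x)
      have "x * (jump x * ladder_V x) \<le> x * (7 / (2 * x * sqrt (ln x)))"
        using elim by (intro mult_left_mono jump_ladder_V_le) auto
      also have "\<dots> = 7 / (2 * sqrt (ln x))" using elim by simp
      finally have "?e x \<le> 7 / (2 * sqrt (ln x)) / (2 * ladder_k x)"
        using elim by (intro divide_right_mono) auto
      also have "\<dots> \<le> 7 / (2 * sqrt (ln x)) / 1" using elim by (intro divide_left_mono) auto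
      finally show ?case using elim by simp
    qed
    show "((\<lambda>x::real. 7 / (2 * sqrt (ln x))) \<longlongrightarrow> 0) at_top" by real_asymp
  qed
  have e_lt: "eventually (\<lambda>x. ?e x < 1 / 2) at_top" by (rule order_tendstoD(2)[OF small]) simp
  have "((\<lambda>x. ladder_V x / ?g x) \<longlongrightarrow> 1) at_top"
  proof (rule lhospital_at_top_at_top)
    show "filterlim ?g at_top at_top"
    proof (rule filterlim_at_top_mono)
      let ?c = "ladder_k 2 + 1"
      show "filterlim (\<lambda>x::real. x\<^sup>2 / (2 * (ladder_k 2 + 1 + 7 * sqrt (ln x)))) at_top at_top"
      proof -
        have "0 < ?c" by (simp add: add_nonneg_pos)
        thus ?thesis by real_asymp
      qed
      show "eventually (\<lambda>x. x\<^sup>2 / (2 * (ladder_k 2 + 1 + 7 * sqrt (ln x))) \<le> ?g x) at_top"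
        using ladder_k_pos eventually_ge_at_top[of "2::real"]
      proof eventually_elim
        case (elim x)
        have "ladder_k x - ladder_k 2 \<le> 7 * (sqrt (ln x) - sqrt (ln 2))" using elim by (intro ladder_k_increment) auto
        moreover have "0 \<le> sqrt (ln (2::real))" by simp
        moreover have "a \<le> b + 1 + 7 * c" if "a - b \<le> 7 * (c - d)" "0 \<le> d" for a b c d :: real
          using that by (simp add: algebra_simps)
        ultimately have "ladder_k x \<le> ladder_k 2 + 1 + 7 * sqrt (ln x)" by blast
        thus ?case using elim by (intro divide_left_mono mult_pos_pos) auto
      qed
    qed
    show "eventually (\<lambda>x. ?g' x \<noteq> 0) at_top"
      using ladder_k_pos eventually_gt_at_top[of "0::real"] e_lt by eventually_elim auto
    show "eventually (\<lambda>x. DERIV ladder_V x :> ladder_U x) at_top"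
      using eventually_gt_at_top[of "0::real"] by eventually_elim (rule DERIV_ladder_V)
    show "eventually (\<lambda>x. DERIV ?g x :> ?g' x) at_top"
      using ladder_k_pos eventually_gt_at_top[of "0::real"]
    proof eventually_elim
      case (elim x)
      have "DERIV ?g x :> (2 * x * (2 * ladder_k x) - x\<^sup>2 * (2 * (jump x * ladder_V (1 * x)))) / (2 * ladder_k x * (2 * ladder_k x))"
        using elim by (intro DERIV_divide DERIV_cmult DERIV_ladder_K) (auto intro!: derivative_eq_intros)
      also have "(2 * x * (2 * ladder_k x) - x\<^sup>2 * (2 * (jump x * ladder_V (1 * x)))) / (2 * ladder_k x * (2 * ladder_k x)) = ?g' x"
        using elim by (simp add: field_simps power2_eq_square)
      finally show ?case .
    qed
    have "((\<lambda>x. ladder_U x * ladder_k x / x / (1 - ?e x)) \<longlongrightarrow> 1 / (1 - 0)) at_top"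
      by (intro tendsto_divide ladder_U_asymp tendsto_diff tendsto_const small) simp
    moreover have "eventually (\<lambda>x. ladder_U x * ladder_k x / x / (1 - ?e x) = ladder_U x / ?g' x) at_top"
      using ladder_k_pos eventually_gt_at_top[of "0::real"] by eventually_elim simp
    ultimately show "((\<lambda>x. ladder_U x / ?g' x) \<longlongrightarrow> 1) at_top"
      by (simp add: tendsto_cong)
  qed
  hence "((\<lambda>x. ladder_V x / ?g x / 2) \<longlongrightarrow> 1 / 2) at_top" by (intro tendsto_divide) auto
  moreover have "ladder_V x / ?g x / 2 = ladder_V x * ladder_k x / x\<^sup>2" for x by simp
  ultimately show ?thesis by simp
qed

text \<open>The derivative of \<open>K\<^sup>2\<close> is \<open>2 * K * f * V\<close>, asymptotic to \<open>1 / (2 x)\<close>, half the derivative of the logarithm.\<close>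

lemma ladder_k_square_asymp: "((\<lambda>x. (ladder_k x)\<^sup>2 / ln x) \<longlongrightarrow> 1 / 2) at_top"
proof (rule lhospital_at_top_at_top)
  show "filterlim (ln :: real \<Rightarrow> real) at_top at_top" by (rule ln_at_top)
  show "eventually (\<lambda>x. 1 / x \<noteq> 0) (at_top :: real filter)"
    using eventually_gt_at_top[of "0::real"] by eventually_elim auto
  show "eventually (\<lambda>x. DERIV ln x :> 1 / x) (at_top :: real filter)"
    using eventually_gt_at_top[of "0::real"] by eventually_elim (rule DERIV_ln_divide)
  show "eventually (\<lambda>x. DERIV (\<lambda>x. (ladder_k x)\<^sup>2) x :> 2 * ladder_k x * (jump x * ladder_V x)) at_top"
    using eventually_gt_at_top[of "0::real"]
  proof eventually_elim
    case (elim x)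
    show ?case using DERIV_power[OF DERIV_ladder_K[of 1 x], of 2] elim by (simp add: mult_ac)
  qed
  have "((\<lambda>x. 2 * (x ^ 3 * jump x) * (ladder_V x * ladder_k x / x\<^sup>2)) \<longlongrightarrow> 2 * (1 / 2) * (1 / 2)) at_top"
    by (intro tendsto_mult tendsto_const jump_asymp ladder_V_asymp)
  moreover have "eventually (\<lambda>x. 2 * (x ^ 3 * jump x) * (ladder_V x * ladder_k x / x\<^sup>2) = 2 * ladder_k x * (jump x * ladder_V x) / (1 / x)) at_top"
    using eventually_gt_at_top[of "0::real"] by eventually_elim (simp add: power2_eq_square power3_eq_cube)
  ultimately show "((\<lambda>x. 2 * ladder_k x * (jump x * ladder_V x) / (1 / x)) \<longlongrightarrow> 1 / 2) at_top"
    by (simp add: tendsto_cong)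
qed

lemma ladder_k_ratio:
  assumes f: "filterlim f at_top at_top" and lim: "((\<lambda>x. ln (f x) / ln x) \<longlongrightarrow> a) at_top"
  shows "((\<lambda>x. ladder_k (f x) / ladder_k x) \<longlongrightarrow> sqrt a) at_top"
proof -
  have "((\<lambda>x. ((ladder_k (f x))\<^sup>2 / ln (f x)) / ((ladder_k x)\<^sup>2 / ln x) * (ln (f x) / ln x)) \<longlongrightarrow> (1 / 2) / (1 / 2) * a) at_top"
    by (intro tendsto_mult tendsto_divide ladder_k_square_asymp lim filterlim_compose[OF ladder_k_square_asymp f]) simp
  moreover have "eventually (\<lambda>x. ((ladder_k (f x))\<^sup>2 / ln (f x)) / ((ladder_k x)\<^sup>2 / ln x) * (ln (f x) / ln x) =
      (ladder_k (f x) / ladder_k x)\<^sup>2) at_top"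
    using ladder_k_pos eventually_gt_at_top[of "1::real"] filterlim_at_top_dense[THEN iffD1, OF f, rule_format, of 1]
    by eventually_elim (simp add: power_divide)
  ultimately have "((\<lambda>x. (ladder_k (f x) / ladder_k x)\<^sup>2) \<longlongrightarrow> a) at_top"
    by (simp add: tendsto_cong)
  hence "((\<lambda>x. sqrt ((ladder_k (f x) / ladder_k x)\<^sup>2)) \<longlongrightarrow> sqrt a) at_top" by (rule tendsto_real_sqrt)
  thus ?thesis by simp
qed

text \<open>The quotient of the derivatives is \<open>V (w x) / V x\<close>, which tends to \<open>w\<^sup>2\<close>.\<close>

lemma ladder_K_ratio:
  assumes w: "0 \<le> w" "w \<le> 1"
  shows "((\<lambda>x. ladder_K w x / ladder_k x) \<longlongrightarrow> w\<^sup>2) at_top"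
proof (cases "w = 0")
  case True
  thus ?thesis by (simp add: ladder_K_def)
next
  case False
  hence w0: "0 < w" using w by simp
  have wt: "filterlim (\<lambda>x. w * x) at_top at_top" using w0 by real_asymp
  show ?thesis
  proof (rule lhospital_at_top_at_top[OF ladder_k_at_top])
    show "eventually (\<lambda>x. jump x * ladder_V x \<noteq> 0) at_top"
      using eventually_gt_at_top[of "0::real"]
    proof eventually_elim
      case (elim x)
      have "ennreal x \<le> ennreal (ladder_V x)" using renewal_mass_integral_ge[of x] elim by (simp add: renewal_mass_integral_eq)
      hence "x \<le> ladder_V x" by simp
      thus ?case using elim jump_pos[of x] by (simp add: less_imp_neq[symmetric])
    qed
    show "eventually (\<lambda>x. DERIV (ladder_K w) x :> jump x * ladder_V (w * x)) at_top"
      using eventually_gt_at_top[of "0::real"] by eventually_elim (rule DERIV_ladder_K[OF w(1)])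
    show "eventually (\<lambda>x. DERIV ladder_k x :> jump x * ladder_V x) at_top"
      using eventually_gt_at_top[of "0::real"]
    proof eventually_elim
      case (elim x) show ?case using DERIV_ladder_K[of 1 x] elim by simp
    qed
    have "((\<lambda>x. ladder_k (w * x) / ladder_k x) \<longlongrightarrow> sqrt 1) at_top"
      by (rule ladder_k_ratio[OF wt]) (use w0 in real_asymp)
    hence "((\<lambda>x. (ladder_V (w * x) * ladder_k (w * x) / (w * x)\<^sup>2) / (ladder_V x * ladder_k x / x\<^sup>2) * w\<^sup>2 /
        (ladder_k (w * x) / ladder_k x)) \<longlongrightarrow> (1 / 2) / (1 / 2) * w\<^sup>2 / sqrt 1) at_top"
      by (intro tendsto_mult tendsto_divide tendsto_const ladder_V_asymp filterlim_compose[OF ladder_V_asymp wt]) auto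
    moreover have "eventually (\<lambda>x. (ladder_V (w * x) * ladder_k (w * x) / (w * x)\<^sup>2) / (ladder_V x * ladder_k x / x\<^sup>2) * w\<^sup>2 /
        (ladder_k (w * x) / ladder_k x) = jump x * ladder_V (w * x) / (jump x * ladder_V x)) at_top"
      using ladder_k_pos eventually_gt_at_top[of "0::real"] filterlim_compose[OF ladder_k_at_top wt, unfolded filterlim_at_top_dense, rule_format, of 0]
    proof eventually_elim
      case (elim x)
      have "jump x \<noteq> 0" using jump_pos[of x] by (metis less_irrefl)
      thus ?case using elim w0 by (simp add: power_mult_distrib)
    qed
    ultimately show "((\<lambda>x. jump x * ladder_V (w * x) / (jump x * ladder_V x)) \<longlongrightarrow> w\<^sup>2) at_top"
      by (simp add: tendsto_cong)
  qed
qed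

lemma exit_prob_limit_interior:
  assumes w: "0 \<le> w" "w \<le> 1" and a: "0 < a" "a < 1"
  shows "((\<lambda>s. exit_prob w (s powr a) s) \<longlongrightarrow> w\<^sup>2 * sqrt a) at_top"
proof (rule tendstoI)
  fix e :: real assume "0 < e"
  have sa: "filterlim (\<lambda>s. s powr a) at_top at_top" using a by real_asymp
  let ?z = "\<lambda>s. ladder_K w (s powr a) / ladder_k (s powr a) * (ladder_k (s powr a) / ladder_k s)"
  have z: "(?z \<longlongrightarrow> w\<^sup>2 * sqrt a) at_top"
  proof (intro tendsto_mult)
    show "((\<lambda>s. ladder_K w (s powr a) / ladder_k (s powr a)) \<longlongrightarrow> w\<^sup>2) at_top"
      by (rule filterlim_compose[OF ladder_K_ratio[OF w] sa])
    show "((\<lambda>s. ladder_k (s powr a) / ladder_k s) \<longlongrightarrow> sqrt a) at_top"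
    proof (rule ladder_k_ratio[OF sa])
      have "eventually (\<lambda>x::real. ln (x powr a) / ln x = a) at_top"
        using eventually_gt_at_top[of "1::real"] by eventually_elim (simp add: ln_powr)
      thus "((\<lambda>x. ln (x powr a) / ln x) \<longlongrightarrow> a) at_top" by (rule tendsto_eventually)
    qed
  qed
  define \<eta> where "\<eta> = min (1 / 4) (e / 20)"
  have \<eta>: "0 < \<eta>" "\<eta> \<le> 1 / 4" "20 * \<eta> \<le> e" using \<open>0 < e\<close> by (auto simp: \<eta>_def)
  obtain \<epsilon> where \<epsilon>: "0 < \<epsilon>" "\<epsilon> \<le> 1 / 2" and
    ap: "eventually (\<lambda>s. \<bar>exit_prob w (s powr a) s - renewal_rate \<epsilon> s * ladder_K w (s powr a)\<bar> \<le> \<eta>) at_top" and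
    rate: "eventually (\<lambda>s. \<bar>renewal_rate \<epsilon> s * ladder_k s - 1\<bar> \<le> 6 * \<eta>) at_top"
  proof (rule renewal_rate_asymp[OF \<eta>(1,2)])
    fix \<epsilon> assume "0 < \<epsilon>" "\<epsilon> \<le> 1 / 2" and
      "\<And>w b. 0 \<le> w \<Longrightarrow> w \<le> 1 \<Longrightarrow> 0 < b \<Longrightarrow> b < 1 \<Longrightarrow>
        eventually (\<lambda>s. \<bar>exit_prob w (s powr b) s - renewal_rate \<epsilon> s * ladder_K w (s powr b)\<bar> \<le> \<eta>) at_top" and
      "eventually (\<lambda>s. \<bar>renewal_rate \<epsilon> s * ladder_k s - 1\<bar> \<le> 6 * \<eta>) at_top"
    thus thesis using that w a by blast
  qed
  have le1: "w\<^sup>2 * sqrt a \<le> 1"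
    using w a by (intro mult_le_one power_le_one) auto
  have "eventually (\<lambda>s. dist (?z s) (w\<^sup>2 * sqrt a) < \<eta>) at_top" using z \<eta>(1) by (rule tendstoD)
  moreover have "eventually (\<lambda>s. 0 < ladder_k (s powr a)) at_top"
    by (rule eventually_compose_filterlim[OF ladder_k_pos sa])
  moreover note ap rate ladder_k_pos
  ultimately show "eventually (\<lambda>s. dist (exit_prob w (s powr a) s) (w\<^sup>2 * sqrt a) < e) at_top"
  proof eventually_elim
    case (elim s)
    let ?r = "renewal_rate \<epsilon> s * ladder_k s" and ?L = "w\<^sup>2 * sqrt a"
    have A: "renewal_rate \<epsilon> s * ladder_K w (s powr a) = ?r * ?z s" using elim(2,5) by simp
    have "\<bar>exit_prob w (s powr a) s - ?r * ?z s\<bar> \<le> \<eta>" using elim(3) unfolding A .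
    moreover have "\<bar>?r * ?z s - ?z s\<bar> \<le> 6 * \<eta> * 2"
    proof -
      have z0: "0 \<le> ?z s" using w elim by (intro mult_nonneg_nonneg divide_nonneg_pos) auto
      have "?r * ?z s - ?z s = (?r - 1) * ?z s" by (simp only: left_diff_distrib mult_1)
      hence "\<bar>?r * ?z s - ?z s\<bar> = \<bar>?r - 1\<bar> * \<bar>?z s\<bar>" by (simp only: abs_mult)
      also have "\<dots> \<le> 6 * \<eta> * 2"
      proof (intro mult_mono)
        show "\<bar>?r - 1\<bar> \<le> 6 * \<eta>" by (rule elim(4))
        have "\<bar>?z s - ?L\<bar> < \<eta>" using elim(1) by (simp only: dist_real_def)
        thus "\<bar>?z s\<bar> \<le> 2" using le1 \<eta> z0 by linarith
      qed (use \<eta> in auto)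
      finally show ?thesis .
    qed
    moreover have "\<bar>?z s - ?L\<bar> < \<eta>" using elim(1) by (simp add: dist_real_def)
    ultimately have "\<bar>exit_prob w (s powr a) s - ?L\<bar> < 14 * \<eta>" by linarith
    thus ?case using \<eta> by (simp add: dist_real_def)
  qed
qed

lemma exit_prob_mono:
  assumes "0 \<le> s" "w \<le> 1" "T \<le> T'" shows "exit_prob w T s \<le> exit_prob w T' s"
proof -
  have "hit {0<..T} w s \<le> hit {0<..T'} w s"
    using assms by (simp add: hit_eq) (intro nn_integral_mono mult_right_mono, auto simp: indicator_def)
  thus ?thesis using assms by (simp add: hit_eq_exit_prob)
qed

text \<open>The increment for \<open>w\<close> is at most that for \<open>w = 1\<close>, where the total mass is at most 1.\<close>

lemma exit_prob_increment:
  assumes "0 \<le> s" "0 \<le> w" "w \<le> 1" "0 \<le> T" "T \<le> T'"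
  shows "exit_prob w T' s - exit_prob w T s \<le> 1 - exit_prob 1 T s"
proof -
  have split: "{0<..T'} = {0<..T} \<union> {T<..T'}" using assms by auto
  have "hit {0<..T'} v s = hit {0<..T} v s + hit {T<..T'} v s" for v
    unfolding split by (rule hit_Un) (use assms in auto)
  note sw = this[of w] and s1 = this[of 1]
  have "hit {T<..T'} w s \<le> hit {T<..T'} 1 s"
  proof -
    have "occupation s (w * x) \<le> occupation s (1 * x)" if "0 \<le> x" for x
      unfolding occupation_def
    proof -
      have "w * x \<le> 1 * x" using assms that by (intro mult_right_mono)
      hence "indicator {0..w * x} y \<le> (indicator {0..1 * x} y :: ennreal)" for y
        by (auto simp: indicator_def)
      thus "indicator {0..w * x} s + (\<integral>\<^sup>+u. indicator {0..w * x} u * green s u \<partial>lborel) \<le>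
        indicator {0..1 * x} s + (\<integral>\<^sup>+u. indicator {0..1 * x} u * green s u \<partial>lborel)"
        by (intro add_mono nn_integral_mono mult_right_mono) auto
    qed
    thus ?thesis using assms
      by (simp add: hit_eq) (intro nn_integral_mono, auto simp: indicator_def intro!: mult_left_mono)
  qed
  also have "hit {T<..T'} 1 s + hit {0<..T} 1 s \<le> 1"
    using s1 hit_le_1[of "{0<..T'}" s 1, OF _ greaterThanAtMost_subset_greaterThan] assms by (simp add: add.commute)
  hence "hit {T<..T'} 1 s \<le> 1 - hit {0<..T} 1 s"
    using assms hit_eq_exit_prob[of s 1 T] by (simp add: ennreal_le_minus_iff)
  finally have "hit {0<..T'} w s \<le> hit {0<..T} w s + (1 - hit {0<..T} 1 s)"
    unfolding sw by (rule add_left_mono)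
  also have "1 - hit {0<..T} 1 s = ennreal (1 - exit_prob 1 T s)"
    using assms exit_prob_le_1[of s 1 T] by (simp add: hit_eq_exit_prob ennreal_minus flip: ennreal_1)
  finally have "ennreal (exit_prob w T' s) \<le> ennreal (exit_prob w T s + (1 - exit_prob 1 T s))"
    using assms exit_prob_le_1[of s 1 T] by (subst ennreal_plus) (auto simp: hit_eq_exit_prob)
  thus ?thesis using exit_prob_le_1[of s 1 T] assms by (subst (asm) ennreal_le_iff) auto
qed

text \<open>The interior case is the product formula. At the endpoints \<open>a = 0\<close> and \<open>a = 1\<close> the probability is compared with nearby interior
exponents: by monotonicity at 0, and at 1 because the mass missing above \<open>s\<^sup>b\<close> is at most \<open>1 - sqrt b\<close> in the limit.\<close>

theorem exit_prob_limit:
  assumes w: "0 \<le> w" "w \<le> 1" and a: "0 \<le> a" "a \<le> 1"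
  shows "((\<lambda>s. exit_prob w (s powr a) s) \<longlongrightarrow> w\<^sup>2 * sqrt a) at_top"
proof -
  consider "a = 0" | "a = 1" | "0 < a" "a < 1" using a by linarith
  thus ?thesis
  proof cases
    case 1
    have "((\<lambda>s. exit_prob w (s powr a) s) \<longlongrightarrow> 0) at_top"
    proof (rule tendstoI)
      fix e :: real assume e: "0 < e"
      define b where "b = min (1 / 2) (e\<^sup>2 / 4)"
      have b: "0 < b" "b < 1" "b \<le> e\<^sup>2 / 4" using e by (auto simp: b_def)
      have "sqrt b \<le> sqrt ((e / 2)\<^sup>2)" using b by (intro real_sqrt_le_mono) (simp add: power_divide)
      hence sb: "sqrt b \<le> e / 2" using e by simp
      have "w\<^sup>2 * sqrt b \<le> 1 * sqrt b" using w b by (intro mult_right_mono power_le_one) auto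
      hence lt: "w\<^sup>2 * sqrt b < e" using sb e by linarith
      have "eventually (\<lambda>s. exit_prob w (s powr b) s < e) at_top"
        by (rule order_tendstoD(2)[OF exit_prob_limit_interior[OF w b(1,2)] lt])
      thus "eventually (\<lambda>s. dist (exit_prob w (s powr a) s) 0 < e) at_top"
        using eventually_ge_at_top[of "1::real"]
      proof eventually_elim
        case (elim s)
        have "exit_prob w (s powr a) s \<le> exit_prob w (s powr b) s"
          using elim w b 1 by (intro exit_prob_mono powr_mono) auto
        thus ?case using elim by simp
      qed
    qed
    thus ?thesis using 1 by simp
  next
    case 2
    have "((\<lambda>s. exit_prob w s s) \<longlongrightarrow> w\<^sup>2) at_top"
    proof (rule tendstoI)
      fix e :: real assume e: "0 < e"
      define b where "b = 1 - min (1 / 2) (e / 4)"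
      have b: "0 < b" "b < 1" "1 - e / 4 \<le> b" using e by (auto simp: b_def)
      have "b \<le> sqrt b" using b real_sqrt_le_mono[of "b * b" b] by (simp add: real_sqrt_mult)
      hence sb: "1 - e / 4 \<le> sqrt b" "sqrt b \<le> 1" using b by auto
      have w2: "0 \<le> w\<^sup>2" "w\<^sup>2 \<le> 1" using w by (auto intro: power_le_one)
      have "w\<^sup>2 - w\<^sup>2 * sqrt b = w\<^sup>2 * (1 - sqrt b)" by (simp add: algebra_simps)
      also have "\<dots> \<le> 1 * (e / 4)" using w2 sb by (intro mult_mono) auto
      finally have wb: "w\<^sup>2 - w\<^sup>2 * sqrt b \<le> e / 4" by simp
      have wb': "w\<^sup>2 * sqrt b \<le> w\<^sup>2" using w2 sb by (simp add: mult_left_le)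
      have e4: "0 < e / 4" using e by simp
      have "eventually (\<lambda>s. dist (exit_prob w (s powr b) s) (w\<^sup>2 * sqrt b) < e / 4) at_top"
        by (rule tendstoD[OF exit_prob_limit_interior[OF w b(1,2)] e4])
      moreover have "eventually (\<lambda>s. dist (exit_prob 1 (s powr b) s) (1\<^sup>2 * sqrt b) < e / 4) at_top"
        by (rule tendstoD[OF exit_prob_limit_interior[OF _ _ b(1,2)] e4]) auto
      ultimately show "eventually (\<lambda>s. dist (exit_prob w s s) (w\<^sup>2) < e) at_top"
        using eventually_ge_at_top[of "1::real"]
      proof eventually_elim
        case (elim s)
        have sbs: "s powr b \<le> s" using powr_mono[of b 1 s] elim b by simp
        have "exit_prob w (s powr b) s \<le> exit_prob w s s"
          using elim w sbs by (intro exit_prob_mono) auto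
        moreover have "exit_prob w s s - exit_prob w (s powr b) s \<le> 1 - exit_prob 1 (s powr b) s"
          using elim w sbs by (intro exit_prob_increment) auto
        ultimately show ?case
          using elim(1,2) wb wb' sb unfolding dist_real_def abs_less_iff by simp
      qed
    qed
    moreover have "eventually (\<lambda>s. exit_prob w s s = exit_prob w (s powr a) s) at_top"
      using eventually_ge_at_top[of "1::real"] by eventually_elim (simp add: 2)
    ultimately show ?thesis using 2 by (simp add: tendsto_cong)
  next
    case 3
    thus ?thesis by (rule exit_prob_limit_interior[OF w])
  qed
qed

section \<open>From random angles to the walk\<close>

lemma measurable_tan_real [measurable]: "(tan :: real \<Rightarrow> real) \<in> borel_measurable borel"
  unfolding tan_def[abs_def] by measurable

lemma nn_integral_angle_density_Iic:
  assumes "- pi / 2 < a" "a < pi / 2"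
  shows "(\<integral>\<^sup>+\<theta>. ennreal (angle_density \<theta>) * indicator {..a} \<theta> \<partial>lborel) = ennreal ((1 + sin a) / 2)"
proof -
  have "(\<integral>\<^sup>+\<theta>. ennreal (angle_density \<theta>) * indicator {..a} \<theta> \<partial>lborel) =
      (\<integral>\<^sup>+\<theta>. ennreal (cos \<theta> / 2) * indicator {- pi / 2..a} \<theta> \<partial>lborel)"
    by (rule nn_integral_cong_AE, rule AE_I[of _ _ "{- pi / 2}"])
      (use assms in \<open>auto simp: indicator_def angle_density_def\<close>)
  also have "\<dots> = ennreal (sin a / 2 - sin (- pi / 2) / 2)"
  proof (rule nn_integral_FTC_Icc[where F = "\<lambda>\<theta>. sin \<theta> / 2"])
    fix x assume x: "x \<in> {- pi / 2..a}"
    show "DERIV (\<lambda>\<theta>. sin \<theta> / 2) x :> cos x / 2" by (auto intro!: derivative_eq_intros)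
    show "0 \<le> cos x / 2" using x assms by (auto intro!: cos_ge_zero)
  qed (use assms in auto)
  also have "sin a / 2 - sin (- pi / 2) / 2 = (1 + sin a) / 2" by simp
  finally show ?thesis .
qed

text \<open>The random angles start at index 1, as the first segment of the ray belongs to \<open>\<Theta> 1\<close>.\<close>

locale angle_walk = prob_space M for M :: "'a measure" +
  fixes \<Theta> :: "nat \<Rightarrow> 'a \<Rightarrow> real"
  assumes indep: "indep_vars (\<lambda>_. borel) \<Theta> {1..}"
    and angle_distributed: "\<And>n. n \<ge> 1 \<Longrightarrow> distributed M lborel (\<Theta> n) (\<lambda>\<theta>. ennreal (angle_density \<theta>))"
begin

lemma measurable_angle [measurable]: "n \<ge> 1 \<Longrightarrow> \<Theta> n \<in> borel_measurable M"
  using distributed_measurable[OF angle_distributed] by simp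

text \<open>The distribution function of \<open>tan \<Theta>\<close> at \<open>x\<close> is that of \<open>\<Theta>\<close> at \<open>arctan x\<close>, and \<open>sin (arctan x) = x / sqrt (1 + x\<^sup>2)\<close>.\<close>

lemma distr_tan_angle:
  assumes "n \<ge> 1"
  shows "distr M borel (\<lambda>\<omega>. tan (\<Theta> n \<omega>)) = density lborel (\<lambda>x. ennreal (jump x))"
proof (rule cdf_unique')
  note [measurable] = measurable_angle[OF assms]
  show "finite_borel_measure (distr M borel (\<lambda>\<omega>. tan (\<Theta> n \<omega>)))"
    by (intro finite_borel_measure.intro finite_measure_distr finite_borel_measure_axioms.intro) auto
  show "finite_borel_measure (density lborel (\<lambda>x. ennreal (jump x)))"
    by (intro finite_borel_measure.intro finite_measureI finite_borel_measure_axioms.intro) (auto simp: emeasure_density)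
  show "cdf (distr M borel (\<lambda>\<omega>. tan (\<Theta> n \<omega>))) = cdf (density lborel (\<lambda>x. ennreal (jump x)))"
  proof
    fix x :: real
    have "emeasure (distr M borel (\<lambda>\<omega>. tan (\<Theta> n \<omega>))) {..x} = (\<integral>\<^sup>+\<omega>. indicator {..x} (tan (\<Theta> n \<omega>)) \<partial>M)"
    proof -
      have "(\<integral>\<^sup>+y. indicator {..x} y \<partial>distr M borel (\<lambda>\<omega>. tan (\<Theta> n \<omega>))) = (\<integral>\<^sup>+\<omega>. indicator {..x} (tan (\<Theta> n \<omega>)) \<partial>M)"
        by (rule nn_integral_distr) auto
      thus ?thesis by simp
    qed
    also have "\<dots> = (\<integral>\<^sup>+\<theta>. ennreal (angle_density \<theta>) * indicator {..x} (tan \<theta>) \<partial>lborel)"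
      by (rule distributed_nn_integral[symmetric, OF angle_distributed[OF assms]]) simp
    also have "\<dots> = (\<integral>\<^sup>+\<theta>. ennreal (angle_density \<theta>) * indicator {..arctan x} \<theta> \<partial>lborel)"
    proof (intro nn_integral_cong)
      fix \<theta> :: real
      have "tan \<theta> \<le> x \<longleftrightarrow> \<theta> \<le> arctan x" if "- pi / 2 < \<theta>" "\<theta> < pi / 2"
        using that by (metis arctan_le_iff arctan_tan minus_divide_left)
      thus "ennreal (angle_density \<theta>) * indicator {..x} (tan \<theta>) = ennreal (angle_density \<theta>) * indicator {..arctan x} \<theta>"
        by (cases "- pi / 2 < \<theta> \<and> \<theta> < pi / 2") (auto simp: angle_density_def indicator_def)
    qed
    also have "\<dots> = ennreal (jump_cdf x)"
      using arctan_bounded[of x] by (subst nn_integral_angle_density_Iic) (auto simp: jump_cdf_def sin_arctan)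
    also have "\<dots> = emeasure (density lborel (\<lambda>x. ennreal (jump x))) {..x}"
      by (subst emeasure_density) (auto simp: nn_integral_jump_Iic)
    finally show "cdf (distr M borel (\<lambda>\<omega>. tan (\<Theta> n \<omega>))) x = cdf (density lborel (\<lambda>x. ennreal (jump x))) x"
      by (simp add: cdf_def measure_def)
  qed
qed

abbreviation "S \<equiv> walk \<Theta>"

lemma measurable_walk [measurable]: "S n \<in> borel_measurable M"
proof (induction n)
  case (Suc n)
  have "\<Theta> (Suc n) \<in> borel_measurable M" by (rule measurable_angle) simp
  thus ?case using Suc unfolding walk.simps[abs_def] by measurable
qed (simp add: walk.simps[abs_def])

definition below :: "nat \<Rightarrow> real \<Rightarrow> 'a \<Rightarrow> ennreal" where
  "below n s \<omega> = (if \<forall>k\<in>{1..n}. S k \<omega> \<le> s then 1 else 0)"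

text \<open>The angle of step \<open>n + 1\<close> is independent of the first \<open>n\<close> angles, which determine the walk up to time \<open>n\<close>; so the
new displacement can be integrated out.\<close>

lemma below_step:
  assumes [measurable]: "(\<lambda>z. Q (fst z) (snd z)) \<in> borel_measurable (borel \<Otimes>\<^sub>M borel)"
  shows "(\<integral>\<^sup>+\<omega>. below n s \<omega> * Q (s - S n \<omega>) (tan (\<Theta> (Suc n) \<omega>)) \<partial>M) =
    (\<integral>\<^sup>+\<omega>. below n s \<omega> * (\<integral>\<^sup>+x. ennreal (jump x) * Q (s - S n \<omega>) x \<partial>lborel) \<partial>M)"
proof -
  let ?P = "PiM {1..n} (\<lambda>_. borel) :: (nat \<Rightarrow> real) measure"
  let ?P1 = "PiM {Suc n} (\<lambda>_. borel) :: (nat \<Rightarrow> real) measure"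
  let ?Y = "\<lambda>\<omega>. restrict (\<lambda>i. \<Theta> i \<omega>) {1..n}"
  let ?Z = "\<lambda>\<omega>. tan (\<Theta> (Suc n) \<omega>)"
  let ?R = "\<lambda>\<omega>. restrict (\<lambda>i. \<Theta> i \<omega>) {Suc n}"
  \<comment> \<open>The walk as a function of the finitely many angles used so far.\<close>
  define W where "W k y = walk (\<lambda>i y. y i) k y" for k and y :: "nat \<Rightarrow> real"
  have W: "S k \<omega> = W k (?Y \<omega>)" if "k \<le> n" for k \<omega>
    using that by (induction k) (auto simp: W_def)
  have Wm: "W k \<in> borel_measurable ?P" if "k \<le> n" for k
    using that
  proof (induction k)
    case (Suc k)
    have "(\<lambda>y. y (Suc k)) \<in> measurable ?P borel"
      using Suc.prems by (intro measurable_component_singleton) auto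
    thus ?case using Suc unfolding W_def[abs_def] by simp
  next
    case 0
    have "W 0 = (\<lambda>_. 0)" by (rule ext) (simp add: W_def)
    thus ?case by simp
  qed
  define B where "B y = (if \<forall>k\<in>{1..n}. W k y \<le> s then 1 else 0 :: ennreal)" for y
  have Bm [measurable]: "B \<in> borel_measurable ?P"
  proof -
    have "Measurable.pred ?P (\<lambda>y. \<forall>k\<in>{1..n}. W k y \<le> s)"
    proof (rule pred_intros_finite(3))
      fix k assume "k \<in> {1..n}"
      hence [measurable]: "W k \<in> borel_measurable ?P" by (intro Wm) simp
      show "Measurable.pred ?P (\<lambda>y. W k y \<le> s)" by measurable
    qed simp
    thus ?thesis unfolding B_def[abs_def] by measurable
  qed
  have [measurable]: "W n \<in> borel_measurable ?P" by (rule Wm) simp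
  have B: "below n s \<omega> = B (?Y \<omega>)" for \<omega>
    using W by (auto simp: below_def B_def)
  have "indep_var ?P ?Y ?P1 (\<lambda>\<omega>. restrict (\<lambda>i. \<Theta> i \<omega>) {Suc n})"
    by (rule indep_var_restrict[OF indep]) auto
  hence iv: "indep_var ?P ?Y ?P1 ?R" .
  hence Ym [measurable]: "?Y \<in> measurable M ?P" and Rm [measurable]: "?R \<in> measurable M ?P1"
    by (auto dest: indep_var_rv1 indep_var_rv2)
  have joint: "distr M (?P \<Otimes>\<^sub>M ?P1) (\<lambda>\<omega>. (?Y \<omega>, ?R \<omega>)) = distr M ?P ?Y \<Otimes>\<^sub>M distr M ?P1 ?R"
    using iv unfolding indep_var_distribution_eq by simp
  have last_m [measurable]: "(\<lambda>y. tan (y (Suc n))) \<in> borel_measurable ?P1"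
  proof -
    have "(\<lambda>y. y (Suc n)) \<in> measurable ?P1 borel" by (intro measurable_component_singleton) simp
    thus ?thesis by measurable
  qed
  have Zm [measurable]: "?Z \<in> borel_measurable M"
    using measurable_angle[of "Suc n"] by simp
  let ?G = "\<lambda>z. B (fst z) * Q (s - W n (fst z)) (tan (snd z (Suc n)))"
  have Gm: "?G \<in> borel_measurable (?P \<Otimes>\<^sub>M ?P1)"
  proof -
    have "(\<lambda>z. tan (snd z (Suc n))) \<in> borel_measurable (?P \<Otimes>\<^sub>M ?P1)"
      using measurable_compose[OF measurable_snd last_m] by simp
    hence "(\<lambda>z. Q (s - W n (fst z)) (tan (snd z (Suc n)))) \<in> borel_measurable (?P \<Otimes>\<^sub>M ?P1)"
    proof -
      assume snd_m: "(\<lambda>z. tan (snd z (Suc n))) \<in> borel_measurable (?P \<Otimes>\<^sub>M ?P1)"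
      have "(\<lambda>z. W n (fst z)) \<in> borel_measurable (?P \<Otimes>\<^sub>M ?P1)"
        by (rule measurable_compose[OF measurable_fst]) (rule Wm, simp)
      hence "(\<lambda>z. s - W n (fst z)) \<in> borel_measurable (?P \<Otimes>\<^sub>M ?P1)" by (intro borel_measurable_diff) simp_all
      hence "(\<lambda>z. (s - W n (fst z), tan (snd z (Suc n)))) \<in> measurable (?P \<Otimes>\<^sub>M ?P1) (borel \<Otimes>\<^sub>M borel)"
        using snd_m by (rule measurable_Pair)
      from measurable_compose[OF this assms] show ?thesis by (simp only: fst_conv snd_conv)
    qed
    thus ?thesis by measurable
  qed
  interpret D: prob_space "distr M ?P1 ?R" by (rule prob_space_distr) simp
  have Qm [measurable]: "Q u \<in> borel_measurable borel" for u
    using measurable_compose[OF measurable_Pair1' assms, of u] by simp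
  have last: "(\<integral>\<^sup>+r. Q u (tan (r (Suc n))) \<partial>distr M ?P1 ?R) = (\<integral>\<^sup>+x. ennreal (jump x) * Q u x \<partial>lborel)" for u
  proof -
    have "(\<integral>\<^sup>+r. Q u (tan (r (Suc n))) \<partial>distr M ?P1 ?R) = (\<integral>\<^sup>+\<omega>. Q u (?Z \<omega>) \<partial>M)"
      by (subst nn_integral_distr) simp_all
    also have "\<dots> = (\<integral>\<^sup>+x. Q u x \<partial>distr M borel ?Z)" by (rule nn_integral_distr[symmetric]) simp_all
    also have "\<dots> = (\<integral>\<^sup>+x. ennreal (jump x) * Q u x \<partial>lborel)"
      by (simp add: distr_tan_angle nn_integral_density)
    finally show ?thesis .
  qed
  have "(\<integral>\<^sup>+\<omega>. below n s \<omega> * Q (s - S n \<omega>) (?Z \<omega>) \<partial>M) = (\<integral>\<^sup>+\<omega>. ?G (?Y \<omega>, ?R \<omega>) \<partial>M)"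
    by (simp add: B W)
  also have "\<dots> = (\<integral>\<^sup>+z. ?G z \<partial>(distr M ?P ?Y \<Otimes>\<^sub>M distr M ?P1 ?R))"
    unfolding joint[symmetric] by (rule nn_integral_distr[symmetric]) (use Gm in measurable)
  also have "\<dots> = (\<integral>\<^sup>+y. \<integral>\<^sup>+r. ?G (y, r) \<partial>distr M ?P1 ?R \<partial>distr M ?P ?Y)"
    by (rule D.nn_integral_fst[symmetric])
      (use Gm in \<open>simp cong: measurable_cong_sets sets_pair_measure_cong\<close>)
  also have "\<dots> = (\<integral>\<^sup>+y. B y * (\<integral>\<^sup>+x. ennreal (jump x) * Q (s - W n y) x \<partial>lborel) \<partial>distr M ?P ?Y)"
    by (intro nn_integral_cong) (simp add: nn_integral_cmult last)
  also have "\<dots> = (\<integral>\<^sup>+\<omega>. B (?Y \<omega>) * (\<integral>\<^sup>+x. ennreal (jump x) * Q (s - W n (?Y \<omega>)) x \<partial>lborel) \<partial>M)"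
  proof (rule nn_integral_distr)
    have "(\<lambda>u. \<integral>\<^sup>+x. ennreal (jump x) * Q u x \<partial>lborel) \<in> borel_measurable borel"
      by (rule lborel.borel_measurable_nn_integral) (use assms in \<open>simp add: split_beta'\<close>)
    moreover have "(\<lambda>y. s - W n y) \<in> borel_measurable ?P" using Wm[of n] by (intro borel_measurable_diff) simp_all
    ultimately have "(\<lambda>y. \<integral>\<^sup>+x. ennreal (jump x) * Q (s - W n y) x \<partial>lborel) \<in> borel_measurable ?P"
      by (rule measurable_compose[rotated])
    thus "(\<lambda>y. B y * (\<integral>\<^sup>+x. ennreal (jump x) * Q (s - W n y) x \<partial>lborel)) \<in> borel_measurable (distr M ?P ?Y)"
      using Bm by (simp only: measurable_distr_eq1) (rule borel_measurable_times_ennreal)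
  qed simp
  finally show ?thesis by (simp add: B W)
qed

text \<open>This identifies the probabilistic walk with the analytic kernel. Since \<open>below_step\<close> splits off the last step, the
induction generalises over the function \<open>\<phi>\<close>.\<close>

lemma expectation_below:
  assumes [measurable]: "\<phi> \<in> borel_measurable borel" and "0 \<le> s"
  shows "(\<integral>\<^sup>+\<omega>. below n s \<omega> * \<phi> (s - S n \<omega>) \<partial>M) = (kill_step ^^ n) \<phi> s"
  using assms(1)
proof (induction n arbitrary: \<phi>)
  case 0
  show ?case by (simp add: below_def emeasure_space_1)
next
  case (Suc n)
  note [measurable] = Suc.prems
  have "(\<integral>\<^sup>+\<omega>. below (Suc n) s \<omega> * \<phi> (s - S (Suc n) \<omega>) \<partial>M) =
    (\<integral>\<^sup>+\<omega>. below n s \<omega> * (indicator {0..} (s - S n \<omega> - tan (\<Theta> (Suc n) \<omega>)) * \<phi> (s - S n \<omega> - tan (\<Theta> (Suc n) \<omega>))) \<partial>M)"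
  proof (intro nn_integral_cong)
    fix \<omega>
    have "below (Suc n) s \<omega> = below n s \<omega> * indicator {0..} (s - S (Suc n) \<omega>)"
      by (simp add: below_def indicator_def atLeastAtMostSuc_conv del: walk.simps)
    thus "below (Suc n) s \<omega> * \<phi> (s - S (Suc n) \<omega>) = below n s \<omega> *
      (indicator {0..} (s - S n \<omega> - tan (\<Theta> (Suc n) \<omega>)) * \<phi> (s - S n \<omega> - tan (\<Theta> (Suc n) \<omega>)))"
      by (simp add: algebra_simps)
  qed
  also have "\<dots> = (\<integral>\<^sup>+\<omega>. below n s \<omega> * (\<integral>\<^sup>+x. ennreal (jump x) * (indicator {0..} (s - S n \<omega> - x) * \<phi> (s - S n \<omega> - x)) \<partial>lborel) \<partial>M)"
    by (rule below_step) simp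
  also have "(\<lambda>u. \<integral>\<^sup>+x. ennreal (jump x) * (indicator {0..} (u - x) * \<phi> (u - x)) \<partial>lborel) = kill_step \<phi>"
  proof
    fix u
    have "kill_step \<phi> u = (\<integral>\<^sup>+x. indicator {0..} (u - x) * (ennreal (jump (u - (u - x))) * \<phi> (u - x)) \<partial>lborel)"
      unfolding kill_step_def by (rule nn_integral_reflect[symmetric]) simp
    thus "(\<integral>\<^sup>+x. ennreal (jump x) * (indicator {0..} (u - x) * \<phi> (u - x)) \<partial>lborel) = kill_step \<phi> u"
      by (simp add: mult_ac)
  qed
  hence "(\<integral>\<^sup>+\<omega>. below n s \<omega> * (\<integral>\<^sup>+x. ennreal (jump x) * (indicator {0..} (s - S n \<omega> - x) * \<phi> (s - S n \<omega> - x)) \<partial>lborel) \<partial>M) =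
     (\<integral>\<^sup>+\<omega>. below n s \<omega> * kill_step \<phi> (s - S n \<omega>) \<partial>M)"
    by (simp only: fun_eq_iff)
  also have "\<dots> = (kill_step ^^ n) (kill_step \<phi>) s" by (rule Suc.IH) simp
  finally show ?case by (simp add: funpow_swap1)
qed

end

section \<open>The geometry of the last segment\<close>

text \<open>The last segment is the one with index \<open>n + 1\<close>, and \<open>n\<close> earlier crossings end short of the edge. Unlike an equation
for the passage time, this condition excludes the paths that never pass the level.\<close>

definition first_passage_at :: "(nat \<Rightarrow> 'a \<Rightarrow> real) \<Rightarrow> real \<Rightarrow> nat \<Rightarrow> 'a \<Rightarrow> bool" where
  "first_passage_at \<Theta> s n \<omega> \<longleftrightarrow> (\<forall>k\<in>{1..n}. walk \<Theta> k \<omega> \<le> s) \<and> s < walk \<Theta> (Suc n) \<omega>"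

lemma passage_time_eq:
  assumes "first_passage_at \<Theta> s n \<omega>" shows "passage_time \<Theta> s \<omega> = Suc n"
  unfolding passage_time_def
proof (rule cInf_eq_minimum)
  fix k assume k: "k \<in> {n. 0 < n \<and> s < walk \<Theta> n \<omega>}"
  show "Suc n \<le> k"
  proof (rule ccontr)
    assume "\<not> Suc n \<le> k"
    hence "k \<in> {1..n}" using k by auto
    with assms have "walk \<Theta> k \<omega> \<le> s" unfolding first_passage_at_def by blast
    thus False using k by simp
  qed
qed (use assms in \<open>simp add: first_passage_at_def\<close>)

lemma first_passage_at_unique:
  "first_passage_at \<Theta> s n \<omega> \<Longrightarrow> first_passage_at \<Theta> s m \<omega> \<Longrightarrow> n = m"
  using passage_time_eq[of \<Theta> s n \<omega>] passage_time_eq[of \<Theta> s m \<omega>] by simp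

lemma first_passage_at_exists:
  assumes "0 < k" "s < walk \<Theta> k \<omega>" shows "\<exists>n. first_passage_at \<Theta> s n \<omega>"
proof -
  define m where "m = (LEAST k. 0 < k \<and> s < walk \<Theta> k \<omega>)"
  have m: "0 < m \<and> s < walk \<Theta> m \<omega>" unfolding m_def by (rule LeastI[of _ k]) (use assms in simp)
  have "walk \<Theta> i \<omega> \<le> s" if "0 < i" "i < m" for i
    using not_less_Least[of i "\<lambda>k. 0 < k \<and> s < walk \<Theta> k \<omega>"] that by (simp add: m_def[symmetric])
  moreover obtain n where "m = Suc n" using m by (cases m) auto
  ultimately have "first_passage_at \<Theta> s n \<omega>" using m by (simp add: first_passage_at_def del: walk.simps)
  thus ?thesis ..
qed

lemma first_passage_at_bounds:
  assumes "first_passage_at \<Theta> s n \<omega>" "0 \<le> s"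
  shows "0 \<le> s - walk \<Theta> n \<omega>" "s - walk \<Theta> n \<omega> < tan (\<Theta> (Suc n) \<omega>)"
proof -
  have "walk \<Theta> n \<omega> \<le> s"
  proof (cases "n = 0")
    case False
    hence "n \<in> {1..n}" by simp
    thus ?thesis using assms(1) unfolding first_passage_at_def by blast
  qed (use assms(2) in simp)
  thus "0 \<le> s - walk \<Theta> n \<omega>" by simp
  show "s - walk \<Theta> n \<omega> < tan (\<Theta> (Suc n) \<omega>)"
    using assms(1) by (simp add: first_passage_at_def algebra_simps)
qed

lemma exit_angle_eq:
  assumes N: "passage_time \<Theta> s \<omega> = Suc n" and "0 < tan (\<Theta> (Suc n) \<omega>)"
  shows "exit_angle \<Theta> s \<omega> = (if even n then 1 else - 1) * arctan (1 / tan (\<Theta> (Suc n) \<omega>))"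
proof -
  let ?x = "tan (\<Theta> (Suc n) \<omega>)"
  have "exit_angle \<Theta> s \<omega> = Arg (Complex ?x (if even n then 1 else - 1))"
    by (simp add: exit_angle_def Let_def N ray_vertex_def)
  also have "\<dots> = arctan ((if even n then 1 else - 1) / ?x)"
    using assms(2) by (subst arg_conv_arctan) auto
  finally show ?thesis by (simp add: arctan_minus)
qed

lemma cot_exit_angle:
  assumes "passage_time \<Theta> s \<omega> = Suc n" "0 < tan (\<Theta> (Suc n) \<omega>)"
  shows "cot \<bar>exit_angle \<Theta> s \<omega>\<bar> = tan (\<Theta> (Suc n) \<omega>)"
proof -
  have "cot (arctan y) = inverse y" for y :: real
    by (metis cot_altdef tan_arctan)
  moreover have "\<bar>exit_angle \<Theta> s \<omega>\<bar> = arctan (1 / tan (\<Theta> (Suc n) \<omega>))"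
    using assms(2) by (simp add: exit_angle_eq[OF assms] abs_mult)
  ultimately show ?thesis by simp
qed

lemma exit_angle_sign:
  assumes "passage_time \<Theta> s \<omega> = Suc n" "0 < tan (\<Theta> (Suc n) \<omega>)"
  shows "0 < exit_angle \<Theta> s \<omega> \<longleftrightarrow> even n" "exit_angle \<Theta> s \<omega> < 0 \<longleftrightarrow> odd n"
  using assms(2) by (auto simp: exit_angle_eq[OF assms])

lemma exit_log_ratio_le_iff:
  assumes "passage_time \<Theta> s \<omega> = Suc n" "0 < tan (\<Theta> (Suc n) \<omega>)" "1 < s" "0 \<le> t"
  shows "exit_log_ratio \<Theta> s \<omega> \<le> t \<longleftrightarrow> tan (\<Theta> (Suc n) \<omega>) \<le> s powr t\<^sup>2"
proof -
  let ?x = "tan (\<Theta> (Suc n) \<omega>)"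
  have "exit_log_ratio \<Theta> s \<omega> \<le> t \<longleftrightarrow> sqrt (max 0 (ln ?x / ln s)) \<le> sqrt (t\<^sup>2)"
    using assms(4) by (simp add: exit_log_ratio_def cot_exit_angle[OF assms(1,2)])
  also have "\<dots> \<longleftrightarrow> ln ?x \<le> t\<^sup>2 * ln s"
    using assms(3) by (simp only: real_sqrt_le_iff) (simp add: field_simps)
  also have "\<dots> \<longleftrightarrow> ?x \<le> s powr t\<^sup>2"
    using assms(2,3) by (metis exp_ln ln_exp ln_le_cancel_iff powr_def exp_gt_zero less_trans zero_less_one less_irrefl)
  finally show ?thesis .
qed

lemma exit_height_eq:
  assumes fp: "first_passage_at \<Theta> s n \<omega>" and "0 \<le> s"
  defines "r \<equiv> (s - walk \<Theta> n \<omega>) / tan (\<Theta> (Suc n) \<omega>)"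
  shows "exit_height \<Theta> s \<omega> = (if even n then r else 1 - r)"
proof -
  let ?x = "tan (\<Theta> (Suc n) \<omega>)" and ?u = "s - walk \<Theta> n \<omega>"
  note N = passage_time_eq[OF fp]
  have "0 \<le> ?u" and "?u < ?x" using first_passage_at_bounds[OF fp \<open>0 \<le> s\<close>] .
  hence x: "0 < ?x" and r: "0 \<le> r" "r \<le> 1" "r * ?x = ?u" by (auto simp: r_def)
  let ?h = "if even n then r else 1 - r"
  have "(0, y) \<in> closed_segment (ray_vertex \<Theta> s \<omega> n) (ray_vertex \<Theta> s \<omega> (Suc n)) \<inter> {0} \<times> {0..1} \<longleftrightarrow> y = ?h" for y
  proof -
    have "(\<exists>c. (0 = (1 - c) *\<^sub>R - ?u + c *\<^sub>R (?x - ?u) \<and>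
          y = (1 - c) *\<^sub>R ((1 - (- 1) ^ n) / 2) + c *\<^sub>R ((1 + (- 1) ^ n) / 2)) \<and> 0 \<le> c \<and> c \<le> 1) \<longleftrightarrow> y = ?h"
    proof -
      have "0 = (1 - c) *\<^sub>R - ?u + c *\<^sub>R (?x - ?u) \<longleftrightarrow> c = r" for c
      proof -
        have "(1 - c) *\<^sub>R - ?u + c *\<^sub>R (?x - ?u) = (c - r) * ?x" by (simp add: algebra_simps r(3)[symmetric])
        thus ?thesis using x by auto
      qed
      thus ?thesis using r by auto
    qed
    moreover have "y \<in> {0..1}" if "y = ?h" using that r by auto
    ultimately show ?thesis
      by (auto simp: in_segment ray_vertex_def algebra_simps)
  qed
  thus ?thesis unfolding exit_height_def Let_def N by simp
qed

text \<open>A segment in the left half-plane meets the vertical axis only in an endpoint, unless it lies in that axis. This describes the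
exit height when the level is never passed.\<close>

lemma degenerate_segment_iff:
  fixes a b p q y :: real
  assumes "a \<le> 0" "b \<le> 0"
  shows "(0, y) \<in> closed_segment (a, p) (b, q) \<longleftrightarrow>
    (\<exists>c. 0 \<le> c \<and> c \<le> 1 \<and> (c = 1 \<or> a = 0) \<and> (c = 0 \<or> b = 0) \<and> y = (1 - c) * p + c * q)"
proof -
  have "0 = (1 - c) * a + c * b \<longleftrightarrow> (c = 1 \<or> a = 0) \<and> (c = 0 \<or> b = 0)" if "0 \<le> c" "c \<le> 1" for c
  proof -
    have "(1 - c) * a \<le> 0" "c * b \<le> 0" using that assms by (auto intro!: mult_nonneg_nonpos)
    hence "0 = (1 - c) * a + c * b \<longleftrightarrow> (1 - c) * a = 0 \<and> c * b = 0" by linarith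
    thus ?thesis by auto
  qed
  thus ?thesis by (auto simp: in_segment)
qed

context angle_walk
begin

lemma measurable_first_passage_at [measurable]: "Measurable.pred M (first_passage_at \<Theta> s n)"
  unfolding first_passage_at_def[abs_def] by measurable

lemma first_passage_at_region:
  fixes n :: nat
  assumes P [measurable]: "Measurable.pred (borel \<Otimes>\<^sub>M borel) (\<lambda>z. P (fst z) (snd z))" and "0 \<le> s"
  defines "A \<equiv> {\<omega> \<in> space M. first_passage_at \<Theta> s n \<omega> \<and> P (s - S n \<omega>) (tan (\<Theta> (Suc n) \<omega>))}"
  shows "A \<in> sets M"
    and "emeasure M A = (kill_step ^^ n) (\<lambda>u. \<integral>\<^sup>+x. ennreal (jump x) * indicator {x. u < x \<and> P u x} x \<partial>lborel) s"
proof -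
  let ?Q = "\<lambda>u x. indicator {x. u < x \<and> P u x} x :: ennreal"
  have [measurable]: "\<Theta> (Suc n) \<in> borel_measurable M" by (rule measurable_angle) simp
  have "(\<lambda>\<omega>. (s - S n \<omega>, tan (\<Theta> (Suc n) \<omega>))) \<in> measurable M (borel \<Otimes>\<^sub>M borel)" by measurable
  from measurable_compose[OF this P]
  have [measurable]: "Measurable.pred M (\<lambda>\<omega>. P (s - S n \<omega>) (tan (\<Theta> (Suc n) \<omega>)))" by simp
  show A [measurable]: "A \<in> sets M" unfolding A_def by measurable
  have Qm: "(\<lambda>z. ?Q (fst z) (snd z)) \<in> borel_measurable (borel \<Otimes>\<^sub>M borel)"
    unfolding indicator_def by measurable
  have "emeasure M A = (\<integral>\<^sup>+\<omega>. indicator A \<omega> \<partial>M)" by simp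
  also have "\<dots> = (\<integral>\<^sup>+\<omega>. below n s \<omega> * ?Q (s - S n \<omega>) (tan (\<Theta> (Suc n) \<omega>)) \<partial>M)"
    by (intro nn_integral_cong) (auto simp: indicator_def A_def below_def first_passage_at_def)
  also have "\<dots> = (\<integral>\<^sup>+\<omega>. below n s \<omega> * (\<integral>\<^sup>+x. ennreal (jump x) * ?Q (s - S n \<omega>) x \<partial>lborel) \<partial>M)"
    using Qm by (rule below_step)
  also have "\<dots> = (kill_step ^^ n) (\<lambda>u. \<integral>\<^sup>+x. ennreal (jump x) * ?Q u x \<partial>lborel) s"
  proof (rule expectation_below)
    show "(\<lambda>u. \<integral>\<^sup>+x. ennreal (jump x) * ?Q u x \<partial>lborel) \<in> borel_measurable borel"
      by (rule lborel.borel_measurable_nn_integral) (use Qm in \<open>simp add: split_beta'\<close>)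
  qed fact
  finally show "emeasure M A = (kill_step ^^ n) (\<lambda>u. \<integral>\<^sup>+x. ennreal (jump x) * ?Q u x \<partial>lborel) s" .
qed

text \<open>The law of the pair of the distance before the last step and the last displacement, jointly with the number of
steps.\<close>

lemma first_passage_region_UN:
  fixes f :: "nat \<Rightarrow> nat"
  assumes P: "Measurable.pred (borel \<Otimes>\<^sub>M borel) (\<lambda>z. P (fst z) (snd z))" and "0 \<le> s" and "inj f"
  defines "A \<equiv> \<lambda>n. {\<omega> \<in> space M. first_passage_at \<Theta> s n \<omega> \<and> P (s - S n \<omega>) (tan (\<Theta> (Suc n) \<omega>))}"
  shows "emeasure M (\<Union>k. A (f k)) =
    (\<Sum>k. (kill_step ^^ f k) (\<lambda>u. \<integral>\<^sup>+x. ennreal (jump x) * indicator {x. u < x \<and> P u x} x \<partial>lborel) s)"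
proof -
  have "disjoint_family (\<lambda>k. A (f k))"
    unfolding disjoint_family_on_def
  proof (intro ballI impI)
    fix k l :: nat assume "k \<noteq> l"
    hence "f k \<noteq> f l" using \<open>inj f\<close> by (auto dest: injD)
    thus "A (f k) \<inter> A (f l) = {}" unfolding A_def using first_passage_at_unique[of \<Theta> s "f k" _ "f l"] by auto
  qed
  hence "emeasure M (\<Union>k. A (f k)) = (\<Sum>k. emeasure M (A (f k)))"
    using first_passage_at_region(1)[OF P \<open>0 \<le> s\<close>] by (intro suminf_emeasure[symmetric]) (auto simp: A_def)
  thus ?thesis unfolding A_def using first_passage_at_region(2)[OF P \<open>0 \<le> s\<close>] by simp
qed

text \<open>The probabilities of the disjoint events \<open>first_passage_at \<Theta> s n\<close> add up to 1 by \<open>passage_certain\<close>.\<close>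

lemma never_exits_null:
  assumes "0 \<le> s"
  shows "emeasure M {\<omega> \<in> space M. \<forall>k>0. S k \<omega> \<le> s} = 0"
proof -
  let ?A = "\<lambda>n. {\<omega> \<in> space M. first_passage_at \<Theta> s n \<omega> \<and> True}"
  have "emeasure M (\<Union>n. ?A n) = (\<Sum>n. (kill_step ^^ n) (\<lambda>u. \<integral>\<^sup>+x. ennreal (jump x) * indicator {x. u < x \<and> True} x \<partial>lborel) s)"
    using first_passage_region_UN[of "\<lambda>_ _. True" s "\<lambda>n. n"] assms by simp
  also have "\<dots> = (\<Sum>n. exit_mass n s)"
  proof (rule suminf_cong)
    fix n
    have "(\<integral>\<^sup>+x. ennreal (jump x) * indicator {x. u < x \<and> True} x \<partial>lborel) = exit_mass 0 u" for u
    proof -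
      have "exit_mass 0 u = (\<integral>\<^sup>+x. indicator {..<0} (u - x) * ennreal (jump (u - (u - x))) \<partial>lborel)"
        unfolding exit_mass_def kern.simps by (rule nn_integral_reflect[symmetric]) simp
      also have "\<dots> = (\<integral>\<^sup>+x. ennreal (jump x) * indicator {x. u < x \<and> True} x \<partial>lborel)"
        by (intro nn_integral_cong) (simp add: indicator_def)
      finally show ?thesis by simp
    qed
    thus "(kill_step ^^ n) (\<lambda>u. \<integral>\<^sup>+x. ennreal (jump x) * indicator {x. u < x \<and> True} x \<partial>lborel) s = exit_mass n s"
      by (simp only: exit_mass_funpow[of n])
  qed
  also have "\<dots> = 1" by (rule passage_certain[OF assms])
  finally have *: "emeasure M (\<Union>n. ?A n) = 1" .
  have [measurable]: "?A n \<in> sets M" for n by measurable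
  have "{\<omega> \<in> space M. \<forall>k>0. S k \<omega> \<le> s} \<subseteq> space M - (\<Union>n. ?A n)"
  proof safe
    fix \<omega> n assume "\<forall>k>0. S k \<omega> \<le> s" "first_passage_at \<Theta> s n \<omega>"
    hence "S (Suc n) \<omega> \<le> s" "s < S (Suc n) \<omega>" unfolding first_passage_at_def by blast+
    thus False by simp
  qed
  hence "emeasure M {\<omega> \<in> space M. \<forall>k>0. S k \<omega> \<le> s} \<le> emeasure M (space M - (\<Union>n. ?A n))"
    by (rule emeasure_mono) measurable
  also have "\<dots> = emeasure M (space M) - emeasure M (\<Union>n. ?A n)"
    by (rule emeasure_compl) (auto simp: emeasure_finite)
  also have "\<dots> = 0" by (simp only: * emeasure_space_1) simp
  finally show ?thesis by simp
qed

end

section \<open>Splitting by the parity of the number of crossings\<close>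

lemma kill_step_add:
  assumes [measurable]: "\<phi> \<in> borel_measurable borel" "\<psi> \<in> borel_measurable borel"
  shows "kill_step (\<lambda>u. \<phi> u + \<psi> u) = (\<lambda>u. kill_step \<phi> u + kill_step \<psi> u)"
  unfolding kill_step_def by (rule ext, subst nn_integral_add[symmetric]) (simp_all add: distrib_left)

lemma even_sum_add:
  assumes [measurable]: "\<phi> \<in> borel_measurable borel" "\<psi> \<in> borel_measurable borel"
  shows "even_sum (\<lambda>u. \<phi> u + \<psi> u) s = even_sum \<phi> s + even_sum \<psi> s"
proof -
  have "(kill_step ^^ n) (\<lambda>u. \<phi> u + \<psi> u) = (\<lambda>u. (kill_step ^^ n) \<phi> u + (kill_step ^^ n) \<psi> u)" for n
  proof (induction n)
    case (Suc n)
    show ?case unfolding funpow.simps o_apply Suc by (rule kill_step_add) simp_all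
  qed simp
  thus ?thesis by (simp add: even_sum_def suminf_add)
qed

text \<open>The even and the odd part add up to \<open>exit_prob\<close> and become equal by \<open>parity_balance\<close>, so each is asymptotically one
half.\<close>

lemma exit_probability_by_parity:
  assumes w: "0 \<le> w" "w \<le> 1" and a: "0 \<le> a" "a \<le> 1"
  shows "((\<lambda>s. enn2real (even_sum (exit_profile {0<..s powr a} w) s)) \<longlongrightarrow> w\<^sup>2 * sqrt a / 2) at_top"
    and "((\<lambda>s. enn2real (even_sum (kill_step (exit_profile {0<..s powr a} w)) s)) \<longlongrightarrow> w\<^sup>2 * sqrt a / 2) at_top"
proof -
  define e where "e s = enn2real (even_sum (exit_profile {0<..s powr a} w) s)" for s
  define d where "d s = enn2real (even_sum (kill_step (exit_profile {0<..s powr a} w)) s)" for s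
  have ed: "even_sum (exit_profile {0<..s powr a} w) s = ennreal (e s)"
    "even_sum (kill_step (exit_profile {0<..s powr a} w)) s = ennreal (d s)"
    "e s + d s = exit_prob w (s powr a) s" if "0 \<le> s" for s
  proof -
    have "even_sum (exit_profile {0<..s powr a} w) s + even_sum (kill_step (exit_profile {0<..s powr a} w)) s
      = ennreal (exit_prob w (s powr a) s)"
      using hit_even_odd[of "{0<..s powr a}" w s] hit_eq_exit_prob[OF that w(2)] by simp
    hence *: "even_sum (exit_profile {0<..s powr a} w) s < top" "even_sum (kill_step (exit_profile {0<..s powr a} w)) s < top"
      by (metis ennreal_add_eq_top ennreal_neq_top less_top)+
    thus 1: "even_sum (exit_profile {0<..s powr a} w) s = ennreal (e s)"
      "even_sum (kill_step (exit_profile {0<..s powr a} w)) s = ennreal (d s)"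
      by (auto simp: e_def d_def)
    show "e s + d s = exit_prob w (s powr a) s"
      unfolding e_def d_def exit_prob_def by (subst hit_even_odd) (simp_all add: enn2real_plus *)
  qed
  have pos: "0 \<le> e s" "0 \<le> d s" for s by (auto simp: e_def d_def)
  have "((\<lambda>s. e s - d s) \<longlongrightarrow> 0) at_top"
  proof (rule tendstoI)
    fix \<epsilon> :: real assume \<epsilon>: "0 < \<epsilon>"
    hence "0 < \<epsilon> / 2" by simp
    then obtain s0 where s0: "0 \<le> s0" and bal:
      "\<And>s \<psi>. s0 \<le> s \<Longrightarrow> \<psi> \<in> borel_measurable borel \<Longrightarrow> (\<And>y. 0 \<le> y \<Longrightarrow> \<psi> y \<le> exit_mass 0 y) \<Longrightarrow>
       even_sum (kill_step \<psi>) s \<le> even_sum \<psi> s + ennreal (\<epsilon> / 2) \<and> even_sum \<psi> s \<le> even_sum (kill_step \<psi>) s + ennreal (\<epsilon> / 2)"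
      by (rule parity_balance) blast
    show "\<forall>\<^sub>F s in at_top. dist (e s - d s) 0 < \<epsilon>"
      using eventually_ge_at_top[of s0]
    proof eventually_elim
      fix s assume s: "s0 \<le> s"
      have "ennreal (d s) \<le> ennreal (e s) + ennreal (\<epsilon> / 2) \<and> ennreal (e s) \<le> ennreal (d s) + ennreal (\<epsilon> / 2)"
        using bal[OF s, of "exit_profile {0<..s powr a} w"] s s0 w
        by (simp add: ed(1,2) exit_profile_le greaterThanAtMost_subset_greaterThan)
      hence "d s \<le> e s + \<epsilon> / 2 \<and> e s \<le> d s + \<epsilon> / 2"
        using pos[of s] \<epsilon> by (simp add: ennreal_plus[symmetric] del: ennreal_plus)
      thus "dist (e s - d s) 0 < \<epsilon>" using \<epsilon> by (auto simp: dist_real_def)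
    qed
  qed
  moreover have "((\<lambda>s. e s + d s) \<longlongrightarrow> w\<^sup>2 * sqrt a) at_top"
    by (rule Lim_transform_eventually[OF exit_prob_limit[OF w a]])
      (use eventually_ge_at_top[of 0] in eventually_elim, simp add: ed(3))
  ultimately have "((\<lambda>s. ((e s + d s) + (e s - d s)) / 2) \<longlongrightarrow> (w\<^sup>2 * sqrt a + 0) / 2) at_top"
    "((\<lambda>s. ((e s + d s) - (e s - d s)) / 2) \<longlongrightarrow> (w\<^sup>2 * sqrt a - 0) / 2) at_top"
    by (intro tendsto_intros; simp)+
  thus "(e \<longlongrightarrow> w\<^sup>2 * sqrt a / 2) at_top" "(d \<longlongrightarrow> w\<^sup>2 * sqrt a / 2) at_top" by simp_all
qed

text \<open>The probability that the next step from distance \<open>u\<close> leaves the strip with a displacement at most \<open>T\<close> and hits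
the edge at height at most \<open>v\<close>, when that step goes upward and, in the second definition, downward.\<close>

definition rising_profile :: "real \<Rightarrow> real \<Rightarrow> real \<Rightarrow> ennreal" where
  "rising_profile T v u = (\<integral>\<^sup>+x. ennreal (jump x) * indicator {x. u < x \<and> x \<le> T \<and> u \<le> v * x} x \<partial>lborel)"

definition falling_profile :: "real \<Rightarrow> real \<Rightarrow> real \<Rightarrow> ennreal" where
  "falling_profile T v u = (\<integral>\<^sup>+x. ennreal (jump x) * indicator {x. u < x \<and> x \<le> T \<and> (1 - v) * x \<le> u} x \<partial>lborel)"

lemma measurable_falling_profile [measurable]: "falling_profile T v \<in> borel_measurable borel"
  unfolding falling_profile_def[abs_def] indicator_def by measurable

lemma rising_profile_eq:
  assumes "0 \<le> u" "v \<le> 1" shows "rising_profile T v u = exit_profile {0<..T} v u"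
  unfolding rising_profile_def exit_profile_def
proof (rule nn_integral_cong_AE, rule AE_I[of _ _ "{u}"])
  have "ennreal (jump x) * indicator {x. u < x \<and> x \<le> T \<and> u \<le> v * x} x =
    indicator {0<..T} x * ennreal (jump x) * indicator {0..} (v * x - u)" if "x \<noteq> u" for x
  proof (cases "0 < x")
    case True
    with assms have "v * x \<le> x" by simp
    hence "u < x" if "u \<le> v * x" using that \<open>x \<noteq> u\<close> by linarith
    thus ?thesis using True by (cases "u \<le> v * x") (auto simp: indicator_def)
  qed (use assms in \<open>auto simp: indicator_def\<close>)
  thus "{x \<in> space lborel. ennreal (jump x) * indicator {x. u < x \<and> x \<le> T \<and> u \<le> v * x} x \<noteq>
    indicator {0<..T} x * ennreal (jump x) * indicator {0..} (v * x - u)} \<subseteq> {u}" by blast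
qed auto

text \<open>The conditions \<open>(1 - v) x \<le> u\<close> and \<open>u \<le> (1 - v) x\<close> are complementary up to one value of \<open>x\<close>. For \<open>u = 0\<close>
and \<open>v = 1\<close> both hold for all \<open>x\<close>, hence the assumption \<open>0 < u\<close>.\<close>

lemma falling_profile_add:
  assumes "0 < u" "0 \<le> v"
  shows "falling_profile T v u + exit_profile {0<..T} (1 - v) u = exit_profile {0<..T} 1 u"
proof -
  let ?F = "\<lambda>x. ennreal (jump x) * indicator {x. u < x \<and> x \<le> T \<and> (1 - v) * x \<le> u} x"
  let ?E = "\<lambda>w x. indicator {0<..T} x * ennreal (jump x) * indicator {0..} (w * x - u)"
  have "falling_profile T v u + exit_profile {0<..T} (1 - v) u = (\<integral>\<^sup>+x. ?F x + ?E (1 - v) x \<partial>lborel)"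
    unfolding falling_profile_def exit_profile_def by (rule nn_integral_add[symmetric]) simp_all
  also have "\<dots> = (\<integral>\<^sup>+x. ?E 1 x \<partial>lborel)"
  proof (rule nn_integral_cong_AE, rule AE_I[of _ _ "{u, u / (1 - v)}"])
    have "?F x + ?E (1 - v) x = ?E 1 x" if "x \<noteq> u" "x \<noteq> u / (1 - v)" for x
    proof (cases "0 < x")
      case True
      hence "(1 - v) * x \<le> x" using assms by (simp add: algebra_simps)
      hence "u \<le> x" if "u \<le> (1 - v) * x" using that by linarith
      moreover have "(1 - v) * x \<noteq> u"
      proof
        assume "(1 - v) * x = u"
        with assms(1) have "1 - v \<noteq> 0" "x * (1 - v) = u" by (auto simp: mult.commute)
        hence "x = u / (1 - v)" by (simp only: nonzero_eq_divide_eq simp_thms)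
        thus False using that(2) by simp
      qed
      ultimately show ?thesis using that(1) True by (auto simp: indicator_def)
    qed (use assms in \<open>auto simp: indicator_def\<close>)
    thus "{x \<in> space lborel. ?F x + ?E (1 - v) x \<noteq> ?E 1 x} \<subseteq> {u, u / (1 - v)}" by blast
  qed (auto simp: emeasure_lborel_countable)
  finally show ?thesis by (simp add: exit_profile_def)
qed

text \<open>After at least one step the distance is almost surely nonzero, so the exceptional case \<open>u = 0\<close> of
\<open>falling_profile_add\<close> does not matter for downward exits.\<close>

lemma kill_step_cong_pos:
  assumes "\<And>y. 0 < y \<Longrightarrow> \<phi> y = \<psi> y" shows "kill_step \<phi> = kill_step \<psi>"
proof
  fix s
  show "kill_step \<phi> s = kill_step \<psi> s"
    unfolding kill_step_def
  proof (rule nn_integral_cong_AE, rule AE_I[of _ _ "{0}"])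
    have "indicator {0..} y * (ennreal (jump (s - y)) * \<phi> y) = indicator {0..} y * (ennreal (jump (s - y)) * \<psi> y)"
      if "y \<noteq> 0" for y
      using assms[of y] that by (cases "0 < y") (simp_all add: indicator_def)
    thus "{y \<in> space lborel. indicator {0..} y * (ennreal (jump (s - y)) * \<phi> y) \<noteq>
      indicator {0..} y * (ennreal (jump (s - y)) * \<psi> y)} \<subseteq> {0}" by blast
  qed auto
qed

lemma rising_limit:
  assumes "0 \<le> v" "v \<le> 1" "0 \<le> t" "t \<le> 1"
  shows "((\<lambda>s. enn2real (even_sum (rising_profile (s powr t\<^sup>2) v) s)) \<longlongrightarrow> t * v\<^sup>2 / 2) at_top"
proof (rule Lim_transform_eventually)
  have "t\<^sup>2 \<le> 1" using assms by (simp add: power_le_one)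
  from exit_probability_by_parity(1)[OF assms(1,2) _ this]
  show "((\<lambda>s. enn2real (even_sum (exit_profile {0<..s powr t\<^sup>2} v) s)) \<longlongrightarrow> t * v\<^sup>2 / 2) at_top"
    using assms(3) by (simp add: mult.commute)
  show "\<forall>\<^sub>F s in at_top. enn2real (even_sum (exit_profile {0<..s powr t\<^sup>2} v) s) =
    enn2real (even_sum (rising_profile (s powr t\<^sup>2) v) s)"
    using eventually_ge_at_top[of "0::real"]
  proof eventually_elim
    fix s :: real assume "0 \<le> s"
    hence "(kill_step ^^ n) (exit_profile {0<..s powr t\<^sup>2} v) s = (kill_step ^^ n) (rising_profile (s powr t\<^sup>2) v) s" for n
      using assms by (intro kill_step_funpow_cong) (simp_all add: rising_profile_eq)
    thus "enn2real (even_sum (exit_profile {0<..s powr t\<^sup>2} v) s) = enn2real (even_sum (rising_profile (s powr t\<^sup>2) v) s)"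
      by (simp add: even_sum_def)
  qed
qed

lemma falling_limit:
  assumes v: "0 \<le> v" "v \<le> 1" and t: "0 \<le> t" "t \<le> 1"
  shows "((\<lambda>s. enn2real (even_sum (kill_step (falling_profile (s powr t\<^sup>2) v)) s)) \<longlongrightarrow> t * (1 - (1 - v)\<^sup>2) / 2) at_top"
proof (rule Lim_transform_eventually)
  let ?h = "\<lambda>w s. even_sum (kill_step (exit_profile {0<..s powr t\<^sup>2} w)) s"
  have "t\<^sup>2 \<le> 1" using t by (simp add: power_le_one)
  hence "((\<lambda>s. enn2real (?h 1 s) - enn2real (?h (1 - v) s)) \<longlongrightarrow> 1\<^sup>2 * sqrt (t\<^sup>2) / 2 - (1 - v)\<^sup>2 * sqrt (t\<^sup>2) / 2) at_top"
    using v by (intro tendsto_diff exit_probability_by_parity(2)) auto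
  thus "((\<lambda>s. enn2real (?h 1 s) - enn2real (?h (1 - v) s)) \<longlongrightarrow> t * (1 - (1 - v)\<^sup>2) / 2) at_top"
    using t by (simp add: field_simps)
  show "\<forall>\<^sub>F s in at_top. enn2real (?h 1 s) - enn2real (?h (1 - v) s) = enn2real (even_sum (kill_step (falling_profile (s powr t\<^sup>2) v)) s)"
    using eventually_ge_at_top[of "0::real"]
  proof eventually_elim
    fix s :: real assume s: "0 \<le> s"
    let ?F = "falling_profile (s powr t\<^sup>2) v" and ?E = "\<lambda>w. exit_profile {0<..s powr t\<^sup>2} w"
    have "kill_step (?E 1) = kill_step (\<lambda>u. ?F u + ?E (1 - v) u)"
      using v by (intro kill_step_cong_pos) (simp add: falling_profile_add)
    also have "\<dots> = (\<lambda>u. kill_step ?F u + kill_step (?E (1 - v)) u)"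
      by (rule kill_step_add) simp_all
    finally have sum: "?h 1 s = even_sum (kill_step ?F) s + ?h (1 - v) s"
      by (simp add: even_sum_add)
    have "?h 1 s \<le> hit {0<..s powr t\<^sup>2} 1 s" by (subst hit_even_odd) simp_all
    also have "\<dots> < top" by (subst hit_eq_exit_prob) (use s in simp_all)
    finally have "even_sum (kill_step ?F) s < top" "?h (1 - v) s < top" unfolding sum by simp_all
    thus "enn2real (?h 1 s) - enn2real (?h (1 - v) s) = enn2real (even_sum (kill_step ?F) s)"
      unfolding sum by (simp add: enn2real_plus)
  qed
qed

section \<open>The probability of the exit event\<close>

context angle_walk
begin

text \<open>On the null event that the level is never passed, the passage time is the infimum \<open>c\<close> of the empty set. Whatever
its value, the exit angle and height are then those of a fixed segment of the ray, and they depend measurably on the walk: the angle continuously, and the height only through the question which endpoints lie exactly on the edge.\<close>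

lemma measurable_exit_event_never:
  assumes "0 \<le> s"
  shows "{\<omega> \<in> space M. (\<forall>k>0. S k \<omega> \<le> s) \<and> exit_log_ratio \<Theta> s \<omega> \<le> t
     \<and> of_int j * exit_angle \<Theta> s \<omega> \<le> 0 \<and> exit_height \<Theta> s \<omega> \<le> v} \<in> sets M"
proof -
  define c where "c = Inf ({} :: nat set)"
  define b where "b = snd (ray_vertex \<Theta> s undefined c) - snd (ray_vertex \<Theta> s undefined (c - 1))"
  define A where "A \<omega> = Arg (Complex (S c \<omega> - S (c - 1) \<omega>) b)" for \<omega>
  define p where "p k = (1 - (- 1) ^ k) / (2 :: real)" for k :: nat
  \<comment> \<open>The Booleans say whether the two ends of the segment lie on the edge.\<close>
  define H where "H \<alpha> \<beta> = (THE y::real. (\<exists>l. 0 \<le> l \<and> l \<le> 1 \<and> (l = 1 \<or> \<alpha>) \<and> (l = 0 \<or> \<beta>) \<and>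
     y = (1 - l) * p (c - 1) + l * p c) \<and> 0 \<le> y \<and> y \<le> 1)" for \<alpha> \<beta>
  have N: "passage_time \<Theta> s \<omega> = c" if "\<forall>k>0. S k \<omega> \<le> s" for \<omega>
  proof -
    have "{n. 0 < n \<and> s < S n \<omega>} = {}" using that by (auto simp: not_less)
    thus ?thesis unfolding passage_time_def c_def by (simp only:)
  qed
  have angle: "exit_angle \<Theta> s \<omega> = A \<omega>" if "\<forall>k>0. S k \<omega> \<le> s" for \<omega>
    by (simp add: exit_angle_def N[OF that] Let_def A_def b_def ray_vertex_def)
  have height: "exit_height \<Theta> s \<omega> = H (S (c - 1) \<omega> = s) (S c \<omega> = s)" if Z: "\<forall>k>0. S k \<omega> \<le> s" for \<omega>
  proof -
    have le: "- s + S k \<omega> \<le> 0" for k using Z assms by (cases "k = 0") auto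
    have "(0, y) \<in> closed_segment (ray_vertex \<Theta> s \<omega> (c - 1)) (ray_vertex \<Theta> s \<omega> c) \<inter> {0} \<times> {0..1} \<longleftrightarrow>
      (\<exists>l. 0 \<le> l \<and> l \<le> 1 \<and> (l = 1 \<or> S (c - 1) \<omega> = s) \<and> (l = 0 \<or> S c \<omega> = s) \<and>
       y = (1 - l) * p (c - 1) + l * p c) \<and> 0 \<le> y \<and> y \<le> 1" for y
    proof -
      have "(0, y) \<in> closed_segment (ray_vertex \<Theta> s \<omega> (c - 1)) (ray_vertex \<Theta> s \<omega> c) \<longleftrightarrow>
        (\<exists>l. 0 \<le> l \<and> l \<le> 1 \<and> (l = 1 \<or> - s + S (c - 1) \<omega> = 0) \<and> (l = 0 \<or> - s + S c \<omega> = 0) \<and>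
         y = (1 - l) * p (c - 1) + l * p c)"
        unfolding ray_vertex_def p_def by (rule degenerate_segment_iff[OF le le])
      moreover have "- s + S k \<omega> = 0 \<longleftrightarrow> S k \<omega> = s" for k by linarith
      ultimately show ?thesis by simp
    qed
    thus ?thesis unfolding exit_height_def Let_def N[OF Z] H_def by (simp only:)
  qed
  have A [measurable]: "A \<in> borel_measurable M"
  proof (cases "c = 0")
    case True
    hence "A = (\<lambda>_. Arg (Complex 0 b))" by (simp add: A_def fun_eq_iff)
    thus ?thesis by simp
  next
    case False
    then obtain m where "c = Suc m" by (cases c) auto
    hence b: "b \<noteq> 0" by (simp add: b_def ray_vertex_def)
    have "continuous_on UNIV (\<lambda>x. Arg (Complex x b))"
      by (intro continuous_intros) (use b in \<open>auto simp: complex_nonpos_Reals_iff\<close>)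
    hence "(\<lambda>x. Arg (Complex x b)) \<in> borel_measurable borel" by (rule borel_measurable_continuous_onI)
    from measurable_compose[OF _ this, of "\<lambda>\<omega>. S c \<omega> - S (c - 1) \<omega>" M]
    show ?thesis unfolding A_def[abs_def] by measurable
  qed
  have "{\<omega> \<in> space M. (\<forall>k>0. S k \<omega> \<le> s) \<and> exit_log_ratio \<Theta> s \<omega> \<le> t
     \<and> of_int j * exit_angle \<Theta> s \<omega> \<le> 0 \<and> exit_height \<Theta> s \<omega> \<le> v} =
    {\<omega> \<in> space M. (\<forall>k>0. S k \<omega> \<le> s) \<and> sqrt (max 0 (ln (cos \<bar>A \<omega>\<bar> / sin \<bar>A \<omega>\<bar>) / ln s)) \<le> t
     \<and> of_int j * A \<omega> \<le> 0 \<and> H (S (c - 1) \<omega> = s) (S c \<omega> = s) \<le> v}"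
    by (intro Collect_cong) (auto simp: exit_log_ratio_def angle height cot_def)
  also have "\<dots> \<in> sets M"
  proof -
    have H: "H \<alpha> \<beta> = (if \<alpha> then if \<beta> then H True True else H True False
       else if \<beta> then H False True else H False False)" for \<alpha> \<beta> by simp
    show ?thesis by (subst H) measurable
  qed
  finally show ?thesis .
qed

text \<open>The event differs from a disjoint union of first-passage events by a subset of the null event on which the level
is never passed. The function \<open>f\<close> enumerates the numbers of earlier crossings with the right parity.\<close>

lemma exit_event_probability:
  assumes "0 < s" and P: "Measurable.pred (borel \<Otimes>\<^sub>M borel) (\<lambda>z. P (fst z) (snd z))" and "inj f"
    and event: "\<And>n \<omega>. first_passage_at \<Theta> s n \<omega> \<Longrightarrow>
      exit_log_ratio \<Theta> s \<omega> \<le> t \<and> of_int j * exit_angle \<Theta> s \<omega> \<le> 0 \<and> exit_height \<Theta> s \<omega> \<le> v \<longleftrightarrow>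
      n \<in> range f \<and> P (s - S n \<omega>) (tan (\<Theta> (Suc n) \<omega>))"
  shows "measure M {\<omega> \<in> space M. exit_log_ratio \<Theta> s \<omega> \<le> t
      \<and> of_int j * exit_angle \<Theta> s \<omega> \<le> 0 \<and> exit_height \<Theta> s \<omega> \<le> v} =
    enn2real (\<Sum>k. (kill_step ^^ f k) (\<lambda>u. \<integral>\<^sup>+x. ennreal (jump x) * indicator {x. u < x \<and> P u x} x \<partial>lborel) s)"
    (is "measure M ?E = enn2real ?s")
proof -
  let ?Z = "{\<omega> \<in> space M. (\<forall>k>0. S k \<omega> \<le> s) \<and> exit_log_ratio \<Theta> s \<omega> \<le> t
      \<and> of_int j * exit_angle \<Theta> s \<omega> \<le> 0 \<and> exit_height \<Theta> s \<omega> \<le> v}"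
  define A where "A n = {\<omega> \<in> space M. first_passage_at \<Theta> s n \<omega> \<and> P (s - S n \<omega>) (tan (\<Theta> (Suc n) \<omega>))}" for n
  have s: "0 \<le> s" using assms(1) by simp
  have A: "(\<Union>k. A (f k)) \<in> sets M"
    unfolding A_def using first_passage_at_region(1)[OF P s] by (intro sets.countable_UN) auto
  have Z: "?Z \<in> null_sets M"
  proof (rule null_setsI)
    have "emeasure M ?Z \<le> emeasure M {\<omega> \<in> space M. \<forall>k>0. S k \<omega> \<le> s}"
      by (intro emeasure_mono) auto
    thus "emeasure M ?Z = 0" using never_exits_null[OF s] by simp
  qed (rule measurable_exit_event_never[OF s])
  have "\<omega> \<in> ?E \<longleftrightarrow> \<omega> \<in> (\<Union>k. A (f k)) \<union> ?Z" for \<omega>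
  proof (cases "\<exists>n. first_passage_at \<Theta> s n \<omega>")
    case True
    then obtain n where n: "first_passage_at \<Theta> s n \<omega>" ..
    have "\<omega> \<in> A (f k) \<longleftrightarrow> \<omega> \<in> space M \<and> n = f k \<and> P (s - S n \<omega>) (tan (\<Theta> (Suc n) \<omega>))" for k
      using n first_passage_at_unique[OF n, of "f k"] by (auto simp: A_def)
    moreover have "\<not> (\<forall>k>0. S k \<omega> \<le> s)"
      using n unfolding first_passage_at_def by (meson not_le zero_less_Suc)
    ultimately show ?thesis using event[OF n] by auto
  next
    case False
    hence "\<forall>k>0. S k \<omega> \<le> s" using first_passage_at_exists[of _ s \<Theta> \<omega>] by (meson not_le)
    thus ?thesis using False by (auto simp: A_def)
  qed
  hence E: "?E = (\<Union>k. A (f k)) \<union> ?Z" by blast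
  have "emeasure M ?E = emeasure M (\<Union>k. A (f k))"
    unfolding E by (rule emeasure_Un_null_set[OF A Z])
  also have "\<dots> = ?s" unfolding A_def by (rule first_passage_region_UN[OF P s \<open>inj f\<close>])
  finally show ?thesis by (simp add: measure_def)
qed

lemma upward_exit_probability:
  assumes "1 < s" "0 \<le> t"
  shows "measure M {\<omega> \<in> space M. exit_log_ratio \<Theta> s \<omega> \<le> t
      \<and> of_int (- 1) * exit_angle \<Theta> s \<omega> \<le> 0 \<and> exit_height \<Theta> s \<omega> \<le> v} =
    enn2real (even_sum (rising_profile (s powr t\<^sup>2) v) s)"
proof -
  have "measure M {\<omega> \<in> space M. exit_log_ratio \<Theta> s \<omega> \<le> t
      \<and> of_int (- 1) * exit_angle \<Theta> s \<omega> \<le> 0 \<and> exit_height \<Theta> s \<omega> \<le> v} =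
    enn2real (\<Sum>k. (kill_step ^^ (2 * k)) (\<lambda>u. \<integral>\<^sup>+x. ennreal (jump x) *
      indicator {x. u < x \<and> x \<le> s powr t\<^sup>2 \<and> u \<le> v * x} x \<partial>lborel) s)"
  proof (rule exit_event_probability)
    fix n \<omega> assume fp: "first_passage_at \<Theta> s n \<omega>"
    note N = passage_time_eq[OF fp]
    have b: "0 \<le> s - S n \<omega>" "s - S n \<omega> < tan (\<Theta> (Suc n) \<omega>)"
      using first_passage_at_bounds[OF fp] assms by auto
    hence x: "0 < tan (\<Theta> (Suc n) \<omega>)" by linarith
    have "of_int (- 1) * exit_angle \<Theta> s \<omega> \<le> 0 \<longleftrightarrow> even n"
      using exit_angle_sign[OF N x] by auto
    moreover have "even n \<longleftrightarrow> n \<in> range (\<lambda>k. 2 * k)" by auto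
    moreover have "exit_height \<Theta> s \<omega> \<le> v \<longleftrightarrow> s - S n \<omega> \<le> v * tan (\<Theta> (Suc n) \<omega>)" if "even n"
      using that x assms by (simp add: exit_height_eq[OF fp] pos_divide_le_eq del: walk.simps)
    ultimately show "exit_log_ratio \<Theta> s \<omega> \<le> t \<and> of_int (- 1) * exit_angle \<Theta> s \<omega> \<le> 0 \<and> exit_height \<Theta> s \<omega> \<le> v \<longleftrightarrow>
      n \<in> range (\<lambda>k. 2 * k) \<and> (tan (\<Theta> (Suc n) \<omega>) \<le> s powr t\<^sup>2 \<and> s - S n \<omega> \<le> v * tan (\<Theta> (Suc n) \<omega>))"
      using exit_log_ratio_le_iff[OF N x assms] by blast
  qed (use assms in \<open>auto intro: injI\<close>)
  thus ?thesis by (simp add: even_sum_def rising_profile_def[abs_def])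
qed

lemma downward_exit_probability:
  assumes "1 < s" "0 \<le> t"
  shows "measure M {\<omega> \<in> space M. exit_log_ratio \<Theta> s \<omega> \<le> t
      \<and> of_int 1 * exit_angle \<Theta> s \<omega> \<le> 0 \<and> exit_height \<Theta> s \<omega> \<le> v} =
    enn2real (even_sum (kill_step (falling_profile (s powr t\<^sup>2) v)) s)"
proof -
  have "measure M {\<omega> \<in> space M. exit_log_ratio \<Theta> s \<omega> \<le> t
      \<and> of_int 1 * exit_angle \<Theta> s \<omega> \<le> 0 \<and> exit_height \<Theta> s \<omega> \<le> v} =
    enn2real (\<Sum>k. (kill_step ^^ Suc (2 * k)) (\<lambda>u. \<integral>\<^sup>+x. ennreal (jump x) *
      indicator {x. u < x \<and> x \<le> s powr t\<^sup>2 \<and> (1 - v) * x \<le> u} x \<partial>lborel) s)"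
  proof (rule exit_event_probability)
    fix n \<omega> assume fp: "first_passage_at \<Theta> s n \<omega>"
    note N = passage_time_eq[OF fp]
    have b: "0 \<le> s - S n \<omega>" "s - S n \<omega> < tan (\<Theta> (Suc n) \<omega>)"
      using first_passage_at_bounds[OF fp] assms by auto
    hence x: "0 < tan (\<Theta> (Suc n) \<omega>)" by linarith
    have "of_int 1 * exit_angle \<Theta> s \<omega> \<le> 0 \<longleftrightarrow> odd n"
      using exit_angle_sign[OF N x] by auto
    moreover have "odd n \<longleftrightarrow> n \<in> range (\<lambda>k. Suc (2 * k))" by (auto elim: oddE)
    moreover have "exit_height \<Theta> s \<omega> \<le> v \<longleftrightarrow> (1 - v) * tan (\<Theta> (Suc n) \<omega>) \<le> s - S n \<omega>" if "odd n"
    proof -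
      have "exit_height \<Theta> s \<omega> \<le> v \<longleftrightarrow> 1 - v \<le> (s - S n \<omega>) / tan (\<Theta> (Suc n) \<omega>)"
        using that assms by (simp add: exit_height_eq[OF fp] algebra_simps del: walk.simps)
      thus ?thesis using x by (simp only: pos_le_divide_eq)
    qed
    ultimately show "exit_log_ratio \<Theta> s \<omega> \<le> t \<and> of_int 1 * exit_angle \<Theta> s \<omega> \<le> 0 \<and> exit_height \<Theta> s \<omega> \<le> v \<longleftrightarrow>
      n \<in> range (\<lambda>k. Suc (2 * k)) \<and> (tan (\<Theta> (Suc n) \<omega>) \<le> s powr t\<^sup>2 \<and> (1 - v) * tan (\<Theta> (Suc n) \<omega>) \<le> s - S n \<omega>)"
      using exit_log_ratio_le_iff[OF N x assms] by blast
  qed (use assms in \<open>auto intro: injI\<close>)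
  thus ?thesis by (simp add: even_sum_def falling_profile_def[abs_def] funpow_swap1)
qed

end

theorem theorem4p14:
  fixes M :: "'a measure" and \<Theta> :: "nat \<Rightarrow> 'a \<Rightarrow> real"
    and t v :: real and j :: int
  assumes "prob_space M"
    and "prob_space.indep_vars M (\<lambda>_. borel) \<Theta> {1..}"
    and "\<And>n. n \<ge> 1 \<Longrightarrow> distributed M lborel (\<Theta> n) (\<lambda>\<theta>. ennreal (angle_density \<theta>))"
    and "t \<in> {0..1}" and "v \<in> {0..1}" and "j \<in> {-1, 1}"
  shows "((\<lambda>s. measure M {\<omega> \<in> space M. exit_log_ratio \<Theta> s \<omega> \<le> t
              \<and> of_int j * exit_angle \<Theta> s \<omega> \<le> 0 \<and> exit_height \<Theta> s \<omega> \<le> v})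
          \<longlongrightarrow> (if j = 1 then t * (1 - (1 - v)\<^sup>2) / 2 else t * v\<^sup>2 / 2)) at_top"
proof -
  interpret angle_walk M \<Theta>
    using assms(1-3) by (intro angle_walk.intro angle_walk_axioms.intro)
  have tv: "0 \<le> v" "v \<le> 1" "0 \<le> t" "t \<le> 1" using assms(4,5) by auto
  show ?thesis
  proof (cases "j = 1")
    case True
    have "((\<lambda>s. measure M {\<omega> \<in> space M. exit_log_ratio \<Theta> s \<omega> \<le> t
        \<and> of_int 1 * exit_angle \<Theta> s \<omega> \<le> 0 \<and> exit_height \<Theta> s \<omega> \<le> v}) \<longlongrightarrow> t * (1 - (1 - v)\<^sup>2) / 2) at_top"
    proof (rule Lim_transform_eventually[OF falling_limit[OF tv]])
      show "\<forall>\<^sub>F s in at_top. enn2real (even_sum (kill_step (falling_profile (s powr t\<^sup>2) v)) s) =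
        measure M {\<omega> \<in> space M. exit_log_ratio \<Theta> s \<omega> \<le> t
          \<and> of_int 1 * exit_angle \<Theta> s \<omega> \<le> 0 \<and> exit_height \<Theta> s \<omega> \<le> v}"
        using eventually_gt_at_top[of "1::real"]
        by eventually_elim (rule downward_exit_probability[symmetric], use tv in simp_all)
    qed
    thus ?thesis using True by (simp only: if_True simp_thms)
  next
    case False
    hence j: "j = - 1" using assms(6) by simp
    have "((\<lambda>s. measure M {\<omega> \<in> space M. exit_log_ratio \<Theta> s \<omega> \<le> t
        \<and> of_int (- 1) * exit_angle \<Theta> s \<omega> \<le> 0 \<and> exit_height \<Theta> s \<omega> \<le> v}) \<longlongrightarrow> t * v\<^sup>2 / 2) at_top"
    proof (rule Lim_transform_eventually[OF rising_limit[OF tv]])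
      show "\<forall>\<^sub>F s in at_top. enn2real (even_sum (rising_profile (s powr t\<^sup>2) v) s) =
        measure M {\<omega> \<in> space M. exit_log_ratio \<Theta> s \<omega> \<le> t
          \<and> of_int (- 1) * exit_angle \<Theta> s \<omega> \<le> 0 \<and> exit_height \<Theta> s \<omega> \<le> v}"
        using eventually_gt_at_top[of "1::real"]
        by eventually_elim (rule upward_exit_probability[symmetric], use tv in simp_all)
    qed
    thus ?thesis unfolding j by simp
  qed
qed

end
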